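(* Let $q$ be a prime power, $m\in\mathbb{Z}_{\ge1}$ and $n\in\mathbb{Z}_{\ge0}$. The normalized finitized Coh zeta functions at $s=0$ of the three families of quadratic orders are given as follows. (a) (Ramified) For $R=R_{2,2m+1}=\mathbb{F}_q[[X,Y]]/(Y^2-X^{2m+1})$, $$\widehat{\nu}_{R,n}(0)=q^{-mn^2}\sum_{r\in \mathbb{Z},\,\mathbf{s}\in \mathbb{Z}^m} {n\brack r}_q (-1)^r q^{\binom{r}{2}}\, G^{((2n)^{m-1},\,2n-r)}_{\mathbf{s}}(q).$$ (b) (Split) For $R=R_{2,2m}=\mathbb{F}_q[[X,Y]]/(Y(Y-X^m))$, $$\widehat{\nu}_{R,n}(0)=q^{-mn^2}\sum_{r_1,r_2\in \mathbb{Z},\, \mathbf{s}\in \mathbb{Z}^m}{n\brack r_1}_q{n\brack r_2}_q(-1)^{r_1+r_2} q^{\binom{r_1}{2}+\binom{r_2}{2}}\,G^{((2n)^{m-1},\,2n-r_1-r_2)}_{\mathbf{s}}(q).$$ (c) (Inert) For $R=R'_{2,2m}=\mathbb{F}_q[[T]]+T^m\mathbb{F}_{q^2}[[T]]$, $$\widehat{\nu}_{R,n}(0)=q^{-mn^2}\sum_{r\in\mathbb{Z},\, \mathbf{s}\in \mathbb{Z}^m} {n\brack r}_{q^2}(-1)^{r}q^{r^{2}-r}\,G_{\mathbf{s}}^{((2n)^{m-1},\,2n-2r)}(q).$$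
   Context: For a commutative ring $R$ and an $R$-module $M$ having finitely many submodules of each finite index, the lattice zeta function is the formal Dirichlet series $\zeta_M^R(s)=\sum_{L\subseteq_R M}(M:L)^{-s}$, summed over all $R$-submodules $L\subseteq M$ of finite index $(M:L)=|M/L|$. The finitized Coh zeta function is $\widehat{\zeta}_{R,n}(s):=\zeta^R_{R^n}(s+n)$. Let $\widetilde R$ be the normalization of $R$ (its integral closure in its total ring of fractions). The normalized finitized Coh zeta function is $$\widehat{\nu}_{R,n}(s):=\frac{\widehat{\zeta}_{R,n}(s)}{\widehat{\zeta}_{\widetilde R,n}(s)}=\frac{\zeta^R_{R^n}(s+n)}{\zeta^{\widetilde R}_{\widetilde R^n}(s+n)}.$$ For the orders $R$ considered here it is known to be a Dirichlet polynomial (a polynomial in $t=q^{-s}$), so that its value at $s=0$ (i.e. $t=1$) makes sense. Notation: $(a;x)_k=\prod_{l=0}^{k-1}(1-ax^l)$; ${n\brack k}_x=\frac{(x;x)_n}{(x;x)_k(x;x)_{n-k}}$ if $0\le k\le n$, and $0$ if $k<0$ or $k>n$. For tuples of integers $\mathbf r=(r_1,\dots,r_m)$ and $\mathbf s=(s_1,\dots,s_m)$, set $$G^{\mathbf r}_{\mathbf s}(q):=q^{\sum_{i=1}^m s_i(r_i-s_i)}\prod_{i=1}^m{r_i-s_{i+1}\brack r_i-s_i}_{q^{-1}},\qquad s_{m+1}:=0.$$ The superscript $((2n)^{m-1},c)$ denotes the $m$-tuple $(2n,\dots,2n,c)$ with $m-1$ entries equal to $2n$. All sums have finitely many nonzero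 terms. *)

theory Defs
  imports
    "HOL-Algebra.Algebra"
    "HOL-Algebra.Algebraic_Closure_Type"
    "HOL-Analysis.Analysis"
    "HOL-Computational_Algebra.Formal_Power_Series"
begin

section \<open>Formal Dirichlet series\<close>

text \<open>
  A formal Dirichlet series \<open>\<Sum>\<^sub>k\<^sub>\<ge>\<^sub>1 f k * k\<^sup>-\<^sup>s\<close> is represented by its coefficient function
  \<open>f\<close> with the convention \<open>f 0 = 0\<close>.
\<close>

type_synonym dirichlet_series = "nat \<Rightarrow> complex"

definition dirichlet_mult :: "dirichlet_series \<Rightarrow> dirichlet_series \<Rightarrow> dirichlet_series" where
  "dirichlet_mult f g k = (if k = 0 then 0 else (\<Sum>d | d dvd k. f d * g (k div d)))"

text \<open>Unique whenever \<open>g 1 \<noteq> 0\<close>; a series counting submodules always has \<open>g 1 = 1\<close>.\<close>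

definition dirichlet_divide :: "dirichlet_series \<Rightarrow> dirichlet_series \<Rightarrow> dirichlet_series" where
  "dirichlet_divide f g = (THE h. h 0 = 0 \<and> dirichlet_mult h g = f)"

text \<open>The coefficients of \<open>f(s + n)\<close> as a series in \<open>s\<close>.\<close>

definition dirichlet_shift :: "dirichlet_series \<Rightarrow> nat \<Rightarrow> dirichlet_series" where
  "dirichlet_shift f n k = f k / of_nat k ^ n"

text \<open>\<open>f\<close> is a Dirichlet polynomial, and its value at \<open>s\<close> is \<open>v\<close>.\<close>

definition dirichlet_poly_value :: "dirichlet_series \<Rightarrow> complex \<Rightarrow> complex \<Rightarrow> bool" where
  "dirichlet_poly_value f s v \<longleftrightarrow>
     finite {k. f k \<noteq> 0} \<and> (\<Sum>k | f k \<noteq> 0. f k * of_nat k powr (- s)) = v"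


section \<open>Lattice zeta functions\<close>

text \<open>The fields \<open>mult\<close> and \<open>one\<close> of a module record play no role for modules.\<close>

definition free_module :: "('a, 'b) ring_scheme \<Rightarrow> nat \<Rightarrow> ('a, nat \<Rightarrow> 'a) module" where
  "free_module R n =
     \<lparr>carrier = {..<n} \<rightarrow>\<^sub>E carrier R,
      monoid.mult = undefined,
      one = undefined,
      ring.zero = (\<lambda>i\<in>{..<n}. \<zero>\<^bsub>R\<^esub>),
      add = (\<lambda>x y. \<lambda>i\<in>{..<n}. x i \<oplus>\<^bsub>R\<^esub> y i),
      module.smult = (\<lambda>a x. \<lambda>i\<in>{..<n}. a \<otimes>\<^bsub>R\<^esub> x i)\<rparr>"

definition lattice_zeta ::
    "('a, 'b) ring_scheme \<Rightarrow> ('a, 'c, 'd) module_scheme \<Rightarrow> dirichlet_series" where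
  "lattice_zeta R M k =
     of_nat (card {L. submodule L R M \<and> finite (a_rcosets\<^bsub>M\<^esub> L) \<and> card (a_rcosets\<^bsub>M\<^esub> L) = k})"

definition finitized_coh_zeta :: "('a, 'b) ring_scheme \<Rightarrow> nat \<Rightarrow> dirichlet_series" where
  "finitized_coh_zeta R n = dirichlet_shift (lattice_zeta R (free_module R n)) n"


section \<open>Normalization\<close>

definition regular_elements :: "('a, 'b) ring_scheme \<Rightarrow> 'a set" where
  "regular_elements R =
     {s \<in> carrier R. \<forall>a\<in>carrier R. a \<otimes>\<^bsub>R\<^esub> s = \<zero>\<^bsub>R\<^esub> \<longrightarrow> a = \<zero>\<^bsub>R\<^esub>}"

text \<open>The fraction \<open>a / s\<close> is the set of all pairs \<open>(b, t)\<close> with \<open>a t = b s\<close>.\<close>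

definition fraction :: "('a, 'b) ring_scheme \<Rightarrow> 'a \<Rightarrow> 'a \<Rightarrow> ('a \<times> 'a) set" where
  "fraction R a s =
     {(b, t). b \<in> carrier R \<and> t \<in> regular_elements R \<and> a \<otimes>\<^bsub>R\<^esub> t = b \<otimes>\<^bsub>R\<^esub> s}"

text \<open>
  As in \<^const>\<open>FactRing\<close>, the operations take the union over all representatives; the
  members of that union coincide.
\<close>

definition total_fraction_ring :: "('a, 'b) ring_scheme \<Rightarrow> ('a \<times> 'a) set ring" where
  "total_fraction_ring R =
     \<lparr>carrier = {fraction R a s | a s. a \<in> carrier R \<and> s \<in> regular_elements R},
      monoid.mult = (\<lambda>x y. \<Union>(a, s)\<in>x. \<Union>(b, t)\<in>y. fraction R (a \<otimes>\<^bsub>R\<^esub> b) (s \<otimes>\<^bsub>R\<^esub> t)),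
      one = fraction R \<one>\<^bsub>R\<^esub> \<one>\<^bsub>R\<^esub>,
      ring.zero = fraction R \<zero>\<^bsub>R\<^esub> \<one>\<^bsub>R\<^esub>,
      add = (\<lambda>x y. \<Union>(a, s)\<in>x. \<Union>(b, t)\<in>y.
               fraction R (a \<otimes>\<^bsub>R\<^esub> t \<oplus>\<^bsub>R\<^esub> b \<otimes>\<^bsub>R\<^esub> s) (s \<otimes>\<^bsub>R\<^esub> t))\<rparr>"

text \<open>\<open>x\<close> is a root of a monic polynomial of degree \<open>d\<close> with coefficients in \<open>S\<close>.\<close>

definition integral_over :: "('a, 'b) ring_scheme \<Rightarrow> 'a set \<Rightarrow> 'a \<Rightarrow> bool" where
  "integral_over Q S x \<longleftrightarrow>
     (\<exists>(d::nat) (c :: nat \<Rightarrow> 'a). (\<forall>i<d. c i \<in> S) \<and>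
        x [^]\<^bsub>Q\<^esub> d \<oplus>\<^bsub>Q\<^esub> (\<Oplus>\<^bsub>Q\<^esub>i\<in>{..<d}. c i \<otimes>\<^bsub>Q\<^esub> x [^]\<^bsub>Q\<^esub> i) = \<zero>\<^bsub>Q\<^esub>)"

definition normalization :: "('a, 'b) ring_scheme \<Rightarrow> ('a \<times> 'a) set ring" where
  "normalization R =
     (let Q = total_fraction_ring R
      in Q\<lparr>carrier := {x \<in> carrier Q. integral_over Q ((\<lambda>a. fraction R a \<one>\<^bsub>R\<^esub>) ` carrier R) x}\<rparr>)"

definition normalized_coh_zeta :: "('a, 'b) ring_scheme \<Rightarrow> nat \<Rightarrow> dirichlet_series" where
  "normalized_coh_zeta R n =
     dirichlet_divide (finitized_coh_zeta R n) (finitized_coh_zeta (normalization R) n)"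


section \<open>The quadratic orders\<close>

text \<open>
  \<open>F[[X, Y]]\<close> is the type of power series in \<open>Y\<close> over \<open>F[[X]]\<close>.
\<close>

abbreviation var_X :: "'a::field fps fps" where
  "var_X \<equiv> fps_const fps_X"

abbreviation var_Y :: "'a::field fps fps" where
  "var_Y \<equiv> fps_X"

definition hypersurface_ring :: "'a::field fps fps \<Rightarrow> 'a fps fps set ring" where
  "hypersurface_ring f = ring_of_type_algebra Quot (Idl\<^bsub>ring_of_type_algebra\<^esub> {f})"

definition ramified_order :: "nat \<Rightarrow> 'a::field fps fps set ring" where
  "ramified_order m = hypersurface_ring (var_Y ^ 2 - var_X ^ (2 * m + 1))"

definition split_order :: "nat \<Rightarrow> 'a::field fps fps set ring" where
  "split_order m = hypersurface_ring (var_Y * (var_Y - var_X ^ m))"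

text \<open>
  \<open>F[[T]] + T\<^sup>m E[[T]]\<close> as a subring of \<open>E[[T]]\<close>, for an embedding of fields \<open>\<phi> : F \<rightarrow> E\<close>.
\<close>

definition inert_order :: "('a::field \<Rightarrow> 'b::field) \<Rightarrow> nat \<Rightarrow> 'b fps ring" where
  "inert_order \<phi> m =
     ring_of_type_algebra\<lparr>carrier :=
       {Abs_fps (\<lambda>i. \<phi> (fps_nth g i)) + fps_X ^ m * h | g h. True}\<rparr>"


section \<open>Gaussian binomials\<close>

definition qpochhammer :: "'k::field \<Rightarrow> 'k \<Rightarrow> nat \<Rightarrow> 'k" where
  "qpochhammer a x k = (\<Prod>l<k. 1 - a * x ^ l)"

definition qbinomial :: "'k::field \<Rightarrow> int \<Rightarrow> int \<Rightarrow> 'k" where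
  "qbinomial x n k =
     (if 0 \<le> k \<and> k \<le> n
      then qpochhammer x x (nat n) / (qpochhammer x x (nat k) * qpochhammer x x (nat (n - k)))
      else 0)"

text \<open>
  \<open>m\<close>-tuples are functions on \<open>{1..m}\<close>; the case distinction implements \<open>s\<^sub>m\<^sub>+\<^sub>1 = 0\<close>.
\<close>

definition G_term :: "nat \<Rightarrow> (nat \<Rightarrow> int) \<Rightarrow> (nat \<Rightarrow> int) \<Rightarrow> 'k::field \<Rightarrow> 'k" where
  "G_term m r s q =
     q powi (\<Sum>i=1..m. s i * (r i - s i)) *
     (\<Prod>i=1..m. qbinomial (inverse q) (r i - (if i = m then 0 else s (i + 1))) (r i - s i))"

abbreviation int_tuples :: "nat \<Rightarrow> (nat \<Rightarrow> int) set" where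
  "int_tuples m \<equiv> {1..m} \<rightarrow>\<^sub>E UNIV"

text \<open>The tuple \<open>((2n)\<^sup>m\<^sup>-\<^sup>1, c)\<close>.\<close>

definition top_tuple :: "nat \<Rightarrow> nat \<Rightarrow> int \<Rightarrow> nat \<Rightarrow> int" where
  "top_tuple m n c = (\<lambda>i\<in>{1..m}. if i < m then 2 * int n else c)"

end

theory Submission
  imports Defs "HOL-Library.Function_Algebras" "HOL-Computational_Algebra.Formal_Laurent_Series"
begin

text \<open>
  Let \<open>S\<close> be the normalization of \<open>R\<close>, a product of power series rings, and let \<open>c S \<subseteq> R\<close>. Sorting
  the \<open>R\<close>-sublattices \<open>L\<close> of \<open>R\<^sup>n\<close> by the \<open>S\<close>-lattice \<open>S L\<close>, which is free, expresses the zeta function of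
  \<open>R\<^sup>n\<close> through matrices \<open>g\<close> and the lattices \<open>L\<close> with \<open>S L = S\<^sup>n\<close> and \<open>L g \<subseteq> R\<^sup>n\<close>. Modulo \<open>c\<close>, the number of such \<open>g\<close>
  is \<open>(S\<^sup>n : L)\<^sup>n\<close> because \<open>R\<close> is Gorenstein; this cancels the weight of \<open>L\<close> at \<open>s = 0\<close>, and the value becomes
  \<open>q\<close> to the power \<open>- m n\<^sup>2\<close> times the number of lattices \<open>L\<close> with \<open>S L = S\<^sup>n\<close>. By Moebius inversion over the
  subspaces of \<open>S\<^sup>n\<close> modulo the radical, this number is an alternating sum, with \<open>q\<close>-binomial weights, of numbers of
  \<open>R\<close>-modules between \<open>c S\<^sup>n\<close> and an \<open>S\<close>-lattice. These are the subspaces stable under a nilpotent operator \<open>X\<close>, and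
  sorting them by the indices \<open>s\<^sub>i\<close> of \<open>X\<^sup>i H\<close> in \<open>X\<^sup>i\<^sup>-\<^sup>1 H\<close>, modulo \<open>c S\<^sup>n\<close>, gives the terms \<open>G\<close>.
\<close>

section \<open>Subgroups and indices\<close>

text \<open>The S-lattices M in S^n have unbounded index, but the number of L with S L = M and given
  index in M depends only on P = M + c S^n, which takes finitely many values. As P is free, the M
  inside P contribute (S^n : P)^(-s) zeta_S(s); inversion over the finite poset of all P makes the
  series of each stratum {M. M + c S^n = P} a Dirichlet polynomial times zeta_S. The same inversion
  applied to matrices modulo c shows that the value of this polynomial at s = n is the proportion of
  matrices g with S^n g + c S^n = P. Hence at s = n all matrices modulo c have equal weight, also
  those without injective action, and the sums over g and L can be interchanged. The prefactor comes
  from (S^n : R^n) = q^(mn) and (S^n : c S^n) = q^(2mn): the quotient to the power n is q^(-m n^2).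
  The three families are one: R = F[[x]] + x^m S with x = T^e and S a product of power series rings
  over E, where (e, number of factors, degree of E over F) is (2, 1, 1), (1, 2, 1) or (1, 1, 2).
  That S has rank 2 over F[[x]] produces the entries 2n.\<close>

definition add_subgroup :: "'v::ab_group_add set \<Rightarrow> bool" where
  "add_subgroup H \<longleftrightarrow> 0 \<in> H \<and> (\<forall>x\<in>H. \<forall>y\<in>H. x - y \<in> H)"

definition subgroup_sum :: "'v::ab_group_add set \<Rightarrow> 'v set \<Rightarrow> 'v set" where
  "subgroup_sum A B = {a + b | a b. a \<in> A \<and> b \<in> B}"

definition grp_cosets :: "'v::ab_group_add set \<Rightarrow> 'v set \<Rightarrow> 'v set set" where
  "grp_cosets A B = (\<lambda>a. (+) a ` B) ` A"

text \<open>An infinite index is represented by \<open>0\<close>; a finite one is positive.\<close>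

definition grp_index :: "'v::ab_group_add set \<Rightarrow> 'v set \<Rightarrow> nat" where
  "grp_index A B = card (grp_cosets A B)"

lemma add_subgroupI:
  assumes "0 \<in> H" "\<And>x y. x \<in> H \<Longrightarrow> y \<in> H \<Longrightarrow> x - y \<in> H"
  shows "add_subgroup H"
  using assms by (auto simp: add_subgroup_def)

lemma add_subgroup_zero: "add_subgroup H \<Longrightarrow> 0 \<in> H"
  and add_subgroup_diff: "add_subgroup H \<Longrightarrow> x \<in> H \<Longrightarrow> y \<in> H \<Longrightarrow> x - y \<in> H"
  by (auto simp: add_subgroup_def)

lemma add_subgroup_uminus: "add_subgroup H \<Longrightarrow> x \<in> H \<Longrightarrow> - x \<in> H"
  using add_subgroup_diff[of H 0 x] add_subgroup_zero[of H] by simp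

lemma add_subgroup_add: "add_subgroup H \<Longrightarrow> x \<in> H \<Longrightarrow> y \<in> H \<Longrightarrow> x + y \<in> H"
  using add_subgroup_diff[of H x "- y"] add_subgroup_uminus[of H y] by simp

lemma add_subgroup_sum:
  "add_subgroup H \<Longrightarrow> (\<And>i. i \<in> I \<Longrightarrow> f i \<in> H) \<Longrightarrow> sum f I \<in> H"
  by (induction I rule: infinite_finite_induct) (auto simp: add_subgroup_zero add_subgroup_add)

lemma add_subgroup_Inter: "(\<And>H. H \<in> \<H> \<Longrightarrow> add_subgroup H) \<Longrightarrow> add_subgroup (\<Inter>\<H>)"
  by (auto simp: add_subgroup_def)

lemma add_subgroup_Int: "add_subgroup A \<Longrightarrow> add_subgroup B \<Longrightarrow> add_subgroup (A \<inter> B)"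
  by (auto simp: add_subgroup_def)

lemma add_subgroup_singleton_zero: "add_subgroup {0}"
  by (simp add: add_subgroup_def)

lemma subgroup_sumI: "a \<in> A \<Longrightarrow> b \<in> B \<Longrightarrow> a + b \<in> subgroup_sum A B"
  by (auto simp: subgroup_sum_def)

lemma subgroup_sumE:
  assumes "x \<in> subgroup_sum A B"
  obtains a b where "a \<in> A" "b \<in> B" "x = a + b"
  using assms by (auto simp: subgroup_sum_def)

lemma add_subgroup_subgroup_sum:
  assumes "add_subgroup A" "add_subgroup B"
  shows "add_subgroup (subgroup_sum A B)"
proof (rule add_subgroupI)
  show "0 \<in> subgroup_sum A B"
    using subgroup_sumI[of 0 A 0 B] assms by (simp add: add_subgroup_zero)
next
  fix x y assume "x \<in> subgroup_sum A B" "y \<in> subgroup_sum A B"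
  then obtain a b a' b' where "a \<in> A" "b \<in> B" "x = a + b" "a' \<in> A" "b' \<in> B" "y = a' + b'"
    by (auto elim!: subgroup_sumE)
  moreover have "a + b - (a' + b') = (a - a') + (b - b')" by simp
  ultimately show "x - y \<in> subgroup_sum A B"
    using assms by (metis subgroup_sumI add_subgroup_diff)
qed

lemma subgroup_sum_upper1: "add_subgroup B \<Longrightarrow> A \<subseteq> subgroup_sum A B"
  using subgroup_sumI[of _ A 0 B] by (auto simp: add_subgroup_zero)

lemma subgroup_sum_upper2: "add_subgroup A \<Longrightarrow> B \<subseteq> subgroup_sum A B"
  using subgroup_sumI[of 0 A _ B] by (auto simp: add_subgroup_zero)

lemma subgroup_sum_least: "add_subgroup H \<Longrightarrow> A \<subseteq> H \<Longrightarrow> B \<subseteq> H \<Longrightarrow> subgroup_sum A B \<subseteq> H"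
  by (auto elim!: subgroup_sumE intro: add_subgroup_add)

lemma coset_eq_iff:
  assumes "add_subgroup B"
  shows "(+) a ` B = (+) b ` B \<longleftrightarrow> a - b \<in> B"
proof
  assume "(+) a ` B = (+) b ` B"
  moreover have "a \<in> (+) a ` B" using add_subgroup_zero[OF assms] by force
  ultimately obtain z where "z \<in> B" "a = b + z" by auto
  then show "a - b \<in> B" by simp
next
  have sub: "(+) a ` B \<subseteq> (+) b ` B" if "a - b \<in> B" for a b
  proof
    fix x assume "x \<in> (+) a ` B"
    then obtain z where "z \<in> B" "x = b + ((a - b) + z)" by auto
    then show "x \<in> (+) b ` B" using that assms by (metis add_subgroup_add imageI)
  qed
  assume "a - b \<in> B"
  moreover from this have "b - a \<in> B" using add_subgroup_uminus[OF assms] by fastforce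
  ultimately show "(+) a ` B = (+) b ` B" using sub by blast
qed

text \<open>Both images are in bijection with the classes of the common kernel relation on
  \<open>A\<close>. This compares coset spaces of different groups without building a map between
  quotients.\<close>

lemma card_image_cong_kernel:
  assumes "\<And>x y. x \<in> A \<Longrightarrow> y \<in> A \<Longrightarrow> f x = f y \<longleftrightarrow> g x = g y"
  shows "card (f ` A) = card (g ` A)"
proof (rule bij_betw_same_card)
  show "bij_betw (\<lambda>z. g (inv_into A f z)) (f ` A) (g ` A)"
  proof (rule bij_betw_imageI)
    show "inj_on (\<lambda>z. g (inv_into A f z)) (f ` A)"
      by (rule inj_onI) (metis assms f_inv_into_f inv_into_into)
    have "g (inv_into A f (f x)) = g x" if "x \<in> A" for x
      using that by (metis assms f_inv_into_f imageI inv_into_into)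
    then show "(\<lambda>z. g (inv_into A f z)) ` f ` A = g ` A"
      by (simp add: image_image cong: image_cong)
  qed
qed

text \<open>The form in which the isomorphism theorems are used: \<open>f\<close> respects and
  reflects congruence, so it induces a bijection of A/B with A'/B'.\<close>

lemma grp_index_transfer:
  assumes "add_subgroup B" "add_subgroup B'" "f ` A = A'"
    and "\<And>x y. x \<in> A \<Longrightarrow> y \<in> A \<Longrightarrow> x - y \<in> B \<longleftrightarrow> f x - f y \<in> B'"
  shows "grp_index A B = grp_index A' B'"
proof -
  have "card ((\<lambda>a. (+) a ` B) ` A) = card ((\<lambda>a. (+) (f a) ` B') ` A)"
    by (rule card_image_cong_kernel) (use assms in \<open>simp add: coset_eq_iff\<close>)
  then show ?thesis
    by (simp add: grp_index_def grp_cosets_def image_image flip: assms(3))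
qed

text \<open>Quotient groups are replaced by sets of representatives, so that the double counts below
  can run over elements.\<close>

lemma transversal_exists:
  assumes "add_subgroup B"
  obtains T where "T \<subseteq> A" "card T = grp_index A B" "finite T \<longleftrightarrow> finite (grp_cosets A B)"
    "\<And>a. a \<in> A \<Longrightarrow> \<exists>t\<in>T. a - t \<in> B"
    "\<And>s t. s \<in> T \<Longrightarrow> t \<in> T \<Longrightarrow> s - t \<in> B \<Longrightarrow> s = t"
proof -
  obtain T where T: "T \<subseteq> A" "inj_on (\<lambda>a. (+) a ` B) T" "grp_cosets A B = (\<lambda>a. (+) a ` B) ` T"
    using subset_image_inj[of "grp_cosets A B" "\<lambda>a. (+) a ` B" A] by (auto simp: grp_cosets_def)
  show thesis
  proof (rule that)
    show "T \<subseteq> A" by fact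
    show "card T = grp_index A B" "finite T \<longleftrightarrow> finite (grp_cosets A B)"
      using T by (auto simp: grp_index_def card_image finite_image_iff)
    show "\<exists>t\<in>T. a - t \<in> B" if "a \<in> A" for a
    proof -
      have "(+) a ` B \<in> (\<lambda>a. (+) a ` B) ` T"
        using that T(3) by (auto simp: grp_cosets_def)
      then show ?thesis using coset_eq_iff[OF assms] by auto
    qed
    show "s = t" if "s \<in> T" "t \<in> T" "s - t \<in> B" for s t
    proof -
      have "(+) s ` B = (+) t ` B" using that(3) coset_eq_iff[OF assms] by blast
      then show ?thesis using T(2) that(1,2) unfolding inj_on_def by blast
    qed
  qed
qed

lemma grp_index_eq_card_transversal:
  assumes "add_subgroup B" "T \<subseteq> A" "\<And>a. a \<in> A \<Longrightarrow> \<exists>t\<in>T. a - t \<in> B"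
    "\<And>s t. s \<in> T \<Longrightarrow> t \<in> T \<Longrightarrow> s - t \<in> B \<Longrightarrow> s = t"
  shows "grp_index A B = card T"
proof -
  have "grp_cosets A B = (\<lambda>a. (+) a ` B) ` T"
  proof -
    have "\<exists>t\<in>T. (+) a ` B = (+) t ` B" if "a \<in> A" for a
      using assms(3)[OF that] by (simp only: coset_eq_iff[OF assms(1)])
    then show ?thesis using assms(2) by (fastforce simp: grp_cosets_def)
  qed
  moreover have "inj_on (\<lambda>a. (+) a ` B) T"
    using assms(4) by (auto simp: inj_on_def coset_eq_iff[OF assms(1)])
  ultimately show ?thesis by (simp add: grp_index_def card_image)
qed

text \<open>Sums of a representative of A/B and one of B/C represent A/C. With the value
  \<open>0\<close> for an infinite index the formula covers the infinite case as well, since sets of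
  representatives are nonempty.\<close>

lemma grp_index_mult:
  assumes B: "add_subgroup B" and C: "add_subgroup C" and A: "add_subgroup A"
    and sub: "C \<subseteq> B" "B \<subseteq> A"
  shows "grp_index A C = grp_index A B * grp_index B C"
proof -
  obtain T where T: "T \<subseteq> A" "card T = grp_index A B"
    "\<And>a. a \<in> A \<Longrightarrow> \<exists>t\<in>T. a - t \<in> B" "\<And>s t. s \<in> T \<Longrightarrow> t \<in> T \<Longrightarrow> s - t \<in> B \<Longrightarrow> s = t"
    using transversal_exists[OF B] by metis
  obtain U where U: "U \<subseteq> B" "card U = grp_index B C"
    "\<And>a. a \<in> B \<Longrightarrow> \<exists>t\<in>U. a - t \<in> C" "\<And>s t. s \<in> U \<Longrightarrow> t \<in> U \<Longrightarrow> s - t \<in> C \<Longrightarrow> s = t"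
    using transversal_exists[OF C] by metis
  define W where "W = (\<lambda>(t, u). t + u) ` (T \<times> U)"
  have key: "t = t' \<and> u = u'" if "t \<in> T" "t' \<in> T" "u \<in> U" "u' \<in> U" "t + u - (t' + u') \<in> C" for t t' u u'
  proof -
    have "t + u - (t' + u') - u + u' \<in> B"
      using that U(1) sub by (meson B add_subgroup_add add_subgroup_diff subsetD)
    then have "t - t' \<in> B" by (simp add: algebra_simps)
    then have "t = t'" using T(4) that by blast
    moreover from this have "u - u' \<in> C" using that by simp
    ultimately show ?thesis using U(4) that by blast
  qed
  have "inj_on (\<lambda>(t, u). t + u) (T \<times> U)"
  proof (rule inj_onI, clarify)
    fix t u t' u' assume "t \<in> T" "u \<in> U" "t' \<in> T" "u' \<in> U" "t + u = t' + u'"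
    then show "t = t' \<and> u = u'" using key[of t t' u u'] add_subgroup_zero[OF C] by simp
  qed
  then have "card W = card T * card U" by (simp add: W_def card_image card_cartesian_product)
  moreover have "grp_index A C = card W"
  proof (rule grp_index_eq_card_transversal[OF C])
    show "W \<subseteq> A" using T(1) U(1) sub(2) by (auto simp: W_def intro!: add_subgroup_add[OF A])
    show "\<exists>t\<in>W. a - t \<in> C" if a: "a \<in> A" for a
    proof -
      obtain t where t: "t \<in> T" "a - t \<in> B" using T(3)[OF a] by blast
      obtain u where u: "u \<in> U" "a - t - u \<in> C" using U(3) t by blast
      have "t + u \<in> W" using t u by (auto simp: W_def)
      moreover have "a - (t + u) \<in> C" using u by (simp add: algebra_simps)
      ultimately show ?thesis by blast
    qed
    show "s = t" if "s \<in> W" "t \<in> W" "s - t \<in> C" for s t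
      using that key by (auto simp: W_def)
  qed
  ultimately show ?thesis using T(2) U(2) by simp
qed

lemma grp_index_finite_iff:
  assumes "add_subgroup A"
  shows "grp_index A B \<noteq> 0 \<longleftrightarrow> finite (grp_cosets A B)"
  using add_subgroup_zero[OF assms] by (auto simp: grp_index_def grp_cosets_def card_eq_0_iff)

lemma grp_index_zero_right: "grp_index A {0} = card A"
proof -
  have "inj_on (\<lambda>a. {a}) A" by (auto simp: inj_on_def)
  then show ?thesis by (simp add: grp_index_def grp_cosets_def card_image)
qed

lemma card_eq_grp_index_mult:
  assumes "add_subgroup A" "add_subgroup B" "B \<subseteq> A"
  shows "card A = grp_index A B * card B"
  using grp_index_mult[of B "{0}" A] assms
  by (simp add: add_subgroup_singleton_zero add_subgroup_zero grp_index_zero_right)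

lemma grp_index_eq_1_iff:
  assumes "add_subgroup A" "add_subgroup B" "B \<subseteq> A"
  shows "grp_index A B = 1 \<longleftrightarrow> A = B"
proof
  assume 1: "grp_index A B = 1"
  then obtain Z where Z: "grp_cosets A B = {Z}" by (auto simp: grp_index_def card_1_singleton_iff)
  have "a \<in> B" if "a \<in> A" for a
  proof -
    have "(+) a ` B \<in> grp_cosets A B" "(+) 0 ` B \<in> grp_cosets A B"
      using that add_subgroup_zero[OF assms(1)] unfolding grp_cosets_def by blast+
    then have "(+) a ` B = (+) 0 ` B" unfolding Z by simp
    then show ?thesis using coset_eq_iff[OF assms(2), of a 0] by simp
  qed
  then show "A = B" using assms by blast
next
  assume "A = B"
  have "grp_index A A = card {0::'a}"
    by (rule grp_index_eq_card_transversal[OF assms(1)]) (use assms in \<open>auto simp: add_subgroup_zero\<close>)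
  then show "grp_index A B = 1" using \<open>A = B\<close> by simp
qed

lemma grp_index_self: "add_subgroup A \<Longrightarrow> grp_index A A = 1"
  using grp_index_eq_1_iff[of A A] by simp

lemma grp_index_sum_Int:
  assumes "add_subgroup A" "add_subgroup B"
  shows "grp_index (subgroup_sum A B) B = grp_index A (A \<inter> B)"
proof -
  obtain T where T: "T \<subseteq> A" "card T = grp_index A (A \<inter> B)"
    "\<And>a. a \<in> A \<Longrightarrow> \<exists>t\<in>T. a - t \<in> A \<inter> B" "\<And>s t. s \<in> T \<Longrightarrow> t \<in> T \<Longrightarrow> s - t \<in> A \<inter> B \<Longrightarrow> s = t"
    using transversal_exists[OF add_subgroup_Int[OF assms]] by metis
  have "grp_index (subgroup_sum A B) B = card T"
  proof (rule grp_index_eq_card_transversal[OF assms(2)])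
    show "T \<subseteq> subgroup_sum A B" using T(1) subgroup_sum_upper1[OF assms(2)] by blast
    show "\<exists>t\<in>T. a - t \<in> B" if a: "a \<in> subgroup_sum A B" for a
    proof -
      obtain x y where xy: "x \<in> A" "y \<in> B" "a = x + y" using a by (elim subgroup_sumE)
      obtain t where t: "t \<in> T" "x - t \<in> B" using T(3)[OF xy(1)] by blast
      have "a - t = (x - t) + y" using xy by simp
      then show ?thesis using t xy assms(2) by (metis add_subgroup_add)
    qed
    show "s = t" if "s \<in> T" "t \<in> T" "s - t \<in> B" for s t
      using that T(1,4) assms(1) by (meson IntI add_subgroup_diff subsetD)
  qed
  then show ?thesis using T(2) by simp
qed

text \<open>Such an \<open>H\<close> is the union of the \<open>B\<close>-cosets it contains, so it
  is determined by a subset of a finite set.\<close>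

lemma finite_between_subgroups:
  assumes "add_subgroup A" "add_subgroup B" "grp_index A B \<noteq> 0"
  shows "finite {H. add_subgroup H \<and> B \<subseteq> H \<and> H \<subseteq> A}"
proof (rule finite_imageD)
  have "finite (grp_cosets A B)" using assms grp_index_finite_iff by blast
  moreover have "(\<lambda>H. {Z \<in> grp_cosets A B. Z \<subseteq> H}) ` {H. add_subgroup H \<and> B \<subseteq> H \<and> H \<subseteq> A} \<subseteq> Pow (grp_cosets A B)"
    by blast
  ultimately show "finite ((\<lambda>H. {Z \<in> grp_cosets A B. Z \<subseteq> H}) ` {H. add_subgroup H \<and> B \<subseteq> H \<and> H \<subseteq> A})"
    by (meson finite_Pow_iff finite_subset)
  have Union_eq: "\<Union>{Z \<in> grp_cosets A B. Z \<subseteq> H} = H" if H: "add_subgroup H" "B \<subseteq> H" "H \<subseteq> A" for H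
  proof -
    have "h \<in> \<Union>{Z \<in> grp_cosets A B. Z \<subseteq> H}" if h: "h \<in> H" for h
    proof (rule UnionI)
      show "h \<in> (+) h ` B"
        using add_subgroup_zero[OF assms(2)] by (metis add.right_neutral image_eqI)
      have "(+) h ` B \<subseteq> H" using H h add_subgroup_add[OF H(1) h] by blast
      then show "(+) h ` B \<in> {Z \<in> grp_cosets A B. Z \<subseteq> H}"
        using H h by (auto simp: grp_cosets_def)
    qed
    then show ?thesis by blast
  qed
  show "inj_on (\<lambda>H. {Z \<in> grp_cosets A B. Z \<subseteq> H}) {H. add_subgroup H \<and> B \<subseteq> H \<and> H \<subseteq> A}"
    by (rule inj_on_inverseI[of _ Union]) (simp only: mem_Collect_eq Union_eq)
qed

section \<open>Free modules\<close>

text \<open>Vectors are functions vanishing from \<open>n\<close> on: they inherit the pointwise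
  group structure of the function type, and \<open>n\<close> stays a variable instead of a
  type.\<close>

definition vecs :: "nat \<Rightarrow> (nat \<Rightarrow> 's::comm_ring_1) set" where
  "vecs n = {x. \<forall>j\<ge>n. x j = 0}"

definition vscale :: "'s::comm_ring_1 \<Rightarrow> (nat \<Rightarrow> 's) \<Rightarrow> nat \<Rightarrow> 's" where
  "vscale a x = (\<lambda>j. a * x j)"

definition submod :: "nat \<Rightarrow> 's::comm_ring_1 set \<Rightarrow> (nat \<Rightarrow> 's) set \<Rightarrow> bool" where
  "submod n R L \<longleftrightarrow> add_subgroup L \<and> L \<subseteq> vecs n \<and> (\<forall>r\<in>R. \<forall>x\<in>L. vscale r x \<in> L)"

text \<open>Row vectors are multiplied by matrices from the right.\<close>

definition vapp :: "nat \<Rightarrow> (nat \<Rightarrow> nat \<Rightarrow> 's::comm_ring_1) \<Rightarrow> (nat \<Rightarrow> 's) \<Rightarrow> nat \<Rightarrow> 's" where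
  "vapp n g x = (\<lambda>j. \<Sum>a<n. x a * g a j)"

definition is_mat :: "nat \<Rightarrow> (nat \<Rightarrow> nat \<Rightarrow> 's::comm_ring_1) \<Rightarrow> bool" where
  "is_mat n g \<longleftrightarrow> (\<forall>a<n. g a \<in> vecs n)"

definition unit_vec :: "nat \<Rightarrow> nat \<Rightarrow> 's::comm_ring_1" where
  "unit_vec a = (\<lambda>j. if j = a then 1 else 0)"

lemma sum_fun_apply: "(\<Sum>i\<in>I. f i) x = (\<Sum>i\<in>I. f i x)"
  by (induction I rule: infinite_finite_induct) auto

lemma vscale_apply [simp]: "vscale a x j = a * x j"
  by (simp add: vscale_def)

lemma vscale_vscale: "vscale a (vscale b x) = vscale (a * b) x"
  by (simp add: fun_eq_iff mult.assoc)

lemma vscale_one [simp]: "vscale 1 x = x"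
  by (simp add: fun_eq_iff)

lemma vscale_zero_right [simp]: "vscale a 0 = 0"
  by (simp add: fun_eq_iff)

lemma vscale_diff_right: "vscale a (x - y) = vscale a x - vscale a y"
  by (simp add: fun_eq_iff algebra_simps)

lemma vscale_add_right: "vscale a (x + y) = vscale a x + vscale a y"
  by (simp add: fun_eq_iff algebra_simps)

lemma vscale_diff_left: "vscale (a - b) x = vscale a x - vscale b x"
  by (simp add: fun_eq_iff algebra_simps)

lemma vscale_add_left: "vscale (a + b) x = vscale a x + vscale b x"
  by (simp add: fun_eq_iff algebra_simps)

lemma vscale_sum_left: "vscale (sum f I) x = (\<Sum>i\<in>I. vscale (f i) x)"
  by (simp add: fun_eq_iff sum_fun_apply sum_distrib_right)

lemma add_subgroup_vecs: "add_subgroup (vecs n)"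
  by (auto simp: add_subgroup_def vecs_def)

lemma vscale_in_vecs: "x \<in> vecs n \<Longrightarrow> vscale a x \<in> vecs n"
  by (simp add: vecs_def)

lemma submod_vecs: "submod n R (vecs n)"
  by (simp add: submod_def add_subgroup_vecs vscale_in_vecs)

lemma submodD:
  assumes "submod n R L"
  shows "add_subgroup L" "L \<subseteq> vecs n" "r \<in> R \<Longrightarrow> x \<in> L \<Longrightarrow> vscale r x \<in> L"
  using assms by (auto simp: submod_def)

lemma submod_sum:
  assumes "submod n R A" "submod n R B"
  shows "submod n R (subgroup_sum A B)"
  unfolding submod_def
proof (intro conjI ballI)
  show "add_subgroup (subgroup_sum A B)" using assms by (simp add: submod_def add_subgroup_subgroup_sum)
  show "subgroup_sum A B \<subseteq> vecs n"
    by (rule subgroup_sum_least) (use assms in \<open>auto simp: submod_def add_subgroup_vecs\<close>)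
  fix r x assume "r \<in> R" "x \<in> subgroup_sum A B"
  then obtain a b where "a \<in> A" "b \<in> B" "x = a + b" by (elim subgroup_sumE)
  then show "vscale r x \<in> subgroup_sum A B"
    using \<open>r \<in> R\<close> assms by (simp add: vscale_add_right subgroup_sumI submod_def)
qed

lemma submod_vscale_image:
  assumes "submod n R L"
  shows "submod n R (vscale c ` L)"
  unfolding submod_def
proof (intro conjI ballI add_subgroupI)
  show "0 \<in> vscale c ` L"
    using add_subgroup_zero[OF submodD(1)[OF assms]] by (metis image_eqI vscale_zero_right)
  fix x y assume "x \<in> vscale c ` L" "y \<in> vscale c ` L"
  then show "x - y \<in> vscale c ` L"
    using add_subgroup_diff[OF submodD(1)[OF assms]] by (force simp flip: vscale_diff_right)
next
  show "vscale c ` L \<subseteq> vecs n" using submodD(2)[OF assms] by (auto simp: vscale_in_vecs)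
next
  fix r x assume "r \<in> R" "x \<in> vscale c ` L"
  then obtain y where "y \<in> L" "x = vscale c y" by blast
  then have "vscale r x = vscale c (vscale r y)" by (simp add: vscale_vscale mult.commute)
  then show "vscale r x \<in> vscale c ` L" using submodD(3)[OF assms] \<open>r \<in> R\<close> \<open>y \<in> L\<close> by auto
qed

lemma vapp_diff: "vapp n g (x - y) = vapp n g x - vapp n g y"
  by (simp add: vapp_def fun_eq_iff algebra_simps sum_subtractf)

lemma vapp_add: "vapp n g (x + y) = vapp n g x + vapp n g y"
  by (simp add: vapp_def fun_eq_iff algebra_simps sum.distrib)

lemma vapp_zero [simp]: "vapp n g 0 = 0"
  by (simp add: vapp_def fun_eq_iff)

lemma vapp_vscale: "vapp n g (vscale a x) = vscale a (vapp n g x)"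
  by (simp add: vapp_def fun_eq_iff sum_distrib_left mult.assoc)

lemma vapp_mat_diff: "vapp n (\<lambda>a. g a - h a) x = vapp n g x - vapp n h x"
  by (simp add: vapp_def fun_eq_iff algebra_simps sum_subtractf)

lemma vapp_eq_sum: "vapp n g x = (\<Sum>a<n. vscale (x a) (g a))"
  by (simp add: vapp_def fun_eq_iff sum_fun_apply)

lemma vapp_in_submod:
  assumes "submod n UNIV D" "\<And>a. a < n \<Longrightarrow> g a \<in> D"
  shows "vapp n g x \<in> D"
  unfolding vapp_eq_sum
  by (rule add_subgroup_sum) (use assms in \<open>auto simp: submod_def\<close>)

lemma vapp_in_vecs: "is_mat n g \<Longrightarrow> vapp n g x \<in> vecs n"
  by (rule vapp_in_submod[OF submod_vecs]) (simp add: is_mat_def)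

lemma unit_vec_in_vecs: "a < n \<Longrightarrow> unit_vec a \<in> vecs n"
  by (simp add: unit_vec_def vecs_def)

lemma vapp_unit_vec: "a < n \<Longrightarrow> vapp n g (unit_vec a) = g a"
  by (simp add: vapp_def unit_vec_def fun_eq_iff if_distrib[of "\<lambda>x. x * _"] cong: if_cong)

lemma vapp_vapp: "vapp n g (vapp n h x) = vapp n (\<lambda>a. vapp n g (h a)) x"
  by (simp add: vapp_def fun_eq_iff sum_distrib_left sum_distrib_right mult.assoc)
     (intro allI sum.swap)

lemma submod_vapp_image:
  assumes "submod n R L" "is_mat n g"
  shows "submod n R (vapp n g ` L)"
  unfolding submod_def
proof (intro conjI ballI add_subgroupI)
  show "0 \<in> vapp n g ` L"
    using add_subgroup_zero[OF submodD(1)[OF assms(1)]] by (metis image_eqI vapp_zero)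
  fix x y assume "x \<in> vapp n g ` L" "y \<in> vapp n g ` L"
  then show "x - y \<in> vapp n g ` L"
    using add_subgroup_diff[OF submodD(1)[OF assms(1)]] by (force simp flip: vapp_diff)
next
  show "vapp n g ` L \<subseteq> vecs n" using vapp_in_vecs[OF assms(2)] by auto
next
  fix r x assume "r \<in> R" "x \<in> vapp n g ` L"
  then show "vscale r x \<in> vapp n g ` L"
    using submodD(3)[OF assms(1)] by (force simp flip: vapp_vscale)
qed

lemma submod_vapp_vimage:
  assumes "submod n R D"
  shows "submod n R {x \<in> vecs n. vapp n g x \<in> D}"
  using submodD[OF assms] add_subgroup_vecs[of n]
  by (auto simp: submod_def add_subgroup_def vapp_diff vapp_vscale vscale_in_vecs)

lemma grp_index_vapp_image:
  assumes "inj_on (vapp n g) (vecs n)" "submod n R A" "submod n R B" "is_mat n g" "B \<subseteq> A"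
  shows "grp_index (vapp n g ` A) (vapp n g ` B) = grp_index A B"
proof (rule sym, rule grp_index_transfer)
  show "add_subgroup B" "add_subgroup (vapp n g ` B)"
    using submodD(1)[OF assms(3)] submodD(1)[OF submod_vapp_image[OF assms(3,4)]] by simp_all
  fix x y assume "x \<in> A" "y \<in> A"
  then have "x - y \<in> vecs n" using submodD(1,2)[OF assms(2)] add_subgroup_diff by blast
  moreover have "B \<subseteq> vecs n" using submodD(2)[OF assms(3)] .
  ultimately have "vapp n g (x - y) \<in> vapp n g ` B \<longleftrightarrow> x - y \<in> B"
    using inj_on_image_mem_iff[OF assms(1)] by blast
  then show "x - y \<in> B \<longleftrightarrow> vapp n g x - vapp n g y \<in> vapp n g ` B"
    by (simp add: vapp_diff)
qed simp

text \<open>The S-span S L of the overview, S being the whole type \<open>'s\<close>.\<close>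

definition gen_hull :: "nat \<Rightarrow> (nat \<Rightarrow> 's::comm_ring_1) set \<Rightarrow> (nat \<Rightarrow> 's) set" where
  "gen_hull n L = \<Inter>{M. submod n UNIV M \<and> L \<subseteq> M}"

lemma gen_hull_subset: "L \<subseteq> gen_hull n L"
  by (auto simp: gen_hull_def)

lemma gen_hull_least: "submod n UNIV M \<Longrightarrow> L \<subseteq> M \<Longrightarrow> gen_hull n L \<subseteq> M"
  by (auto simp: gen_hull_def)

lemma submod_gen_hull:
  assumes "L \<subseteq> vecs n"
  shows "submod n UNIV (gen_hull n L)"
proof -
  have "gen_hull n L \<subseteq> vecs n" using gen_hull_least[OF submod_vecs assms] .
  moreover have "add_subgroup (gen_hull n L)"
    unfolding gen_hull_def by (rule add_subgroup_Inter) (auto simp: submod_def)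
  moreover have "vscale r x \<in> gen_hull n L" if "x \<in> gen_hull n L" for r x
    using that by (auto simp: gen_hull_def submod_def)
  ultimately show ?thesis by (simp add: submod_def)
qed

lemma gen_hull_vapp_image:
  assumes "L \<subseteq> vecs n" "is_mat n g"
  shows "gen_hull n (vapp n g ` L) = vapp n g ` gen_hull n L"
proof (rule antisym)
  show "gen_hull n (vapp n g ` L) \<subseteq> vapp n g ` gen_hull n L"
    by (intro gen_hull_least submod_vapp_image submod_gen_hull assms image_mono gen_hull_subset)
  have sub: "submod n UNIV (gen_hull n (vapp n g ` L))"
    by (rule submod_gen_hull) (use vapp_in_vecs[OF assms(2)] in auto)
  have "gen_hull n L \<subseteq> {x \<in> vecs n. vapp n g x \<in> gen_hull n (vapp n g ` L)}"
    by (intro gen_hull_least submod_vapp_vimage sub) (use gen_hull_subset[of "vapp n g ` L" n] assms(1) in auto)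
  then show "vapp n g ` gen_hull n L \<subseteq> gen_hull n (vapp n g ` L)" by blast
qed

section \<open>Dirichlet polynomials times a fixed series\<close>

text \<open>The coefficients of j^(-s) F(s).\<close>

definition dirichlet_dilate :: "nat \<Rightarrow> dirichlet_series \<Rightarrow> dirichlet_series" where
  "dirichlet_dilate j F k = (if j dvd k then F (k div j) else 0)"

text \<open>\<open>F\<close> is \<open>Z\<close> times a Dirichlet polynomial whose value at \<open>s = n\<close> is \<open>v\<close>.\<close>

definition poly_multiple :: "nat \<Rightarrow> dirichlet_series \<Rightarrow> dirichlet_series \<Rightarrow> complex \<Rightarrow> bool" where
  "poly_multiple n Z F v \<longleftrightarrow> (\<exists>\<rho> S. finite S \<and> 0 \<notin> S \<and> (\<forall>k. k \<notin> S \<longrightarrow> \<rho> k = 0) \<and>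
     F = dirichlet_mult \<rho> Z \<and> (\<Sum>k\<in>S. \<rho> k / of_nat k ^ n) = v)"

lemma poly_multipleI:
  assumes "finite S" "0 \<notin> S" "\<And>k. k \<notin> S \<Longrightarrow> \<rho> k = 0" "F = dirichlet_mult \<rho> Z"
    "(\<Sum>k\<in>S. \<rho> k / of_nat k ^ n) = v"
  shows "poly_multiple n Z F v"
  unfolding poly_multiple_def using assms by (intro exI[of _ \<rho>] exI[of _ S]) simp

lemma poly_multiple_self:
  assumes "Z 0 = 0"
  shows "poly_multiple n Z Z 1"
proof (rule poly_multipleI[of "{1}" "\<lambda>k. if k = 1 then 1 else 0"])
  show "Z = dirichlet_mult (\<lambda>k. if k = 1 then 1 else 0) Z"
  proof
    fix k
    have "(\<Sum>d | d dvd k. (if d = 1 then 1 else 0) * Z (k div d)) = Z k" if "k > 0"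
      using that by (simp add: if_distrib[of "\<lambda>x. x * _"] sum.delta cong: if_cong)
    then show "Z k = dirichlet_mult (\<lambda>k. if k = 1 then 1 else 0) Z k"
      using assms by (cases "k = 0") (simp_all add: dirichlet_mult_def)
  qed
qed auto

text \<open>For k = j l only the divisors of k that are multiples of j matter, and these are j times
  the divisors of l.\<close>

lemma dirichlet_dilate_mult:
  assumes "j > 0" "\<rho> 0 = 0"
  shows "dirichlet_dilate j (dirichlet_mult \<rho> Z) = dirichlet_mult (dirichlet_dilate j \<rho>) Z"
proof
  fix k
  show "dirichlet_dilate j (dirichlet_mult \<rho> Z) k = dirichlet_mult (dirichlet_dilate j \<rho>) Z k"
  proof (cases "k = 0")
    case True
    then show ?thesis by (simp add: dirichlet_dilate_def dirichlet_mult_def)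
  next
    case False
    show ?thesis
    proof (cases "j dvd k")
      case dvd: True
      then obtain l where l: "k = j * l" by blast
      then have l0: "l > 0" using False by auto
      have "dirichlet_mult (dirichlet_dilate j \<rho>) Z k =
          (\<Sum>d | d dvd k. dirichlet_dilate j \<rho> d * Z (k div d))"
        using False by (simp add: dirichlet_mult_def)
      also have "\<dots> = (\<Sum>d\<in>(*) j ` {d. d dvd l}. dirichlet_dilate j \<rho> d * Z (k div d))"
      proof (rule sum.mono_neutral_right)
        show "\<forall>d\<in>{d. d dvd k} - (*) j ` {d. d dvd l}. dirichlet_dilate j \<rho> d * Z (k div d) = 0"
          using l assms(1) by (auto simp: dirichlet_dilate_def)
      qed (use False l in auto)
      also have "\<dots> = (\<Sum>d | d dvd l. dirichlet_dilate j \<rho> (j * d) * Z (k div (j * d)))"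
        using assms(1) by (subst sum.reindex) (auto simp: inj_on_def)
      also have "\<dots> = (\<Sum>d | d dvd l. \<rho> d * Z (l div d))"
        using assms(1) l by (simp add: dirichlet_dilate_def)
      finally show ?thesis
        using l assms(1) l0 by (simp add: dirichlet_dilate_def dirichlet_mult_def)
    next
      case ndvd: False
      have "\<not> j dvd d" if "d dvd k" for d using that ndvd dvd_trans by blast
      then have "(\<Sum>d | d dvd k. dirichlet_dilate j \<rho> d * Z (k div d)) = 0"
        by (intro sum.neutral) (auto simp: dirichlet_dilate_def)
      then show ?thesis
        using ndvd False by (simp add: dirichlet_dilate_def dirichlet_mult_def)
    qed
  qed
qed

lemma poly_multiple_dilate:
  assumes "poly_multiple n Z F v" "j > 0"
  shows "poly_multiple n Z (dirichlet_dilate j F) (v / of_nat j ^ n)"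
proof -
  obtain \<rho> S where *: "finite S" "0 \<notin> S" "\<And>k. k \<notin> S \<Longrightarrow> \<rho> k = 0" "F = dirichlet_mult \<rho> Z"
    "(\<Sum>k\<in>S. \<rho> k / of_nat k ^ n) = v"
    using assms(1) unfolding poly_multiple_def by blast
  show ?thesis
  proof (rule poly_multipleI)
    show "finite ((*) j ` S)" "0 \<notin> (*) j ` S" using * assms(2) by auto
    show "dirichlet_dilate j \<rho> k = 0" if "k \<notin> (*) j ` S" for k
      using that *(3) unfolding dirichlet_dilate_def by (metis dvd_mult_div_cancel image_eqI)
    show "dirichlet_dilate j F = dirichlet_mult (dirichlet_dilate j \<rho>) Z"
      using dirichlet_dilate_mult[of j \<rho> Z] *(2,3,4) assms(2) by simp
    have "(\<Sum>k\<in>(*) j ` S. dirichlet_dilate j \<rho> k / of_nat k ^ n)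
        = (\<Sum>k\<in>S. \<rho> k / of_nat k ^ n / of_nat j ^ n)"
      using assms(2)
      by (subst sum.reindex)
         (auto simp: inj_on_def dirichlet_dilate_def power_mult_distrib field_simps intro!: sum.cong)
    then show "(\<Sum>k\<in>(*) j ` S. dirichlet_dilate j \<rho> k / of_nat k ^ n) = v / of_nat j ^ n"
      by (simp add: sum_divide_distrib flip: *(5))
  qed
qed

lemma poly_multiple_sum:
  assumes "finite I" "\<And>i. i \<in> I \<Longrightarrow> poly_multiple n Z (F i) (v i)"
  shows "poly_multiple n Z (\<lambda>k. \<Sum>i\<in>I. a i * F i k) (\<Sum>i\<in>I. a i * v i)"
proof -
  have "\<forall>i\<in>I. \<exists>\<rho> S. finite S \<and> 0 \<notin> S \<and> (\<forall>k. k \<notin> S \<longrightarrow> \<rho> k = 0) \<and>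
     F i = dirichlet_mult \<rho> Z \<and> (\<Sum>k\<in>S. \<rho> k / of_nat k ^ n) = v i"
    using assms(2) unfolding poly_multiple_def by blast
  then obtain \<rho> S where *: "\<And>i. i \<in> I \<Longrightarrow> finite (S i) \<and> 0 \<notin> S i \<and> (\<forall>k. k \<notin> S i \<longrightarrow> \<rho> i k = 0) \<and>
     F i = dirichlet_mult (\<rho> i) Z \<and> (\<Sum>k\<in>S i. \<rho> i k / of_nat k ^ n) = v i"
    by metis
  show ?thesis
  proof (rule poly_multipleI)
    show "finite (\<Union>i\<in>I. S i)" "0 \<notin> (\<Union>i\<in>I. S i)" using assms(1) * by auto
    show "(\<Sum>i\<in>I. a i * \<rho> i k) = 0" if "k \<notin> (\<Union>i\<in>I. S i)" for k
      by (rule sum.neutral) (use that * in auto)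
    show "(\<lambda>k. \<Sum>i\<in>I. a i * F i k) = dirichlet_mult (\<lambda>k. \<Sum>i\<in>I. a i * \<rho> i k) Z"
    proof
      fix k
      have "(\<Sum>i\<in>I. a i * F i k) = (\<Sum>i\<in>I. a i * dirichlet_mult (\<rho> i) Z k)"
        using * by simp
      also have "\<dots> = dirichlet_mult (\<lambda>k. \<Sum>i\<in>I. a i * \<rho> i k) Z k"
        by (simp add: dirichlet_mult_def sum_distrib_left sum_distrib_right mult.assoc)
           (intro impI sum.swap)
      finally show "(\<Sum>i\<in>I. a i * F i k) = dirichlet_mult (\<lambda>k. \<Sum>i\<in>I. a i * \<rho> i k) Z k" .
    qed
    have "(\<Sum>k\<in>(\<Union>i\<in>I. S i). (\<Sum>i\<in>I. a i * \<rho> i k) / of_nat k ^ n) =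
        (\<Sum>i\<in>I. \<Sum>k\<in>(\<Union>i\<in>I. S i). a i * (\<rho> i k / of_nat k ^ n))"
      by (simp add: sum_divide_distrib) (rule sum.swap)
    also have "\<dots> = (\<Sum>i\<in>I. a i * v i)"
    proof (rule sum.cong[OF refl])
      fix i assume i: "i \<in> I"
      have "(\<Sum>k\<in>(\<Union>i\<in>I. S i). \<rho> i k / of_nat k ^ n) = (\<Sum>k\<in>S i. \<rho> i k / of_nat k ^ n)"
        by (rule sum.mono_neutral_right) (use i assms(1) * in auto)
      then show "(\<Sum>k\<in>(\<Union>i\<in>I. S i). a i * (\<rho> i k / of_nat k ^ n)) = a i * v i"
        using *[OF i] unfolding sum_distrib_left[symmetric] by simp
    qed
    finally show "(\<Sum>k\<in>(\<Union>i\<in>I. S i). (\<Sum>i\<in>I. a i * \<rho> i k) / of_nat k ^ n) = (\<Sum>i\<in>I. a i * v i)" .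
  qed
qed

lemma poly_multiple_diff:
  assumes "poly_multiple n Z F v" "poly_multiple n Z G w"
  shows "poly_multiple n Z (\<lambda>k. F k - G k) (v - w)"
  using poly_multiple_sum[of "UNIV :: bool set" n Z "\<lambda>b. if b then F else G" "\<lambda>b. if b then v else w"
      "\<lambda>b. if b then 1 else - 1"] assms
  by (simp add: UNIV_bool if_distrib[of "\<lambda>f. f _"])

text \<open>Since \<open>Z 1 = 1\<close>, the Dirichlet polynomial is supported where \<open>F\<close> is.\<close>

lemma poly_multiple_contract:
  assumes "poly_multiple n Z F v" "Z 1 = 1" "w > 0" "\<And>k. \<not> w dvd k \<Longrightarrow> F k = 0"
  obtains \<nu> where "\<nu> 0 = 0" "dirichlet_mult \<nu> Z = (\<lambda>k. F (k * w))" "finite {k. \<nu> k \<noteq> 0}"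
    "(\<Sum>k | \<nu> k \<noteq> 0. \<nu> k / of_nat k ^ n) = v * of_nat w ^ n"
proof -
  obtain \<rho> S where *: "finite S" "0 \<notin> S" "\<And>k. k \<notin> S \<Longrightarrow> \<rho> k = 0" "F = dirichlet_mult \<rho> Z"
    "(\<Sum>k\<in>S. \<rho> k / of_nat k ^ n) = v"
    using assms(1) unfolding poly_multiple_def by blast
  have \<rho>0: "\<rho> 0 = 0" using * by blast
  have supp: "\<rho> k = 0" if "\<not> w dvd k" for k
    using that
  proof (induction k rule: less_induct)
    case (less k)
    then have k: "k > 0" by (auto intro: Nat.gr0I)
    have "0 = F k" using assms(4) less.prems by simp
    also have "\<dots> = (\<Sum>d | d dvd k. \<rho> d * Z (k div d))"
      using k by (simp add: *(4) dirichlet_mult_def)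
    also have "\<dots> = (\<Sum>d\<in>{k}. \<rho> d * Z (k div d))"
    proof (rule sum.mono_neutral_right)
      show "\<forall>d\<in>{d. d dvd k} - {k}. \<rho> d * Z (k div d) = 0"
      proof
        fix d assume "d \<in> {d. d dvd k} - {k}"
        then have "d dvd k" "d < k" using k dvd_imp_le[of d k] by auto
        then show "\<rho> d * Z (k div d) = 0" using less by (metis dvd_trans mult_zero_left)
      qed
    qed (use k in auto)
    finally show ?case using k assms(2) by simp
  qed
  define \<nu> where "\<nu> k = \<rho> (k * w)" for k
  have dil: "\<rho> = dirichlet_dilate w \<nu>"
    using supp by (auto simp: fun_eq_iff dirichlet_dilate_def \<nu>_def)
  have \<nu>0: "\<nu> 0 = 0" by (simp add: \<nu>_def \<rho>0)
  have F: "F = dirichlet_dilate w (dirichlet_mult \<nu> Z)"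
    using dirichlet_dilate_mult[of w \<nu> Z] assms(3) \<nu>0 *(4) dil by simp
  have fin: "finite {k. \<rho> k \<noteq> 0}" by (rule finite_subset[OF _ *(1)]) (use *(3) in blast)
  have img: "{k. \<rho> k \<noteq> 0} = (\<lambda>k. k * w) ` {k. \<nu> k \<noteq> 0}"
    using supp by (auto simp: \<nu>_def image_iff) (metis dvd_def mult.commute)
  have inj: "inj_on (\<lambda>k. k * w) A" for A using assms(3) by (auto simp: inj_on_def)
  show thesis
  proof (rule that[of \<nu>])
    show "\<nu> 0 = 0" by fact
    show "dirichlet_mult \<nu> Z = (\<lambda>k. F (k * w))"
      using assms(3) by (simp add: F dirichlet_dilate_def)
    show "finite {k. \<nu> k \<noteq> 0}" using fin inj unfolding img by (simp add: finite_image_iff)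
    have "v = (\<Sum>k | \<rho> k \<noteq> 0. \<rho> k / of_nat k ^ n)"
      unfolding *(5)[symmetric] by (rule sum.mono_neutral_right) (use * in auto)
    also have "\<dots> = (\<Sum>k | \<nu> k \<noteq> 0. \<nu> k / of_nat k ^ n / of_nat w ^ n)"
      unfolding img by (simp add: sum.reindex[OF inj] \<nu>_def power_mult_distrib)
    finally show "(\<Sum>k | \<nu> k \<noteq> 0. \<nu> k / of_nat k ^ n) = v * of_nat w ^ n"
      using assms(3) by (simp add: sum_divide_distrib[symmetric] del: divide_divide_eq_left divide_divide_eq_right)
  qed
qed

text \<open>Since \<open>g 1 = 1\<close>, the term d = k of the convolution is \<open>h k\<close>
  itself, so the coefficients of a quotient are determined one after the other.\<close>

lemma dirichlet_divide_eqI: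
  assumes "h 0 = 0" "dirichlet_mult h g = f" "g 1 = 1"
  shows "dirichlet_divide f g = h"
  unfolding dirichlet_divide_def
proof (rule the_equality)
  fix h' assume h': "h' 0 = 0 \<and> dirichlet_mult h' g = f"
  have "h' k = h k" for k
  proof (induction k rule: less_induct)
    case (less k)
    show ?case
    proof (cases "k = 0")
      case False
      have split: "dirichlet_mult u g k = u k + (\<Sum>d\<in>{d. d dvd k} - {k}. u d * g (k div d))" for u
        using False assms(3) sum.remove[of "{d. d dvd k}" k "\<lambda>d. u d * g (k div d)"]
        by (simp add: dirichlet_mult_def)
      have "(\<Sum>d\<in>{d. d dvd k} - {k}. h' d * g (k div d)) = (\<Sum>d\<in>{d. d dvd k} - {k}. h d * g (k div d))"
      proof (rule sum.cong[OF refl])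
        fix d assume "d \<in> {d. d dvd k} - {k}"
        then have "d < k" using False dvd_imp_le[of d k] by auto
        then show "h' d * g (k div d) = h d * g (k div d)" by (simp add: less.IH)
      qed
      moreover have "dirichlet_mult h' g k = dirichlet_mult h g k" using h' assms(2) by simp
      ultimately show ?thesis using split[of h] split[of h'] by simp
    qed (use h' assms(1) in simp)
  qed
  then show "h' = h" by (rule ext)
qed (use assms in blast)

text \<open>k^n is completely multiplicative, so the shift of s by n commutes with products.\<close>

lemma dirichlet_shift_mult:
  "dirichlet_mult (dirichlet_shift f n) (dirichlet_shift g n) = dirichlet_shift (dirichlet_mult f g) n"
proof
  fix k
  have eq: "f d / of_nat d ^ n * (g (k div d) / of_nat (k div d) ^ n) = f d * g (k div d) / of_nat k ^ n"
    if "d dvd k" for d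
  proof -
    obtain l where l: "k = d * l" using \<open>d dvd k\<close> by blast
    show ?thesis
    proof (cases "d = 0")
      case False
      then show ?thesis by (simp add: l power_mult_distrib)
    qed (cases n; simp add: l)
  qed
  show "dirichlet_mult (dirichlet_shift f n) (dirichlet_shift g n) k = dirichlet_shift (dirichlet_mult f g) n k"
    unfolding dirichlet_mult_def dirichlet_shift_def
    by (auto simp: sum_divide_distrib eq simp del: times_divide_eq_right times_divide_eq_left intro!: sum.cong)
qed

text \<open>At s = 0 every k^(-s) is 1 and only the weights k^(-n) of the shift remain. From here on
  the object of study is therefore the value at s = n of an unshifted Dirichlet polynomial.\<close>

lemma dirichlet_poly_value_divide:
  assumes "\<nu> 0 = 0" "dirichlet_mult \<nu> g = f" "g 1 = 1" "finite {k. \<nu> k \<noteq> 0}"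
    "(\<Sum>k | \<nu> k \<noteq> 0. \<nu> k / of_nat k ^ n) = v"
  shows "dirichlet_poly_value (dirichlet_divide (dirichlet_shift f n) (dirichlet_shift g n)) 0 v"
proof -
  have "dirichlet_divide (dirichlet_shift f n) (dirichlet_shift g n) = dirichlet_shift \<nu> n"
    by (rule dirichlet_divide_eqI)
       (use assms in \<open>simp_all add: dirichlet_shift_mult\<close>, simp_all add: dirichlet_shift_def)
  moreover have "{k. dirichlet_shift \<nu> n k \<noteq> 0} = {k. \<nu> k \<noteq> 0}"
    using assms(1) by (auto simp: dirichlet_shift_def intro: Nat.gr0I)
  moreover have "of_nat k powr (- 0 :: complex) = 1" if "\<nu> k \<noteq> 0" for k
  proof -
    have "k \<noteq> 0" using that assms(1) by metis
    then show ?thesis by simp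
  qed
  ultimately show ?thesis
    using assms(4,5) unfolding dirichlet_poly_value_def by (simp add: dirichlet_shift_def)
qed

section \<open>The zeta function of an order as a multiple of that of its normalization\<close>

lemma card_fibres:
  assumes "finite A" "finite B" "f ` A \<subseteq> B"
  shows "card A = (\<Sum>b\<in>B. card {a \<in> A. f a = b})"
  using sum.group[OF assms, of "\<lambda>_. 1 :: nat"] by simp

lemma card_matrices:
  "card {g :: nat \<Rightarrow> 'v::zero. (\<forall>a<n. g a \<in> A) \<and> (\<forall>a\<ge>n. g a = 0)} = card A ^ n"
proof -
  have "bij_betw (\<lambda>g. restrict g {..<n})
      {g :: nat \<Rightarrow> 'v. (\<forall>a<n. g a \<in> A) \<and> (\<forall>a\<ge>n. g a = 0)} ({..<n} \<rightarrow>\<^sub>E A)"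
  proof (rule bij_betwI[where g = "\<lambda>h a. if a < n then h a else 0"])
    show "(\<lambda>g. restrict g {..<n}) \<in> {g. (\<forall>a<n. g a \<in> A) \<and> (\<forall>a\<ge>n. g a = 0)} \<rightarrow> {..<n} \<rightarrow>\<^sub>E A"
      by (rule Pi_I) (simp add: PiE_iff)
    show "(\<lambda>h a. if a < n then h a else 0) \<in> ({..<n} \<rightarrow>\<^sub>E A) \<rightarrow> {g. (\<forall>a<n. g a \<in> A) \<and> (\<forall>a\<ge>n. g a = 0)}"
      by (rule Pi_I) (simp add: PiE_iff)
    show "(\<lambda>a. if a < n then restrict g {..<n} a else 0) = g"
      if "g \<in> {g. (\<forall>a<n. g a \<in> A) \<and> (\<forall>a\<ge>n. g a = 0)}" for g
      using that by (simp add: fun_eq_iff)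
    show "restrict (\<lambda>a. if a < n then h a else 0) {..<n} = h" if "h \<in> {..<n} \<rightarrow>\<^sub>E A" for h
      using that by (simp add: fun_eq_iff PiE_iff extensional_def)
  qed
  then show ?thesis
    using bij_betw_same_card by (fastforce simp: card_PiE)
qed

text \<open>The type \<open>'s\<close> is the normalization S and \<open>c\<close> generates an
  S-ideal inside the order \<open>R\<close>. \<open>free\<close> expresses that S is a principal
  ideal ring, \<open>stable_range\<close> that it is semilocal (a matrix that is onto modulo
  \<open>D\<close> is congruent modulo \<open>D\<close> to an invertible one), and
  \<open>duality\<close> is the Gorenstein property of \<open>R\<close>. Power series enter the zeta
  quotient only through these assumptions.\<close>

locale order_lattices =
  fixes n :: nat and R :: "'s::comm_ring_1 set" and c :: 's
  assumes one_mem: "1 \<in> R" and diff_mem: "a \<in> R \<Longrightarrow> b \<in> R \<Longrightarrow> a - b \<in> R"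
    and mult_mem: "a \<in> R \<Longrightarrow> b \<in> R \<Longrightarrow> a * b \<in> R"
    and conductor: "c * s \<in> R"
    and conductor_index: "grp_index (UNIV :: 's set) (range ((*) c)) \<noteq> 0"
    and free: "submod n (UNIV :: 's set) M \<Longrightarrow> grp_index (vecs n) M \<noteq> 0 \<Longrightarrow>
      \<exists>g. is_mat n g \<and> inj_on (vapp n g) (vecs n) \<and> vapp n g ` vecs n = M"
    and stable_range: "is_mat n \<alpha> \<Longrightarrow> submod n (UNIV :: 's set) D \<Longrightarrow>
      subgroup_sum (vapp n \<alpha> ` vecs n) D = vecs n \<Longrightarrow>
      \<exists>\<beta>. is_mat n \<beta> \<and> bij_betw (vapp n \<beta>) (vecs n) (vecs n) \<and> (\<forall>a<n. \<alpha> a - \<beta> a \<in> D)"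
    and finite_submods: "k \<noteq> 0 \<Longrightarrow> finite {M. submod n (UNIV :: 's set) M \<and> grp_index (vecs n) M = k}"
    and duality: "submod n R L \<Longrightarrow> vscale c ` vecs n \<subseteq> L \<Longrightarrow>
      grp_index {v \<in> vecs n. \<forall>x\<in>L. (\<Sum>a<n. x a * v a) \<in> R} (vscale c ` vecs n) = grp_index (vecs n) L"
begin

abbreviation "V \<equiv> vecs n :: (nat \<Rightarrow> 's) set"
abbreviation "C \<equiv> vscale c ` V"

definition Rn :: "(nat \<Rightarrow> 's) set" where "Rn = {x \<in> V. \<forall>j. x j \<in> R}"

definition full_lattices :: "(nat \<Rightarrow> 's) set set" where
  "full_lattices = {L. submod n R L \<and> gen_hull n L = V}"

definition nlat :: "(nat \<Rightarrow> 's) set \<Rightarrow> nat \<Rightarrow> nat" where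
  "nlat M j = card {L. submod n R L \<and> L \<subseteq> Rn \<and> gen_hull n L = M \<and> grp_index M L = j}"

text \<open>The lattices L of \<open>nlat\<close> pulled back along \<open>g\<close>. Unlike
  \<open>nlat\<close> this makes sense for a matrix that does not act injectively, and it depends
  only on \<open>g\<close> modulo \<open>C\<close>.\<close>

definition nmat :: "(nat \<Rightarrow> nat \<Rightarrow> 's) \<Rightarrow> nat \<Rightarrow> nat" where
  "nmat g j = card {L \<in> full_lattices. vapp n g ` L \<subseteq> Rn \<and> grp_index V L = j}"

lemma subgroup_V: "add_subgroup V"
  by (rule add_subgroup_vecs)

lemma zero_mem: "0 \<in> R"
  using conductor[of 0] by simp

lemma submod_C: "submod n UNIV C"
  by (rule submod_vscale_image[OF submod_vecs])

lemma subgroup_C: "add_subgroup C"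
  using submod_C by (rule submodD)

lemma C_sub_V: "C \<subseteq> V"
  using submod_C by (rule submodD)

lemma submod_Rn: "submod n R Rn"
  unfolding submod_def
proof (intro conjI ballI add_subgroupI)
  show "0 \<in> Rn" by (simp add: Rn_def zero_mem vecs_def)
  show "x - y \<in> Rn" if "x \<in> Rn" "y \<in> Rn" for x y
    using that by (simp add: Rn_def diff_mem vecs_def)
  show "vscale r x \<in> Rn" if "r \<in> R" "x \<in> Rn" for r x
    using that by (simp add: Rn_def mult_mem vscale_in_vecs)
qed (auto simp: Rn_def)

lemma C_sub_Rn: "C \<subseteq> Rn"
  using C_sub_V by (auto simp: Rn_def conductor)

text \<open>The vectors x with c s x in L for all s form an S-module, and it contains L because c S
  lies in R; so it contains S L.\<close>

lemma conductor_gen_hull: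
  assumes "submod n R L" "x \<in> gen_hull n L"
  shows "vscale c x \<in> L"
proof -
  let ?M = "{x \<in> V. \<forall>s. vscale (c * s) x \<in> L}"
  note L = submodD[OF assms(1)]
  have "submod n UNIV ?M"
    unfolding submod_def
  proof (intro conjI ballI add_subgroupI)
    show "0 \<in> ?M" using add_subgroup_zero[OF L(1)] by (simp add: vecs_def)
    show "x - y \<in> ?M" if "x \<in> ?M" "y \<in> ?M" for x y
      using that add_subgroup_diff[OF L(1)] add_subgroup_diff[OF subgroup_V]
      by (simp add: vscale_diff_right)
    show "vscale r x \<in> ?M" if "x \<in> ?M" for r x
      using that by (simp add: vscale_vscale vscale_in_vecs mult.assoc)
  qed auto
  moreover have "L \<subseteq> ?M" using L(2) L(3)[OF conductor] by blast
  ultimately have "gen_hull n L \<subseteq> ?M" by (rule gen_hull_least)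
  then have "vscale (c * 1) x \<in> L" using assms(2) by blast
  then show ?thesis by simp
qed

text \<open>The transversal of \<open>V\<close> modulo \<open>C\<close> is taken coordinatewise, so that it is stable under
  transposition of matrices.\<close>

definition T0 :: "'s set" where
  "T0 = (SOME T. card T = grp_index (UNIV :: 's set) (range ((*) c)) \<and>
     (\<forall>a. \<exists>t\<in>T. a - t \<in> range ((*) c)) \<and> (\<forall>s\<in>T. \<forall>t\<in>T. s - t \<in> range ((*) c) \<longrightarrow> s = t))"

definition T :: "(nat \<Rightarrow> 's) set" where
  "T = {x. (\<forall>j<n. x j \<in> T0) \<and> (\<forall>j\<ge>n. x j = 0)}"

text \<open>Rows from \<open>n\<close> on are set to zero to make \<open>Mat T\<close> a finite set
  of representatives of the n by n matrices over S modulo c.\<close>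

definition Mat :: "(nat \<Rightarrow> 's) set \<Rightarrow> (nat \<Rightarrow> nat \<Rightarrow> 's) set" where
  "Mat A = {g. (\<forall>a<n. g a \<in> A) \<and> (\<forall>a\<ge>n. g a = 0)}"

lemma subgroup_range_c: "add_subgroup (range ((*) c))"
proof (rule add_subgroupI)
  show "0 \<in> range ((*) c)" by (metis mult_zero_right rangeI)
  fix x y assume "x \<in> range ((*) c)" "y \<in> range ((*) c)"
  then obtain u w where "x = c * u" "y = c * w" by auto
  then have "x - y = c * (u - w)" by (simp add: right_diff_distrib)
  then show "x - y \<in> range ((*) c)" by simp
qed

lemma T0: "card T0 = grp_index (UNIV :: 's set) (range ((*) c))"
  "\<exists>t\<in>T0. a - t \<in> range ((*) c)" "s \<in> T0 \<Longrightarrow> t \<in> T0 \<Longrightarrow> s - t \<in> range ((*) c) \<Longrightarrow> s = t"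
proof -
  have "\<exists>T. card T = grp_index (UNIV :: 's set) (range ((*) c)) \<and>
     (\<forall>a. \<exists>t\<in>T. a - t \<in> range ((*) c)) \<and> (\<forall>s\<in>T. \<forall>t\<in>T. s - t \<in> range ((*) c) \<longrightarrow> s = t)"
    by (rule transversal_exists[OF subgroup_range_c, of UNIV]) blast
  from someI_ex[OF this] show "card T0 = grp_index (UNIV :: 's set) (range ((*) c))"
    "\<exists>t\<in>T0. a - t \<in> range ((*) c)" "s \<in> T0 \<Longrightarrow> t \<in> T0 \<Longrightarrow> s - t \<in> range ((*) c) \<Longrightarrow> s = t"
    unfolding T0_def[symmetric] by blast+
qed

lemma T_sub_V: "T \<subseteq> V"
  by (auto simp: T_def vecs_def)

lemma mem_C_iff: "x \<in> C \<longleftrightarrow> x \<in> V \<and> (\<forall>j<n. x j \<in> range ((*) c))"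
proof
  assume "x \<in> V \<and> (\<forall>j<n. x j \<in> range ((*) c))"
  then have x: "x \<in> V" and "\<forall>j. \<exists>y. j < n \<longrightarrow> x j = c * y" by auto
  then obtain y where y: "\<And>j. j < n \<Longrightarrow> x j = c * y j" by metis
  have "x = vscale c (\<lambda>j. if j < n then y j else 0)"
    using x y by (auto simp: fun_eq_iff vecs_def)
  then show "x \<in> C" by (auto simp: vecs_def)
qed (auto simp: vscale_in_vecs)

lemma T_cover: 
  assumes "v \<in> V"
  obtains t where "t \<in> T" "v - t \<in> C"
proof -
  have "\<forall>j. \<exists>t. t \<in> T0 \<and> v j - t \<in> range ((*) c)" using T0(2) by blast
  then obtain f where f: "\<And>j. f j \<in> T0 \<and> v j - f j \<in> range ((*) c)" by metis
  define t where "t = (\<lambda>j. if j < n then f j else 0)"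
  have "t \<in> T" using f by (simp add: T_def t_def)
  moreover have "v - t \<in> V" using assms by (simp add: vecs_def t_def)
  then have "v - t \<in> C" unfolding mem_C_iff using f by (simp add: t_def)
  ultimately show thesis by (rule that)
qed

lemma T_unique: 
  assumes "s \<in> T" "t \<in> T" "s - t \<in> C"
  shows "s = t"
proof
  fix j
  show "s j = t j"
  proof (cases "j < n")
    case True
    then have "s j - t j \<in> range ((*) c)" using assms(3) by (simp add: mem_C_iff)
    then show ?thesis using T0(3) assms(1,2) True by (simp add: T_def)
  qed (use assms in \<open>simp add: T_def\<close>)
qed

lemma card_T_Int:
  assumes "add_subgroup A" "C \<subseteq> A" "A \<subseteq> V"
  shows "card (T \<inter> A) = grp_index A C"
proof (rule sym, rule grp_index_eq_card_transversal[OF subgroup_C])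
  show "\<exists>t\<in>T \<inter> A. a - t \<in> C" if a: "a \<in> A" for a
  proof -
    obtain t where t: "t \<in> T" "a - t \<in> C" using T_cover a assms(3) by blast
    then have "a - (a - t) \<in> A" using a assms add_subgroup_diff by blast
    then show ?thesis using t by auto
  qed
qed (auto intro: T_unique)

lemma card_T: "card T = card T0 ^ n"
  using card_matrices[of n T0] by (simp add: T_def)

lemma grp_index_V_C: "grp_index V C = card T0 ^ n"
  using card_T_Int[OF subgroup_V C_sub_V] T_sub_V card_T by (simp add: Int_absorb2)

lemma grp_index_V_C_pos: "grp_index V C \<noteq> 0"
  unfolding grp_index_V_C T0(1) using conductor_index by simp

lemma card_Mat: "card (Mat A) = card A ^ n"
  unfolding Mat_def by (rule card_matrices)

lemma finite_T: "finite T"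
  using card_T conductor_index T0(1) by (metis card.infinite power_not_zero)

lemma finite_Mat: "finite (Mat T)"
proof (cases "n = 0")
  case True
  then have "Mat T = {0}" unfolding Mat_def by (auto simp: fun_eq_iff)
  then show ?thesis by simp
next
  case False
  have "T \<noteq> {}"
    using T_cover[of 0] add_subgroup_zero[OF add_subgroup_vecs] by blast
  then have "card (Mat T) \<noteq> 0" using finite_T by (simp add: card_Mat)
  then show ?thesis by (intro card_ge_0_finite) simp
qed

lemma Mat_is_mat: "g \<in> Mat T \<Longrightarrow> is_mat n g"
  using T_sub_V by (auto simp: Mat_def is_mat_def)

lemma finite_index_between:
  assumes "add_subgroup P" "C \<subseteq> P" "P \<subseteq> V"
  shows "grp_index V P \<noteq> 0" "grp_index P C \<noteq> 0" "grp_index V C = grp_index V P * grp_index P C"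
proof -
  show *: "grp_index V C = grp_index V P * grp_index P C"
    by (rule grp_index_mult) (use assms subgroup_V subgroup_C in auto)
  show "grp_index V P \<noteq> 0" "grp_index P C \<noteq> 0" using * grp_index_V_C_pos by auto
qed

lemma grp_index_conductor:
  assumes "submod n UNIV M" "grp_index V M \<noteq> 0"
  shows "grp_index M (vscale c ` M) \<noteq> 0"
proof -
  obtain g where g: "is_mat n g" "inj_on (vapp n g) V" "vapp n g ` V = M"
    using free[OF assms] by blast
  have "vscale c ` M = vapp n g ` C"
    unfolding g(3)[symmetric] by (simp add: image_image vapp_vscale)
  then have "grp_index M (vscale c ` M) = grp_index V C"
    using grp_index_vapp_image[OF g(2) submod_vecs submod_C g(1) C_sub_V] g(3) by simp
  then show ?thesis using grp_index_V_C_pos by simp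
qed

text \<open>By \<open>conductor_gen_hull\<close> such an L lies between c M and M, and the index of
  c M in M is finite because M is free.\<close>

lemma finite_lattices_in:
  assumes "submod n UNIV M" "grp_index V M \<noteq> 0"
  shows "finite {L. submod n R L \<and> gen_hull n L = M}"
proof (rule finite_subset)
  show "{L. submod n R L \<and> gen_hull n L = M} \<subseteq> {H. add_subgroup H \<and> vscale c ` M \<subseteq> H \<and> H \<subseteq> M}"
  proof
    fix L assume "L \<in> {L. submod n R L \<and> gen_hull n L = M}"
    then have L: "submod n R L" "gen_hull n L = M" by auto
    have "L \<subseteq> M" using gen_hull_subset[of L n] L(2) by simp
    moreover have "vscale c ` M \<subseteq> L" using conductor_gen_hull[OF L(1)] L(2) by auto
    ultimately show "L \<in> {H. add_subgroup H \<and> vscale c ` M \<subseteq> H \<and> H \<subseteq> M}"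
      using submodD(1)[OF L(1)] by simp
  qed
  show "finite {H. add_subgroup H \<and> vscale c ` M \<subseteq> H \<and> H \<subseteq> M}"
    by (rule finite_between_subgroups[OF submodD(1)[OF assms(1)]
          submodD(1)[OF submod_vscale_image[OF assms(1)]] grp_index_conductor[OF assms]])
qed

lemma finite_full_lattices: "finite full_lattices"
  unfolding full_lattices_def
  by (rule finite_lattices_in[OF submod_vecs]) (simp add: grp_index_self add_subgroup_vecs)

lemma gen_hull_index:
  assumes "submod n R L"
  shows "submod n UNIV (gen_hull n L)" "grp_index V L = grp_index V (gen_hull n L) * grp_index (gen_hull n L) L"
proof -
  note L = submodD[OF assms]
  show s: "submod n UNIV (gen_hull n L)" by (rule submod_gen_hull[OF L(2)])
  show "grp_index V L = grp_index V (gen_hull n L) * grp_index (gen_hull n L) L"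
    by (rule grp_index_mult[OF submodD(1)[OF s] L(1) add_subgroup_vecs gen_hull_subset submodD(2)[OF s]])
qed

lemma finite_lattices:
  assumes "k \<noteq> 0"
  shows "finite {L. submod n R L \<and> grp_index V L = k}"
proof (rule finite_subset)
  let ?\<M> = "\<Union>d\<in>{d. d dvd k}. {M. submod n UNIV M \<and> grp_index V M = d}"
  show "{L. submod n R L \<and> grp_index V L = k} \<subseteq> (\<Union>M\<in>?\<M>. {L. submod n R L \<and> gen_hull n L = M})"
  proof clarify
    fix L assume L: "submod n R L" "k = grp_index V L"
    then show "L \<in> (\<Union>M\<in>(\<Union>d\<in>{d. d dvd grp_index V L}. {M. submod n UNIV M \<and> grp_index V M = d}). {L. submod n R L \<and> gen_hull n L = M})"
      using gen_hull_index[OF L(1)] by auto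
  qed
  show "finite (\<Union>M\<in>?\<M>. {L. submod n R L \<and> gen_hull n L = M})"
  proof (rule finite_UN_I)
    show "finite ?\<M>"
    proof (rule finite_UN_I)
      fix d assume "d \<in> {d. d dvd k}"
      then show "finite {M. submod n (UNIV :: 's set) M \<and> grp_index V M = d}"
        using assms by (intro finite_submods) auto
    qed (use assms in simp)
    show "finite {L. submod n R L \<and> gen_hull n L = M}" if "M \<in> ?\<M>" for M
      using that assms by (intro finite_lattices_in) auto
  qed
qed

end

section \<open>Lattices spanned by matrices, and their dependence on the matrix modulo the
  conductor\<close>

context order_lattices begin

text \<open>The map L to L g is a bijection from the lattices with span S^n to those with span S^n
  g; injectivity of \<open>g\<close> preserves indices.\<close>

lemma nlat_vapp:
  assumes g: "is_mat n g" "inj_on (vapp n g) V"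
  shows "nlat (vapp n g ` V) j = nmat g j"
proof -
  let ?A = "{L \<in> full_lattices. vapp n g ` L \<subseteq> Rn \<and> grp_index V L = j}"
  let ?B = "{L. submod n R L \<and> L \<subseteq> Rn \<and> gen_hull n L = vapp n g ` V \<and> grp_index (vapp n g ` V) L = j}"
  have bij: "bij_betw ((`) (vapp n g)) ?A ?B"
  proof (rule bij_betw_imageI)
    have "?A \<subseteq> Pow V" using submodD(2) by (auto simp: full_lattices_def)
    then show "inj_on ((`) (vapp n g)) ?A"
      using inj_on_image_Pow[OF g(2)] inj_on_subset by blast
    show "(`) (vapp n g) ` ?A = ?B"
    proof (intro equalityI subsetI)
      fix L' assume "L' \<in> (`) (vapp n g) ` ?A"
      then obtain L where L: "L' = vapp n g ` L" "submod n R L" "gen_hull n L = V"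
        "vapp n g ` L \<subseteq> Rn" "grp_index V L = j"
        by (auto simp: full_lattices_def)
      have "grp_index (vapp n g ` V) L' = j"
        unfolding L(1) using grp_index_vapp_image[OF g(2) submod_vecs L(2) g(1) submodD(2)[OF L(2)]] L(5)
        by simp
      moreover have "gen_hull n L' = vapp n g ` V"
        unfolding L(1) gen_hull_vapp_image[OF submodD(2)[OF L(2)] g(1)] L(3) by simp
      ultimately show "L' \<in> ?B"
        using L(1,4) submod_vapp_image[OF L(2) g(1)] by simp
    next
      fix L' assume "L' \<in> ?B"
      then have L': "submod n R L'" "L' \<subseteq> Rn" "gen_hull n L' = vapp n g ` V"
        "grp_index (vapp n g ` V) L' = j" by auto
      define L where "L = {x \<in> V. vapp n g x \<in> L'}"
      have sub: "submod n R L" unfolding L_def by (rule submod_vapp_vimage[OF L'(1)])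
      have "L' \<subseteq> vapp n g ` V" using gen_hull_subset[of L' n] L'(3) by simp
      then have img: "L' = vapp n g ` L" by (auto simp: L_def)
      have LV: "L \<subseteq> V" by (auto simp: L_def)
      have "vapp n g ` gen_hull n L = vapp n g ` V"
        using gen_hull_vapp_image[OF LV g(1)] L'(3) img by simp
      moreover have "gen_hull n L \<subseteq> V" by (rule gen_hull_least[OF submod_vecs LV])
      ultimately have "gen_hull n L = V" using inj_on_image_eq_iff[OF g(2)] by blast
      moreover have "grp_index V L = j"
        using grp_index_vapp_image[OF g(2) submod_vecs sub g(1) LV] L'(4) img by simp
      ultimately have "L \<in> ?A" using sub L'(2) img by (simp add: full_lattices_def)
      then show "L' \<in> (`) (vapp n g) ` ?A" using img by blast
    qed
  qed
  show ?thesis unfolding nlat_def nmat_def by (rule bij_betw_same_card[OF bij, symmetric])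
qed

lemma vapp_cong_mod:
  assumes "submod n UNIV D" "\<And>a. a < n \<Longrightarrow> h a - g a \<in> D"
  shows "vapp n h x - vapp n g x \<in> D"
  unfolding vapp_mat_diff[symmetric] by (rule vapp_in_submod[OF assms(1)]) (rule assms(2))

text \<open>Images of a vector under congruent matrices differ by an element of \<open>C\<close>,
  and \<open>C\<close> lies in R^n.\<close>

lemma nmat_cong:
  assumes "\<And>a. a < n \<Longrightarrow> h a - g a \<in> C"
  shows "nmat h j = nmat g j"
proof -
  have "vapp n h x \<in> Rn \<longleftrightarrow> vapp n g x \<in> Rn" for x
  proof -
    have d: "vapp n h x - vapp n g x \<in> Rn"
      by (rule subsetD[OF C_sub_Rn vapp_cong_mod[OF submod_C assms]])
    note Rn = submodD(1)[OF submod_Rn]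
    show ?thesis
      using add_subgroup_diff[OF Rn, of "vapp n h x" "vapp n h x - vapp n g x"]
        add_subgroup_add[OF Rn, of "vapp n g x" "vapp n h x - vapp n g x"] d by auto
  qed
  then show ?thesis unfolding nmat_def by (simp add: image_subset_iff)
qed

lemma image_plus_C:
  assumes "is_mat n g"
  shows "submod n UNIV (subgroup_sum (vapp n g ` V) C)" "C \<subseteq> subgroup_sum (vapp n g ` V) C"
    "subgroup_sum (vapp n g ` V) C \<subseteq> V" "grp_index V (subgroup_sum (vapp n g ` V) C) \<noteq> 0"
proof -
  have im: "submod n UNIV (vapp n g ` V)" by (rule submod_vapp_image[OF submod_vecs assms])
  show s: "submod n UNIV (subgroup_sum (vapp n g ` V) C)" by (rule submod_sum[OF im submod_C])
  show C: "C \<subseteq> subgroup_sum (vapp n g ` V) C" by (rule subgroup_sum_upper2[OF submodD(1)[OF im]])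
  show "subgroup_sum (vapp n g ` V) C \<subseteq> V" by (rule submodD(2)[OF s])
  then show "grp_index V (subgroup_sum (vapp n g ` V) C) \<noteq> 0"
    using finite_index_between[OF submodD(1)[OF s] C] by simp
qed

text \<open>Let p be a basis matrix of P = V g + C, so that g = alpha p. Then alpha is onto modulo
  D, the preimage of \<open>C\<close> under p; \<open>stable_range\<close> replaces alpha by an
  invertible beta congruent to it modulo D, and h = beta p is injective with image P.\<close>

lemma lift_matrix:
  assumes "is_mat n g"
  obtains h where "is_mat n h" "inj_on (vapp n h) V"
    "vapp n h ` V = subgroup_sum (vapp n g ` V) C" "\<And>a. a < n \<Longrightarrow> h a - g a \<in> C"
proof -
  define P where "P = subgroup_sum (vapp n g ` V) C"
  note P = image_plus_C[OF assms, folded P_def]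
  obtain p where p: "is_mat n p" "inj_on (vapp n p) V" "vapp n p ` V = P"
    using free[OF P(1,4)] by blast
  have "\<exists>x\<in>V. vapp n p x = g a" if "a < n" for a
  proof -
    have "g a = vapp n g (unit_vec a)" using vapp_unit_vec[OF that, of g] by simp
    then have "g a \<in> vapp n g ` V" using unit_vec_in_vecs[OF that] by blast
    then have "g a \<in> P" using subgroup_sum_upper1[OF subgroup_C, of "vapp n g ` V"] unfolding P_def by blast
    then show ?thesis using p(3) by (metis imageE)
  qed
  then obtain \<alpha> where \<alpha>: "\<And>a. a < n \<Longrightarrow> \<alpha> a \<in> V \<and> vapp n p (\<alpha> a) = g a" by metis
  have \<alpha>_mat: "is_mat n \<alpha>" using \<alpha> by (simp add: is_mat_def)
  have p\<alpha>: "vapp n p (vapp n \<alpha> x) = vapp n g x" for x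
    unfolding vapp_vapp by (subst (1 3) vapp_def) (simp add: \<alpha>)
  \<comment> \<open>Changing alpha by rows in \<open>D\<close> changes the product with p by rows in
    \<open>C\<close>.\<close>
  define D where "D = {x \<in> V. vapp n p x \<in> C}"
  have D: "submod n UNIV D" unfolding D_def by (rule submod_vapp_vimage[OF submod_C])
  have "subgroup_sum (vapp n \<alpha> ` V) D = V"
  proof (rule antisym)
    show "subgroup_sum (vapp n \<alpha> ` V) D \<subseteq> V"
      by (rule submodD(2)[OF submod_sum[OF submod_vapp_image[OF submod_vecs \<alpha>_mat] D]])
    show "V \<subseteq> subgroup_sum (vapp n \<alpha> ` V) D"
    proof
      fix y :: "nat \<Rightarrow> 's" assume y: "y \<in> V"
      then have "vapp n p y \<in> P" using p(3) by blast
      then obtain x z where xz: "x \<in> V" "z \<in> C" "vapp n p y = vapp n g x + z"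
        unfolding P_def by (auto elim!: subgroup_sumE)
      obtain u where u: "u \<in> V" "vapp n p u = z" using P(2) xz(2) p(3) by (metis imageE subsetD)
      have "vapp n p y = vapp n p (vapp n \<alpha> x + u)" using xz u p\<alpha> by (simp add: vapp_add)
      moreover have "vapp n \<alpha> x + u \<in> V"
        using add_subgroup_add[OF subgroup_V vapp_in_vecs[OF \<alpha>_mat] u(1)] .
      ultimately have "y = vapp n \<alpha> x + u" using p(2) y by (auto dest: inj_onD)
      moreover have "u \<in> D" using u xz(2) by (simp add: D_def)
      ultimately show "y \<in> subgroup_sum (vapp n \<alpha> ` V) D" using xz(1) by (auto intro: subgroup_sumI)
    qed
  qed
  from stable_range[OF \<alpha>_mat D this] obtain \<beta> where \<beta>: "is_mat n \<beta>"
    "bij_betw (vapp n \<beta>) V V" "\<And>a. a < n \<Longrightarrow> \<alpha> a - \<beta> a \<in> D" by blast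
  define h where "h = (\<lambda>a. vapp n p (\<beta> a))"
  have h: "vapp n h = vapp n p \<circ> vapp n \<beta>" by (simp add: fun_eq_iff h_def flip: vapp_vapp)
  show thesis
  proof (rule that[of h])
    show "is_mat n h" by (simp add: is_mat_def h_def vapp_in_vecs[OF p(1)])
    have "inj_on (vapp n p) (vapp n \<beta> ` V)" using p(2) \<beta>(2) by (simp add: bij_betw_def)
    then show "inj_on (vapp n h) V"
      unfolding h using \<beta>(2) by (intro comp_inj_on) (auto simp: bij_betw_def)
    show "vapp n h ` V = subgroup_sum (vapp n g ` V) C"
      unfolding h image_comp[symmetric] using \<beta>(2) p(3) by (simp add: bij_betw_def P_def)
    fix a assume a: "a < n"
    have "g a - h a = vapp n p (\<alpha> a - \<beta> a)" using \<alpha>[OF a] by (simp add: h_def vapp_diff)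
    then have "g a - h a \<in> C" using \<beta>(3)[OF a] by (simp add: D_def)
    then have "- (g a - h a) \<in> C" by (rule add_subgroup_uminus[OF subgroup_C])
    then show "h a - g a \<in> C" by simp
  qed
qed

lemma nlat_image_plus_C:
  assumes "is_mat n g"
  shows "nlat (subgroup_sum (vapp n g ` V) C) j = nmat g j"
proof -
  obtain h where h: "is_mat n h" "inj_on (vapp n h) V"
    "vapp n h ` V = subgroup_sum (vapp n g ` V) C" "\<And>a. a < n \<Longrightarrow> h a - g a \<in> C"
    using lift_matrix[OF assms] by blast
  have "nlat (subgroup_sum (vapp n g ` V) C) j = nmat h j" using nlat_vapp[OF h(1,2)] h(3) by simp
  also have "\<dots> = nmat g j" by (rule nmat_cong[OF h(4)])
  finally show ?thesis .
qed

text \<open>The reason why finitely many strata suffice: the count for M sees only M + C. Both sides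
  equal \<open>nmat\<close> of a basis matrix of M.\<close>

lemma nlat_plus_C:
  assumes "submod n UNIV M" "grp_index V M \<noteq> 0"
  shows "nlat (subgroup_sum M C) j = nlat M j"
proof -
  obtain g where g: "is_mat n g" "inj_on (vapp n g) V" "vapp n g ` V = M"
    using free[OF assms] by blast
  show ?thesis using nlat_image_plus_C[OF g(1)] nlat_vapp[OF g(1,2)] g(3) by simp
qed

section \<open>Strata of S-lattices with a given sum with the conductor\<close>

definition PP :: "(nat \<Rightarrow> 's) set set" where
  "PP = {P. submod n UNIV P \<and> C \<subseteq> P}"

definition zetaS :: dirichlet_series where
  "zetaS k = (if k = 0 then 0 else of_nat (card {M. submod n (UNIV :: 's set) M \<and> grp_index V M = k}))"

definition stratum :: "(nat \<Rightarrow> 's) set \<Rightarrow> dirichlet_series" where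
  "stratum P k = (if k = 0 then 0 else
     of_nat (card {M. submod n UNIV M \<and> subgroup_sum M C = P \<and> grp_index V M = k}))"

text \<open>The index is taken in S^n, not in R^n, so that it factors through S L. The resulting
  factor (S^n : R^n)^(-s) is removed in \<open>order_zeta_quotient\<close>.\<close>

definition latticeF :: dirichlet_series where
  "latticeF k = (if k = 0 then 0 else of_nat (card {L. submod n R L \<and> L \<subseteq> Rn \<and> grp_index V L = k}))"

text \<open>The proportion of matrices modulo c whose image generates P together with
  \<open>C\<close>. By \<open>poly_multiple_stratum\<close> it is the value at s = n of the stratum
  divided by \<open>zetaS\<close>.\<close>

definition weight :: "(nat \<Rightarrow> 's) set \<Rightarrow> complex" where
  "weight P = of_nat (card {g \<in> Mat T. subgroup_sum (vapp n g ` V) C = P}) / of_nat (grp_index V C) ^ n"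

lemma PP_D:
  assumes "P \<in> PP"
  shows "submod n UNIV P" "C \<subseteq> P" "add_subgroup P" "P \<subseteq> V" "grp_index V P \<noteq> 0"
proof -
  show 1: "submod n UNIV P" "C \<subseteq> P" using assms by (auto simp: PP_def)
  show 2: "add_subgroup P" "P \<subseteq> V" using submodD[OF 1(1)] by auto
  show "grp_index V P \<noteq> 0" using finite_index_between(1)[OF 2(1) 1(2) 2(2)] .
qed

lemma finite_PP: "finite PP"
proof (rule finite_subset)
  show "PP \<subseteq> {H. add_subgroup H \<and> C \<subseteq> H \<and> H \<subseteq> V}" using PP_D by blast
  show "finite {H. add_subgroup H \<and> C \<subseteq> H \<and> H \<subseteq> V}"
    by (rule finite_between_subgroups[OF subgroup_V subgroup_C grp_index_V_C_pos])
qed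

lemma plus_C_in_PP: "submod n UNIV M \<Longrightarrow> subgroup_sum M C \<in> PP"
  using submod_sum[OF _ submod_C] subgroup_sum_upper2[OF submodD(1)] by (simp add: PP_def)

lemma plus_C_subset_iff:
  assumes "P \<in> PP" "submod n UNIV M"
  shows "subgroup_sum M C \<subseteq> P \<longleftrightarrow> M \<subseteq> P"
  using subgroup_sum_least[OF PP_D(3)[OF assms(1)] _ PP_D(2)[OF assms(1)]]
    subgroup_sum_upper1[OF subgroup_C, of M] by blast

text \<open>A basis matrix of the free module P carries the S-lattices in V to those in P and
  multiplies the index by (V : P).\<close>

lemma card_submods_below:
  assumes "P \<in> PP" "k \<noteq> 0"
  shows "of_nat (card {M. submod n UNIV M \<and> M \<subseteq> P \<and> grp_index V M = k}) = dirichlet_dilate (grp_index V P) zetaS k"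
proof -
  note P = PP_D[OF assms(1)]
  obtain p where p: "is_mat n p" "inj_on (vapp n p) V" "vapp n p ` V = P"
    using free[OF P(1,5)] by blast
  let ?B = "{M. submod n UNIV M \<and> M \<subseteq> P \<and> grp_index V M = k}"
  let ?A = "{M. submod n (UNIV :: 's set) M \<and> grp_index V P * grp_index V M = k}"
  have idx: "grp_index V (vapp n p ` M) = grp_index V P * grp_index V M" if "submod n UNIV M" for M
  proof -
    have "vapp n p ` M \<subseteq> P" using submodD(2)[OF that] p(3) by blast
    then have "grp_index V (vapp n p ` M) = grp_index V P * grp_index P (vapp n p ` M)"
      by (rule grp_index_mult[OF P(3) submodD(1)[OF submod_vapp_image[OF that p(1)]] subgroup_V _ P(4)])
    also have "grp_index P (vapp n p ` M) = grp_index V M"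
      using grp_index_vapp_image[OF p(2) submod_vecs that p(1) submodD(2)[OF that]] p(3) by simp
    finally show ?thesis .
  qed
  have bij: "bij_betw ((`) (vapp n p)) ?A ?B"
  proof (rule bij_betw_imageI)
    have "?A \<subseteq> Pow V" using submodD(2) by auto
    then show "inj_on ((`) (vapp n p)) ?A"
      using inj_on_image_Pow[OF p(2)] inj_on_subset by blast
    show "(`) (vapp n p) ` ?A = ?B"
    proof (intro equalityI subsetI)
      fix M' assume "M' \<in> (`) (vapp n p) ` ?A"
      then obtain M where M: "M' = vapp n p ` M" "submod n UNIV M" "grp_index V P * grp_index V M = k" by blast
      then show "M' \<in> ?B"
        using submod_vapp_image[OF M(2) p(1)] idx[OF M(2)] submodD(2)[OF M(2)] p(3) by blast
    next
      fix M' assume "M' \<in> ?B"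
      then have M': "submod n UNIV M'" "M' \<subseteq> P" "grp_index V M' = k" by auto
      define M where "M = {x \<in> V. vapp n p x \<in> M'}"
      have sub: "submod n UNIV M" unfolding M_def by (rule submod_vapp_vimage[OF M'(1)])
      have img: "M' = vapp n p ` M" using M'(2) p(3) by (auto simp: M_def)
      then have "M \<in> ?A" using sub idx[OF sub] M'(3) by simp
      then show "M' \<in> (`) (vapp n p) ` ?A" using img by blast
    qed
  qed
  have "card ?B = card ?A" by (rule bij_betw_same_card[OF bij, symmetric])
  moreover have "of_nat (card ?A) = dirichlet_dilate (grp_index V P) zetaS k"
  proof (cases "grp_index V P dvd k")
    case True
    then obtain l where l: "k = grp_index V P * l" by blast
    then have "l \<noteq> 0" using assms(2) by auto
    then show ?thesis using l P(5) by (simp add: dirichlet_dilate_def zetaS_def)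
  next
    case False
    then have "?A = {}" by auto
    then show ?thesis using False by (simp add: dirichlet_dilate_def del: Collect_empty_eq)
  qed
  ultimately show ?thesis by simp
qed

text \<open>Sort the M inside P by M + C, which again lies inside P.\<close>

lemma sum_stratum_below:
  assumes "P \<in> PP"
  shows "(\<Sum>P' | P' \<in> PP \<and> P' \<subseteq> P. stratum P' k) = dirichlet_dilate (grp_index V P) zetaS k"
proof (cases "k = 0")
  case True
  then show ?thesis by (simp add: stratum_def dirichlet_dilate_def zetaS_def)
next
  case False
  let ?B = "{M. submod n UNIV M \<and> M \<subseteq> P \<and> grp_index V M = k}"
  have "card ?B = (\<Sum>P'\<in>{P' \<in> PP. P' \<subseteq> P}. card {M \<in> ?B. subgroup_sum M C = P'})"
  proof (rule card_fibres)
    show "finite ?B" by (rule finite_subset[OF _ finite_submods[OF False]]) auto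
    show "finite {P' \<in> PP. P' \<subseteq> P}" using finite_PP by simp
    show "(\<lambda>M. subgroup_sum M C) ` ?B \<subseteq> {P' \<in> PP. P' \<subseteq> P}"
      using plus_C_in_PP plus_C_subset_iff[OF assms] by auto
  qed
  also have "of_nat \<dots> = (\<Sum>P' | P' \<in> PP \<and> P' \<subseteq> P. stratum P' k)"
    unfolding of_nat_sum
  proof (rule sum.cong[OF refl])
    fix P' assume "P' \<in> {P' \<in> PP. P' \<subseteq> P}"
    then have "{M \<in> ?B. subgroup_sum M C = P'} = {M. submod n UNIV M \<and> subgroup_sum M C = P' \<and> grp_index V M = k}"
      using plus_C_subset_iff[OF assms] by auto
    then show "of_nat (card {M \<in> ?B. subgroup_sum M C = P'}) = stratum P' k"
      using False by (simp add: stratum_def)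
  qed
  finally show ?thesis using card_submods_below[OF assms False] by simp
qed

lemma image_plus_C_subset_iff:
  assumes "P \<in> PP" "g \<in> Mat T"
  shows "subgroup_sum (vapp n g ` V) C \<subseteq> P \<longleftrightarrow> g \<in> Mat (T \<inter> P)"
proof -
  have "vapp n g ` V \<subseteq> P \<longleftrightarrow> (\<forall>a<n. g a \<in> P)"
  proof
    assume *: "vapp n g ` V \<subseteq> P"
    show "\<forall>a<n. g a \<in> P"
    proof (intro allI impI)
      fix a assume a: "a < n"
      have "vapp n g (unit_vec a) \<in> P" using * unit_vec_in_vecs[OF a] by blast
      then show "g a \<in> P" by (simp add: vapp_unit_vec[OF a])
    qed
  next
    assume "\<forall>a<n. g a \<in> P"
    then show "vapp n g ` V \<subseteq> P" using vapp_in_submod[OF PP_D(1)[OF assms(1)]] by blast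
  qed
  then show ?thesis
    using plus_C_subset_iff[OF assms(1) submod_vapp_image[OF submod_vecs Mat_is_mat[OF assms(2)]]] assms(2)
    by (auto simp: Mat_def)
qed

text \<open>The image of \<open>g\<close> lies in P iff its n rows do, which leaves (P : C)^n of the
  (V : C)^n matrices. The right-hand side is the value of (V : P)^(-s) at s = n, so the weights
  solve the system of \<open>sum_stratum_below\<close> at that point.\<close>

lemma sum_weight_below:
  assumes "P \<in> PP"
  shows "(\<Sum>P' | P' \<in> PP \<and> P' \<subseteq> P. weight P') = 1 / of_nat (grp_index V P) ^ n"
proof -
  note P = PP_D[OF assms]
  have sub: "Mat (T \<inter> P) \<subseteq> Mat T" by (auto simp: Mat_def)
  have "card (Mat (T \<inter> P)) = (\<Sum>P'\<in>{P' \<in> PP. P' \<subseteq> P}. card {g \<in> Mat (T \<inter> P). subgroup_sum (vapp n g ` V) C = P'})"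
  proof (rule card_fibres)
    show "finite (Mat (T \<inter> P))" using finite_subset[OF sub finite_Mat] .
    show "finite {P' \<in> PP. P' \<subseteq> P}" using finite_PP by simp
    show "(\<lambda>g. subgroup_sum (vapp n g ` V) C) ` Mat (T \<inter> P) \<subseteq> {P' \<in> PP. P' \<subseteq> P}"
      using sub image_plus_C_subset_iff[OF assms] plus_C_in_PP submod_vapp_image[OF submod_vecs Mat_is_mat]
      by (auto simp: subset_iff)
  qed
  also have "\<dots> = (\<Sum>P'\<in>{P' \<in> PP. P' \<subseteq> P}. card {g \<in> Mat T. subgroup_sum (vapp n g ` V) C = P'})"
  proof (rule sum.cong[OF refl])
    fix P' assume "P' \<in> {P' \<in> PP. P' \<subseteq> P}"
    then have "{g \<in> Mat (T \<inter> P). subgroup_sum (vapp n g ` V) C = P'} = {g \<in> Mat T. subgroup_sum (vapp n g ` V) C = P'}"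
      using sub image_plus_C_subset_iff[OF assms] by auto
    then show "card {g \<in> Mat (T \<inter> P). subgroup_sum (vapp n g ` V) C = P'} = card {g \<in> Mat T. subgroup_sum (vapp n g ` V) C = P'}"
      by simp
  qed
  finally have "(\<Sum>P' | P' \<in> PP \<and> P' \<subseteq> P. weight P') = of_nat (card (Mat (T \<inter> P))) / of_nat (grp_index V C) ^ n"
    by (simp add: weight_def flip: sum_divide_distrib)
  also have "card (Mat (T \<inter> P)) = grp_index P C ^ n"
    unfolding card_Mat card_T_Int[OF P(3,2,4)] ..
  finally show ?thesis
    unfolding finite_index_between(3)[OF P(3,2,4)]
    using finite_index_between(1,2)[OF P(3,2,4)] by (simp add: power_mult_distrib)
qed


text \<open>The two triangular systems for strata and weights have the same shape; they are solved
  together by induction on the number of members of \<open>PP\<close> strictly below P.\<close>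

lemma poly_multiple_stratum:
  assumes "P \<in> PP"
  shows "poly_multiple n zetaS (stratum P) (weight P)"
proof -
  have "\<forall>P\<in>PP. card {P' \<in> PP. P' \<subset> P} = N \<longrightarrow> poly_multiple n zetaS (stratum P) (weight P)" for N
  proof (induction N rule: less_induct)
    case (less N)
    show ?case
    proof (intro ballI impI)
      fix P assume P: "P \<in> PP" and N: "card {P' \<in> PP. P' \<subset> P} = N"
      let ?I = "{P' \<in> PP. P' \<subset> P}"
      have fin: "finite ?I" using finite_PP by simp
      have IH: "poly_multiple n zetaS (stratum P') (weight P')" if P': "P' \<in> ?I" for P'
      proof -
        have "{Q \<in> PP. Q \<subset> P'} \<subset> ?I" using P' by blast
        then have "card {Q \<in> PP. Q \<subset> P'} < N" unfolding N[symmetric] by (rule psubset_card_mono[OF fin])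
        then show ?thesis using less.IH P' by blast
      qed
      have split: "{P' \<in> PP. P' \<subseteq> P} = insert P ?I" using P by auto
      have nin: "P \<notin> ?I" by simp
      have "stratum P = (\<lambda>k. dirichlet_dilate (grp_index V P) zetaS k - (\<Sum>P'\<in>?I. 1 * stratum P' k))"
        using sum_stratum_below[OF P] unfolding split by (simp add: fin fun_eq_iff algebra_simps)
      moreover have "weight P = 1 / of_nat (grp_index V P) ^ n - (\<Sum>P'\<in>?I. 1 * weight P')"
        using sum_weight_below[OF P] unfolding split by (simp add: fin algebra_simps)
      moreover have "poly_multiple n zetaS (dirichlet_dilate (grp_index V P) zetaS) (1 / of_nat (grp_index V P) ^ n)"
        by (intro poly_multiple_dilate poly_multiple_self) (use PP_D(5)[OF P] in \<open>auto simp: zetaS_def\<close>)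
      ultimately show "poly_multiple n zetaS (stratum P) (weight P)"
        by (simp only:) (intro poly_multiple_diff poly_multiple_sum[where a = "\<lambda>_. 1"] fin IH)
    qed
  qed
  then show ?thesis using assms by blast
qed

end

section \<open>Sorting the R-lattices by their span, and the value at s = n\<close>

context order_lattices begin

text \<open>The possible indices (S L : L). By \<open>nlat_plus_C\<close> it is enough to look at
  spans in \<open>PP\<close>, which makes the set finite.\<close>

definition JJ :: "nat set" where
  "JJ = {j. j \<noteq> 0 \<and> (\<exists>P\<in>PP. nlat P j \<noteq> 0)}"

lemma finite_JJ: "finite JJ"
proof (rule finite_subset)
  show "JJ \<subseteq> (\<Union>P\<in>PP. grp_index P ` {L. submod n R L \<and> gen_hull n L = P})"
  proof
    fix j assume "j \<in> JJ"
    then obtain P where P: "P \<in> PP" "nlat P j \<noteq> 0" by (auto simp: JJ_def)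
    then have "{L. submod n R L \<and> L \<subseteq> Rn \<and> gen_hull n L = P \<and> grp_index P L = j} \<noteq> {}"
      unfolding nlat_def by (metis card.empty)
    then show "j \<in> (\<Union>P\<in>PP. grp_index P ` {L. submod n R L \<and> gen_hull n L = P})"
      using P(1) by auto
  qed
  show "finite (\<Union>P\<in>PP. grp_index P ` {L. submod n R L \<and> gen_hull n L = P})"
    using finite_PP finite_lattices_in PP_D(1,5) by blast
qed

lemma lattice_cases:
  assumes "submod n R L" "L \<subseteq> Rn" "grp_index V L = k" "k \<noteq> 0"
  shows "subgroup_sum (gen_hull n L) C \<in> PP" "grp_index (gen_hull n L) L \<in> JJ"
    "grp_index V (gen_hull n L) * grp_index (gen_hull n L) L = k"
proof -
  note g = gen_hull_index[OF assms(1)]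
  show 1: "subgroup_sum (gen_hull n L) C \<in> PP" by (rule plus_C_in_PP[OF g(1)])
  show 2: "grp_index V (gen_hull n L) * grp_index (gen_hull n L) L = k" using g(2) assms(3) by simp
  have idx: "grp_index V (gen_hull n L) \<noteq> 0" "grp_index (gen_hull n L) L \<noteq> 0"
    using 2 assms(4) by auto
  let ?S = "{L'. submod n R L' \<and> L' \<subseteq> Rn \<and> gen_hull n L' = gen_hull n L \<and>
      grp_index (gen_hull n L) L' = grp_index (gen_hull n L) L}"
  have "finite ?S"
    by (rule finite_subset[OF _ finite_lattices_in[OF g(1) idx(1)]]) auto
  moreover have "L \<in> ?S" using assms by simp
  ultimately have "card ?S \<noteq> 0" by (simp only: card_0_eq) blast
  then have "nlat (gen_hull n L) (grp_index (gen_hull n L) L) \<noteq> 0" unfolding nlat_def .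
  then have "nlat (subgroup_sum (gen_hull n L) C) (grp_index (gen_hull n L) L) \<noteq> 0"
    unfolding nlat_plus_C[OF g(1) idx(1)] .
  then show "grp_index (gen_hull n L) L \<in> JJ" using 1 idx(2) by (auto simp: JJ_def)
qed

text \<open>Sort L by the pair of P = S L + C and j = (S L : L). Each M in the stratum of P is the
  span of \<open>nlat P j\<close> such lattices, all of index (V : M) j in V.\<close>

lemma latticeF_eq:
  "latticeF k = (\<Sum>(P, j)\<in>PP \<times> JJ. of_nat (nlat P j) * dirichlet_dilate j (stratum P) k)"
proof (cases "k = 0")
  case True
  then show ?thesis by (simp add: latticeF_def dirichlet_dilate_def stratum_def case_prod_beta)
next
  case False
  let ?A = "{L. submod n R L \<and> L \<subseteq> Rn \<and> grp_index V L = k}"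
  let ?f = "\<lambda>L. (subgroup_sum (gen_hull n L) C, grp_index (gen_hull n L) L)"
  have finA: "finite ?A" by (rule finite_subset[OF _ finite_lattices[OF False]]) auto
  have "card ?A = (\<Sum>p\<in>PP \<times> JJ. card {L \<in> ?A. ?f L = p})"
  proof (rule card_fibres[OF finA])
    show "finite (PP \<times> JJ)" using finite_PP finite_JJ by simp
    show "?f ` ?A \<subseteq> PP \<times> JJ" using lattice_cases(1,2) False by blast
  qed
  also have "of_nat \<dots> = (\<Sum>(P, j)\<in>PP \<times> JJ. of_nat (nlat P j) * dirichlet_dilate j (stratum P) k)"
    unfolding of_nat_sum
  proof (rule sum.cong[OF refl])
    fix p assume "p \<in> PP \<times> JJ"
    then obtain P j where p: "p = (P, j)" "P \<in> PP" "j \<in> JJ" by blast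
    then have j: "j \<noteq> 0" by (simp add: JJ_def)
    let ?M = "{M. submod n (UNIV :: 's set) M \<and> subgroup_sum M C = P \<and> grp_index V M * j = k}"
    have finM: "finite ?M"
    proof (rule finite_subset)
      show "?M \<subseteq> (\<Union>d\<in>{d. d dvd k}. {M. submod n (UNIV :: 's set) M \<and> grp_index V M = d})" by auto
      show "finite (\<Union>d\<in>{d. d dvd k}. {M. submod n (UNIV :: 's set) M \<and> grp_index V M = d})"
      proof (rule finite_UN_I)
        fix d assume "d \<in> {d. d dvd k}"
        then show "finite {M. submod n (UNIV :: 's set) M \<and> grp_index V M = d}"
          using False by (intro finite_submods) auto
      qed (use False in simp)
    qed
    have "card {L \<in> ?A. ?f L = p} = (\<Sum>M\<in>?M. card {L \<in> {L \<in> ?A. ?f L = p}. gen_hull n L = M})"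
    proof (rule card_fibres[OF _ finM])
      show "finite {L \<in> ?A. ?f L = p}" by (rule finite_subset[OF _ finA]) blast
      show "gen_hull n ` {L \<in> ?A. ?f L = p} \<subseteq> ?M"
        using gen_hull_index by (auto simp: p(1))
    qed
    also have "\<dots> = (\<Sum>M\<in>?M. nlat P j)"
    proof (rule sum.cong[OF refl])
      fix M assume "M \<in> ?M"
      then have M: "submod n UNIV M" "subgroup_sum M C = P" "grp_index V M * j = k" by auto
      have idx: "grp_index V M \<noteq> 0" using M(3) False by auto
      have "{L \<in> {L \<in> ?A. ?f L = p}. gen_hull n L = M} =
          {L. submod n R L \<and> L \<subseteq> Rn \<and> gen_hull n L = M \<and> grp_index M L = j}"
        using gen_hull_index(2) M(2,3) by (auto simp: p(1))
      then have "card {L \<in> {L \<in> ?A. ?f L = p}. gen_hull n L = M} = nlat M j"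
        unfolding nlat_def by simp
      also have "nlat M j = nlat P j" using nlat_plus_C[OF M(1) idx] M(2) by simp
      finally show "card {L \<in> {L \<in> ?A. ?f L = p}. gen_hull n L = M} = nlat P j" .
    qed
    finally have "card {L \<in> ?A. ?f L = p} = card ?M * nlat P j" by simp
    moreover have "of_nat (card ?M) = dirichlet_dilate j (stratum P) k"
    proof (cases "j dvd k")
      case True
      then obtain l where l: "k = l * j" by (metis dvd_def mult.commute)
      then have "l \<noteq> 0" using False by auto
      moreover have "?M = {M. submod n (UNIV :: 's set) M \<and> subgroup_sum M C = P \<and> grp_index V M = l}"
        using l j by auto
      ultimately show ?thesis using l j by (simp add: dirichlet_dilate_def stratum_def)
    next
      case ndvd: False
      then have "?M = {}" by auto
      then show ?thesis using ndvd by (simp add: dirichlet_dilate_def del: Collect_empty_eq)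
    qed
    ultimately show "of_nat (card {L \<in> ?A. ?f L = p}) =
        (case p of (P, j) \<Rightarrow> of_nat (nlat P j) * dirichlet_dilate j (stratum P) k)"
      by (simp add: p(1) mult.commute)
  qed
  finally show ?thesis using False by (simp add: latticeF_def)
qed

text \<open>L g lies in R^n iff every column of \<open>g\<close> lies in the dual lattice D of
  vectors pairing L into R. That leaves (D : C)^n matrices modulo c, and (D : C) = (V : L) by
  \<open>duality\<close>.\<close>

lemma card_Mat_dual:
  assumes "L \<in> full_lattices"
  shows "card {g \<in> Mat T. vapp n g ` L \<subseteq> Rn} = grp_index V L ^ n"
proof -
  have L: "submod n R L" "gen_hull n L = V" using assms by (auto simp: full_lattices_def)
  define D where "D = {v \<in> V. \<forall>x\<in>L. (\<Sum>a<n. x a * v a) \<in> R}"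
  have subR: "add_subgroup R" by (rule add_subgroupI) (auto simp: zero_mem diff_mem)
  have D: "add_subgroup D"
  proof (rule add_subgroupI)
    show "0 \<in> D" by (simp add: D_def zero_mem add_subgroup_zero[OF subgroup_V])
    fix v w assume "v \<in> D" "w \<in> D"
    then show "v - w \<in> D"
      by (simp add: D_def add_subgroup_diff[OF subgroup_V] right_diff_distrib sum_subtractf diff_mem)
  qed
  have CD: "C \<subseteq> D"
  proof
    fix v assume v: "v \<in> C"
    then obtain w where w: "v = vscale c w" by blast
    have "(\<Sum>a<n. x a * v a) = c * (\<Sum>a<n. x a * w a)" for x
      by (simp add: w sum_distrib_left mult.left_commute)
    then show "v \<in> D" using v C_sub_V by (auto simp: D_def conductor)
  qed
  \<comment> \<open>The condition is on columns while \<open>Mat\<close> constrains rows.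
    Transposition exchanges them, and it maps \<open>Mat T\<close> to itself because
    \<open>T\<close> is a coordinatewise transversal.\<close>
  define tr :: "(nat \<Rightarrow> nat \<Rightarrow> 's) \<Rightarrow> nat \<Rightarrow> nat \<Rightarrow> 's" where "tr = (\<lambda>g a b. g b a)"
  have tr_Mat: "tr g \<in> Mat T \<longleftrightarrow> g \<in> Mat T" for g
    by (auto simp: Mat_def T_def tr_def fun_eq_iff not_less) (metis not_less)+
  have iff: "vapp n g ` L \<subseteq> Rn \<longleftrightarrow> tr g \<in> Mat (T \<inter> D)" if g: "g \<in> Mat T" for g
  proof -
    have "vapp n g ` L \<subseteq> Rn \<longleftrightarrow> (\<forall>x\<in>L. \<forall>j. vapp n g x j \<in> R)"
      using vapp_in_vecs[OF Mat_is_mat[OF g]] by (auto simp: Rn_def)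
    also have "\<dots> \<longleftrightarrow> (\<forall>j<n. \<forall>x\<in>L. vapp n g x j \<in> R)"
    proof -
      have "vapp n g x j \<in> R" if "\<not> j < n" for x j
        using vapp_in_vecs[OF Mat_is_mat[OF g], of x] that zero_mem by (simp add: vecs_def)
      then show ?thesis by blast
    qed
    also have "\<dots> \<longleftrightarrow> (\<forall>j<n. tr g j \<in> D)"
    proof -
      have "tr g j \<in> V" if "j < n" for j
        using g tr_Mat[of g] that T_sub_V by (auto simp: Mat_def)
      then show ?thesis by (auto simp: D_def vapp_def tr_def)
    qed
    also have "\<dots> \<longleftrightarrow> tr g \<in> Mat (T \<inter> D)" using g tr_Mat[of g] by (auto simp: Mat_def)
    finally show ?thesis .
  qed
  have "bij_betw tr {g \<in> Mat T. vapp n g ` L \<subseteq> Rn} (Mat (T \<inter> D))"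
  proof (rule bij_betwI[where g = tr])
    show "tr \<in> {g \<in> Mat T. vapp n g ` L \<subseteq> Rn} \<rightarrow> Mat (T \<inter> D)"
      using iff by blast
    have "tr g \<in> Mat T" if "g \<in> Mat (T \<inter> D)" for g
    proof -
      have "g \<in> Mat T" using that by (simp add: Mat_def)
      then show ?thesis using tr_Mat by simp
    qed
    moreover have "tr (tr g) = g" for g by (simp add: tr_def)
    ultimately show "tr \<in> Mat (T \<inter> D) \<rightarrow> {g \<in> Mat T. vapp n g ` L \<subseteq> Rn}"
      using iff by (intro Pi_I) simp
  qed (simp_all add: tr_def)
  then have "card {g \<in> Mat T. vapp n g ` L \<subseteq> Rn} = card (Mat (T \<inter> D))" by (rule bij_betw_same_card)
  also have "\<dots> = grp_index D C ^ n" unfolding card_Mat using card_T_Int[OF D CD] by (simp add: D_def)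
  also have "grp_index D C = grp_index V L" unfolding D_def
    by (rule duality[OF L(1)]) (use conductor_gen_hull[OF L(1)] L(2) in auto)
  finally show ?thesis .
qed

lemma C_sub_full: 
  assumes "L \<in> full_lattices"
  shows "C \<subseteq> L" "add_subgroup L" "L \<subseteq> V" "submod n R L" "grp_index V L \<noteq> 0"
proof -
  have L: "submod n R L" "gen_hull n L = V" using assms by (auto simp: full_lattices_def)
  show 1: "C \<subseteq> L" using conductor_gen_hull[OF L(1)] L(2) by auto
  show 2: "add_subgroup L" "L \<subseteq> V" "submod n R L" using submodD[OF L(1)] L(1) by auto
  show "grp_index V L \<noteq> 0" by (rule finite_index_between(1)[OF 2(1) 1 2(2)])
qed

text \<open>Group the L by index. Each index that occurs is in \<open>JJ\<close>, because the count
  for \<open>g\<close> is also that for V g + C, a member of \<open>PP\<close>.\<close>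

lemma sum_nmat:
  assumes "g \<in> Mat T"
  shows "(\<Sum>j\<in>JJ. of_nat (nmat g j) / of_nat j ^ n :: complex) =
    (\<Sum>L\<in>full_lattices. if vapp n g ` L \<subseteq> Rn then 1 / of_nat (grp_index V L) ^ n else 0)"
proof -
  let ?A = "{L \<in> full_lattices. vapp n g ` L \<subseteq> Rn}"
  have finA: "finite ?A" using finite_full_lattices by simp
  have mem: "grp_index V L \<in> JJ" if "L \<in> ?A" for L
  proof -
    have "nmat g (grp_index V L) \<noteq> 0"
      unfolding nmat_def using that finite_full_lattices by (auto simp: card_eq_0_iff)
    then have "nlat (subgroup_sum (vapp n g ` V) C) (grp_index V L) \<noteq> 0"
      using nlat_image_plus_C[OF Mat_is_mat[OF assms]] by simp
    moreover have "subgroup_sum (vapp n g ` V) C \<in> PP"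
      by (rule plus_C_in_PP[OF submod_vapp_image[OF submod_vecs Mat_is_mat[OF assms]]])
    moreover have "grp_index V L \<noteq> 0" using C_sub_full(5) that by blast
    ultimately show ?thesis unfolding JJ_def by blast
  qed
  have "(\<Sum>L\<in>full_lattices. if vapp n g ` L \<subseteq> Rn then 1 / of_nat (grp_index V L) ^ n else 0) =
      (\<Sum>L\<in>?A. 1 / of_nat (grp_index V L) ^ n :: complex)"
    by (rule sum.inter_filter[OF finite_full_lattices, symmetric])
  also have "\<dots> = (\<Sum>j\<in>JJ. \<Sum>L\<in>{L \<in> ?A. grp_index V L = j}. 1 / of_nat (grp_index V L) ^ n)"
    using mem by (intro sum.group[symmetric] finA finite_JJ) blast
  also have "\<dots> = (\<Sum>j\<in>JJ. of_nat (nmat g j) / of_nat j ^ n)"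
  proof (rule sum.cong[OF refl])
    fix j
    have "{L \<in> ?A. grp_index V L = j} = {L \<in> full_lattices. vapp n g ` L \<subseteq> Rn \<and> grp_index V L = j}"
      by blast
    then show "(\<Sum>L\<in>{L \<in> ?A. grp_index V L = j}. 1 / of_nat (grp_index V L) ^ n) =
        (of_nat (nmat g j) / of_nat j ^ n :: complex)"
      by (simp add: nmat_def)
  qed
  finally show ?thesis by simp
qed

text \<open>Written as an average over matrices modulo c, the sum can be taken over L on the
  outside. There are (V : L)^n matrices with L g inside R^n and each contributes (V : L)^(-n), so
  every L with span S^n counts exactly once.\<close>

lemma sum_weights:
  "(\<Sum>(P, j)\<in>PP \<times> JJ. of_nat (nlat P j) * (weight P / of_nat j ^ n)) =
    of_nat (card full_lattices) / of_nat (grp_index V C) ^ n"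
proof -
  let ?N = "of_nat (grp_index V C) ^ n :: complex"
  let ?w = "\<lambda>P. \<Sum>j\<in>JJ. of_nat (nlat P j) / of_nat j ^ n :: complex"
  let ?P = "\<lambda>g. subgroup_sum (vapp n g ` V) C"
  have "(\<Sum>(P, j)\<in>PP \<times> JJ. of_nat (nlat P j) * (weight P / of_nat j ^ n)) = (\<Sum>P\<in>PP. weight P * ?w P)"
    unfolding sum.cartesian_product[symmetric]
    by (intro sum.cong refl) (simp add: sum_distrib_left mult.commute)
  also have "\<dots> = (\<Sum>P\<in>PP. \<Sum>g\<in>{g \<in> Mat T. ?P g = P}. ?w (?P g)) / ?N"
    by (subst sum_divide_distrib) (intro sum.cong refl, simp add: weight_def)
  also have "(\<Sum>P\<in>PP. \<Sum>g\<in>{g \<in> Mat T. ?P g = P}. ?w (?P g)) = (\<Sum>g\<in>Mat T. ?w (?P g))"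
    by (rule sum.group[OF finite_Mat finite_PP])
       (use plus_C_in_PP[OF submod_vapp_image[OF submod_vecs Mat_is_mat]] in blast)
  also have "\<dots> = (\<Sum>g\<in>Mat T. \<Sum>L\<in>full_lattices. if vapp n g ` L \<subseteq> Rn then 1 / of_nat (grp_index V L) ^ n else 0)"
  proof (rule sum.cong[OF refl])
    fix g assume g: "g \<in> Mat T"
    show "?w (?P g) = (\<Sum>L\<in>full_lattices. if vapp n g ` L \<subseteq> Rn then 1 / of_nat (grp_index V L) ^ n else 0)"
      unfolding nlat_image_plus_C[OF Mat_is_mat[OF g]] by (rule sum_nmat[OF g])
  qed
  also have "\<dots> = (\<Sum>L\<in>full_lattices. \<Sum>g\<in>Mat T. if vapp n g ` L \<subseteq> Rn then 1 / of_nat (grp_index V L) ^ n else 0)"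
    by (rule sum.swap)
  also have "\<dots> = (\<Sum>L\<in>full_lattices. 1)"
  proof (rule sum.cong[OF refl])
    fix L assume L: "L \<in> full_lattices"
    have "(\<Sum>g\<in>Mat T. if vapp n g ` L \<subseteq> Rn then 1 / of_nat (grp_index V L) ^ n else 0) =
        (\<Sum>g\<in>{g \<in> Mat T. vapp n g ` L \<subseteq> Rn}. 1 / of_nat (grp_index V L) ^ n :: complex)"
      by (rule sum.inter_filter[OF finite_Mat, symmetric])
    also have "\<dots> = 1" using card_Mat_dual[OF L] C_sub_full(5)[OF L] by simp
    finally show "(\<Sum>g\<in>Mat T. if vapp n g ` L \<subseteq> Rn then 1 / of_nat (grp_index V L) ^ n else 0) = (1 :: complex)" .
  qed
  also have "(\<Sum>L\<in>full_lattices. 1) = (of_nat (card full_lattices) :: complex)" by simp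
  finally show ?thesis .
qed

lemma poly_multiple_latticeF:
  "poly_multiple n zetaS latticeF (of_nat (card full_lattices) / of_nat (grp_index V C) ^ n)"
proof -
  have "poly_multiple n zetaS (\<lambda>k. \<Sum>p\<in>PP \<times> JJ. of_nat (nlat (fst p) (snd p)) * dirichlet_dilate (snd p) (stratum (fst p)) k)
    (\<Sum>p\<in>PP \<times> JJ. of_nat (nlat (fst p) (snd p)) * (weight (fst p) / of_nat (snd p) ^ n))"
  proof (rule poly_multiple_sum)
    show "finite (PP \<times> JJ)" using finite_PP finite_JJ by simp
    fix p assume "p \<in> PP \<times> JJ"
    then have "fst p \<in> PP" "snd p > 0" by (auto simp: JJ_def)
    then show "poly_multiple n zetaS (dirichlet_dilate (snd p) (stratum (fst p))) (weight (fst p) / of_nat (snd p) ^ n)"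
      by (intro poly_multiple_dilate poly_multiple_stratum)
  qed
  moreover have "latticeF = (\<lambda>k. \<Sum>p\<in>PP \<times> JJ. of_nat (nlat (fst p) (snd p)) * dirichlet_dilate (snd p) (stratum (fst p)) k)"
    by (rule ext) (simp add: latticeF_eq case_prod_unfold)
  ultimately show ?thesis
    using sum_weights by (simp add: case_prod_unfold)
qed

text \<open>All indices in V of sublattices of R^n are multiples of (V : R^n). Dividing this factor
  out of the indices multiplies the value at s = n by (V : R^n)^n.\<close>

theorem order_zeta_quotient:
  fixes zR :: dirichlet_series
  assumes "\<And>k. k \<noteq> 0 \<Longrightarrow> zR k = of_nat (card {L. submod n R L \<and> L \<subseteq> Rn \<and> grp_index Rn L = k})"
    and "zR 0 = 0"
    and "\<And>k. k \<noteq> 0 \<Longrightarrow> zS k = of_nat (card {M. submod n (UNIV :: 's set) M \<and> grp_index V M = k})"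
    and "zS 0 = 0"
  shows "dirichlet_poly_value (dirichlet_divide (dirichlet_shift zR n) (dirichlet_shift zS n)) 0
    (of_nat (card full_lattices) * of_nat (grp_index V Rn) ^ n / of_nat (grp_index V C) ^ n)"
proof -
  have zS: "zS = zetaS" using assms(3,4) by (auto simp: zetaS_def fun_eq_iff)
  let ?w = "grp_index V Rn"
  note Rn = submodD[OF submod_Rn]
  have w: "?w \<noteq> 0" by (rule finite_index_between(1)[OF Rn(1) C_sub_Rn Rn(2)])
  have idx: "grp_index V L = ?w * grp_index Rn L" if "submod n R L" "L \<subseteq> Rn" for L
    by (rule grp_index_mult[OF Rn(1) submodD(1)[OF that(1)] subgroup_V that(2) Rn(2)])
  have "M = V" if "submod n (UNIV :: 's set) M" "grp_index V M = 1" for M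
    using grp_index_eq_1_iff[OF subgroup_V submodD(1,2)[OF that(1)]] that(2) by simp
  then have "{M. submod n (UNIV :: 's set) M \<and> grp_index V M = 1} = {V}"
    using submod_vecs grp_index_self[OF subgroup_V] by blast
  then have z1: "zetaS 1 = 1" by (simp add: zetaS_def)
  have supp: "latticeF k = 0" if ndvd: "\<not> ?w dvd k" for k
  proof -
    have "{L. submod n R L \<and> L \<subseteq> Rn \<and> grp_index V L = k} = {}" using idx ndvd by auto
    then show ?thesis by (simp add: latticeF_def del: Collect_empty_eq)
  qed
  have zR: "zR = (\<lambda>k. latticeF (k * ?w))"
  proof
    fix k
    show "zR k = latticeF (k * ?w)"
    proof (cases "k = 0")
      case False
      have "{L. submod n R L \<and> L \<subseteq> Rn \<and> grp_index V L = k * ?w} =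
          {L. submod n R L \<and> L \<subseteq> Rn \<and> grp_index Rn L = k}"
        using idx w by auto
      then show ?thesis using assms(1) False w by (simp add: latticeF_def)
    qed (simp add: assms(2) latticeF_def)
  qed
  obtain \<nu> where \<nu>: "\<nu> 0 = 0" "dirichlet_mult \<nu> zetaS = (\<lambda>k. latticeF (k * ?w))" "finite {k. \<nu> k \<noteq> 0}"
    "(\<Sum>k | \<nu> k \<noteq> 0. \<nu> k / of_nat k ^ n) = of_nat (card full_lattices) / of_nat (grp_index V C) ^ n * of_nat ?w ^ n"
    using poly_multiple_contract[OF poly_multiple_latticeF z1 _ supp] w by blast
  show ?thesis
    unfolding zS
  proof (rule dirichlet_poly_value_divide[where \<nu> = \<nu>])
    show "dirichlet_mult \<nu> zetaS = zR" unfolding \<nu>(2) zR ..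
    show "(\<Sum>k | \<nu> k \<noteq> 0. \<nu> k / of_nat k ^ n) =
        of_nat (card full_lattices) * of_nat (grp_index V Rn) ^ n / of_nat (grp_index V C) ^ n"
      unfolding \<nu>(4) by simp
  qed (fact \<nu> z1)+
qed

end

section \<open>Linear algebra over a finite field\<close>

lemma card_vecs: "card (vecs n :: (nat \<Rightarrow> 'e::{field,finite}) set) = CARD('e) ^ n"
  using card_matrices[of n "UNIV :: 'e set"] by (simp add: vecs_def)

lemma finite_vecs: "finite (vecs n :: (nat \<Rightarrow> 'e::{field,finite}) set)"
  by (rule card_ge_0_finite) (simp add: card_vecs)

lemma subspace_image_vapp:
  assumes "is_mat n a"
  shows "submod n UNIV (vapp n a ` vecs n)" "vapp n a ` vecs n \<subseteq> vecs n"
  using submod_vapp_image[OF submod_vecs assms] by (auto dest: submodD(2))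

lemma inj_iff_surj_field:
  fixes a :: "nat \<Rightarrow> nat \<Rightarrow> 'e::{field,finite}"
  assumes "is_mat n a"
  shows "inj_on (vapp n a) (vecs n) \<longleftrightarrow> vapp n a ` vecs n = vecs n"
  using subspace_image_vapp(2)[OF assms] finite_vecs[of n, where 'e = 'e]
  by (metis card_subset_eq card_image eq_card_imp_inj_on)

lemma kernel_vector:
  fixes a :: "nat \<Rightarrow> nat \<Rightarrow> 'e::{field,finite}"
  assumes "is_mat n a" "vapp n a ` vecs n \<noteq> vecs n"
  obtains v k where "v \<in> vecs n" "vapp n a v = 0" "k < n" "v k \<noteq> 0"
proof -
  have "\<not> inj_on (vapp n a) (vecs n)" using inj_iff_surj_field[OF assms(1)] assms(2) by simp
  then obtain x y where xy: "x \<in> vecs n" "y \<in> vecs n" "vapp n a x = vapp n a y" "x \<noteq> y"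
    by (auto simp: inj_on_def)
  define v where "v = x - y"
  have v: "v \<in> vecs n" "vapp n a v = 0" "v \<noteq> 0"
    using xy by (simp_all add: v_def vapp_diff add_subgroup_diff[OF add_subgroup_vecs])
  then obtain k where "v k \<noteq> 0" by (auto simp: fun_eq_iff)
  moreover from this have "k < n" using v(1) by (auto simp: vecs_def not_less[symmetric])
  ultimately show thesis using that v by blast
qed

lemma vapp_upd:
  assumes "k < n"
  shows "vapp n (a(k := a k + d)) x = vapp n a x + vscale (x k) d"
proof -
  have "vapp n (a(k := a k + d)) x = (\<Sum>j<n. vscale (x j) (a j) + (if j = k then vscale (x k) d else 0))"
    unfolding vapp_eq_sum by (rule sum.cong) (auto simp: vscale_add_right)
  then show ?thesis using assms by (simp add: sum.distrib vapp_eq_sum)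
qed

text \<open>\<open>v\<close> is a kernel vector with nonzero entry k. A vector x can be corrected by
  a multiple of \<open>v\<close> to have entry k equal to zero, so the old image survives the change
  of row k; and \<open>v\<close> divided by its entry k is mapped to the new vector
  \<open>d\<close>.\<close>

lemma rank_one_update:
  fixes a :: "nat \<Rightarrow> nat \<Rightarrow> 'e::{field,finite}"
  assumes "is_mat n a" "v \<in> vecs n" "vapp n a v = 0" "k < n" "v k \<noteq> 0" "d \<in> vecs n"
  shows "is_mat n (a(k := a k + d))" "vapp n a ` vecs n \<subseteq> vapp n (a(k := a k + d)) ` vecs n"
    "d \<in> vapp n (a(k := a k + d)) ` vecs n"
proof -
  let ?a = "a(k := a k + d)"
  show "is_mat n ?a"
    using assms(1,6) by (auto simp: is_mat_def intro: add_subgroup_add[OF add_subgroup_vecs])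
  show "vapp n a ` vecs n \<subseteq> vapp n ?a ` vecs n"
  proof
    fix y assume "y \<in> vapp n a ` vecs n"
    then obtain x where x: "x \<in> vecs n" "y = vapp n a x" by blast
    define z where "z = x - vscale (x k / v k) v"
    have "vapp n ?a z = y"
      unfolding vapp_upd[OF assms(4)]
      using assms(5) by (simp add: z_def vapp_diff vapp_vscale assms(3) x(2) fun_eq_iff)
    moreover have "z \<in> vecs n"
      unfolding z_def by (intro add_subgroup_diff[OF add_subgroup_vecs] x(1) vscale_in_vecs assms(2))
    ultimately show "y \<in> vapp n ?a ` vecs n" by blast
  qed
  have "vapp n ?a (vscale (1 / v k) v) = d"
    unfolding vapp_upd[OF assms(4)]
    using assms(5) by (simp add: vapp_vscale assms(3) fun_eq_iff)
  then show "d \<in> vapp n ?a ` vecs n" using vscale_in_vecs[OF assms(2)] by (metis imageI)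
qed

text \<open>Among the matrices congruent to \<open>a\<close> modulo W take one, b, with largest
  image. If the image missed some d in W, it would be proper, so b would have a kernel vector and
  \<open>rank_one_update\<close> with d would enlarge it within the same congruence class.\<close>

lemma matrix_completion:
  fixes a :: "nat \<Rightarrow> nat \<Rightarrow> 'e::{field,finite}"
  assumes a: "is_mat n a" and W: "submod n UNIV W"
  obtains b where "is_mat n b" "\<And>k. k < n \<Longrightarrow> b k - a k \<in> W"
    "vapp n b ` vecs n = subgroup_sum (vapp n a ` vecs n) W"
proof -
  let ?P = "\<lambda>b. is_mat n b \<and> (\<forall>k<n. b k - a k \<in> W)"
  let ?r = "\<lambda>b. card (vapp n b ` vecs n)"
  let ?U = "subgroup_sum (vapp n a ` vecs n) W"
  have Pa: "?P a" using a add_subgroup_zero[OF submodD(1)[OF W]] by simp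
  have le: "?r b \<le> card (vecs n :: (nat \<Rightarrow> 'e) set)" if "is_mat n b" for b :: "nat \<Rightarrow> nat \<Rightarrow> 'e"
    by (rule card_mono[OF finite_vecs subspace_image_vapp(2)[OF that]])
  have "\<forall>b. ?P b \<longrightarrow> ?r b < Suc (card (vecs n :: (nat \<Rightarrow> 'e) set))"
    by (intro allI impI, elim conjE, rule le_imp_less_Suc, rule le)
  from ex_has_greatest_nat[of ?P, OF Pa this] obtain b where
    b: "is_mat n b" "\<And>k. k < n \<Longrightarrow> b k - a k \<in> W" and max: "\<And>b'. ?P b' \<Longrightarrow> ?r b' \<le> ?r b"
    by (elim exE conjE) metis
  have dW: "vapp n b x - vapp n a x \<in> W" for x
    unfolding vapp_mat_diff[symmetric] by (rule vapp_in_submod[OF W]) (rule b(2))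
  have "vapp n b ` vecs n \<subseteq> ?U"
  proof
    fix y assume "y \<in> vapp n b ` vecs n"
    then obtain x where x: "x \<in> vecs n" "y = vapp n a x + (vapp n b x - vapp n a x)" by auto
    show "y \<in> ?U" unfolding x(2) by (intro subgroup_sumI imageI x(1) dW)
  qed
  moreover have "W \<subseteq> vapp n b ` vecs n"
  proof (rule ccontr)
    assume "\<not> W \<subseteq> vapp n b ` vecs n"
    then obtain d where d: "d \<in> W" "d \<notin> vapp n b ` vecs n" by blast
    have dV: "d \<in> vecs n" using d(1) submodD(2)[OF W] by blast
    then have "vapp n b ` vecs n \<noteq> vecs n" using d(2) by blast
    then obtain v k where v: "v \<in> vecs n" "vapp n b v = 0" "k < n" "v k \<noteq> 0"
      using kernel_vector[OF b(1)] by blast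
    let ?b = "b(k := b k + d)"
    note up = rank_one_update[OF b(1) v dV]
    have "?P ?b"
    proof (intro conjI allI impI)
      show "is_mat n ?b" by (rule up)
      fix j assume j: "j < n"
      have eq: "b k + d - a k = (b k - a k) + d" by simp
      have "b k + d - a k \<in> W" unfolding eq by (rule add_subgroup_add[OF submodD(1)[OF W] b(2)[OF v(3)] d(1)])
      then show "?b j - a j \<in> W"
        using b(2)[OF j] by simp
    qed
    moreover have "?r b < ?r ?b"
      by (rule psubset_card_mono) (use up(2,3) d(2) finite_vecs in auto)
    ultimately show False using max[of ?b] by simp
  qed
  moreover have "vapp n a ` vecs n \<subseteq> vapp n b ` vecs n"
  proof
    fix y assume "y \<in> vapp n a ` vecs n"
    then obtain x where x: "x \<in> vecs n" "y = vapp n b x - (vapp n b x - vapp n a x)" by auto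
    show "y \<in> vapp n b ` vecs n"
      unfolding x(2)
      by (intro add_subgroup_diff[OF submodD(1)[OF subspace_image_vapp(1)[OF b(1)]]] imageI x(1)
          subsetD[OF \<open>W \<subseteq> vapp n b ` vecs n\<close>] dW)
  qed
  ultimately have "vapp n b ` vecs n = ?U"
    using subgroup_sum_least[OF submodD(1)[OF subspace_image_vapp(1)[OF b(1)]]] by (intro subset_antisym)
  then show thesis using that[OF b] by simp
qed

section \<open>Lattices over a finite product of power series rings\<close>

definition residue_vec :: "'i \<Rightarrow> (nat \<Rightarrow> 'i \<Rightarrow> 'e::field fps) \<Rightarrow> nat \<Rightarrow> 'e" where
  "residue_vec i x = (\<lambda>a. fps_nth (x a i) 0)"

definition uniformizer :: "'i \<Rightarrow> 'e::field fps" where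
  "uniformizer = (\<lambda>_. fps_X)"

definition idempotent :: "'i \<Rightarrow> 'i \<Rightarrow> 'e::field fps" where
  "idempotent i = (\<lambda>j. if j = i then 1 else 0)"

lemma power_fun_apply: "(f ^ k) x = f x ^ k"
  by (induction k) auto

lemma residue_vec_in_vecs: "x \<in> vecs n \<Longrightarrow> residue_vec i x \<in> vecs n"
  by (simp add: residue_vec_def vecs_def)

lemma residue_vec_diff: "residue_vec i (x - y) = residue_vec i x - residue_vec i y"
  by (simp add: residue_vec_def fun_eq_iff)

lemma residue_vec_add: "residue_vec i (x + y) = residue_vec i x + residue_vec i y"
  by (simp add: residue_vec_def fun_eq_iff)

lemma residue_vec_vscale: "residue_vec i (vscale s x) = vscale (fps_nth (s i) 0) (residue_vec i x)"
  by (simp add: residue_vec_def fun_eq_iff)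

lemma residue_vec_vapp: "residue_vec i (vapp n g x) = vapp n (\<lambda>a. residue_vec i (g a)) (residue_vec i x)"
  by (simp add: residue_vec_def vapp_def fun_eq_iff sum_fun_apply fps_sum_nth)

lemma residue_vec_surj:
  assumes "u \<in> vecs n"
  shows "\<exists>x\<in>vecs n. residue_vec i x = u"
proof
  show "(\<lambda>a _. fps_const (u a)) \<in> vecs n" using assms by (simp add: vecs_def fun_eq_iff)
  show "residue_vec i (\<lambda>a _. fps_const (u a)) = u" by (simp add: residue_vec_def)
qed

lemma submod_residue_image:
  fixes M :: "(nat \<Rightarrow> 'i \<Rightarrow> 'e::field fps) set"
  assumes "submod n UNIV M"
  shows "submod n UNIV (residue_vec i ` M)"
  unfolding submod_def
proof (intro conjI ballI add_subgroupI)
  note M = submodD[OF assms]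
  show "0 \<in> residue_vec i ` M"
    using add_subgroup_zero[OF M(1)] by (rule rev_image_eqI) (simp add: residue_vec_def fun_eq_iff)
  show "residue_vec i ` M \<subseteq> vecs n" using M(2) by (auto intro: residue_vec_in_vecs)
  fix x y assume "x \<in> residue_vec i ` M" "y \<in> residue_vec i ` M"
  then obtain x' y' where "x' \<in> M" "y' \<in> M" "x = residue_vec i x'" "y = residue_vec i y'" by blast
  then show "x - y \<in> residue_vec i ` M"
    using add_subgroup_diff[OF M(1), of x' y'] by (simp add: image_eqI flip: residue_vec_diff)
next
  fix r x assume "x \<in> residue_vec i ` M"
  then obtain x' where x': "x' \<in> M" "x = residue_vec i x'" by blast
  have "vscale r x = residue_vec i (vscale (\<lambda>_. fps_const r) x')"
    by (simp add: residue_vec_vscale x'(2))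
  then show "vscale r x \<in> residue_vec i ` M" using submodD(3)[OF assms UNIV_I x'(1)] by blast
qed

text \<open>The idempotents of the product ring lie in the scalars, so each component may be taken
  from a different element of M.\<close>

lemma combine_components:
  fixes M :: "(nat \<Rightarrow> 'i::finite \<Rightarrow> 'e::field fps) set"
  assumes "submod n UNIV M" "\<And>i. f i \<in> M"
  shows "(\<lambda>a i. f i a i) \<in> M"
proof -
  have "(\<lambda>a i. f i a i) = (\<Sum>i\<in>UNIV. vscale (idempotent i) (f i))"
    by (simp add: fun_eq_iff sum_fun_apply idempotent_def if_distrib[of "\<lambda>x. x * _"] cong: if_cong)
  also have "\<dots> \<in> M"
    by (rule add_subgroup_sum[OF submodD(1)[OF assms(1)]]) (rule submodD(3)[OF assms(1) UNIV_I assms(2)])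
  finally show ?thesis .
qed

text \<open>If component i of \<open>x\<close> vanishes below degree d, only the constant terms of
  the matrix reach degree d.\<close>

lemma nth_vapp_least:
  assumes "\<And>a l. l < d \<Longrightarrow> fps_nth (x a i) l = 0"
  shows "fps_nth (vapp n \<beta> x b i) d = vapp n (\<lambda>a. residue_vec i (\<beta> a)) (\<lambda>a. fps_nth (x a i) d) b"
proof -
  have "fps_nth (x a i * \<beta> a b i) d = fps_nth (x a i) d * fps_nth (\<beta> a b i) 0" for a
  proof -
    have "fps_nth (x a i * \<beta> a b i) d = (\<Sum>l=0..d. fps_nth (x a i) l * fps_nth (\<beta> a b i) (d - l))"
      by (simp add: fps_mult_nth)
    also have "\<dots> = (\<Sum>l\<in>{d}. fps_nth (x a i) l * fps_nth (\<beta> a b i) (d - l))"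
      by (rule sum.mono_neutral_right) (use assms in auto)
    finally show ?thesis by simp
  qed
  then show ?thesis by (simp add: vapp_def sum_fun_apply fps_sum_nth residue_vec_def)
qed

text \<open>Invertibility over the power series rings follows from invertibility over the residue
  fields without determinants. For injectivity compare lowest coefficients; for surjectivity solve
  for the coefficients degree by degree.\<close>

lemma bij_of_residues:
  fixes \<beta> :: "nat \<Rightarrow> nat \<Rightarrow> 'i::finite \<Rightarrow> 'e::{field,finite} fps"
  assumes \<beta>: "is_mat n \<beta>"
    and res: "\<And>i. vapp n (\<lambda>a. residue_vec i (\<beta> a)) ` vecs n = vecs n"
  shows "bij_betw (vapp n \<beta>) (vecs n) (vecs n)"
proof (rule bij_betw_imageI)
  have res_mat: "is_mat n (\<lambda>a. residue_vec i (\<beta> a))" for i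
    using \<beta> by (simp add: is_mat_def residue_vec_in_vecs)
  have res_inj: "inj_on (vapp n (\<lambda>a. residue_vec i (\<beta> a))) (vecs n)" for i
    using inj_iff_surj_field[OF res_mat] res by blast
  have ker: "x = 0" if x: "x \<in> vecs n" "vapp n \<beta> x = 0" for x
  proof (rule ccontr)
    assume "x \<noteq> 0"
    then obtain a i l where "fps_nth (x a i) l \<noteq> 0" by (auto simp: fun_eq_iff fps_eq_iff)
    then have ex: "\<exists>d. \<exists>a. fps_nth (x a i) d \<noteq> 0" by blast
    define d where "d = (LEAST d. \<exists>a. fps_nth (x a i) d \<noteq> 0)"
    have d: "\<exists>a. fps_nth (x a i) d \<noteq> 0" unfolding d_def using ex by (rule LeastI_ex)
    have less: "fps_nth (x a i) l = 0" if "l < d" for a l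
      using not_less_Least[OF that[unfolded d_def]] by blast
    let ?u = "\<lambda>a. fps_nth (x a i) d"
    have "vapp n (\<lambda>a. residue_vec i (\<beta> a)) ?u = 0"
      using nth_vapp_least[of d x i n \<beta>] less x(2) by (simp add: fun_eq_iff)
    moreover have "?u \<in> vecs n" "0 \<in> vecs n" using x(1) by (simp_all add: vecs_def)
    ultimately have "?u = 0" using res_inj[of i] by (metis inj_onD vapp_zero)
    then show False using d by (auto simp: fun_eq_iff)
  qed
  show "inj_on (vapp n \<beta>) (vecs n)"
  proof (rule inj_onI)
    fix x y assume "x \<in> vecs n" "y \<in> vecs n" "vapp n \<beta> x = vapp n \<beta> y"
    then have "x - y \<in> vecs n" "vapp n \<beta> (x - y) = 0"
      by (simp_all add: vapp_diff add_subgroup_diff[OF add_subgroup_vecs])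
    then have "x - y = 0" by (rule ker)
    then show "x = y" by simp
  qed
  show "vapp n \<beta> ` vecs n = vecs n"
  proof (intro equalityI subsetI)
    fix y assume "y \<in> vapp n \<beta> ` vecs n"
    then show "y \<in> vecs n" using vapp_in_vecs[OF \<beta>] by blast
  next
    fix y :: "nat \<Rightarrow> 'i \<Rightarrow> 'e fps" assume y: "y \<in> vecs n"
    \<comment> \<open>\<open>Q i f d r\<close> is the degree d part at component i of the equation
      \<open>vapp n \<beta> x = y\<close>: r is the unknown coefficient vector of degree d, and
      \<open>f\<close> supplies those of lower degree. Only the residue matrix acts on r, so r
      exists.\<close>
    define Q where "Q i f d r \<longleftrightarrow> r \<in> vecs n \<and> (\<forall>b<n. (\<Sum>a<n. r a * fps_nth (\<beta> a b i) 0 +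
        (\<Sum>l<d. f l a * fps_nth (\<beta> a b i) (d - l))) = fps_nth (y b i) d)" for i f d r
    have "\<exists>f. \<forall>d. Q i f d (f d)" for i
    proof (rule dependent_wf_choice[of less_than "Q i"])
      show "Q i f d r = Q i g d r" if "\<And>l. (l, d) \<in> less_than \<Longrightarrow> f l = g l" for f g d r
        using that by (simp add: Q_def)
      show "\<exists>r. Q i f d r" for f d
      proof -
        define w where "w = (\<lambda>b. if b < n then fps_nth (y b i) d -
            (\<Sum>a<n. \<Sum>l<d. f l a * fps_nth (\<beta> a b i) (d - l)) else 0)"
        have "w \<in> vecs n" by (simp add: w_def vecs_def)
        then obtain r where r: "r \<in> vecs n" "vapp n (\<lambda>a. residue_vec i (\<beta> a)) r = w"
          using res[of i] by (metis imageE)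
        have "(\<Sum>a<n. r a * fps_nth (\<beta> a b i) 0) = w b" for b
          using r(2) by (auto simp: vapp_def residue_vec_def fun_eq_iff)
        then have "Q i f d r" using r(1) by (simp add: Q_def sum.distrib w_def)
        then show ?thesis by blast
      qed
    qed simp
    then obtain f where f: "\<And>i d. Q i (f i) d (f i d)" by metis
    define x where "x = (\<lambda>a i. Abs_fps (\<lambda>d. f i d a))"
    have "x \<in> vecs n" using f by (auto simp: x_def vecs_def Q_def fun_eq_iff fps_eq_iff)
    moreover have "vapp n \<beta> x = y"
    proof (rule ext, rule ext)
      fix b i
      show "vapp n \<beta> x b i = y b i"
      proof (cases "b < n")
        case True
        show ?thesis
        proof (rule fps_ext)
          fix d
          have "fps_nth (x a i * \<beta> a b i) d = f i d a * fps_nth (\<beta> a b i) 0 +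
              (\<Sum>l<d. f i l a * fps_nth (\<beta> a b i) (d - l))" for a
            by (simp add: fps_mult_nth x_def atLeast0AtMost lessThan_Suc_atMost[symmetric])
          then have "fps_nth (vapp n \<beta> x b i) d = (\<Sum>a<n. f i d a * fps_nth (\<beta> a b i) 0 +
              (\<Sum>l<d. f i l a * fps_nth (\<beta> a b i) (d - l)))"
            by (simp add: vapp_def sum_fun_apply fps_sum_nth)
          then show "fps_nth (vapp n \<beta> x b i) d = fps_nth (y b i) d"
            using f[of i d] True by (simp add: Q_def)
        qed
      next
        case False
        then show ?thesis using y vapp_in_vecs[OF \<beta>, of x] by (simp add: vecs_def)
      qed
    qed
    ultimately show "y \<in> vapp n \<beta> ` vecs n" by blast
  qed
qed

text \<open>The residues of \<open>D\<close> at each i make the residue matrix completable to an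
  invertible one. The corrections lift to \<open>D\<close>, a single lift serves all i by
  \<open>combine_components\<close>, and \<open>bij_of_residues\<close> gives invertibility.\<close>

lemma stable_range_fps:
  fixes \<alpha> :: "nat \<Rightarrow> nat \<Rightarrow> 'i::finite \<Rightarrow> 'e::{field,finite} fps"
  assumes \<alpha>: "is_mat n \<alpha>" and D: "submod n UNIV D"
    and sum: "subgroup_sum (vapp n \<alpha> ` vecs n) D = vecs n"
  shows "\<exists>\<beta>. is_mat n \<beta> \<and> bij_betw (vapp n \<beta>) (vecs n) (vecs n) \<and> (\<forall>a<n. \<alpha> a - \<beta> a \<in> D)"
proof -
  have res_mat: "is_mat n (\<lambda>a. residue_vec i (\<alpha> a))" for i
    using \<alpha> by (simp add: is_mat_def residue_vec_in_vecs)
  have "\<exists>b. is_mat n b \<and> (\<forall>k<n. b k - residue_vec i (\<alpha> k) \<in> residue_vec i ` D) \<and> vapp n b ` vecs n = vecs n" for i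
  proof -
    obtain b where b: "is_mat n b" "\<And>k. k < n \<Longrightarrow> b k - residue_vec i (\<alpha> k) \<in> residue_vec i ` D"
      "vapp n b ` vecs n = subgroup_sum (vapp n (\<lambda>a. residue_vec i (\<alpha> a)) ` vecs n) (residue_vec i ` D)"
      using matrix_completion[OF res_mat submod_residue_image[OF D]] by blast
    have "vecs n \<subseteq> vapp n b ` vecs n"
    proof
      fix u :: "nat \<Rightarrow> 'e" assume "u \<in> vecs n"
      then obtain y where y: "y \<in> vecs n" "residue_vec i y = u" using residue_vec_surj[of u n i] by blast
      then have "y \<in> subgroup_sum (vapp n \<alpha> ` vecs n) D" by (simp only: sum)
      then obtain z d where z: "z \<in> vapp n \<alpha> ` vecs n" "d \<in> D" "y = z + d"
        unfolding subgroup_sum_def by blast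
      then obtain x where x: "x \<in> vecs n" "z = vapp n \<alpha> x" by blast
      then have "u = vapp n (\<lambda>a. residue_vec i (\<alpha> a)) (residue_vec i x) + residue_vec i d"
        using y(2) x z(3) by (simp add: residue_vec_add residue_vec_vapp)
      then show "u \<in> vapp n b ` vecs n"
        unfolding b(3) by (simp only:) (intro subgroup_sumI imageI residue_vec_in_vecs x(1) z(2))
    qed
    then have "vapp n b ` vecs n = vecs n" using subspace_image_vapp(2)[OF b(1)] by blast
    then show ?thesis using b by blast
  qed
  then obtain b where b: "\<And>i. is_mat n (b i)"
    "\<And>i k. k < n \<Longrightarrow> b i k - residue_vec i (\<alpha> k) \<in> residue_vec i ` D" "\<And>i. vapp n (b i) ` vecs n = vecs n"
    by metis
  have "\<exists>d. k < n \<longrightarrow> d \<in> D \<and> residue_vec i d = b i k - residue_vec i (\<alpha> k)" for k i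
    using b(2)[of k i] by (metis (mono_tags, lifting) image_iff)
  then obtain d where d: "\<And>k i. k < n \<Longrightarrow> d k i \<in> D \<and> residue_vec i (d k i) = b i k - residue_vec i (\<alpha> k)"
    by metis
  define e where "e k = (\<lambda>a i. d k i a i)" for k
  have e: "e k \<in> D" if "k < n" for k
    unfolding e_def by (rule combine_components[OF D]) (rule d[OF that, THEN conjunct1])
  define \<beta> where "\<beta> k = \<alpha> k + e k" for k
  have \<beta>: "is_mat n \<beta>"
    using \<alpha> e submodD(2)[OF D] by (auto simp: is_mat_def \<beta>_def intro!: add_subgroup_add[OF add_subgroup_vecs])
  have "residue_vec i (\<beta> k) = b i k" if "k < n" for i k
  proof -
    have "residue_vec i (e k) = residue_vec i (d k i)" by (simp add: residue_vec_def e_def)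
    then show ?thesis using d[OF that, of i] by (simp add: \<beta>_def residue_vec_add)
  qed
  then have "vapp n (\<lambda>a. residue_vec i (\<beta> a)) = vapp n (b i)" for i
    by (simp add: vapp_def fun_eq_iff)
  then have "bij_betw (vapp n \<beta>) (vecs n) (vecs n)" using bij_of_residues[OF \<beta>] b(3) by simp
  moreover have "\<alpha> k - \<beta> k \<in> D" if "k < n" for k
    using add_subgroup_uminus[OF submodD(1)[OF D] e[OF that]] by (simp add: \<beta>_def)
  ultimately show ?thesis using \<beta> by blast
qed

lemma vapp_unit_mat: "x \<in> vecs n \<Longrightarrow> vapp n (\<lambda>a. unit_vec a) x = x"
  by (auto simp: vapp_def unit_vec_def fun_eq_iff vecs_def if_distrib[of "\<lambda>x. _ * x"] not_less cong: if_cong)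

lemma uniformizer_divides:
  fixes x :: "nat \<Rightarrow> 'i \<Rightarrow> 'e::field fps"
  assumes "x \<in> vecs n" "\<And>i. residue_vec i x = 0"
  obtains y where "y \<in> vecs n" "x = vscale uniformizer y"
proof -
  define y where "y = (\<lambda>a i. fps_shift 1 (x a i))"
  have "y \<in> vecs n" using assms(1) by (simp add: y_def vecs_def fun_eq_iff)
  moreover have "x = vscale uniformizer y"
  proof (rule ext, rule ext)
    fix a i
    have "fps_nth (x a i) 0 = 0" using assms(2)[of i] by (simp add: residue_vec_def fun_eq_iff)
    then show "x a i = vscale uniformizer y a i"
      by (auto simp: y_def uniformizer_def fps_eq_iff)
  qed
  ultimately show thesis by (rule that)
qed

lemma residue_vscale_uniformizer: "residue_vec i (vscale uniformizer y) = 0"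
  by (simp add: residue_vec_vscale uniformizer_def fun_eq_iff)

lemma vscale_inj: 
  fixes x :: "nat \<Rightarrow> 'i \<Rightarrow> 'e::field fps"
  assumes "vscale uniformizer x = vscale uniformizer y"
  shows "x = y"
proof (rule ext, rule ext)
  fix a i
  have "fps_X * x a i = fps_X * y a i" using assms by (simp add: fun_eq_iff uniformizer_def)
  then show "x a i = y a i" by simp
qed

text \<open>Taking residues at all components identifies the quotient with a product of copies of
  E^n, one for each i.\<close>

lemma grp_index_uniformizer_vecs:
  "grp_index (vecs n :: (nat \<Rightarrow> 'i::finite \<Rightarrow> 'e::{field,finite} fps) set) (vscale uniformizer ` vecs n) =
    CARD('e) ^ (CARD('i) * n)"
proof -
  let ?V = "vecs n :: (nat \<Rightarrow> 'i \<Rightarrow> 'e fps) set"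
  let ?f = "\<lambda>x i. residue_vec i x"
  have sub: "add_subgroup (vscale uniformizer ` ?V)"
    by (rule submodD(1)[OF submod_vscale_image[OF submod_vecs]])
  have "grp_index ?V (vscale uniformizer ` ?V) = grp_index (?f ` ?V) {0}"
  proof (rule grp_index_transfer[OF sub add_subgroup_singleton_zero refl])
    fix x y assume "x \<in> ?V" "y \<in> ?V"
    then have xy: "x - y \<in> ?V" by (rule add_subgroup_diff[OF add_subgroup_vecs])
    have "x - y \<in> vscale uniformizer ` ?V \<longleftrightarrow> (\<forall>i. residue_vec i (x - y) = 0)"
    proof
      assume "\<forall>i. residue_vec i (x - y) = 0"
      then obtain z where "z \<in> ?V" "x - y = vscale uniformizer z" using uniformizer_divides[OF xy] by metis
      then show "x - y \<in> vscale uniformizer ` ?V" by (metis imageI)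
    next
      assume "x - y \<in> vscale uniformizer ` ?V"
      then obtain z where "x - y = vscale uniformizer z" by (rule imageE)
      then show "\<forall>i. residue_vec i (x - y) = 0" by (simp only: residue_vscale_uniformizer simp_thms)
    qed
    also have "\<dots> \<longleftrightarrow> ?f x - ?f y \<in> {0}" unfolding residue_vec_diff by (auto simp: fun_eq_iff)
    finally show "x - y \<in> vscale uniformizer ` ?V \<longleftrightarrow> ?f x - ?f y \<in> {0}" .
  qed
  moreover have "?f ` ?V = PiE UNIV (\<lambda>_. vecs n)"
  proof (intro equalityI subsetI)
    fix u :: "'i \<Rightarrow> nat \<Rightarrow> 'e" assume u: "u \<in> PiE UNIV (\<lambda>_. vecs n)"
    show "u \<in> ?f ` ?V"
    proof (rule image_eqI)
      show "u = ?f (\<lambda>a i. fps_const (u i a))" by (simp add: residue_vec_def)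
      show "(\<lambda>a i. fps_const (u i a)) \<in> ?V" using u by (simp add: vecs_def PiE_iff fun_eq_iff)
    qed
  qed (auto intro: residue_vec_in_vecs)
  then have "card (?f ` ?V) = CARD('e) ^ (CARD('i) * n)"
    by (simp add: card_PiE card_vecs power_mult mult.commute[of "CARD('i)"])
  ultimately show ?thesis by (simp add: grp_index_zero_right)
qed

lemma grp_index_uniformizer_power_vecs:
  "grp_index (vecs n :: (nat \<Rightarrow> 'i::finite \<Rightarrow> 'e::{field,finite} fps) set) (vscale (uniformizer ^ k) ` vecs n) =
    CARD('e) ^ (CARD('i) * n * k)"
proof (induction k)
  case 0
  then show ?case by (simp add: grp_index_self add_subgroup_vecs)
next
  case (Suc k)
  let ?V = "vecs n :: (nat \<Rightarrow> 'i \<Rightarrow> 'e fps) set"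
  let ?C = "\<lambda>k. vscale (uniformizer ^ k) ` ?V"
  have sub: "submod n UNIV (?C k)" for k by (rule submod_vscale_image[OF submod_vecs])
  have eq: "?C (Suc k) = vscale uniformizer ` ?C k" by (simp add: image_image vscale_vscale)
  have tV: "submod n UNIV (vscale uniformizer ` ?V)" by (rule submod_vscale_image[OF submod_vecs])
  have "grp_index ?V (?C (Suc k)) = grp_index ?V (vscale uniformizer ` ?V) * grp_index (vscale uniformizer ` ?V) (?C (Suc k))"
    unfolding eq
    by (intro grp_index_mult submodD(1)[OF tV] add_subgroup_vecs submodD(2)[OF tV] image_mono submodD(2)[OF sub]
        submodD(1)[OF submod_vscale_image[OF sub]])
  also have "grp_index (vscale uniformizer ` ?V) (?C (Suc k)) = grp_index ?V (?C k)"
    unfolding eq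
  proof (rule sym, rule grp_index_transfer[where f = "vscale uniformizer"])
    fix x y :: "nat \<Rightarrow> 'i \<Rightarrow> 'e fps"
    show "x - y \<in> ?C k \<longleftrightarrow> vscale uniformizer x - vscale uniformizer y \<in> vscale uniformizer ` ?C k"
      unfolding vscale_diff_right[symmetric] by (rule inj_image_mem_iff[symmetric]) (rule injI, rule vscale_inj)
  qed (rule submodD(1)[OF sub], rule submodD(1)[OF submod_vscale_image[OF sub]], rule refl)
  finally show ?case unfolding Suc.IH grp_index_uniformizer_vecs by (simp only: power_add mult_Suc_right)
qed

text \<open>Pigeonhole: of the k + 1 vectors x, t x, ..., t^k x two are congruent modulo M, say with
  exponents i < j. Their difference is t^i (1 - t^(j-i)) x and the bracket is a unit, so t^i x and
  hence t^k x is in M.\<close>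

lemma finite_index_contains_power:
  fixes M :: "(nat \<Rightarrow> 'i::finite \<Rightarrow> 'e::{field,finite} fps) set"
  assumes M: "submod n UNIV M" and k: "grp_index (vecs n) M = k" "k \<noteq> 0"
  shows "vscale (uniformizer ^ k) ` vecs n \<subseteq> M"
proof
  fix z :: "nat \<Rightarrow> 'i \<Rightarrow> 'e fps" assume "z \<in> vscale (uniformizer ^ k) ` vecs n"
  then obtain x where x: "x \<in> vecs n" "z = vscale (uniformizer ^ k) x" by blast
  let ?f = "\<lambda>j. (+) (vscale (uniformizer ^ j) x) ` M"
  have "?f ` {..k} \<subseteq> grp_cosets (vecs n) M"
    using vscale_in_vecs[OF x(1)] by (auto simp: grp_cosets_def)
  moreover have "finite (grp_cosets (vecs n) M)" using k by (simp add: grp_index_def card_ge_0_finite)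
  ultimately have "card (?f ` {..k}) \<le> k" using k(1) unfolding grp_index_def by (metis card_mono)
  then have "\<not> inj_on ?f {..k}" by (metis card_atMost card_image not_less_eq_eq order_refl)
  then obtain i j where ij: "i \<le> k" "j \<le> k" "i < j" "?f i = ?f j"
    unfolding inj_on_def by (metis atMost_iff nat_neq_iff)
  \<comment> \<open>The inverse of the unit 1 - t^(j-i).\<close>
  define u :: "'i \<Rightarrow> 'e fps" where "u = (\<lambda>_. inverse (1 - fps_X ^ (j - i)))"
  have h1: "u * (1 - uniformizer ^ (j - i)) = 1"
  proof
    fix l
    have "fps_nth (1 - fps_X ^ (j - i) :: 'e fps) 0 \<noteq> 0" using ij(3) by simp
    then show "(u * (1 - uniformizer ^ (j - i))) l = (1 :: 'i \<Rightarrow> 'e fps) l"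
      by (simp add: u_def uniformizer_def power_fun_apply inverse_mult_eq_1)
  qed
  have h2: "uniformizer ^ i - uniformizer ^ j = uniformizer ^ i * (1 - (uniformizer :: 'i \<Rightarrow> 'e fps) ^ (j - i))"
    using ij(3) by (simp add: right_diff_distrib flip: power_add)
  have eq: "u * (uniformizer ^ i - uniformizer ^ j) = (uniformizer :: 'i \<Rightarrow> 'e fps) ^ i"
    unfolding h2 mult.left_commute[of u] h1 by simp
  have "vscale (uniformizer ^ i) x - vscale (uniformizer ^ j) x \<in> M"
    using ij(4) coset_eq_iff[OF submodD(1)[OF M]] by blast
  then have "vscale (uniformizer ^ (k - i) * u) (vscale (uniformizer ^ i) x - vscale (uniformizer ^ j) x) \<in> M"
    by (rule submodD(3)[OF M UNIV_I])
  then have "vscale (uniformizer ^ (k - i) * (u * (uniformizer ^ i - uniformizer ^ j))) x \<in> M"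
    by (simp add: vscale_vscale mult.assoc flip: vscale_diff_left)
  then show "z \<in> M" unfolding eq x(2) using ij(1) by (simp flip: power_add)
qed

lemma finite_submods_fps:
  assumes "k \<noteq> 0"
  shows "finite {M :: (nat \<Rightarrow> 'i::finite \<Rightarrow> 'e::{field,finite} fps) set. submod n UNIV M \<and> grp_index (vecs n) M = k}"
proof (rule finite_subset)
  let ?V = "vecs n :: (nat \<Rightarrow> 'i \<Rightarrow> 'e fps) set"
  let ?C = "vscale (uniformizer ^ k) ` ?V"
  show "{M. submod n UNIV M \<and> grp_index ?V M = k} \<subseteq> {H. add_subgroup H \<and> ?C \<subseteq> H \<and> H \<subseteq> ?V}"
  proof
    fix M assume "M \<in> {M. submod n UNIV M \<and> grp_index ?V M = k}"
    then have M: "submod n UNIV M" "grp_index ?V M = k" by auto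
    show "M \<in> {H. add_subgroup H \<and> ?C \<subseteq> H \<and> H \<subseteq> ?V}"
      using finite_index_contains_power[OF M assms] submodD(1,2)[OF M(1)] by simp
  qed
  have "grp_index ?V ?C \<noteq> 0" unfolding grp_index_uniformizer_power_vecs by simp
  then show "finite {H. add_subgroup H \<and> ?C \<subseteq> H \<and> H \<subseteq> ?V}"
    by (rule finite_between_subgroups[OF add_subgroup_vecs submodD(1)[OF submod_vscale_image[OF submod_vecs]]])
qed

text \<open>Full residues give V = M + t V, hence V = M + t^k V for all k; for k = (V : M) the
  second summand lies in M by \<open>finite_index_contains_power\<close>.\<close>

lemma nakayama:
  fixes M :: "(nat \<Rightarrow> 'i::finite \<Rightarrow> 'e::{field,finite} fps) set"
  assumes M: "submod n UNIV M" and fin: "grp_index (vecs n) M \<noteq> 0"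
    and res: "\<And>i. residue_vec i ` M = vecs n"
  shows "M = vecs n"
proof -
  note MD = submodD[OF M]
  have step: "\<exists>m\<in>M. \<exists>y\<in>vecs n. x = m + vscale uniformizer y" if x: "x \<in> vecs n" for x
  proof -
    have "\<exists>m. m \<in> M \<and> residue_vec i m = residue_vec i x" for i
    proof -
      have "residue_vec i x \<in> residue_vec i ` M" using res residue_vec_in_vecs[OF x] by simp
      then show ?thesis by force
    qed
    then obtain f where f: "\<And>i. f i \<in> M" "\<And>i. residue_vec i (f i) = residue_vec i x" by metis
    define m where "m = (\<lambda>a i. f i a i)"
    have m: "m \<in> M" unfolding m_def by (rule combine_components[OF M f(1)])
    have "residue_vec i m = residue_vec i x" for i
      using f(2)[of i] by (simp add: residue_vec_def m_def fun_eq_iff)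
    then have "residue_vec i (x - m) = 0" for i by (simp add: residue_vec_diff)
    moreover have "x - m \<in> vecs n" using x m MD(2) by (intro add_subgroup_diff[OF add_subgroup_vecs]) auto
    ultimately obtain y where "y \<in> vecs n" "x - m = vscale uniformizer y"
      using uniformizer_divides by metis
    then have "x = m + vscale uniformizer y" by (simp add: algebra_simps)
    then show ?thesis using m \<open>y \<in> vecs n\<close> by blast
  qed
  have "\<exists>m\<in>M. \<exists>y\<in>vecs n. x = m + vscale (uniformizer ^ k) y" if x: "x \<in> vecs n" for x k
  proof (induction k)
    case 0
    show ?case by (intro bexI[of _ 0] bexI[of _ x]) (simp_all add: x add_subgroup_zero[OF MD(1)])
  next
    case (Suc k)
    then obtain m y where my: "m \<in> M" "y \<in> vecs n" "x = m + vscale (uniformizer ^ k) y" by blast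
    obtain m' y' where my': "m' \<in> M" "y' \<in> vecs n" "y = m' + vscale uniformizer y'" using step[OF my(2)] by blast
    have "x = (m + vscale (uniformizer ^ k) m') + vscale (uniformizer ^ Suc k) y'"
      using my(3) my'(3) by (simp add: vscale_add_right vscale_vscale mult.commute add.assoc)
    moreover have "m + vscale (uniformizer ^ k) m' \<in> M"
      by (rule add_subgroup_add[OF MD(1) my(1) MD(3)[OF UNIV_I my'(1)]])
    ultimately show ?case using my'(2) by blast
  qed
  note expand = this
  have "x \<in> M" if x: "x \<in> vecs n" for x
  proof -
    obtain m y where "m \<in> M" "y \<in> vecs n" "x = m + vscale (uniformizer ^ grp_index (vecs n) M) y"
      using expand[OF x] by blast
    moreover have "vscale (uniformizer ^ grp_index (vecs n) M) y \<in> M"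
      using finite_index_contains_power[OF M refl fin] \<open>y \<in> vecs n\<close> by blast
    ultimately show ?thesis using add_subgroup_add[OF MD(1)] by blast
  qed
  then show ?thesis using MD(2) by blast
qed

lemma proper_subspace_maximal:
  fixes W0 :: "(nat \<Rightarrow> 'e::{field,finite}) set"
  assumes "submod n UNIV W0" "W0 \<noteq> vecs n"
  obtains W where "submod n UNIV W" "W0 \<subseteq> W" "W \<noteq> vecs n"
    "\<And>U. submod n UNIV U \<Longrightarrow> W \<subset> U \<Longrightarrow> U = vecs n"
proof -
  let ?A = "{W. submod n UNIV W \<and> W0 \<subseteq> W \<and> W \<noteq> vecs n}"
  have "?A \<subseteq> Pow (vecs n)" using submodD(2) by blast
  then have fin: "finite ?A" by (rule finite_subset) (simp add: finite_vecs)
  have "W0 \<in> ?A" using assms by simp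
  from finite_has_maximal2[OF fin this] obtain W where
    W: "W \<in> ?A" and max: "\<forall>U\<in>?A. W \<subseteq> U \<longrightarrow> W = U" by (elim bexE conjE)
  show thesis
  proof (rule that[of W])
    fix U assume U: "submod n UNIV U" "W \<subset> U"
    show "U = vecs n"
    proof (rule ccontr)
      assume "U \<noteq> vecs n"
      then have "U \<in> ?A" using U W by blast
      then show False using max U(2) by blast
    qed
  qed (use W in auto)
qed

text \<open>Enlarge the residue of \<open>M\<close> at \<open>i\<close> to a hyperplane; the lattice of all vectors with residue in
  that hyperplane is the image of an elementary matrix.\<close>

lemma elementary_overlattice:
  fixes M :: "(nat \<Rightarrow> 'i::finite \<Rightarrow> 'e::{field,finite} fps) set"
  assumes M: "submod n UNIV M" and proper: "residue_vec i ` M \<noteq> vecs n"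
  obtains \<gamma> where "is_mat n \<gamma>" "inj_on (vapp n \<gamma>) (vecs n)" "M \<subseteq> vapp n \<gamma> ` vecs n"
    "vapp n \<gamma> ` vecs n \<noteq> vecs n"
proof -
  obtain W where W: "submod n UNIV W" "residue_vec i ` M \<subseteq> W" "W \<noteq> vecs n"
    "\<And>U. submod n UNIV U \<Longrightarrow> W \<subset> U \<Longrightarrow> U = vecs n"
    using proper_subspace_maximal[OF submod_residue_image[OF M] proper] by blast
  have zero: "is_mat n (\<lambda>a. 0 :: nat \<Rightarrow> 'e)" by (simp add: is_mat_def vecs_def)
  \<comment> \<open>Completing the zero matrix modulo W yields a matrix whose image is exactly
    W.\<close>
  obtain a where a: "is_mat n a" "vapp n a ` vecs n = subgroup_sum (vapp n (\<lambda>a. 0 :: nat \<Rightarrow> 'e) ` vecs n) W"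
    using matrix_completion[OF zero W(1)] by metis
  have aW: "vapp n a ` vecs n = W"
  proof -
    have "vapp n (\<lambda>a. 0 :: nat \<Rightarrow> 'e) x = 0" for x by (simp add: vapp_def fun_eq_iff)
    then have "subgroup_sum (vapp n (\<lambda>a. 0 :: nat \<Rightarrow> 'e) ` vecs n) W = W"
      using add_subgroup_zero[OF add_subgroup_vecs, of n] unfolding subgroup_sum_def by force
    then show ?thesis using a(2) by simp
  qed
  have "vapp n a ` vecs n \<noteq> vecs n" using aW W(3) by simp
  then obtain v k where v: "v \<in> vecs n" "vapp n a v = 0" "k < n" "v k \<noteq> 0"
    using kernel_vector[OF a(1)] by blast
  obtain d where d: "d \<in> vecs n" "d \<notin> W" using W(3) submodD(2)[OF W(1)] by blast
  define b where "b = a(k := a k + d)"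
  note up = rank_one_update[OF a(1) v d(1), folded b_def]
  have b_surj: "vapp n b ` vecs n = vecs n"
  proof (rule W(4))
    show "submod n UNIV (vapp n b ` vecs n)" by (rule subspace_image_vapp(1)[OF up(1)])
    show "W \<subset> vapp n b ` vecs n" using up(2,3) aW d(2) by blast
  qed
  have b_inj: "inj_on (vapp n b) (vecs n)" using inj_iff_surj_field[OF up(1)] b_surj by simp
  \<comment> \<open>W is the image of \<open>a\<close>, and preimages under \<open>a\<close> can be
    chosen with entry k zero by subtracting a multiple of the kernel vector. There \<open>a\<close>
    and \<open>b\<close> agree, and \<open>b\<close> is injective.\<close>
  have b_W: "u k = 0" if u: "u \<in> vecs n" "vapp n b u \<in> W" for u
  proof -
    obtain z where z: "z \<in> vecs n" "vapp n a z = vapp n b u" using u(2) unfolding aW[symmetric] by force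
    define z' where "z' = z - vscale (z k / v k) v"
    have "vapp n b z' = vapp n a z' + vscale (z' k) d" unfolding b_def by (rule vapp_upd[OF v(3)])
    moreover have "z' k = 0" using v(4) by (simp add: z'_def)
    moreover have "vapp n a z' = vapp n b u" by (simp add: z'_def vapp_diff vapp_vscale v(2) z(2))
    ultimately have "vapp n b z' = vapp n b u" by (simp add: fun_eq_iff)
    moreover have "z' \<in> vecs n"
      unfolding z'_def by (intro add_subgroup_diff[OF add_subgroup_vecs] z(1) vscale_in_vecs v(1))
    ultimately have "z' = u" using b_inj u(1) by (auto dest: inj_onD)
    then show ?thesis using v(4) by (auto simp: z'_def)
  qed
  \<comment> \<open>The invertible matrix with residue \<open>b\<close> at component i and the
    identity at all others. In the coordinates it defines, a residue in W means vanishing constant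
    term of coordinate k at i.\<close>
  define \<beta> :: "nat \<Rightarrow> nat \<Rightarrow> 'i \<Rightarrow> 'e fps" where
    "\<beta> = (\<lambda>r s j. if j = i then fps_const (b r s) else unit_vec r s)"
  have \<beta>_mat: "is_mat n \<beta>"
    using up(1) by (auto simp: is_mat_def \<beta>_def vecs_def unit_vec_def fun_eq_iff)
  have \<beta>_res: "residue_vec j (\<beta> r) = (if j = i then b r else unit_vec r)" for j r
    by (auto simp: residue_vec_def \<beta>_def unit_vec_def fun_eq_iff)
  have \<beta>: "bij_betw (vapp n \<beta>) (vecs n) (vecs n)"
  proof (rule bij_of_residues[OF \<beta>_mat])
    fix j
    show "vapp n (\<lambda>r. residue_vec j (\<beta> r)) ` vecs n = vecs n"
    proof (cases "j = i")
      case True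
      then show ?thesis using b_surj by (simp add: \<beta>_res cong: if_cong)
    next
      case False
      then have eq: "(\<lambda>r. residue_vec j (\<beta> r)) = (\<lambda>r. unit_vec r)" by (simp add: \<beta>_res)
      show ?thesis unfolding eq by (simp add: vapp_unit_mat cong: image_cong)
    qed
  qed
  \<comment> \<open>Multiplication of coordinate k at component i by the uniformizer;
    \<open>\<gamma>\<close> is this diagonal matrix times \<open>\<beta>\<close>.\<close>
  define \<delta> :: "(nat \<Rightarrow> 'i \<Rightarrow> 'e fps) \<Rightarrow> nat \<Rightarrow> 'i \<Rightarrow> 'e fps" where
    "\<delta> x = (\<lambda>r j. if r = k \<and> j = i then fps_X * x r j else x r j)" for x
  define \<gamma> where "\<gamma> = (\<lambda>r s j. if r = k \<and> j = i then fps_X * \<beta> r s j else \<beta> r s j)"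
  have \<gamma>_eq: "vapp n \<gamma> x = vapp n \<beta> (\<delta> x)" for x
    by (auto simp: vapp_def \<gamma>_def \<delta>_def fun_eq_iff sum_fun_apply intro!: sum.cong)
  have \<delta>_vecs: "\<delta> x \<in> vecs n" if "x \<in> vecs n" for x
    using that by (simp add: \<delta>_def vecs_def fun_eq_iff)
  have \<delta>_inj: "x = y" if "\<delta> x = \<delta> y" for x y
  proof (rule ext, rule ext)
    fix r j
    have "\<delta> x r j = \<delta> y r j" using that by simp
    then show "x r j = y r j" by (simp add: \<delta>_def split: if_splits)
  qed
  show thesis
  proof (rule that[of \<gamma>])
    show "is_mat n \<gamma>" using \<beta>_mat by (simp add: is_mat_def \<gamma>_def vecs_def fun_eq_iff)
    show "inj_on (vapp n \<gamma>) (vecs n)"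
    proof (rule inj_onI)
      fix x y assume xy: "x \<in> vecs n" "y \<in> vecs n" "vapp n \<gamma> x = vapp n \<gamma> y"
      then have "\<delta> x = \<delta> y"
        using \<beta> \<delta>_vecs unfolding \<gamma>_eq bij_betw_def by (metis inj_onD)
      then show "x = y" by (rule \<delta>_inj)
    qed
    show "M \<subseteq> vapp n \<gamma> ` vecs n"
    proof
      fix y assume y: "y \<in> M"
      then have "y \<in> vecs n" using submodD(2)[OF M] by blast
      then obtain x where x: "x \<in> vecs n" "y = vapp n \<beta> x" using \<beta> unfolding bij_betw_def by blast
      have "residue_vec i y = vapp n b (residue_vec i x)"
        unfolding x(2) residue_vec_vapp by (simp add: \<beta>_res)
      moreover have "residue_vec i y \<in> W" using W(2) y by blast
      ultimately have "residue_vec i x k = 0" using b_W[OF residue_vec_in_vecs[OF x(1)]] by simp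
      then have x0: "fps_nth (x k i) 0 = 0" by (simp add: residue_vec_def)
      define x' where "x' = (\<lambda>r j. if r = k \<and> j = i then fps_shift 1 (x r j) else x r j)"
      have "x' \<in> vecs n" using x(1) by (simp add: x'_def vecs_def fun_eq_iff)
      moreover have "\<delta> x' = x"
      proof (rule ext, rule ext)
        fix r j
        show "\<delta> x' r j = x r j" using x0 by (auto simp: \<delta>_def x'_def fps_eq_iff)
      qed
      ultimately show "y \<in> vapp n \<gamma> ` vecs n" using x(2) \<gamma>_eq by (metis imageI)
    qed
    show "vapp n \<gamma> ` vecs n \<noteq> vecs n"
    proof
      assume *: "vapp n \<gamma> ` vecs n = vecs n"
      have u: "unit_vec k \<in> vecs n" by (rule unit_vec_in_vecs[OF v(3)])
      then have "vapp n \<beta> (unit_vec k) \<in> vapp n \<gamma> ` vecs n" unfolding * by (intro vapp_in_vecs \<beta>_mat)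
      then obtain x where x: "x \<in> vecs n" "vapp n \<beta> (unit_vec k) = vapp n \<beta> (\<delta> x)"
        unfolding \<gamma>_eq by blast
      then have "unit_vec k = \<delta> x" using \<beta> u \<delta>_vecs[OF x(1)] unfolding bij_betw_def by (metis inj_onD)
      then have "unit_vec k k i = \<delta> x k i" by simp
      then have "(1 :: 'e fps) = fps_X * x k i" by (simp add: unit_vec_def \<delta>_def)
      then have "fps_nth (1 :: 'e fps) 0 = fps_nth (fps_X * x k i) 0" by simp
      then show False by simp
    qed
  qed
qed

text \<open>Unless M = V, some residue of M is proper by \<open>nakayama\<close>, so M lies in the
  image of a non-surjective elementary matrix. The preimage of M has smaller index, and its basis
  matrix is composed with the elementary one.\<close>

lemma free_fps:
  fixes M :: "(nat \<Rightarrow> 'i::finite \<Rightarrow> 'e::{field,finite} fps) set"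
  assumes "submod n UNIV M" "grp_index (vecs n) M \<noteq> 0"
  shows "\<exists>g. is_mat n g \<and> inj_on (vapp n g) (vecs n) \<and> vapp n g ` vecs n = M"
  using assms
proof (induction "grp_index (vecs n) M" arbitrary: M rule: less_induct)
  case (less M)
  let ?V = "vecs n :: (nat \<Rightarrow> 'i \<Rightarrow> 'e fps) set"
  show ?case
  proof (cases "M = ?V")
    case True
    have "is_mat n (\<lambda>a. unit_vec a :: nat \<Rightarrow> 'i \<Rightarrow> 'e fps)" by (simp add: is_mat_def unit_vec_in_vecs)
    moreover have "inj_on (vapp n (\<lambda>a. unit_vec a :: nat \<Rightarrow> 'i \<Rightarrow> 'e fps)) ?V"
      by (rule inj_onI) (simp add: vapp_unit_mat)
    moreover have "vapp n (\<lambda>a. unit_vec a :: nat \<Rightarrow> 'i \<Rightarrow> 'e fps) ` ?V = M"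
      using True by (simp add: vapp_unit_mat cong: image_cong)
    ultimately show ?thesis by blast
  next
    case False
    then obtain i where i: "residue_vec i ` M \<noteq> vecs n" using nakayama[OF less.prems] by blast
    obtain \<gamma> where \<gamma>: "is_mat n \<gamma>" "inj_on (vapp n \<gamma>) ?V" "M \<subseteq> vapp n \<gamma> ` ?V" "vapp n \<gamma> ` ?V \<noteq> ?V"
      using elementary_overlattice[OF less.prems(1) i] by blast
    define M' where "M' = {x \<in> ?V. vapp n \<gamma> x \<in> M}"
    have M': "submod n UNIV M'" unfolding M'_def by (rule submod_vapp_vimage[OF less.prems(1)])
    have img: "vapp n \<gamma> ` M' = M" using \<gamma>(3) by (auto simp: M'_def)
    have sub: "submod n UNIV (vapp n \<gamma> ` ?V)" by (rule submod_vapp_image[OF submod_vecs \<gamma>(1)])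
    have "grp_index ?V M = grp_index ?V (vapp n \<gamma> ` ?V) * grp_index (vapp n \<gamma> ` ?V) M"
      by (rule grp_index_mult[OF submodD(1)[OF sub] submodD(1)[OF less.prems(1)] add_subgroup_vecs \<gamma>(3) submodD(2)[OF sub]])
    also have "grp_index (vapp n \<gamma> ` ?V) M = grp_index ?V M'"
      using grp_index_vapp_image[OF \<gamma>(2) submod_vecs M' \<gamma>(1) submodD(2)[OF M']] img by simp
    finally have idx: "grp_index ?V M = grp_index ?V (vapp n \<gamma> ` ?V) * grp_index ?V M'" .
    have "grp_index ?V (vapp n \<gamma> ` ?V) \<noteq> 1"
      using grp_index_eq_1_iff[OF add_subgroup_vecs submodD(1,2)[OF sub]] \<gamma>(4) by blast
    moreover have "grp_index ?V (vapp n \<gamma> ` ?V) \<noteq> 0" and pos: "grp_index ?V M' \<noteq> 0"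
      using idx less.prems(2) by (metis mult_eq_0_iff)+
    ultimately have "1 < grp_index ?V (vapp n \<gamma> ` ?V)" by linarith
    then have "1 * grp_index ?V M' < grp_index ?V M"
      unfolding idx by (rule mult_strict_right_mono) (use pos in simp)
    then have "grp_index ?V M' < grp_index ?V M" by (simp only: mult_1)
    from less.hyps[OF this M' pos] obtain g where
      g: "is_mat n g" "inj_on (vapp n g) ?V" "vapp n g ` ?V = M'" by blast
    define h where "h = (\<lambda>a. vapp n \<gamma> (g a))"
    have h: "vapp n h = vapp n \<gamma> \<circ> vapp n g" by (simp add: fun_eq_iff h_def flip: vapp_vapp)
    have "is_mat n h" using vapp_in_vecs[OF \<gamma>(1)] by (simp add: is_mat_def h_def)
    moreover have "inj_on (vapp n h) ?V"
      unfolding h using g(2) inj_on_subset[OF \<gamma>(2) submodD(2)[OF M']] g(3) by (intro comp_inj_on) auto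
    moreover have "vapp n h ` ?V = M" unfolding h image_comp[symmetric] g(3) img ..
    ultimately show ?thesis by blast
  qed
qed

lemma grp_index_uniformizer:
  "grp_index (UNIV :: ('i::finite \<Rightarrow> 'e::{field,finite} fps) set) (range ((*) (uniformizer ^ k))) = CARD('e) ^ (CARD('i) * k)"
proof -
  let ?S = "UNIV :: ('i \<Rightarrow> 'e fps) set"
  let ?C = "\<lambda>k. range ((*) (uniformizer ^ k :: 'i \<Rightarrow> 'e fps))"
  have mem: "s \<in> range ((*) (uniformizer * r)) \<longleftrightarrow> (\<forall>i. fps_nth (s i) 0 = 0) \<and> (\<lambda>i. fps_shift 1 (s i)) \<in> range ((*) r)"
    for s r :: "'i \<Rightarrow> 'e fps"
  proof
    assume "s \<in> range ((*) (uniformizer * r))"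
    then obtain u where "s = uniformizer * r * u" by blast
    then have "s i = fps_X * (r * u) i" for i by (simp add: uniformizer_def mult.assoc)
    then have "(\<forall>i. fps_nth (s i) 0 = 0) \<and> (\<lambda>i. fps_shift 1 (s i)) = r * u"
      by (simp add: fun_eq_iff fps_eq_iff)
    then show "(\<forall>i. fps_nth (s i) 0 = 0) \<and> (\<lambda>i. fps_shift 1 (s i)) \<in> range ((*) r)" by simp
  next
    assume *: "(\<forall>i. fps_nth (s i) 0 = 0) \<and> (\<lambda>i. fps_shift 1 (s i)) \<in> range ((*) r)"
    then obtain u where u: "(\<lambda>i. fps_shift 1 (s i)) = r * u" by blast
    have "s = uniformizer * (\<lambda>i. fps_shift 1 (s i))"
      using * by (auto simp: fun_eq_iff uniformizer_def fps_eq_iff)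
    then show "s \<in> range ((*) (uniformizer * r))" unfolding u by (metis mult.assoc rangeI)
  qed
  have sub: "add_subgroup (range ((*) r))" for r :: "'i \<Rightarrow> 'e fps"
  proof (rule add_subgroupI)
    show "0 \<in> range ((*) r)" by (metis mult_zero_right rangeI)
    fix x y assume "x \<in> range ((*) r)" "y \<in> range ((*) r)"
    then obtain u w where "x = r * u" "y = r * w" by blast
    then have "x - y = r * (u - w)" by (simp add: right_diff_distrib)
    then show "x - y \<in> range ((*) r)" by simp
  qed
  have base: "grp_index ?S (range ((*) uniformizer)) = CARD('e) ^ CARD('i)"
  proof -
    have "grp_index ?S (range ((*) uniformizer)) = grp_index (UNIV :: ('i \<Rightarrow> 'e) set) {0}"
    proof (rule grp_index_transfer[where f = "\<lambda>s i. fps_nth (s i) 0", OF sub add_subgroup_singleton_zero])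
      have "u \<in> range (\<lambda>s i. fps_nth (s i) 0)" for u :: "'i \<Rightarrow> 'e"
        by (rule range_eqI[of _ _ "\<lambda>i. fps_const (u i)"]) simp
      then show "range (\<lambda>(s :: 'i \<Rightarrow> 'e fps) i. fps_nth (s i) 0) = UNIV" by blast
      fix x y :: "'i \<Rightarrow> 'e fps"
      show "x - y \<in> range ((*) uniformizer) \<longleftrightarrow> (\<lambda>i. fps_nth (x i) 0) - (\<lambda>i. fps_nth (y i) 0) \<in> {0}"
        using mem[of "x - y" 1] by (simp add: fun_eq_iff)
    qed
    then show ?thesis by (simp add: grp_index_zero_right card_fun)
  qed
  show ?thesis
  proof (induction k)
    case 0
    have "?C 0 = UNIV" by simp
    then show ?case using grp_index_self[OF sub[of 1]] by simp
  next
    case (Suc k)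
    have "grp_index ?S (?C (Suc k)) = grp_index ?S (range ((*) uniformizer)) * grp_index (range ((*) uniformizer)) (?C (Suc k))"
    proof (rule grp_index_mult[OF sub sub])
      show "add_subgroup ?S" by (simp add: add_subgroup_def)
      show "?C (Suc k) \<subseteq> range ((*) uniformizer)" by (auto simp: mult.assoc)
    qed simp
    also have "grp_index (range ((*) uniformizer)) (?C (Suc k)) = grp_index ?S (?C k)"
    proof (rule sym, rule grp_index_transfer[where f = "(*) uniformizer", OF sub sub])
      fix x y :: "'i \<Rightarrow> 'e fps"
      have "uniformizer * x - uniformizer * y = uniformizer * (x - y)" by (simp add: right_diff_distrib)
      moreover have "(\<lambda>i. fps_shift 1 ((uniformizer * (x - y)) i)) = x - y"
        by (simp add: fun_eq_iff uniformizer_def fps_eq_iff)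
      moreover have "fps_nth ((uniformizer * (x - y)) i) 0 = 0" for i by (simp add: uniformizer_def)
      ultimately show "x - y \<in> ?C k \<longleftrightarrow> uniformizer * x - uniformizer * y \<in> ?C (Suc k)"
        using mem[of "uniformizer * (x - y)" "uniformizer ^ k"] by simp
    qed simp
    finally show ?case unfolding Suc.IH base by (simp only: power_add mult_Suc_right)
  qed
qed

section \<open>Counting subspaces\<close>

lemma qpochhammer_Suc: "qpochhammer x x (Suc k) = qpochhammer x x k * (1 - x ^ Suc k)"
  by (simp add: qpochhammer_def)

lemma qpochhammer_nonzero:
  assumes "\<And>l. l > 0 \<Longrightarrow> x ^ l \<noteq> 1"
  shows "qpochhammer x x k \<noteq> 0"
proof (induction k)
  case (Suc k)
  then show ?case using assms[of "Suc k"] by (simp only: qpochhammer_Suc) simp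
qed (simp add: qpochhammer_def)

lemma qbinomial_nat:
  "k \<le> n \<Longrightarrow> qbinomial x (int n) (int k) = qpochhammer x x n / (qpochhammer x x k * qpochhammer x x (n - k))"
  by (simp add: qbinomial_def nat_diff_distrib)

lemma qbinomial_zero [simp]:
  assumes "\<And>l. l > 0 \<Longrightarrow> x ^ l \<noteq> 1"
  shows "qbinomial x (int n) 0 = 1"
  using qpochhammer_nonzero[OF assms, where k = n] qbinomial_nat[of 0 n x]
  by (simp add: qpochhammer_def)

lemma qbinomial_Suc_Suc:
  assumes "\<And>l. l > 0 \<Longrightarrow> x ^ l \<noteq> 1"
  shows "qbinomial x (int (Suc n)) (int (Suc k)) * (x ^ Suc k - 1) = (x ^ Suc n - 1) * qbinomial x (int n) (int k)"
proof (cases "k \<le> n")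
  case True
  note nz = qpochhammer_nonzero[of x, OF assms]
  have "1 - x ^ Suc k \<noteq> 0" using assms[of "Suc k"] by simp
  then show ?thesis
    unfolding qbinomial_nat[OF True] qbinomial_nat[OF Suc_le_mono[THEN iffD2, OF True]] qpochhammer_Suc diff_Suc_Suc
    using nz[of k] nz[of "n - k"] by (simp add: field_simps del: power_Suc)
next
  case False
  then show ?thesis by (simp add: qbinomial_def)
qed

text \<open>\<open>U\<close> is a union of cosets of \<open>B\<close>, and a coset inside
  \<open>U\<close> has its representative in \<open>U\<close>.\<close>

lemma card_transversal_Int:
  assumes "add_subgroup B" "add_subgroup U" "B \<subseteq> U" "U \<subseteq> A"
    and "\<And>a. a \<in> A \<Longrightarrow> \<exists>t\<in>T. a - t \<in> B"
    and "\<And>s t. s \<in> T \<Longrightarrow> t \<in> T \<Longrightarrow> s - t \<in> B \<Longrightarrow> s = t"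
  shows "card {t \<in> T. t \<in> U} = grp_index U B"
proof (rule sym, rule grp_index_eq_card_transversal[OF assms(1)])
  show "\<exists>t\<in>{t \<in> T. t \<in> U}. a - t \<in> B" if a: "a \<in> U" for a
  proof -
    obtain t where t: "t \<in> T" "a - t \<in> B" using assms(4,5) a by blast
    then have "a - (a - t) \<in> U" using a assms(2,3) add_subgroup_diff by blast
    then show ?thesis using t by auto
  qed
  show "s = t" if "s \<in> {t \<in> T. t \<in> U}" "t \<in> {t \<in> T. t \<in> U}" "s - t \<in> B" for s t
    using that assms(6) by simp
qed blast

text \<open>The finite spaces of interest are quotients such as S^n/cS^n. They are handled as pairs
  of subspaces B of A in an ambient space that may be infinite, the dimension being the exponent of
  q in the index.\<close>

locale fspace =
  fixes smul :: "'f::{field,finite} \<Rightarrow> 'v::ab_group_add \<Rightarrow> 'v" and q :: nat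
  assumes card_scalars: "CARD('f) = q"
    and smul_diff_right: "smul a (x - y) = smul a x - smul a y"
    and smul_diff_left: "smul (a - b) x = smul a x - smul b x"
    and smul_smul: "smul a (smul b x) = smul (a * b) x"
    and smul_one: "smul 1 x = x"
begin

definition subsp :: "'v set \<Rightarrow> bool" where
  "subsp U \<longleftrightarrow> add_subgroup U \<and> (\<forall>a. \<forall>x\<in>U. smul a x \<in> U)"

definition extend :: "'v set \<Rightarrow> 'v \<Rightarrow> 'v set" where
  "extend B a = subgroup_sum B (range (\<lambda>c. smul c a))"

abbreviation qc :: complex where "qc \<equiv> of_nat q"

lemma q_gt_1: "q > 1"
proof -
  have "card {0, 1 :: 'f} \<le> q" unfolding card_scalars[symmetric] by (rule card_mono) auto
  then show ?thesis by simp
qed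

lemma qc_power: "l > 0 \<Longrightarrow> qc ^ l \<noteq> 1"
  using q_gt_1 by (metis of_nat_1 of_nat_eq_iff of_nat_power one_less_power order_less_irrefl)

lemma qc_nonzero: "qc \<noteq> 0"
  using q_gt_1 by simp

lemma subspD:
  assumes "subsp U"
  shows "add_subgroup U" "x \<in> U \<Longrightarrow> smul a x \<in> U"
  using assms by (auto simp: subsp_def)

lemma smul_zero_left: "smul 0 x = 0"
  using smul_diff_left[of 0 0 x] by simp

lemma smul_add_right: "smul a (x + y) = smul a x + smul a y"
  using smul_diff_right[of a "x + y" y] by (simp add: algebra_simps)

lemma subsp_line: "subsp (range (\<lambda>c. smul c a))"
  unfolding subsp_def
proof (intro conjI allI ballI add_subgroupI)
  show "0 \<in> range (\<lambda>c. smul c a)" by (rule range_eqI[of _ _ 0]) (simp add: smul_zero_left)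
  fix x y assume "x \<in> range (\<lambda>c. smul c a)" "y \<in> range (\<lambda>c. smul c a)"
  then obtain c d where "x = smul c a" "y = smul d a" by blast
  then have "x - y = smul (c - d) a" by (simp add: smul_diff_left)
  then show "x - y \<in> range (\<lambda>c. smul c a)" by (rule range_eqI)
next
  fix b x assume "x \<in> range (\<lambda>c. smul c a)"
  then obtain c where "x = smul c a" by blast
  then have "smul b x = smul (b * c) a" by (simp add: smul_smul)
  then show "smul b x \<in> range (\<lambda>c. smul c a)" by (rule range_eqI)
qed

lemma subsp_sum:
  assumes "subsp A" "subsp B"
  shows "subsp (subgroup_sum A B)"
  unfolding subsp_def
proof (intro conjI allI ballI)
  show "add_subgroup (subgroup_sum A B)" using assms by (simp add: subsp_def add_subgroup_subgroup_sum)
  fix c x assume "x \<in> subgroup_sum A B"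
  then obtain a b where "a \<in> A" "b \<in> B" "x = a + b" unfolding subgroup_sum_def by blast
  then show "smul c x \<in> subgroup_sum A B"
    using subspD(2)[OF assms(1)] subspD(2)[OF assms(2)] by (simp add: smul_add_right subgroup_sumI)
qed

lemma subsp_Int: "subsp A \<Longrightarrow> subsp B \<Longrightarrow> subsp (A \<inter> B)"
  by (auto simp: subsp_def add_subgroup_Int)

lemma subsp_extend: "subsp B \<Longrightarrow> subsp (extend B a)"
  unfolding extend_def by (rule subsp_sum[OF _ subsp_line])

lemma extend_subset_iff:
  assumes "subsp B" "subsp U"
  shows "extend B a \<subseteq> U \<longleftrightarrow> B \<subseteq> U \<and> a \<in> U"
proof
  assume *: "extend B a \<subseteq> U"
  have "a \<in> range (\<lambda>c. smul c a)" by (rule range_eqI[of _ _ 1]) (simp add: smul_one)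
  then show "B \<subseteq> U \<and> a \<in> U"
    using * subgroup_sum_upper1[OF subspD(1)[OF subsp_line], of B a]
      subgroup_sum_upper2[OF subspD(1)[OF assms(1)], of "range (\<lambda>c. smul c a)"]
    unfolding extend_def by blast
next
  assume "B \<subseteq> U \<and> a \<in> U"
  then show "extend B a \<subseteq> U"
    unfolding extend_def using subspD(2)[OF assms(2)]
    by (intro subgroup_sum_least subspD(1)[OF assms(2)]) auto
qed

lemma subset_extend: "subsp B \<Longrightarrow> B \<subseteq> extend B a" "subsp B \<Longrightarrow> a \<in> extend B a"
  using extend_subset_iff[OF _ subsp_extend, of B B a] by auto

lemma grp_index_extend:
  assumes "subsp B" "a \<notin> B"
  shows "grp_index (extend B a) B = q"
proof -
  have key: "c = d" if "smul c a - smul d a \<in> B" for c d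
  proof (rule ccontr)
    assume "c \<noteq> d"
    have "smul (inverse (c - d)) (smul c a - smul d a) \<in> B" by (rule subspD(2)[OF assms(1) that])
    then have "a \<in> B" using \<open>c \<noteq> d\<close> by (simp add: smul_smul smul_one flip: smul_diff_left)
    then show False using assms(2) by simp
  qed
  have "grp_index (extend B a) B = card (range (\<lambda>c. smul c a))"
  proof (rule grp_index_eq_card_transversal[OF subspD(1)[OF assms(1)]])
    show "range (\<lambda>c. smul c a) \<subseteq> extend B a"
      unfolding extend_def by (rule subgroup_sum_upper2[OF subspD(1)[OF assms(1)]])
    show "\<exists>t\<in>range (\<lambda>c. smul c a). x - t \<in> B" if x: "x \<in> extend B a" for x
    proof -
      obtain b c where "b \<in> B" "x = b + smul c a" using x unfolding extend_def subgroup_sum_def by blast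
      then have "x - smul c a \<in> B" by simp
      then show ?thesis by blast
    qed
    show "s = t" if "s \<in> range (\<lambda>c. smul c a)" "t \<in> range (\<lambda>c. smul c a)" "s - t \<in> B" for s t
      using that key by blast
  qed
  also have "\<dots> = q"
    unfolding card_scalars[symmetric]
  proof (rule card_image, rule injI)
    fix c d assume "smul c a = smul d a"
    then have "smul c a - smul d a = 0" by simp
    then show "c = d" using key[of c d] add_subgroup_zero[OF subspD(1)[OF assms(1)]] by simp
  qed
  finally show ?thesis .
qed

lemma grp_index_subsp_mult:
  assumes "subsp A" "subsp B" "subsp D" "D \<subseteq> B" "B \<subseteq> A"
  shows "grp_index A D = grp_index A B * grp_index B D"
  by (rule grp_index_mult) (use assms subspD(1) in auto)

text \<open>Adjoin vectors of A outside B one at a time; each divides the index by q.\<close>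

lemma grp_index_power:
  assumes "subsp A" "subsp B" "B \<subseteq> A" "grp_index A B \<noteq> 0"
  obtains d where "grp_index A B = q ^ d"
proof -
  have "\<exists>d. grp_index A B = q ^ d"
    using assms
  proof (induction "grp_index A B" arbitrary: B rule: less_induct)
    case (less B)
    show ?case
    proof (cases "A = B")
      case True
      then show ?thesis using grp_index_self[OF subspD(1)[OF less.prems(1)]] by (intro exI[of _ 0]) simp
    next
      case False
      then obtain a where a: "a \<in> A" "a \<notin> B" using less.prems(3) by blast
      have sub: "extend B a \<subseteq> A" using extend_subset_iff[OF less.prems(2,1)] a(1) less.prems(3) by simp
      have mult: "grp_index A B = grp_index A (extend B a) * q"
        using grp_index_subsp_mult[OF less.prems(1) subsp_extend less.prems(2) subset_extend(1) sub]
          less.prems(2) grp_index_extend[OF less.prems(2) a(2)] by simp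
      then have nz: "grp_index A (extend B a) \<noteq> 0" using less.prems(4) by (metis mult_0)
      moreover have "grp_index A (extend B a) < grp_index A B" using mult nz q_gt_1 by simp
      ultimately obtain d where "grp_index A (extend B a) = q ^ d"
        using less.hyps[OF _ less.prems(1) subsp_extend[OF less.prems(2)] sub] by blast
      then show ?thesis using mult by (intro exI[of _ "Suc d"]) simp
    qed
  qed
  then show thesis using that by blast
qed

lemma finite_subsp_between:
  assumes "subsp A" "subsp B" "grp_index A B \<noteq> 0"
  shows "finite {U. subsp U \<and> B \<subseteq> U \<and> U \<subseteq> A}"
  by (rule finite_subset[OF _ finite_between_subgroups[OF subspD(1)[OF assms(1)] subspD(1)[OF assms(2)] assms(3)]])
     (auto simp: subsp_def)

text \<open>Double count of pairs (t, U) with t a nonzero class of A/B lying in U. Each U has q^k -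
  1 such classes, and the U through t are those above \<open>extend B t\<close>, counted with d and
  k lowered by one; \<open>qbinomial_Suc_Suc\<close> is this recursion.\<close>

lemma card_subspaces:
  assumes "subsp A" "subsp B" "B \<subseteq> A" "grp_index A B = q ^ d"
  shows "of_nat (card {U. subsp U \<and> B \<subseteq> U \<and> U \<subseteq> A \<and> grp_index U B = q ^ k}) = qbinomial qc (int d) (int k)"
  using assms
proof (induction d arbitrary: B k)
  case 0
  then have "A = B" using grp_index_eq_1_iff[OF subspD(1) subspD(1)] by simp
  show ?case
  proof (cases "k = 0")
    case True
    have "{U. subsp U \<and> B \<subseteq> U \<and> U \<subseteq> A \<and> grp_index U B = q ^ k} = {B}"
      using \<open>A = B\<close> 0 True by auto
    then show ?thesis using True qbinomial_zero[of qc 0] qc_power by simp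
  next
    case False
    have "q ^ k > 1" using False q_gt_1 by (intro one_less_power) auto
    then have "{U. subsp U \<and> B \<subseteq> U \<and> U \<subseteq> A \<and> grp_index U B = q ^ k} = {}"
      using \<open>A = B\<close> 0(4) by auto
    then show ?thesis using False by (simp add: qbinomial_def del: Collect_empty_eq)
  qed
next
  case (Suc d)
  note AB = Suc.prems
  note sg = subspD(1)[OF AB(1)] subspD(1)[OF AB(2)]
  show ?case
  proof (cases k)
    case 0
    have "{U. subsp U \<and> B \<subseteq> U \<and> U \<subseteq> A \<and> grp_index U B = q ^ k} = {B}"
    proof (intro equalityI subsetI)
      fix U assume "U \<in> {U. subsp U \<and> B \<subseteq> U \<and> U \<subseteq> A \<and> grp_index U B = q ^ k}"
      then have "subsp U" "B \<subseteq> U" "grp_index U B = 1" using 0 by auto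
      then show "U \<in> {B}" using grp_index_eq_1_iff[OF subspD(1) sg(2)] by simp
    next
      fix U assume "U \<in> {B}"
      then show "U \<in> {U. subsp U \<and> B \<subseteq> U \<and> U \<subseteq> A \<and> grp_index U B = q ^ k}"
        using AB grp_index_self[OF sg(2)] 0 by simp
    qed
    then show ?thesis using 0 qbinomial_zero[of qc "Suc d"] qc_power by simp
  next
    case k: (Suc l)
    let ?Us = "{U. subsp U \<and> B \<subseteq> U \<and> U \<subseteq> A \<and> grp_index U B = q ^ k}"
    obtain T where T: "T \<subseteq> A" "finite T \<longleftrightarrow> finite (grp_cosets A B)"
      "\<And>a. a \<in> A \<Longrightarrow> \<exists>t\<in>T. a - t \<in> B" "\<And>s t. s \<in> T \<Longrightarrow> t \<in> T \<Longrightarrow> s - t \<in> B \<Longrightarrow> s = t"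
      using transversal_exists[OF sg(2)] by metis
    have nz: "grp_index A B \<noteq> 0" unfolding AB(4) using q_gt_1 by simp
    have finT: "finite T" using T(2) grp_index_finite_iff[OF sg(1)] nz by blast
    have finU: "finite ?Us" by (rule finite_subset[OF _ finite_subsp_between[OF AB(1,2) nz]]) blast
    \<comment> \<open>Representatives of the nonzero classes of A/B.\<close>
    let ?T = "{t \<in> T. t \<notin> B}"
    have cardT: "card {t \<in> ?T. t \<in> U} + 1 = grp_index U B" if U: "subsp U" "B \<subseteq> U" "U \<subseteq> A" for U
    proof -
      have "card {t \<in> T. t \<in> U} = grp_index U B"
        by (rule card_transversal_Int[OF sg(2) subspD(1)[OF U(1)] U(2,3) T(3,4)])
      moreover have "card {t \<in> T. t \<in> B} = 1"
        using card_transversal_Int[OF sg(2) sg(2) order_refl AB(3) T(3,4)] grp_index_self[OF sg(2)] by simp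
      moreover have "{t \<in> T. t \<in> U} = {t \<in> ?T. t \<in> U} \<union> {t \<in> T. t \<in> B}" using U(2) by blast
      moreover have "card ({t \<in> ?T. t \<in> U} \<union> {t \<in> T. t \<in> B}) = card {t \<in> ?T. t \<in> U} + card {t \<in> T. t \<in> B}"
        by (rule card_Un_disjoint) (use finT in auto)
      ultimately show ?thesis by simp
    qed
    have through: "of_nat (card {U \<in> ?Us. t \<in> U}) = qbinomial qc (int d) (int l)" if t: "t \<in> ?T" for t
    proof -
      have tA: "t \<in> A" "t \<notin> B" using t T(1) by auto
      let ?B = "extend B t"
      have sub: "?B \<subseteq> A" using extend_subset_iff[OF AB(2,1)] AB(3) tA by simp
      have ext: "grp_index ?B B = q" by (rule grp_index_extend[OF AB(2) tA(2)])
      have mult: "grp_index U B = grp_index U ?B * q" if "subsp U" "?B \<subseteq> U" for U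
        using grp_index_subsp_mult[OF that(1) subsp_extend[OF AB(2)] AB(2) subset_extend(1)[OF AB(2)] that(2)] ext by simp
      have "grp_index A ?B = q ^ d" using mult[OF AB(1) sub] AB(4) q_gt_1 by simp
      from Suc.IH[OF AB(1) subsp_extend[OF AB(2)] sub this]
      have "of_nat (card {U. subsp U \<and> ?B \<subseteq> U \<and> U \<subseteq> A \<and> grp_index U ?B = q ^ l}) = qbinomial qc (int d) (int l)" .
      moreover have "{U. subsp U \<and> ?B \<subseteq> U \<and> U \<subseteq> A \<and> grp_index U ?B = q ^ l} = {U \<in> ?Us. t \<in> U}"
        using extend_subset_iff[OF AB(2)] mult q_gt_1 by (auto simp: k)
      ultimately show ?thesis by simp
    qed
    have "(\<Sum>U\<in>?Us. card {t \<in> ?T. t \<in> U}) = (\<Sum>t\<in>?T. card {U \<in> ?Us. t \<in> U})"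
      by (rule sum_multicount_gen) (use finT finU in auto)
    then have "(\<Sum>U\<in>?Us. of_nat (card {t \<in> ?T. t \<in> U})) = (\<Sum>t\<in>?T. of_nat (card {U \<in> ?Us. t \<in> U}) :: complex)"
      unfolding of_nat_sum[symmetric] by (rule arg_cong)
    moreover have "(\<Sum>U\<in>?Us. of_nat (card {t \<in> ?T. t \<in> U})) = of_nat (card ?Us) * (qc ^ k - 1)"
    proof -
      have "of_nat (card {t \<in> ?T. t \<in> U}) = qc ^ k - 1" if "U \<in> ?Us" for U
      proof -
        have "card {t \<in> ?T. t \<in> U} + 1 = q ^ k" using cardT that by simp
        then have "of_nat (card {t \<in> ?T. t \<in> U} + 1) = qc ^ k" by simp
        then show ?thesis by (simp add: algebra_simps)
      qed
      then show ?thesis by simp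
    qed
    moreover have "(\<Sum>t\<in>?T. of_nat (card {U \<in> ?Us. t \<in> U})) = (qc ^ Suc d - 1) * qbinomial qc (int d) (int l)"
    proof -
      have "{t \<in> ?T. t \<in> A} = ?T" using T(1) by blast
      then have "card ?T + 1 = q ^ Suc d" using cardT[OF AB(1,3) order_refl] AB(4) by simp
      then have "of_nat (card ?T + 1) = qc ^ Suc d" by (simp only: of_nat_power)
      then have "of_nat (card ?T) = qc ^ Suc d - 1" by (simp add: algebra_simps)
      moreover have "(\<Sum>t\<in>?T. of_nat (card {U \<in> ?Us. t \<in> U})) = of_nat (card ?T) * qbinomial qc (int d) (int l)"
        using through by simp
      ultimately show ?thesis by simp
    qed
    ultimately have "of_nat (card ?Us) * (qc ^ k - 1) = (qc ^ Suc d - 1) * qbinomial qc (int d) (int l)"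
      by (simp only:)
    moreover have "qbinomial qc (int (Suc d)) (int k) * (qc ^ k - 1) = (qc ^ Suc d - 1) * qbinomial qc (int d) (int l)"
      unfolding k by (rule qbinomial_Suc_Suc) (rule qc_power)
    ultimately have "of_nat (card ?Us) * (qc ^ k - 1) = qbinomial qc (int (Suc d)) (int k) * (qc ^ k - 1)"
      by (simp only:)
    moreover have "qc ^ k - 1 \<noteq> 0" using qc_power[of k] k by simp
    ultimately show ?thesis by (rule iffD1[OF mult_right_cancel, rotated])
  qed
qed

text \<open>Double count of pairs (t, U) with t in U outside Z. A U with U + Z = A has q^k (1 -
  q^(-e)) classes outside Z, since (U : U \<inter> Z) = (A : Z). Adjoining t to B and Z lowers d, k
  and e by one. Each step gives a factor q^(d-k) with d - k unchanged, whence the power q^(e(d-k));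
  for e = 0 the condition on Z is void and \<open>card_subspaces\<close> applies.\<close>

lemma card_supplements:
  assumes "subsp A" "subsp B" "subsp Z" "B \<subseteq> Z" "Z \<subseteq> A" "grp_index A B = q ^ d" "grp_index A Z = q ^ e"
  shows "of_nat (card {U. subsp U \<and> B \<subseteq> U \<and> U \<subseteq> A \<and> subgroup_sum U Z = A \<and> grp_index U B = q ^ k}) =
    qc powi (int e * (int d - int k)) * qbinomial qc (int d - int e) (int k - int e)"
  using assms
proof (induction e arbitrary: B Z d k)
  case 0
  then have "A = Z" using grp_index_eq_1_iff[OF subspD(1) subspD(1)] by simp
  moreover have "subgroup_sum U A = A" if "subsp U" "U \<subseteq> A" for U
    using subgroup_sum_upper2[OF subspD(1)[OF that(1)]] subgroup_sum_least[OF subspD(1)[OF 0(1)] that(2) order_refl]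
    by blast
  ultimately have "{U. subsp U \<and> B \<subseteq> U \<and> U \<subseteq> A \<and> subgroup_sum U Z = A \<and> grp_index U B = q ^ k} =
      {U. subsp U \<and> B \<subseteq> U \<and> U \<subseteq> A \<and> grp_index U B = q ^ k}" by blast
  then show ?case using card_subspaces[OF 0(1,2) _ 0(6), of k] 0(4,5) by simp
next
  case (Suc e)
  note AB = Suc.prems(1,2) and Z = Suc.prems(3,4,5) and idx = Suc.prems(6,7)
  have BA: "B \<subseteq> A" using Z by blast
  note sg = subspD(1)[OF AB(1)] subspD(1)[OF AB(2)] subspD(1)[OF Z(1)]
  let ?Us = "{U. subsp U \<and> B \<subseteq> U \<and> U \<subseteq> A \<and> subgroup_sum U Z = A \<and> grp_index U B = q ^ k}"
  have ZA: "Z \<noteq> A"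
  proof
    assume "Z = A"
    then have "q ^ Suc e = 1" using idx(2) grp_index_self[OF sg(1)] by simp
    then show False using q_gt_1 by simp
  qed
  have idxZ: "q ^ d = q ^ Suc e * grp_index Z B"
    using grp_index_subsp_mult[OF AB(1) Z(1) AB(2) Z(2,3)] idx by simp
  have d0: "d \<noteq> 0"
  proof
    assume "d = 0"
    then have "q * (q ^ e * grp_index Z B) = 1" using idxZ by (simp add: mult.assoc)
    then show False using q_gt_1 by simp
  qed
  then obtain d' where d': "d = Suc d'" by (cases d) auto
  show ?case
  proof (cases k)
    case 0
    have "?Us = {}"
    proof -
      have "subgroup_sum U Z \<noteq> A" if "subsp U" "B \<subseteq> U" "grp_index U B = q ^ k" for U
      proof -
        have "U = B" using grp_index_eq_1_iff[OF subspD(1)[OF that(1)] sg(2) that(2)] that(3) 0 by simp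
        then have "subgroup_sum U Z \<subseteq> Z" using subgroup_sum_least[OF sg(3) _ order_refl] Z(2) by simp
        then show ?thesis using ZA Z(3) by blast
      qed
      then show ?thesis by blast
    qed
    then show ?thesis using 0 by (simp add: qbinomial_def del: Collect_empty_eq)
  next
    case k: (Suc l)
    obtain T where T: "T \<subseteq> A" "finite T \<longleftrightarrow> finite (grp_cosets A B)"
      "\<And>a. a \<in> A \<Longrightarrow> \<exists>t\<in>T. a - t \<in> B" "\<And>s t. s \<in> T \<Longrightarrow> t \<in> T \<Longrightarrow> s - t \<in> B \<Longrightarrow> s = t"
      using transversal_exists[OF sg(2)] by metis
    have nz: "grp_index A B \<noteq> 0" unfolding idx(1) using q_gt_1 by simp
    have finT: "finite T" using T(2) grp_index_finite_iff[OF sg(1)] nz by blast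
    have finU: "finite ?Us" by (rule finite_subset[OF _ finite_subsp_between[OF AB nz]]) blast
    \<comment> \<open>Unlike in \<open>card_subspaces\<close> only the classes outside Z are used:
      adjoining such a t makes Z grow, so the induction on e proceeds.\<close>
    let ?T = "{t \<in> T. t \<notin> Z}"
    have cardT: "of_nat (card {t \<in> ?T. t \<in> U}) = of_nat (grp_index U B) * (1 - 1 / qc ^ Suc e)"
      if U: "subsp U" "B \<subseteq> U" "U \<subseteq> A" "subgroup_sum U Z = A" for U
    proof -
      note sU = subspD(1)[OF U(1)]
      have UZ: "subsp (U \<inter> Z)" "B \<subseteq> U \<inter> Z" "U \<inter> Z \<subseteq> A" using U Z subsp_Int by auto
      have "card {t \<in> T. t \<in> U} = grp_index U B"
        by (rule card_transversal_Int[OF sg(2) sU U(2,3) T(3,4)])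
      moreover have "card {t \<in> T. t \<in> U \<inter> Z} = grp_index (U \<inter> Z) B"
        by (rule card_transversal_Int[OF sg(2) subspD(1)[OF UZ(1)] UZ(2,3) T(3,4)])
      moreover have "{t \<in> T. t \<in> U} = {t \<in> ?T. t \<in> U} \<union> {t \<in> T. t \<in> U \<inter> Z}" by blast
      moreover have "card ({t \<in> ?T. t \<in> U} \<union> {t \<in> T. t \<in> U \<inter> Z}) = card {t \<in> ?T. t \<in> U} + card {t \<in> T. t \<in> U \<inter> Z}"
        by (rule card_Un_disjoint) (use finT in auto)
      ultimately have "grp_index U B = card {t \<in> ?T. t \<in> U} + grp_index (U \<inter> Z) B" by simp
      then have "of_nat (grp_index U B) = (of_nat (card {t \<in> ?T. t \<in> U} + grp_index (U \<inter> Z) B) :: complex)"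
        by (rule arg_cong)
      then have "of_nat (grp_index U B) = of_nat (card {t \<in> ?T. t \<in> U}) + (of_nat (grp_index (U \<inter> Z) B) :: complex)"
        by (simp only: of_nat_add)
      moreover have "grp_index U (U \<inter> Z) = q ^ Suc e"
        using grp_index_sum_Int[OF sU sg(3)] U(4) idx(2) by simp
      then have "grp_index U B = q ^ Suc e * grp_index (U \<inter> Z) B"
        using grp_index_subsp_mult[OF U(1) UZ(1) AB(2) UZ(2)] by simp
      then have "of_nat (grp_index U B) = (of_nat (q ^ Suc e * grp_index (U \<inter> Z) B) :: complex)"
        by (rule arg_cong)
      then have "of_nat (grp_index U B) = qc ^ Suc e * (of_nat (grp_index (U \<inter> Z) B) :: complex)"
        by (simp only: of_nat_mult of_nat_power)
      ultimately show ?thesis using qc_nonzero by (simp add: field_simps del: power_Suc)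
    qed
    have through: "of_nat (card {U \<in> ?Us. t \<in> U}) =
        qc powi (int e * (int d - int k)) * qbinomial qc (int d - int (Suc e)) (int k - int (Suc e))"
      if t: "t \<in> ?T" for t
    proof -
      have tA: "t \<in> A" "t \<notin> Z" "t \<notin> B" using t T(1) Z(2) by auto
      let ?B = "extend B t" and ?Z = "extend Z t"
      have BZ: "?B \<subseteq> ?Z"
        using extend_subset_iff[OF AB(2) subsp_extend[OF Z(1)]] subset_extend[OF Z(1)] Z(2) by blast
      have sub: "?Z \<subseteq> A" using extend_subset_iff[OF Z(1) AB(1)] Z(3) tA by simp
      have ext: "grp_index ?B B = q" by (rule grp_index_extend[OF AB(2) tA(3)])
      have mult: "grp_index U B = grp_index U ?B * q" if "subsp U" "?B \<subseteq> U" for U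
        using grp_index_subsp_mult[OF that(1) subsp_extend[OF AB(2)] AB(2) subset_extend(1)[OF AB(2)] that(2)] ext by simp
      have "grp_index A ?B = q ^ d'" using mult[OF AB(1) order_trans[OF BZ sub]] idx(1) q_gt_1 d' by simp
      moreover have "grp_index A Z = grp_index A ?Z * q"
        using grp_index_subsp_mult[OF AB(1) subsp_extend[OF Z(1)] Z(1) subset_extend(1)[OF Z(1)] sub]
          grp_index_extend[OF Z(1) tA(2)] by simp
      then have "grp_index A ?Z = q ^ e" using idx(2) q_gt_1 by simp
      ultimately have "of_nat (card {U. subsp U \<and> ?B \<subseteq> U \<and> U \<subseteq> A \<and> subgroup_sum U ?Z = A \<and> grp_index U ?B = q ^ l})
          = qc powi (int e * (int d' - int l)) * qbinomial qc (int d' - int e) (int l - int e)"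
        by (rule Suc.IH[OF AB(1) subsp_extend[OF AB(2)] subsp_extend[OF Z(1)] BZ sub])
      moreover have eqZ: "subgroup_sum U ?Z = A \<longleftrightarrow> subgroup_sum U Z = A" if U: "subsp U" "U \<subseteq> A" "t \<in> U" for U
      proof -
        note s = subspD(1)[OF U(1)]
        have "subgroup_sum U ?Z \<subseteq> subgroup_sum U Z"
        proof (rule subgroup_sum_least[OF subspD(1)[OF subsp_sum[OF U(1) Z(1)]]])
          show "U \<subseteq> subgroup_sum U Z" by (rule subgroup_sum_upper1[OF sg(3)])
          show "?Z \<subseteq> subgroup_sum U Z"
            using extend_subset_iff[OF Z(1) subsp_sum[OF U(1) Z(1)]] subgroup_sum_upper2[OF s, of Z]
              subgroup_sum_upper1[OF sg(3), of U] U(3) by blast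
        qed
        moreover have "subgroup_sum U Z \<subseteq> subgroup_sum U ?Z"
        proof (rule subgroup_sum_least[OF subspD(1)[OF subsp_sum[OF U(1) subsp_extend[OF Z(1)]]]])
          show "U \<subseteq> subgroup_sum U ?Z" by (rule subgroup_sum_upper1[OF subspD(1)[OF subsp_extend[OF Z(1)]]])
          show "Z \<subseteq> subgroup_sum U ?Z"
            using subgroup_sum_upper2[OF s, of ?Z] subset_extend(1)[OF Z(1)] by blast
        qed
        ultimately show ?thesis by blast
      qed
      have "subsp U \<and> ?B \<subseteq> U \<and> U \<subseteq> A \<and> subgroup_sum U ?Z = A \<and> grp_index U ?B = q ^ l \<longleftrightarrow>
          (subsp U \<and> B \<subseteq> U \<and> U \<subseteq> A \<and> subgroup_sum U Z = A \<and> grp_index U B = q ^ k) \<and> t \<in> U" for U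
      proof (cases "subsp U \<and> B \<subseteq> U \<and> t \<in> U \<and> U \<subseteq> A")
        case True
        then show ?thesis
          using eqZ[of U] extend_subset_iff[OF AB(2), of U t] mult[of U] q_gt_1 by (simp add: k)
      next
        case False
        then show ?thesis using extend_subset_iff[OF AB(2), of U t] by blast
      qed
      then have "{U. subsp U \<and> ?B \<subseteq> U \<and> U \<subseteq> A \<and> subgroup_sum U ?Z = A \<and> grp_index U ?B = q ^ l} = {U \<in> ?Us. t \<in> U}"
        by (simp only: mem_Collect_eq)
      moreover have "int d' - int l = int d - int k" "int d' - int e = int d - int (Suc e)" "int l - int e = int k - int (Suc e)"
        by (simp_all add: d' k)
      ultimately show ?thesis by simp
    qed
    have "(\<Sum>U\<in>?Us. card {t \<in> ?T. t \<in> U}) = (\<Sum>t\<in>?T. card {U \<in> ?Us. t \<in> U})"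
      by (rule sum_multicount_gen) (use finT finU in auto)
    then have "(\<Sum>U\<in>?Us. of_nat (card {t \<in> ?T. t \<in> U})) = (\<Sum>t\<in>?T. of_nat (card {U \<in> ?Us. t \<in> U}) :: complex)"
      unfolding of_nat_sum[symmetric] by (rule arg_cong)
    moreover have "(\<Sum>U\<in>?Us. of_nat (card {t \<in> ?T. t \<in> U})) = of_nat (card ?Us) * (qc ^ k * (1 - 1 / qc ^ Suc e))"
      using cardT by simp
    moreover have "(\<Sum>t\<in>?T. of_nat (card {U \<in> ?Us. t \<in> U})) = qc ^ d * (1 - 1 / qc ^ Suc e) *
        (qc powi (int e * (int d - int k)) * qbinomial qc (int d - int (Suc e)) (int k - int (Suc e)))"
    proof -
      have "{t \<in> ?T. t \<in> A} = ?T" using T(1) by blast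
      moreover have "subgroup_sum A Z = A"
        using subgroup_sum_upper1[OF sg(3), of A] subgroup_sum_least[OF sg(1) order_refl Z(3)] by blast
      ultimately have "of_nat (card ?T) = qc ^ d * (1 - 1 / qc ^ Suc e)"
        using cardT[OF AB(1) BA order_refl] idx(1) by simp
      then show ?thesis using through by simp
    qed
    ultimately have "of_nat (card ?Us) * (qc ^ k * (1 - 1 / qc ^ Suc e)) = qc ^ d * (1 - 1 / qc ^ Suc e) *
        (qc powi (int e * (int d - int k)) * qbinomial qc (int d - int (Suc e)) (int k - int (Suc e)))"
      by (simp only:)
    then have "(of_nat (card ?Us) * qc ^ k) * (1 - 1 / qc ^ Suc e) = (qc ^ d *
        (qc powi (int e * (int d - int k)) * qbinomial qc (int d - int (Suc e)) (int k - int (Suc e)))) * (1 - 1 / qc ^ Suc e)"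
      by (simp only: mult_ac)
    moreover have "1 - 1 / qc ^ Suc e \<noteq> 0" using qc_power[of "Suc e"] qc_nonzero by (simp del: power_Suc)
    ultimately have "of_nat (card ?Us) * qc ^ k = qc ^ d *
        (qc powi (int e * (int d - int k)) * qbinomial qc (int d - int (Suc e)) (int k - int (Suc e)))"
      by (rule iffD1[OF mult_right_cancel, rotated])
    then have eq: "of_nat (card ?Us) = qc ^ d *
        (qc powi (int e * (int d - int k)) * qbinomial qc (int d - int (Suc e)) (int k - int (Suc e))) / qc ^ k"
      by (subst nonzero_eq_divide_eq) (use qc_nonzero in simp_all)
    have "qc powi (int (Suc e) * (int d - int k)) = qc powi (int e * (int d - int k)) * qc ^ d / qc ^ k"
      using qc_nonzero by (simp add: distrib_right power_int_add power_int_diff)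
    then show ?thesis unfolding eq by (simp only: times_divide_eq_left times_divide_eq_right mult_ac)
  qed
qed

end

section \<open>Counting submodules over a nilpotent operator\<close>

text \<open>Everything is relative to the base \<open>C\<close>: the subspaces containing \<open>C\<close> stand for the
  subspaces of a quotient by \<open>C\<close> on which \<open>opr\<close> is nilpotent.\<close>

locale fspace_op = fspace smul q
  for smul :: "'f::{field,finite} \<Rightarrow> 'v::ab_group_add \<Rightarrow> 'v" and q :: nat +
  fixes opr :: "'v \<Rightarrow> 'v" and C :: "'v set"
  assumes opr_diff: "opr (x - y) = opr x - opr y"
    and opr_smul: "opr (smul a x) = smul a (opr x)"
    and subsp_C: "subsp C" and opr_C: "opr ` C \<subseteq> C"
begin

definition down :: "'v set \<Rightarrow> 'v set" where
  "down H = subgroup_sum (opr ` H) C"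

text \<open>The submodules of Y/C over the polynomial ring F[X], with X acting through
  \<open>opr\<close>.\<close>

definition stable :: "'v set \<Rightarrow> 'v set set" where
  "stable Y = {H. subsp H \<and> C \<subseteq> H \<and> H \<subseteq> Y \<and> opr ` H \<subseteq> H}"

definition preim :: "'v set \<Rightarrow> 'v set \<Rightarrow> 'v set" where
  "preim Y P = {y \<in> Y. opr y \<in> P}"

definition log_index :: "nat \<Rightarrow> nat" where
  "log_index x = (THE d. x = q ^ d)"

lemma log_index_power: "log_index (q ^ d) = d"
  unfolding log_index_def using q_gt_1 by (intro the_equality) auto

lemma opr_zero: "opr 0 = 0"
  using opr_diff[of 0 0] by simp

lemma opr_add: "opr (x + y) = opr x + opr y"
  using opr_diff[of "x + y" y] by (simp add: algebra_simps)

lemma subsp_opr_image: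
  assumes "subsp H"
  shows "subsp (opr ` H)"
  unfolding subsp_def
proof (intro conjI allI ballI add_subgroupI)
  note H = subspD[OF assms]
  show "0 \<in> opr ` H" using add_subgroup_zero[OF H(1)] opr_zero by force
  fix x y assume "x \<in> opr ` H" "y \<in> opr ` H"
  then obtain u v where "u \<in> H" "v \<in> H" "x = opr u" "y = opr v" by blast
  then show "x - y \<in> opr ` H" using add_subgroup_diff[OF H(1), of u v] opr_diff[of u v] by (metis imageI)
next
  fix a x assume "x \<in> opr ` H"
  then obtain u where "u \<in> H" "x = opr u" by blast
  then show "smul a x \<in> opr ` H" using subspD(2)[OF assms, of u a] opr_smul[of a u] by (metis imageI)
qed

lemma subsp_down: "subsp H \<Longrightarrow> subsp (down H)"
  unfolding down_def by (rule subsp_sum[OF subsp_opr_image subsp_C])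

lemma C_sub_down: "subsp H \<Longrightarrow> C \<subseteq> down H"
  unfolding down_def by (rule subgroup_sum_upper2[OF subspD(1)[OF subsp_opr_image]])

lemma opr_sub_down: "opr ` H \<subseteq> down H"
  unfolding down_def by (rule subgroup_sum_upper1[OF subspD(1)[OF subsp_C]])

lemma down_least: "subsp P \<Longrightarrow> opr ` H \<subseteq> P \<Longrightarrow> C \<subseteq> P \<Longrightarrow> down H \<subseteq> P"
  unfolding down_def by (rule subgroup_sum_least[OF subspD(1)])

lemma down_mono:
  assumes "subsp H'" "H \<subseteq> H'"
  shows "down H \<subseteq> down H'"
  by (rule down_least[OF subsp_down[OF assms(1)] _ C_sub_down[OF assms(1)]])
     (use opr_sub_down[of H'] assms(2) in blast)

lemma stableD:
  assumes "H \<in> stable Y"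
  shows "subsp H" "C \<subseteq> H" "H \<subseteq> Y" "opr ` H \<subseteq> H" "down H \<subseteq> H"
  using assms down_least[of H H] by (auto simp: stable_def)

lemma down_stable:
  assumes "subsp H" "C \<subseteq> H" "opr ` H \<subseteq> H"
  shows "opr ` down H \<subseteq> down H"
  using down_least[OF assms(1,3,2)] opr_sub_down[of H] by blast

lemma subsp_preim:
  assumes "subsp Y" "subsp P"
  shows "subsp (preim Y P)"
  using subspD[OF assms(1)] subspD[OF assms(2)]
  unfolding subsp_def preim_def
  by (auto simp: add_subgroup_def opr_diff opr_zero opr_smul)

text \<open>\<open>opr\<close> maps the preimage of P onto P modulo Q, because P lies in
  \<open>opr\<close> Y + C, and the kernel is the preimage of Q.\<close>

lemma preim_index:
  assumes Y: "subsp Y" and P: "subsp P" and Q: "subsp Q" "C \<subseteq> Q" "Q \<subseteq> P" "P \<subseteq> down Y"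
  shows "grp_index (preim Y P) (preim Y Q) = grp_index P Q"
proof -
  let ?A = "preim Y P"
  note A = subsp_preim[OF Y P]
  have "subgroup_sum (opr ` ?A) Q = P"
  proof (rule antisym)
    show "subgroup_sum (opr ` ?A) Q \<subseteq> P"
      by (rule subgroup_sum_least[OF subspD(1)[OF P] _ Q(3)]) (auto simp: preim_def)
    show "P \<subseteq> subgroup_sum (opr ` ?A) Q"
    proof
      fix p assume p: "p \<in> P"
      then obtain y c where yc: "y \<in> Y" "c \<in> C" "p = opr y + c"
        using Q(4) unfolding down_def subgroup_sum_def by blast
      have "p - c \<in> P" using add_subgroup_diff[OF subspD(1)[OF P] p] yc(2) Q(2,3) by blast
      then have "y \<in> ?A" using yc by (simp add: preim_def)
      then show "p \<in> subgroup_sum (opr ` ?A) Q"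
        unfolding yc(3) using yc(2) Q(2) by (intro subgroup_sumI) auto
    qed
  qed
  then have "grp_index P Q = grp_index (opr ` ?A) (opr ` ?A \<inter> Q)"
    using grp_index_sum_Int[OF subspD(1)[OF subsp_opr_image[OF A]] subspD(1)[OF Q(1)]] by simp
  also have "\<dots> = grp_index ?A (preim Y Q)"
  proof (rule sym, rule grp_index_transfer[where f = opr])
    show "add_subgroup (preim Y Q)" by (rule subspD(1)[OF subsp_preim[OF Y Q(1)]])
    show "add_subgroup (opr ` ?A \<inter> Q)" by (rule subspD(1)[OF subsp_Int[OF subsp_opr_image[OF A] Q(1)]])
    fix x y assume "x \<in> ?A" "y \<in> ?A"
    then have d: "x - y \<in> ?A" by (rule add_subgroup_diff[OF subspD(1)[OF A]])
    then have "x - y \<in> preim Y Q \<longleftrightarrow> opr (x - y) \<in> Q" by (simp add: preim_def)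
    moreover have "opr (x - y) \<in> opr ` ?A" using d by blast
    ultimately show "x - y \<in> preim Y Q \<longleftrightarrow> opr x - opr y \<in> opr ` ?A \<inter> Q" by (simp add: opr_diff)
  qed simp
  finally show ?thesis by simp
qed

lemma finite_stable:
  assumes "subsp Y" "grp_index Y C \<noteq> 0"
  shows "finite (stable Y)"
  by (rule finite_subset[OF _ finite_subsp_between[OF assms(1) subsp_C assms(2)]]) (auto simp: stable_def)

text \<open>Iterating H' = J + X H' gives H' = J + X^k H', and X^k H' lies in C, hence in J.\<close>

lemma down_nakayama:
  assumes H': "subsp H'" and J: "subsp J" "C \<subseteq> J" "opr ` J \<subseteq> J" and eq: "H' = subgroup_sum J (opr ` H')"
    and nil: "(opr ^^ k) ` H' \<subseteq> C"
  shows "H' \<subseteq> J"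
proof -
  have Jk: "(opr ^^ l) x \<in> J" if "x \<in> J" for x l
    using that J(3) by (induction l) auto
  have opk: "(opr ^^ l) (x + y) = (opr ^^ l) x + (opr ^^ l) y" for x y l
    by (induction l) (simp_all add: opr_add)
  have "\<exists>j\<in>J. \<exists>y\<in>H'. x = j + (opr ^^ l) y" if x: "x \<in> H'" for x l
  proof (induction l)
    case 0
    show ?case
      by (intro bexI[of _ 0] bexI[of _ x]) (simp_all add: x add_subgroup_zero[OF subspD(1)[OF J(1)]])
  next
    case (Suc l)
    then obtain j y where jy: "j \<in> J" "y \<in> H'" "x = j + (opr ^^ l) y" by blast
    have "y \<in> subgroup_sum J (opr ` H')" using jy(2) eq by simp
    then obtain j' y' where jy': "j' \<in> J" "y' \<in> H'" "y = j' + opr y'" unfolding subgroup_sum_def by blast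
    have "x = (j + (opr ^^ l) j') + (opr ^^ Suc l) y'"
      using jy(3) jy'(3) by (simp add: opk add.assoc funpow_swap1)
    moreover have "j + (opr ^^ l) j' \<in> J"
      by (rule add_subgroup_add[OF subspD(1)[OF J(1)] jy(1) Jk[OF jy'(1)]])
    ultimately show ?case using jy'(2) by blast
  qed
  note expand = this
  show ?thesis
  proof
    fix x assume "x \<in> H'"
    then obtain j y where "j \<in> J" "y \<in> H'" "x = j + (opr ^^ k) y" using expand by blast
    moreover have "(opr ^^ k) y \<in> J" using nil \<open>y \<in> H'\<close> J(2) by blast
    ultimately show "x \<in> J" using add_subgroup_add[OF subspD(1)[OF J(1)]] by blast
  qed
qed

text \<open>The H with X H + C = H' become supplements, with no stability condition left: from H'
  inside U and X U inside H' stability is automatic. The supplement condition says X U + X H' = H'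
  modulo C, which by \<open>down_nakayama\<close> is equivalent to X U = H' modulo C.\<close>

lemma stable_fibre_eq:
  assumes Y: "subsp Y" "C \<subseteq> Y" "opr ` Y \<subseteq> Y" and nil: "(opr ^^ k) ` Y \<subseteq> C" and H': "H' \<in> stable (down Y)"
  shows "{H \<in> stable Y. down H = H'} =
    {U. subsp U \<and> H' \<subseteq> U \<and> U \<subseteq> preim Y H' \<and> subgroup_sum U (preim Y (down H')) = preim Y H'}"
proof -
  note H = stableD[OF H']
  have dY: "down Y \<subseteq> Y" by (rule down_least[OF Y(1,3,2)])
  let ?K = "preim Y H'" and ?Z = "preim Y (down H')"
  note K = subsp_preim[OF Y(1) H(1)] and Z = subsp_preim[OF Y(1) subsp_down[OF H(1)]]
  have ZK: "?Z \<subseteq> ?K" using H(5) by (auto simp: preim_def)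
  show ?thesis
  proof (intro equalityI subsetI)
    fix U assume "U \<in> {H \<in> stable Y. down H = H'}"
    then have U: "U \<in> stable Y" "down U = H'" by auto
    note Us = stableD[OF U(1)]
    have UK: "U \<subseteq> ?K" using Us(3) opr_sub_down[of U] U(2) by (auto simp: preim_def)
    have "?K \<subseteq> subgroup_sum U ?Z"
    proof
      fix y assume y: "y \<in> ?K"
      then have "opr y \<in> down U" using U(2) by (simp add: preim_def)
      then obtain u c where uc: "u \<in> U" "c \<in> C" "opr y = opr u + c" unfolding down_def subgroup_sum_def by blast
      have "opr (y - u) \<in> down H'" using uc C_sub_down[OF H(1)] by (auto simp: opr_diff)
      moreover have "y - u \<in> Y"
        using y uc(1) Us(3) add_subgroup_diff[OF subspD(1)[OF Y(1)]] by (auto simp: preim_def)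
      ultimately have "y - u \<in> ?Z" by (simp add: preim_def)
      then have "u + (y - u) \<in> subgroup_sum U ?Z" using uc(1) by (intro subgroup_sumI)
      then show "y \<in> subgroup_sum U ?Z" by simp
    qed
    then have "subgroup_sum U ?Z = ?K" using subgroup_sum_least[OF subspD(1)[OF K] UK ZK] by blast
    then show "U \<in> {U. subsp U \<and> H' \<subseteq> U \<and> U \<subseteq> ?K \<and> subgroup_sum U ?Z = ?K}"
      using Us(1,5) U(2) UK by simp
  next
    fix U assume "U \<in> {U. subsp U \<and> H' \<subseteq> U \<and> U \<subseteq> ?K \<and> subgroup_sum U ?Z = ?K}"
    then have U: "subsp U" "H' \<subseteq> U" "U \<subseteq> ?K" "subgroup_sum U ?Z = ?K" by auto
    have UY: "U \<subseteq> Y" and oU: "opr ` U \<subseteq> H'" using U(3) by (auto simp: preim_def)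
    let ?J = "down U"
    have JH: "?J \<subseteq> H'" by (rule down_least[OF H(1) oU H(2)])
    have CU: "C \<subseteq> U" using H(2) U(2) by blast
    have oUU: "opr ` U \<subseteq> U" using oU U(2) by blast
    have "H' = subgroup_sum ?J (opr ` H')"
    proof (rule antisym)
      show "subgroup_sum ?J (opr ` H') \<subseteq> H'" by (rule subgroup_sum_least[OF subspD(1)[OF H(1)] JH H(4)])
      show "H' \<subseteq> subgroup_sum ?J (opr ` H')"
      proof
        fix h assume h: "h \<in> H'"
        then obtain y c where yc: "y \<in> Y" "c \<in> C" "h = opr y + c"
          using H(3) unfolding down_def subgroup_sum_def by blast
        have "h - c \<in> H'" using add_subgroup_diff[OF subspD(1)[OF H(1)] h] yc(2) H(2) by blast
        then have "y \<in> subgroup_sum U ?Z" unfolding U(4) using yc by (simp add: preim_def)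
        then obtain u z where uz: "u \<in> U" "z \<in> ?Z" "y = u + z" unfolding subgroup_sum_def by blast
        have "opr z \<in> down H'" using uz(2) by (simp add: preim_def)
        then obtain h' c' where hc: "h' \<in> H'" "c' \<in> C" "opr z = opr h' + c'" unfolding down_def subgroup_sum_def by blast
        have "h = (opr u + (c' + c)) + opr h'" using yc(3) uz(3) hc(3) by (simp add: opr_add algebra_simps)
        moreover have "opr u + (c' + c) \<in> ?J"
          unfolding down_def using uz(1) hc(2) yc(2) add_subgroup_add[OF subspD(1)[OF subsp_C]]
          by (intro subgroup_sumI) auto
        ultimately show "h \<in> subgroup_sum ?J (opr ` H')" using hc(1) by (simp add: subgroup_sumI)
      qed
    qed
    moreover have "(opr ^^ k) ` H' \<subseteq> C" using nil H(3) dY by blast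
    ultimately have "H' \<subseteq> ?J"
      by (intro down_nakayama[OF H(1) subsp_down[OF U(1)] C_sub_down[OF U(1)] down_stable[OF U(1) CU oUU]])
    then have "down U = H'" using JH by blast
    then show "U \<in> {H \<in> stable Y. down H = H'}" using U(1) CU UY oUU by (simp add: stable_def)
  qed
qed

definition num_stable :: "'v set \<Rightarrow> nat \<Rightarrow> complex" where
  "num_stable Y s = of_nat (card {H \<in> stable Y. grp_index H (down H) = q ^ s})"

lemma stable_index:
  assumes Y: "subsp Y" "C \<subseteq> Y" and D: "grp_index Y C = q ^ D" and H: "H \<in> stable Y"
  obtains s where "s \<le> D" "grp_index H (down H) = q ^ s"
proof -
  note Hs = stableD[OF H]
  note dH = subsp_down[OF Hs(1)]
  have 1: "grp_index Y C = grp_index Y H * (grp_index H (down H) * grp_index (down H) C)"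
    using grp_index_subsp_mult[OF Y(1) Hs(1) subsp_C Hs(2,3)]
      grp_index_subsp_mult[OF Hs(1) dH subsp_C C_sub_down[OF Hs(1)] Hs(5)] by simp
  have "grp_index Y C \<noteq> 0" using D q_gt_1 by simp
  then have nz: "grp_index H (down H) \<noteq> 0" "grp_index H (down H) dvd q ^ D"
    unfolding D[symmetric] 1 by simp_all
  then obtain s where s: "grp_index H (down H) = q ^ s" using grp_index_power[OF Hs(1) dH Hs(5)] by blast
  have "q ^ s \<le> q ^ D" using nz(2) q_gt_1 unfolding s by (intro dvd_imp_le) auto
  then have "s \<le> D" using q_gt_1 by simp
  then show thesis using that s by blast
qed

lemma card_stable:
  assumes Y: "subsp Y" "C \<subseteq> Y" and D: "grp_index Y C = q ^ D"
  shows "of_nat (card (stable Y)) = (\<Sum>s\<le>D. num_stable Y s)"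
proof -
  let ?f = "\<lambda>H. log_index (grp_index H (down H))"
  have nz: "grp_index Y C \<noteq> 0" using D q_gt_1 by simp
  have f: "?f H \<le> D \<and> grp_index H (down H) = q ^ ?f H" if H: "H \<in> stable Y" for H
  proof -
    obtain s where "s \<le> D" "grp_index H (down H) = q ^ s" using stable_index[OF Y D H] by blast
    then show ?thesis by (simp add: log_index_power)
  qed
  have "card (stable Y) = (\<Sum>s\<in>{..D}. card {H \<in> stable Y. ?f H = s})"
    by (rule card_fibres[OF finite_stable[OF Y(1) nz]]) (use f in auto)
  moreover have "{H \<in> stable Y. ?f H = s} = {H \<in> stable Y. grp_index H (down H) = q ^ s}" for s
    using f log_index_power by metis
  ultimately show ?thesis by (simp add: num_stable_def)
qed

text \<open>Sort H by H' = X H. With K and Z the preimages of H' and X H' in Y, the fibre over H' is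
  counted by \<open>card_supplements\<close> for (K : H') = q^r and (K : Z) = (H' : X H') = q^s', so
  it depends on H' only through s'.\<close>

lemma num_stable_rec:
  assumes Y: "subsp Y" "C \<subseteq> Y" "opr ` Y \<subseteq> Y" and nil: "(opr ^^ k) ` Y \<subseteq> C"
    and D: "grp_index Y C = q ^ D" and r: "grp_index Y (down Y) = q ^ r"
  shows "num_stable Y s = (\<Sum>s'\<le>D. num_stable (down Y) s' *
    (qc powi (int s' * (int r - int s)) * qbinomial qc (int r - int s') (int s - int s')))"
proof -
  let ?w = "\<lambda>s'. qc powi (int s' * (int r - int s)) * qbinomial qc (int r - int s') (int s - int s')"
  let ?A = "{H \<in> stable Y. grp_index H (down H) = q ^ s}"
  let ?f = "\<lambda>H. log_index (grp_index H (down H))"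
  have dY: "down Y \<subseteq> Y" by (rule down_least[OF Y(1,3,2)])
  note dYs = subsp_down[OF Y(1)] C_sub_down[OF Y(1)]
  have nz: "grp_index Y C \<noteq> 0" using D q_gt_1 by simp
  have mult: "grp_index Y C = q ^ r * grp_index (down Y) C"
    using grp_index_subsp_mult[OF Y(1) dYs(1) subsp_C dYs(2) dY] r by simp
  have nz': "grp_index (down Y) C \<noteq> 0" using mult nz by (metis mult_0_right)
  have fin: "finite (stable Y)" "finite (stable (down Y))"
    by (rule finite_stable[OF Y(1) nz], rule finite_stable[OF dYs(1) nz'])
  have dst: "down H \<in> stable (down Y)" if "H \<in> stable Y" for H
    using stableD[OF that] down_stable down_mono[OF Y(1)] by (simp add: stable_def subsp_down C_sub_down)
  have logd: "?f H' \<le> D \<and> grp_index H' (down H') = q ^ ?f H'" if H': "H' \<in> stable (down Y)" for H'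
  proof -
    have "H' \<in> stable Y" using H' dY by (auto simp: stable_def)
    then obtain s where "s \<le> D" "grp_index H' (down H') = q ^ s" using stable_index[OF Y(1,2) D] by blast
    then show ?thesis by (simp add: log_index_power)
  qed
  have fibre: "of_nat (card {H \<in> ?A. down H = H'}) = ?w (?f H')" if H': "H' \<in> stable (down Y)" for H'
  proof -
    note H = stableD[OF H']
    let ?K = "preim Y H'" and ?Z = "preim Y (down H')"
    note dH = subsp_down[OF H(1)] C_sub_down[OF H(1)]
    note K = subsp_preim[OF Y(1) H(1)] and Z = subsp_preim[OF Y(1) dH(1)]
    have HZ: "H' \<subseteq> ?Z" using H(3) dY opr_sub_down[of H'] by (auto simp: preim_def)
    have ZK: "?Z \<subseteq> ?K" using H(5) by (auto simp: preim_def)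
    have "grp_index ?K ?Z = grp_index H' (down H')" by (rule preim_index[OF Y(1) H(1) dH H(5) H(3)])
    then have idx1: "grp_index ?K ?Z = q ^ ?f H'" using logd[OF H'] by simp
    \<comment> \<open>On the finite space Y/C the kernel and the cokernel of X have equal size. K/C
      is an extension of H'/C by the kernel, so (K : H') is the size of the kernel, while (Y : X Y)
      = q^r is that of the cokernel.\<close>
    have idx2: "grp_index ?K H' = q ^ r"
    proof -
      note N = subsp_preim[OF Y(1) subsp_C]
      have CN: "C \<subseteq> preim Y C" using opr_C Y(2) by (auto simp: preim_def)
      have NK: "preim Y C \<subseteq> ?K" using H(2) by (auto simp: preim_def)
      have a: "grp_index ?K (preim Y C) = grp_index H' C" by (rule preim_index[OF Y(1) H(1) subsp_C order_refl H(2,3)])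
      have "preim Y (down Y) = Y" using opr_sub_down[of Y] by (auto simp: preim_def)
      then have b: "grp_index Y (preim Y C) = grp_index (down Y) C"
        using preim_index[OF Y(1) dYs(1) subsp_C order_refl dYs(2) order_refl] by simp
      have "grp_index Y C = grp_index (down Y) C * grp_index (preim Y C) C"
        using grp_index_subsp_mult[OF Y(1) N subsp_C CN] b by (simp add: preim_def)
      then have c: "grp_index (preim Y C) C = q ^ r" using mult nz' by simp
      have "grp_index ?K C = grp_index H' C * q ^ r"
        using grp_index_subsp_mult[OF K N subsp_C CN NK] a c by simp
      moreover have "grp_index ?K C = grp_index ?K H' * grp_index H' C"
        by (rule grp_index_subsp_mult[OF K H(1) subsp_C H(2) order_trans[OF HZ ZK]])
      moreover have "grp_index H' C \<noteq> 0"
        using grp_index_subsp_mult[OF dYs(1) H(1) subsp_C H(2,3)] nz' by (metis mult_0_right)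
      ultimately show ?thesis by simp
    qed
    have "{H \<in> ?A. down H = H'} = {H \<in> {H \<in> stable Y. down H = H'}. grp_index H H' = q ^ s}" by blast
    also have "\<dots> = {U. subsp U \<and> H' \<subseteq> U \<and> U \<subseteq> ?K \<and> subgroup_sum U ?Z = ?K \<and> grp_index U H' = q ^ s}"
      unfolding stable_fibre_eq[OF Y nil H'] by blast
    finally show ?thesis
      using card_supplements[OF K H(1) Z HZ ZK idx2 idx1, of s] by simp
  qed
  have "card ?A = (\<Sum>H'\<in>stable (down Y). card {H \<in> ?A. down H = H'})"
    by (rule card_fibres[OF _ fin(2)]) (use fin(1) dst in auto)
  then have "num_stable Y s = (\<Sum>H'\<in>stable (down Y). of_nat (card {H \<in> ?A. down H = H'}))"
    unfolding num_stable_def by (simp only: of_nat_sum)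
  also have "\<dots> = (\<Sum>H'\<in>stable (down Y). ?w (?f H'))" by (rule sum.cong[OF refl fibre])
  also have "\<dots> = (\<Sum>s'\<in>{..D}. \<Sum>H'\<in>{H' \<in> stable (down Y). ?f H' = s'}. ?w (?f H'))"
    by (rule sum.group[symmetric, OF fin(2)]) (use logd in auto)
  also have "\<dots> = (\<Sum>s'\<le>D. num_stable (down Y) s' * ?w s')"
  proof (rule sum.cong[OF refl])
    fix s'
    have "{H' \<in> stable (down Y). ?f H' = s'} = {H' \<in> stable (down Y). grp_index H' (down H') = q ^ s'}"
      using logd log_index_power by metis
    then show "(\<Sum>H'\<in>{H' \<in> stable (down Y). ?f H' = s'}. ?w (?f H')) = num_stable (down Y) s' * ?w s'"
      by (simp add: num_stable_def log_index_power)
  qed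
  finally show ?thesis .
qed

lemma num_stable_base: "num_stable C s = (if s = 0 then 1 else 0)"
proof -
  have dC: "down C = C" using down_least[OF subsp_C opr_C order_refl] C_sub_down[OF subsp_C] by blast
  have "stable C = {C}" using subsp_C opr_C by (auto simp: stable_def)
  moreover have "grp_index C C = 1" by (rule grp_index_self[OF subspD(1)[OF subsp_C]])
  moreover have "s \<noteq> 0 \<Longrightarrow> q ^ s > 1" using q_gt_1 by (intro one_less_power) auto
  ultimately have "{H \<in> stable C. grp_index H (down H) = q ^ s} = (if s = 0 then {C} else {})"
    using dC by (cases "s = 0") auto
  then show ?thesis by (simp add: num_stable_def)
qed

end

section \<open>Gaussian binomial identities\<close>

lemma sum_PiE_insert:
  assumes "i \<notin> I"
  shows "(\<Sum>s\<in>insert i I \<rightarrow>\<^sub>E S. F s) = (\<Sum>x\<in>S. \<Sum>g\<in>I \<rightarrow>\<^sub>E S. F (g(i := x)))"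
proof -
  have "(\<Sum>s\<in>insert i I \<rightarrow>\<^sub>E S. F s) = (\<Sum>(x, g)\<in>S \<times> (I \<rightarrow>\<^sub>E S). F (g(i := x)))"
    unfolding PiE_insert_eq
    by (subst sum.reindex[OF inj_combinator[OF assms]]) (simp add: case_prod_unfold)
  then show ?thesis by (simp add: sum.cartesian_product)
qed

text \<open>Unrolls a recursion W i = sum over y of W (i+1) y times f i into a sum over tuples. The
  test function \<open>g\<close> is arbitrary because each step absorbs one factor f into
  it.\<close>

lemma chain_sum:
  fixes f :: "nat \<Rightarrow> int \<Rightarrow> int \<Rightarrow> complex" and W :: "nat \<Rightarrow> int \<Rightarrow> complex"
  assumes S: "finite S" "0 \<in> S"
    and base: "\<And>y. W (Suc m) y = (if y = 0 then 1 else 0)"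
    and step: "\<And>i x. 1 \<le> i \<Longrightarrow> i \<le> m \<Longrightarrow> x \<in> S \<Longrightarrow> W i x = (\<Sum>y\<in>S. W (Suc i) y * f i x y)"
    and i: "1 \<le> i" "i \<le> Suc m"
  shows "(\<Sum>x\<in>S. W i x * g x) = (\<Sum>s\<in>{i..m} \<rightarrow>\<^sub>E S. g (if i \<le> m then s i else 0) *
    (\<Prod>k=i..m. f k (s k) (if k < m then s (Suc k) else 0)))"
  using i(2) i(1)
proof (induction arbitrary: g rule: inc_induct)
  case base
  have "(\<Sum>x\<in>S. W (Suc m) x * g x) = g 0"
    using S by (simp add: assms(3) if_distrib[of "\<lambda>x. x * _"] cong: if_cong)
  then show ?case by simp
next
  case (step i)
  have im: "i \<le> m" using step.hyps by simp
  have ins: "{i..m} = insert i {Suc i..m}" using im by auto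
  let ?P = "\<lambda>s. \<Prod>k=Suc i..m. f k (s k) (if k < m then s (Suc k) else 0)"
  let ?n = "\<lambda>s. if Suc i \<le> m then s (Suc i) else 0"
  have "(\<Sum>x\<in>S. W i x * g x) = (\<Sum>x\<in>S. \<Sum>y\<in>S. W (Suc i) y * (f i x y * g x))"
    using assms(4)[OF step.prems im] by (simp add: sum_distrib_right mult.assoc)
  also have "\<dots> = (\<Sum>y\<in>S. W (Suc i) y * (\<Sum>x\<in>S. f i x y * g x))"
    by (subst sum.swap) (simp add: sum_distrib_left)
  also have "\<dots> = (\<Sum>s\<in>{Suc i..m} \<rightarrow>\<^sub>E S. (\<Sum>x\<in>S. f i x (?n s) * g x) * ?P s)"
    by (rule step.IH) simp
  also have "\<dots> = (\<Sum>x\<in>S. \<Sum>s\<in>{Suc i..m} \<rightarrow>\<^sub>E S. g x * (f i x (?n s) * ?P s))"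
    by (subst sum.swap) (simp add: sum_distrib_right mult_ac)
  also have "\<dots> = (\<Sum>s\<in>{i..m} \<rightarrow>\<^sub>E S. g (if i \<le> m then s i else 0) *
    (\<Prod>k=i..m. f k (s k) (if k < m then s (Suc k) else 0)))"
  proof -
    have nin: "i \<notin> {Suc i..m}" by simp
    have upd: "(\<Prod>k=Suc i..m. f k ((s(i := x)) k) (if k < m then (s(i := x)) (Suc k) else 0)) = ?P s" for s x
      by (rule prod.cong) auto
    show ?thesis
      unfolding ins sum_PiE_insert[OF nin]
      by (intro sum.cong refl) (simp add: im upd prod.insert[OF _ nin] Suc_le_eq del: fun_upd_apply, simp)
  qed
  finally show ?case .
qed

lemma qpochhammer_inverse:
  fixes x :: "'k::field"
  assumes "x \<noteq> 0"
  shows "qpochhammer (inverse x) (inverse x) n = (- 1) ^ n * qpochhammer x x n / x ^ (\<Sum>l<n. Suc l)"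
proof (induction n)
  case (Suc n)
  have "1 - inverse x ^ Suc n = - (1 - x ^ Suc n) / x ^ Suc n"
    using assms by (simp add: field_simps del: power_Suc)
  moreover have "a * b / y * (- (1 - u) / u) = (- 1 * a) * (b * (1 - u)) / (y * u)" for a b y u :: 'k
    by (simp add: algebra_simps flip: minus_divide_left)
  ultimately show ?case
    unfolding qpochhammer_Suc Suc.IH sum.lessThan_Suc power_add power_Suc[of "- 1 :: 'k"] by (simp only:)
qed (simp add: qpochhammer_def)

lemma sum_Suc_add: "(\<Sum>l<b + c. Suc l) = (\<Sum>l<b. Suc l) + (\<Sum>l<c. Suc l) + b * c"
  by (induction c) auto

lemma qbinomial_inverse:
  fixes x :: "'k::field"
  assumes "x \<noteq> 0"
  shows "qbinomial (inverse x) (int (b + c)) (int b) = qbinomial x (int (b + c)) (int c) / x ^ (b * c)"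
proof -
  let ?t = "\<lambda>n. \<Sum>l<n. Suc l"
  have 1: "qbinomial (inverse x) (int (b + c)) (int b) =
    qpochhammer (inverse x) (inverse x) (b + c) / (qpochhammer (inverse x) (inverse x) b * qpochhammer (inverse x) (inverse x) c)"
    by (subst qbinomial_nat) simp_all
  have 2: "qbinomial x (int (b + c)) (int c) = qpochhammer x x (b + c) / (qpochhammer x x c * qpochhammer x x b)"
    by (subst qbinomial_nat) simp_all
  have pw: "x ^ ?t (b + c) = x ^ ?t b * x ^ ?t c * x ^ (b * c)" unfolding sum_Suc_add power_add ..
  have cancel: "(s * s') * u / (tb * tc * tbc) / ((s * v / tb) * (s' * w / tc)) = u / (w * v) / tbc"
    if "s \<noteq> 0" "s' \<noteq> 0" "tb \<noteq> 0" "tc \<noteq> 0" "tbc \<noteq> 0" for s s' u v w tb tc tbc :: 'k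
    using that by (cases "v = 0"; cases "w = 0") (simp_all add: field_simps)
  show ?thesis
    unfolding 1 2 qpochhammer_inverse[OF assms] pw power_add[of "- 1 :: 'k"]
    by (rule cancel) (use assms in simp_all)
qed

text \<open>Translates a factor of \<open>G_term\<close>, in q^(-1), into the form of
  \<open>card_supplements\<close>: s(r - s) = y(r - s) + (s - y)(r - s), and the last product is the
  exponent by which the Gaussian binomials at q^(-1) and q differ. Outside y \<le> s \<le> r both
  binomials vanish.\<close>

lemma G_factor:
  fixes x :: "'k::field"
  assumes "x \<noteq> 0"
  shows "x powi (s * (r - s)) * qbinomial (inverse x) (r - y) (r - s) =
    x powi (y * (r - s)) * qbinomial x (r - y) (s - y)"
proof (cases "y \<le> s \<and> s \<le> r")
  case True
  define b c where "b = nat (r - s)" and "c = nat (s - y)"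
  have bc: "r - s = int b" "s - y = int c" "r - y = int (b + c)" using True by (auto simp: b_def c_def)
  have s: "s * (r - s) = y * (r - s) + int (b * c)" using bc by (simp add: algebra_simps)
  show ?thesis
    unfolding s unfolding bc qbinomial_inverse[OF assms]
    using assms by (simp add: power_int_add del: of_nat_mult of_nat_add)
next
  case False
  then have "qbinomial (inverse x) (r - y) (r - s) = 0" "qbinomial x (r - y) (s - y) = 0"
    by (auto simp: qbinomial_def)
  then show ?thesis by simp
qed

lemma power_int_sum:
  fixes x :: "'k::field"
  assumes "x \<noteq> 0"
  shows "x powi (\<Sum>i\<in>I. f i) = (\<Prod>i\<in>I. x powi f i)"
  by (induction I rule: infinite_finite_induct) (simp_all add: power_int_add assms)

lemma G_term_eq_prod:
  fixes x :: "'k::field"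
  assumes "x \<noteq> 0"
  shows "G_term m r s x = (\<Prod>k=1..m. x powi ((if k < m then s (Suc k) else 0) * (r k - s k)) *
     qbinomial x (r k - (if k < m then s (Suc k) else 0)) (s k - (if k < m then s (Suc k) else 0)))"
proof -
  have "G_term m r s x = (\<Prod>k=1..m. x powi (s k * (r k - s k)) *
      qbinomial (inverse x) (r k - (if k = m then 0 else s (k + 1))) (r k - s k))"
    unfolding G_term_def power_int_sum[OF assms] prod.distrib ..
  also have "\<dots> = (\<Prod>k=1..m. x powi ((if k < m then s (Suc k) else 0) * (r k - s k)) *
     qbinomial x (r k - (if k < m then s (Suc k) else 0)) (s k - (if k < m then s (Suc k) else 0)))"
  proof (rule prod.cong[OF refl])
    fix k assume "k \<in> {1..m}"
    then have "(if k = m then 0 else s (k + 1)) = (if k < m then s (Suc k) else 0)" by auto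
    then show "x powi (s k * (r k - s k)) * qbinomial (inverse x) (r k - (if k = m then 0 else s (k + 1))) (r k - s k) =
      x powi ((if k < m then s (Suc k) else 0) * (r k - s k)) *
      qbinomial x (r k - (if k < m then s (Suc k) else 0)) (s k - (if k < m then s (Suc k) else 0))"
      by (simp only: G_factor[OF assms])
  qed
  finally show ?thesis .
qed

text \<open>A nonzero product of binomials forces s_(k+1) \<le> s_k \<le> r_k with s_(m+1) = 0. This
  makes the sums over all integer tuples finite.\<close>

lemma G_term_support:
  assumes "G_term m r s x \<noteq> 0" "\<And>k. 1 \<le> k \<Longrightarrow> k \<le> m \<Longrightarrow> r k \<le> B" "1 \<le> k" "k \<le> m"
  shows "0 \<le> s k" "s k \<le> B"
proof -
  have nz: "qbinomial (inverse x) (r k - (if k = m then 0 else s (k + 1))) (r k - s k) \<noteq> 0"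
    if "1 \<le> k" "k \<le> m" for k
    using assms(1) that by (auto simp: G_term_def)
  then have le: "s k \<le> r k" "(if k = m then 0 else s (k + 1)) \<le> s k" if "1 \<le> k" "k \<le> m" for k
    using that by (force simp: qbinomial_def split: if_splits)+
  show "s k \<le> B" using le(1)[OF assms(3,4)] assms(2)[OF assms(3,4)] by linarith
  show "0 \<le> s k"
    using assms(4,3)
  proof (induction rule: inc_induct)
    case base
    then show ?case using le(2)[of m] by simp
  next
    case (step k)
    then show ?case using le(2)[of k] by simp
  qed
qed

lemma qbinomial_Pascal:
  fixes x :: "'k::field"
  assumes "\<And>l. l > 0 \<Longrightarrow> x ^ l \<noteq> 1"
  shows "qbinomial x (int (Suc d)) (int r) = x ^ r * qbinomial x (int d) (int r) + qbinomial x (int d) (int r - 1)"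
proof (cases r)
  case 0
  have "qbinomial x (int d) (- 1) = 0" by (simp add: qbinomial_def)
  then show ?thesis using 0 qbinomial_zero[OF assms, where n = d] qbinomial_zero[OF assms, where n = "Suc d"] by simp
next
  case r: (Suc k)
  note nz = qpochhammer_nonzero[of x, OF assms]
  consider "k < d" | "k = d" | "k > d" by linarith
  then show ?thesis
  proof cases
    case 1
    then obtain c where c: "d = Suc k + c" by (metis add_Suc less_iff_Suc_add)
    have 1: "qbinomial x (int (Suc d)) (int r) = qpochhammer x x (Suc d) / (qpochhammer x x (Suc k) * qpochhammer x x (Suc c))"
      unfolding r by (subst qbinomial_nat) (simp_all add: c)
    have 2: "qbinomial x (int d) (int r) = qpochhammer x x d / (qpochhammer x x (Suc k) * qpochhammer x x c)"
      unfolding r by (subst qbinomial_nat) (simp_all add: c)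
    have "int r - 1 = int k" by (simp add: r)
    then have 3: "qbinomial x (int d) (int r - 1) = qpochhammer x x d / (qpochhammer x x k * qpochhammer x x (Suc c))"
      by (simp only:) (subst qbinomial_nat, simp_all add: c)
    have 4: "x ^ Suc d = x ^ Suc k * x ^ Suc c" by (simp add: c power_add)
    have 5: "1 - x ^ Suc k \<noteq> 0" "1 - x ^ Suc c \<noteq> 0" using assms[of "Suc k"] assms[of "Suc c"] by auto
    have key: "P * (1 - u * v) / (A * (1 - u) * (B * (1 - v))) = u * (P / (A * (1 - u) * B)) + P / (A * (B * (1 - v)))"
      if "A \<noteq> 0" "B \<noteq> 0" "1 - u \<noteq> 0" "1 - v \<noteq> 0" for P A B u v :: 'k
      using that by (simp add: divide_simps) (simp add: algebra_simps)
    show ?thesis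
      unfolding 1 2 3 qpochhammer_Suc[of x k] qpochhammer_Suc[of x c] qpochhammer_Suc[of x d] 4
      unfolding r by (rule key) (use nz 5 in blast)+
  next
    case 2
    have "qbinomial x (int j) (int j) = 1" for j
      using nz[of j] qbinomial_nat[of j j x] by (simp add: qpochhammer_def)
    moreover have "qbinomial x (int d) (int r) = 0" using 2 by (simp add: qbinomial_def r)
    moreover have "int r - 1 = int d" "Suc d = r" using 2 r by simp_all
    ultimately show ?thesis by (simp only:) simp
  next
    case 3
    then show ?thesis by (simp add: qbinomial_def r)
  qed
qed

text \<open>The q-binomial theorem at the point where the product contains the factor 1 - 1. In the
  proof the Pascal rule splits the sum into two halves that cancel.\<close>

lemma sum_alternating_qbinomial:
  fixes x :: "'k::field"
  assumes "\<And>l. l > 0 \<Longrightarrow> x ^ l \<noteq> 1"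
  shows "(\<Sum>r\<le>d. (- 1) ^ r * x ^ (r choose 2) * qbinomial x (int d) (int r)) = (if d = 0 then 1 else 0)"
proof (cases d)
  case 0
  then show ?thesis using qbinomial_zero[OF assms, where n = 0] by (simp add: numeral_2_eq_2)
next
  case (Suc e)
  let ?h = "\<lambda>r. (- 1) ^ r * x ^ (Suc r choose 2) * qbinomial x (int e) (int r)"
  have ch: "Suc r choose 2 = (r choose 2) + r" for r by (simp add: numeral_2_eq_2)
  have "(\<Sum>r\<le>d. (- 1) ^ r * x ^ (r choose 2) * qbinomial x (int d) (int r)) =
      (\<Sum>r\<le>Suc e. ?h r + (- 1) ^ r * x ^ (r choose 2) * qbinomial x (int e) (int r - 1))"
    unfolding Suc
    by (intro sum.cong refl, subst qbinomial_Pascal[OF assms]) (simp_all add: ch power_add algebra_simps)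
  also have "\<dots> = (\<Sum>r\<le>Suc e. ?h r) + (\<Sum>r\<le>Suc e. (- 1) ^ r * x ^ (r choose 2) * qbinomial x (int e) (int r - 1))"
    by (rule sum.distrib)
  also have "(\<Sum>r\<le>Suc e. (- 1) ^ r * x ^ (r choose 2) * qbinomial x (int e) (int r - 1)) = - (\<Sum>r\<le>e. ?h r)"
  proof -
    have "qbinomial x (int e) (- 1) = 0" by (simp add: qbinomial_def)
    then show ?thesis by (simp add: sum.atMost_Suc_shift sum_negf del: sum.atMost_Suc)
  qed
  also have "(\<Sum>r\<le>Suc e. ?h r) = (\<Sum>r\<le>e. ?h r)"
    by (simp add: qbinomial_def)
  finally show ?thesis using Suc by simp
qed

section \<open>Transport of lattice zeta functions\<close>

text \<open>A ring record identified with a subset R of a type of class \<open>comm_ring_1\<close>.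
  The ring laws of \<open>A\<close> are inherited through the injection, so closure and
  compatibility suffice, and the locale also fits raw records such as
  \<open>normalization\<close>.\<close>

locale ring_model =
  fixes A :: "('r, 'm) ring_scheme" and R :: "'s::comm_ring_1 set" and \<iota> :: "'r \<Rightarrow> 's"
  assumes bij: "bij_betw \<iota> (carrier A) R"
    and add_closed: "a \<in> carrier A \<Longrightarrow> b \<in> carrier A \<Longrightarrow> a \<oplus>\<^bsub>A\<^esub> b \<in> carrier A"
    and mult_closed: "a \<in> carrier A \<Longrightarrow> b \<in> carrier A \<Longrightarrow> a \<otimes>\<^bsub>A\<^esub> b \<in> carrier A"
    and zero_closed: "\<zero>\<^bsub>A\<^esub> \<in> carrier A" and one_closed: "\<one>\<^bsub>A\<^esub> \<in> carrier A"
    and map_add: "a \<in> carrier A \<Longrightarrow> b \<in> carrier A \<Longrightarrow> \<iota> (a \<oplus>\<^bsub>A\<^esub> b) = \<iota> a + \<iota> b"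
    and map_mult: "a \<in> carrier A \<Longrightarrow> b \<in> carrier A \<Longrightarrow> \<iota> (a \<otimes>\<^bsub>A\<^esub> b) = \<iota> a * \<iota> b"
    and map_zero: "\<iota> \<zero>\<^bsub>A\<^esub> = 0" and map_one: "\<iota> \<one>\<^bsub>A\<^esub> = 1"
    and R_diff: "r \<in> R \<Longrightarrow> r' \<in> R \<Longrightarrow> r - r' \<in> R"
begin

definition vec_map :: "nat \<Rightarrow> (nat \<Rightarrow> 'r) \<Rightarrow> nat \<Rightarrow> 's" where
  "vec_map n x = (\<lambda>j. if j < n then \<iota> (x j) else 0)"

definition Rvecs :: "nat \<Rightarrow> (nat \<Rightarrow> 's) set" where
  "Rvecs n = {x \<in> vecs n. \<forall>j. x j \<in> R}"

lemma \<iota>_R: "a \<in> carrier A \<Longrightarrow> \<iota> a \<in> R"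
  using bij by (auto simp: bij_betw_def)

lemma \<iota>_inj: "a \<in> carrier A \<Longrightarrow> b \<in> carrier A \<Longrightarrow> \<iota> a = \<iota> b \<Longrightarrow> a = b"
  using bij by (auto simp: bij_betw_def inj_on_def)

lemma \<iota>_surj: "r \<in> R \<Longrightarrow> \<exists>a\<in>carrier A. \<iota> a = r"
  using bij by (force simp: bij_betw_def)

lemma zero_R: "0 \<in> R"
  using \<iota>_R[OF zero_closed] map_zero by simp

lemma carrier_free: "carrier (free_module A n) = {..<n} \<rightarrow>\<^sub>E carrier A"
  by (simp add: free_module_def)

lemma free_add: "x \<oplus>\<^bsub>free_module A n\<^esub> y = (\<lambda>i\<in>{..<n}. x i \<oplus>\<^bsub>A\<^esub> y i)"
  by (simp add: free_module_def)

lemma free_smult: "a \<odot>\<^bsub>free_module A n\<^esub> x = (\<lambda>i\<in>{..<n}. a \<otimes>\<^bsub>A\<^esub> x i)"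
  by (simp add: free_module_def)

lemma free_zero: "\<zero>\<^bsub>free_module A n\<^esub> = (\<lambda>i\<in>{..<n}. \<zero>\<^bsub>A\<^esub>)"
  by (simp add: free_module_def)

lemma free_add_closed:
  "x \<in> carrier (free_module A n) \<Longrightarrow> y \<in> carrier (free_module A n) \<Longrightarrow> x \<oplus>\<^bsub>free_module A n\<^esub> y \<in> carrier (free_module A n)"
  unfolding carrier_free free_add by (auto intro: add_closed)

lemma vec_map_bij: "bij_betw (vec_map n) (carrier (free_module A n)) (Rvecs n)"
proof (rule bij_betw_imageI)
  show "inj_on (vec_map n) (carrier (free_module A n))"
  proof (rule inj_onI)
    fix x y assume xy: "x \<in> carrier (free_module A n)" "y \<in> carrier (free_module A n)" "vec_map n x = vec_map n y"
    show "x = y"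
    proof (rule PiE_ext)
      show "x \<in> {..<n} \<rightarrow>\<^sub>E carrier A" "y \<in> {..<n} \<rightarrow>\<^sub>E carrier A" using xy by (auto simp: carrier_free)
      fix i assume i: "i \<in> {..<n}"
      have "vec_map n x i = vec_map n y i" using xy(3) by simp
      then have "\<iota> (x i) = \<iota> (y i)" using i by (simp add: vec_map_def)
      then show "x i = y i"
        by (rule \<iota>_inj[OF PiE_mem[OF xy(1)[unfolded carrier_free] i] PiE_mem[OF xy(2)[unfolded carrier_free] i]])
    qed
  qed
  show "vec_map n ` carrier (free_module A n) = Rvecs n"
  proof (intro equalityI subsetI)
    fix y assume "y \<in> vec_map n ` carrier (free_module A n)"
    then obtain x where x: "x \<in> {..<n} \<rightarrow>\<^sub>E carrier A" "y = vec_map n x" unfolding carrier_free by blast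
    have "y j \<in> R" for j
      unfolding x(2) vec_map_def using \<iota>_R[OF PiE_mem[OF x(1)], of j] zero_R by simp
    moreover have "y \<in> vecs n" by (simp add: x(2) vec_map_def vecs_def)
    ultimately show "y \<in> Rvecs n" by (simp add: Rvecs_def)
  next
    fix y assume y: "y \<in> Rvecs n"
    define x where "x = (\<lambda>i\<in>{..<n}. inv_into (carrier A) \<iota> (y i))"
    have inv: "inv_into (carrier A) \<iota> (y i) \<in> carrier A" "\<iota> (inv_into (carrier A) \<iota> (y i)) = y i" for i
    proof -
      have "y i \<in> \<iota> ` carrier A" using y bij by (simp add: Rvecs_def bij_betw_def)
      then show "inv_into (carrier A) \<iota> (y i) \<in> carrier A" "\<iota> (inv_into (carrier A) \<iota> (y i)) = y i"
        by (rule inv_into_into, rule f_inv_into_f)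
    qed
    have "x \<in> carrier (free_module A n)" using inv by (auto simp: x_def carrier_free)
    moreover have "vec_map n x = y" using y inv(2) by (auto simp: vec_map_def x_def Rvecs_def vecs_def fun_eq_iff)
    ultimately show "y \<in> vec_map n ` carrier (free_module A n)" by blast
  qed
qed

lemma vec_map_add:
  assumes "x \<in> carrier (free_module A n)" "y \<in> carrier (free_module A n)"
  shows "vec_map n (x \<oplus>\<^bsub>free_module A n\<^esub> y) = vec_map n x + vec_map n y"
  using assms by (auto simp: vec_map_def free_add carrier_free fun_eq_iff intro!: map_add)

lemma vec_map_smult:
  assumes "a \<in> carrier A" "x \<in> carrier (free_module A n)"
  shows "vec_map n (a \<odot>\<^bsub>free_module A n\<^esub> x) = vscale (\<iota> a) (vec_map n x)"
  using assms by (auto simp: vec_map_def free_smult carrier_free fun_eq_iff intro!: map_mult)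

lemma vec_map_zero: "vec_map n \<zero>\<^bsub>free_module A n\<^esub> = 0"
  by (auto simp: vec_map_def free_zero map_zero fun_eq_iff)

lemma free_zero_closed: "\<zero>\<^bsub>free_module A n\<^esub> \<in> carrier (free_module A n)"
  by (auto simp: free_zero carrier_free zero_closed)

lemma free_smult_closed:
  "a \<in> carrier A \<Longrightarrow> x \<in> carrier (free_module A n) \<Longrightarrow> a \<odot>\<^bsub>free_module A n\<^esub> x \<in> carrier (free_module A n)"
  unfolding carrier_free free_smult by (auto intro: mult_closed)

lemma vec_map_inj:
  "x \<in> carrier (free_module A n) \<Longrightarrow> y \<in> carrier (free_module A n) \<Longrightarrow> vec_map n x = vec_map n y \<Longrightarrow> x = y"
  using vec_map_bij[of n] by (auto simp: bij_betw_def inj_on_def)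

lemma vec_map_surj: "y \<in> Rvecs n \<Longrightarrow> \<exists>x\<in>carrier (free_module A n). vec_map n x = y"
  using vec_map_bij[of n] by (force simp: bij_betw_def)

lemma vec_map_mem: "x \<in> carrier (free_module A n) \<Longrightarrow> vec_map n x \<in> Rvecs n"
  using vec_map_bij[of n] by (auto simp: bij_betw_def)

lemma Rvecs_subgroup: "add_subgroup (Rvecs n)"
  by (rule add_subgroupI) (auto simp: Rvecs_def zero_R R_diff vecs_def)

lemma free_group: "group (add_monoid (free_module A n))"
proof (rule groupI)
  let ?M = "free_module A n"
  show "x \<otimes>\<^bsub>add_monoid ?M\<^esub> y \<in> carrier (add_monoid ?M)"
    if "x \<in> carrier (add_monoid ?M)" "y \<in> carrier (add_monoid ?M)" for x y
    using that free_add_closed by simp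
  show "\<one>\<^bsub>add_monoid ?M\<^esub> \<in> carrier (add_monoid ?M)" using free_zero_closed by simp
  show "x \<otimes>\<^bsub>add_monoid ?M\<^esub> y \<otimes>\<^bsub>add_monoid ?M\<^esub> z = x \<otimes>\<^bsub>add_monoid ?M\<^esub> (y \<otimes>\<^bsub>add_monoid ?M\<^esub> z)"
    if "x \<in> carrier (add_monoid ?M)" "y \<in> carrier (add_monoid ?M)" "z \<in> carrier (add_monoid ?M)" for x y z
  proof -
    have "x \<oplus>\<^bsub>?M\<^esub> y \<oplus>\<^bsub>?M\<^esub> z = x \<oplus>\<^bsub>?M\<^esub> (y \<oplus>\<^bsub>?M\<^esub> z)"
      by (rule vec_map_inj[of _ n]) (use that in \<open>simp_all add: free_add_closed vec_map_add add.assoc\<close>)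
    then show ?thesis by simp
  qed
  show "\<one>\<^bsub>add_monoid ?M\<^esub> \<otimes>\<^bsub>add_monoid ?M\<^esub> x = x" if "x \<in> carrier (add_monoid ?M)" for x
  proof -
    have "\<zero>\<^bsub>?M\<^esub> \<oplus>\<^bsub>?M\<^esub> x = x"
      by (rule vec_map_inj[of _ n]) (use that in \<open>simp_all add: free_add_closed free_zero_closed vec_map_add vec_map_zero\<close>)
    then show ?thesis by simp
  qed
  show "\<exists>y\<in>carrier (add_monoid ?M). y \<otimes>\<^bsub>add_monoid ?M\<^esub> x = \<one>\<^bsub>add_monoid ?M\<^esub>" if "x \<in> carrier (add_monoid ?M)" for x
  proof -
    have "- vec_map n x \<in> Rvecs n" using vec_map_mem that add_subgroup_uminus[OF Rvecs_subgroup] by simp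
    then obtain y where y: "y \<in> carrier ?M" "vec_map n y = - vec_map n x" using vec_map_surj by blast
    have "y \<oplus>\<^bsub>?M\<^esub> x = \<zero>\<^bsub>?M\<^esub>"
      by (rule vec_map_inj[of _ n]) (use that y in \<open>simp_all add: free_add_closed free_zero_closed vec_map_add vec_map_zero\<close>)
    then show ?thesis using y(1) by auto
  qed
qed

lemma submodule_iff:
  assumes L: "L \<subseteq> carrier (free_module A n)"
  shows "submodule L A (free_module A n) \<longleftrightarrow> submod n R (vec_map n ` L)"
proof
  let ?M = "free_module A n"
  interpret G: group "add_monoid ?M" by (rule free_group)
  assume sub: "submodule L A ?M"
  then have sg: "subgroup L (add_monoid ?M)" by (rule submodule.axioms)
  show "submod n R (vec_map n ` L)"
    unfolding submod_def
  proof (intro conjI ballI add_subgroupI)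
    have "\<zero>\<^bsub>?M\<^esub> \<in> L" using subgroup.one_closed[OF sg] by simp
    then show "0 \<in> vec_map n ` L" using vec_map_zero by (metis imageI)
    show "vec_map n ` L \<subseteq> vecs n" by (auto simp: vec_map_def vecs_def)
    fix x y assume "x \<in> vec_map n ` L" "y \<in> vec_map n ` L"
    then obtain u v where uv: "u \<in> L" "v \<in> L" "x = vec_map n u" "y = vec_map n v" by blast
    let ?i = "inv\<^bsub>add_monoid ?M\<^esub> v"
    have vc: "v \<in> carrier ?M" "u \<in> carrier ?M" using uv L by auto
    have i: "?i \<in> L" by (rule subgroup.m_inv_closed[OF sg uv(2)])
    then have ic: "?i \<in> carrier ?M" using L by blast
    have "v \<oplus>\<^bsub>?M\<^esub> ?i = \<zero>\<^bsub>?M\<^esub>" using G.r_inv[of v] vc by simp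
    then have "vec_map n v + vec_map n ?i = 0" using vec_map_add[OF vc(1) ic] vec_map_zero by simp
    then have "vec_map n ?i = - vec_map n v" by (simp add: add_eq_0_iff)
    then have "x - y = vec_map n (u \<oplus>\<^bsub>?M\<^esub> ?i)" using vec_map_add[OF vc(2) ic] uv(3,4) by simp
    moreover have "u \<oplus>\<^bsub>?M\<^esub> ?i \<in> L" using subgroup.m_closed[OF sg uv(1) i] by simp
    ultimately show "x - y \<in> vec_map n ` L" by blast
  next
    fix r x assume r: "r \<in> R" and "x \<in> vec_map n ` L"
    then obtain u where u: "u \<in> L" "x = vec_map n u" by blast
    obtain a where a: "a \<in> carrier A" "\<iota> a = r" using \<iota>_surj[OF r] by blast
    have "a \<odot>\<^bsub>?M\<^esub> u \<in> L" using submodule.smult_closed[OF sub a(1) u(1)] .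
    moreover have "u \<in> carrier ?M" using u(1) L by blast
    then have "vec_map n (a \<odot>\<^bsub>?M\<^esub> u) = vscale r x" using vec_map_smult[OF a(1)] a(2) u(2) by simp
    ultimately show "vscale r x \<in> vec_map n ` L" by (metis imageI)
  qed
next
  let ?M = "free_module A n"
  interpret G: group "add_monoid ?M" by (rule free_group)
  assume sub: "submod n R (vec_map n ` L)"
  note s = submodD[OF sub]
  have mem: "x \<in> L" if "x \<in> carrier ?M" "vec_map n x \<in> vec_map n ` L" for x
    using that L vec_map_inj by blast
  have "\<zero>\<^bsub>?M\<^esub> \<in> L"
    using mem[OF free_zero_closed] add_subgroup_zero[OF s(1)] vec_map_zero by simp
  have "subgroup L (add_monoid ?M)"
  proof (rule G.subgroupI)
    show "L \<subseteq> carrier (add_monoid ?M)" using L by simp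
    show "L \<noteq> {}" using \<open>\<zero>\<^bsub>?M\<^esub> \<in> L\<close> by blast
    fix x assume x: "x \<in> L"
    have xc: "x \<in> carrier ?M" using x L by blast
    let ?i = "inv\<^bsub>add_monoid ?M\<^esub> x"
    have ic: "?i \<in> carrier ?M" using G.inv_closed[of x] xc by simp
    have "x \<oplus>\<^bsub>?M\<^esub> ?i = \<zero>\<^bsub>?M\<^esub>" using G.r_inv[of x] xc by simp
    then have "vec_map n x + vec_map n ?i = 0" using vec_map_add[OF xc ic] vec_map_zero by simp
    then have "vec_map n ?i = - vec_map n x" by (simp add: add_eq_0_iff)
    then show "?i \<in> L" using mem[OF ic] add_subgroup_uminus[OF s(1)] x by simp
    fix y assume y: "y \<in> L"
    have yc: "y \<in> carrier ?M" using y L by blast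
    have "vec_map n (x \<oplus>\<^bsub>?M\<^esub> y) \<in> vec_map n ` L"
      unfolding vec_map_add[OF xc yc] using x y by (intro add_subgroup_add[OF s(1)]) auto
    then show "x \<otimes>\<^bsub>add_monoid ?M\<^esub> y \<in> L" using mem free_add_closed[OF xc yc] by simp
  qed
  moreover have "a \<odot>\<^bsub>?M\<^esub> x \<in> L" if a: "a \<in> carrier A" and x: "x \<in> L" for a x
  proof -
    have xc: "x \<in> carrier ?M" using x L by blast
    have "vec_map n (a \<odot>\<^bsub>?M\<^esub> x) \<in> vec_map n ` L"
      unfolding vec_map_smult[OF a xc] using x by (intro s(3) \<iota>_R[OF a]) auto
    then show ?thesis using mem free_smult_closed[OF a xc] by blast
  qed
  ultimately show "submodule L A ?M" by (simp add: submodule_def submodule_axioms_def)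
qed

lemma card_rcosets:
  assumes L: "L \<subseteq> carrier (free_module A n)"
  shows "card (a_rcosets\<^bsub>free_module A n\<^esub> L) = grp_index (Rvecs n) (vec_map n ` L)"
proof -
  let ?M = "free_module A n"
  let ?f = "\<lambda>a. (\<lambda>h. h \<oplus>\<^bsub>?M\<^esub> a) ` L"
  have "a_rcosets\<^bsub>?M\<^esub> L = ?f ` carrier ?M"
    by (auto simp: A_RCOSETS_def RCOSETS_def r_coset_def)
  moreover have "card (?f ` carrier ?M) = card ((\<lambda>a. (+) (vec_map n a) ` vec_map n ` L) ` carrier ?M)"
  proof (rule card_image_cong_kernel)
    fix a b assume a: "a \<in> carrier ?M" and b: "b \<in> carrier ?M"
    have sub: "?f a \<subseteq> carrier ?M" if "a \<in> carrier ?M" for a using that L free_add_closed by blast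
    have img: "vec_map n ` ?f a = (+) (vec_map n a) ` vec_map n ` L" if "a \<in> carrier ?M" for a
      unfolding image_image
      by (rule image_cong[OF refl]) (use that L vec_map_add in \<open>simp add: subset_iff add.commute\<close>)
    have "inj_on (vec_map n) (carrier ?M)" using vec_map_bij by (simp add: bij_betw_def)
    from inj_on_image_eq_iff[OF this sub[OF a] sub[OF b]]
    show "?f a = ?f b \<longleftrightarrow> (+) (vec_map n a) ` vec_map n ` L = (+) (vec_map n b) ` vec_map n ` L"
      unfolding img[OF a] img[OF b] by simp
  qed
  moreover have "(\<lambda>a. (+) (vec_map n a) ` vec_map n ` L) ` carrier ?M = grp_cosets (Rvecs n) (vec_map n ` L)"
  proof -
    have "Rvecs n = vec_map n ` carrier ?M" using vec_map_bij by (simp add: bij_betw_def)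
    then show ?thesis by (simp only: grp_cosets_def image_image)
  qed
  ultimately show ?thesis by (simp add: grp_index_def)
qed

lemma lattice_zeta_eq:
  assumes "k \<noteq> 0"
  shows "lattice_zeta A (free_module A n) k =
    of_nat (card {L. submod n R L \<and> L \<subseteq> Rvecs n \<and> grp_index (Rvecs n) L = k})"
proof -
  let ?M = "free_module A n"
  let ?A = "{L. submodule L A ?M \<and> finite (a_rcosets\<^bsub>?M\<^esub> L) \<and> card (a_rcosets\<^bsub>?M\<^esub> L) = k}"
  let ?B = "{L. submod n R L \<and> L \<subseteq> Rvecs n \<and> grp_index (Rvecs n) L = k}"
  have carr: "L \<subseteq> carrier ?M" if "submodule L A ?M" for L
    using subgroup.subset[OF submodule.axioms(1)[OF that]] by simp
  have inj: "inj_on (vec_map n) (carrier ?M)" using vec_map_bij by (simp add: bij_betw_def)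
  have bijAB: "bij_betw ((`) (vec_map n)) ?A ?B"
  proof (rule bij_betw_imageI)
    show "inj_on ((`) (vec_map n)) ?A"
      by (rule inj_on_subset[OF inj_on_image_Pow[OF inj]]) (use carr in blast)
    show "(`) (vec_map n) ` ?A = ?B"
    proof (intro equalityI subsetI)
      fix L' assume "L' \<in> (`) (vec_map n) ` ?A"
      then obtain L where L: "L' = vec_map n ` L" "submodule L A ?M" "card (a_rcosets\<^bsub>?M\<^esub> L) = k" by blast
      note c = carr[OF L(2)]
      have "vec_map n ` L \<subseteq> Rvecs n" using c vec_map_mem by blast
      then show "L' \<in> ?B" using L submodule_iff[OF c] card_rcosets[OF c] by simp
    next
      fix L' assume "L' \<in> ?B"
      then have L': "submod n R L'" "L' \<subseteq> Rvecs n" "grp_index (Rvecs n) L' = k" by auto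
      define L where "L = {x \<in> carrier ?M. vec_map n x \<in> L'}"
      have c: "L \<subseteq> carrier ?M" by (auto simp: L_def)
      have img: "vec_map n ` L = L'" using L'(2) vec_map_surj by (fastforce simp: L_def)
      have "card (a_rcosets\<^bsub>?M\<^esub> L) = k" using card_rcosets[OF c] img L'(3) by simp
      moreover from this have "finite (a_rcosets\<^bsub>?M\<^esub> L)" using assms by (intro card_ge_0_finite) simp
      ultimately have "L \<in> ?A" using submodule_iff[OF c] img L'(1) by simp
      then show "L' \<in> (`) (vec_map n) ` ?A" using img by blast
    qed
  qed
  show ?thesis unfolding lattice_zeta_def using bij_betw_same_card[OF bijAB] by simp
qed

lemma lattice_zeta_zero: "lattice_zeta A (free_module A n) 0 = 0"
proof -
  let ?M = "free_module A n"
  have "a_rcosets\<^bsub>?M\<^esub> L \<noteq> {}" for L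
    using free_zero_closed by (auto simp: A_RCOSETS_def RCOSETS_def)
  then have "{L. submodule L A ?M \<and> finite (a_rcosets\<^bsub>?M\<^esub> L) \<and> card (a_rcosets\<^bsub>?M\<^esub> L) = 0} = {}"
    by (simp only: card_0_eq simp_thms cong: conj_cong) simp
  then show ?thesis unfolding lattice_zeta_def by (simp only: card.empty of_nat_0)
qed

end

section \<open>Normalizations inside a product of power series rings\<close>

lemma fls_mult_power_eq_fps:
  fixes f :: "'e::field fls"
  assumes "k \<ge> nat (- fls_subdegree f)"
  shows "\<exists>g. f * fps_to_fls (fps_X ^ k) = fps_to_fls g"
proof
  have "fls_subdegree (f * fls_X ^ k) \<ge> 0"
    using assms by (cases "f = 0") (auto simp: fls_subdegree_mult fls_subdegree_pow)
  then have "fps_to_fls (fls_regpart (f * fls_X ^ k)) = f * fls_X ^ k" by (rule fls_regpart_to_fls_trivial)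
  then show "f * fps_to_fls (fps_X ^ k) = fps_to_fls (fls_regpart (f * fls_X ^ k))"
    by (simp add: fps_to_fls_power)
qed

text \<open>Since \<open>R\<close> contains t^N times the whole product of power series rings, it
  has the same total ring of fractions, a product of Laurent series fields, and the same
  normalization.\<close>

locale power_series_order = ring_model A R \<iota>
  for A :: "('r, 'm) ring_scheme" and R :: "('i::finite \<Rightarrow> 'e::{field,finite} fps) set" and \<iota> :: "'r \<Rightarrow> 'i \<Rightarrow> 'e fps" +
  fixes N :: nat
  assumes conductor: "uniformizer ^ N * s \<in> R"
begin

definition emb :: "('i \<Rightarrow> 'e fps) \<Rightarrow> 'i \<Rightarrow> 'e fls" where
  "emb s = (\<lambda>i. fps_to_fls (s i))"

definition quo :: "'r \<Rightarrow> 'r \<Rightarrow> 'i \<Rightarrow> 'e fls" where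
  "quo a s = (\<lambda>i. fps_to_fls (\<iota> a i) / fps_to_fls (\<iota> s i))"

text \<open>By \<open>fraction_eq_fib\<close> an abstract fraction, which is a set of pairs, is a
  fibre of \<open>quo\<close>. This labels the elements of the total fraction ring by tuples of
  Laurent series.\<close>

definition fib :: "('i \<Rightarrow> 'e fls) \<Rightarrow> ('r \<times> 'r) set" where
  "fib v = {(b, t). b \<in> carrier A \<and> t \<in> regular_elements A \<and> quo b t = v}"

lemma emb_simps: "emb (s + t) = emb s + emb t" "emb (s * t) = emb s * emb t" "emb 0 = 0" "emb 1 = 1"
  by (simp_all add: emb_def fun_eq_iff fls_times_fps_to_fls)

lemma emb_inj: "emb s = emb t \<Longrightarrow> s = t"
  by (simp add: emb_def fun_eq_iff)

text \<open>An element that vanishes at component i is annihilated by t^N times the idempotent of i,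
  a nonzero element of \<open>R\<close>.\<close>

lemma regular_iff: "s \<in> regular_elements A \<longleftrightarrow> s \<in> carrier A \<and> (\<forall>i. \<iota> s i \<noteq> 0)"
proof
  assume s: "s \<in> regular_elements A"
  then have sc: "s \<in> carrier A" by (simp add: regular_elements_def)
  have "\<iota> s i \<noteq> 0" for i
  proof
    assume 0: "\<iota> s i = 0"
    obtain a where a: "a \<in> carrier A" "\<iota> a = uniformizer ^ N * idempotent i" using \<iota>_surj[OF conductor] by blast
    have "\<iota> (a \<otimes>\<^bsub>A\<^esub> s) = \<iota> \<zero>\<^bsub>A\<^esub>"
      unfolding map_mult[OF a(1) sc] map_zero a(2) using 0 by (auto simp: fun_eq_iff idempotent_def)
    then have "a \<otimes>\<^bsub>A\<^esub> s = \<zero>\<^bsub>A\<^esub>" using mult_closed[OF a(1) sc] zero_closed \<iota>_inj by blast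
    then have "a = \<zero>\<^bsub>A\<^esub>" using s a(1) by (simp add: regular_elements_def)
    then have "(uniformizer ^ N * idempotent i) i = (0 :: 'e fps)" using a(2) map_zero by simp
    then show False by (simp add: idempotent_def power_fun_apply uniformizer_def)
  qed
  then show "s \<in> carrier A \<and> (\<forall>i. \<iota> s i \<noteq> 0)" using sc by simp
next
  assume s: "s \<in> carrier A \<and> (\<forall>i. \<iota> s i \<noteq> 0)"
  have "a = \<zero>\<^bsub>A\<^esub>" if a: "a \<in> carrier A" "a \<otimes>\<^bsub>A\<^esub> s = \<zero>\<^bsub>A\<^esub>" for a
  proof -
    have "\<iota> a * \<iota> s = 0" using map_mult[OF a(1), of s] a(2) s map_zero by simp
    then have "\<iota> a i * \<iota> s i = 0" for i by (metis times_fun_apply zero_fun_apply)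
    then have "\<iota> a = \<iota> \<zero>\<^bsub>A\<^esub>" using s by (simp add: map_zero fun_eq_iff)
    then show ?thesis using a(1) zero_closed \<iota>_inj by blast
  qed
  then show "s \<in> regular_elements A" using s by (simp add: regular_elements_def)
qed

lemma one_regular: "\<one>\<^bsub>A\<^esub> \<in> regular_elements A"
  using one_closed map_one by (simp add: regular_iff)

lemma mult_regular: "s \<in> regular_elements A \<Longrightarrow> t \<in> regular_elements A \<Longrightarrow> s \<otimes>\<^bsub>A\<^esub> t \<in> regular_elements A"
  using mult_closed by (auto simp: regular_iff map_mult)

lemma fraction_eq_fib:
  assumes a: "a \<in> carrier A" and s: "s \<in> regular_elements A"
  shows "fraction A a s = fib (quo a s)"
proof -
  have "a \<otimes>\<^bsub>A\<^esub> t = b \<otimes>\<^bsub>A\<^esub> s \<longleftrightarrow> quo b t = quo a s" if b: "b \<in> carrier A" and t: "t \<in> regular_elements A" for b t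
  proof -
    note sc = s[unfolded regular_iff] and tc = t[unfolded regular_iff]
    have "a \<otimes>\<^bsub>A\<^esub> t = b \<otimes>\<^bsub>A\<^esub> s \<longleftrightarrow> \<iota> (a \<otimes>\<^bsub>A\<^esub> t) = \<iota> (b \<otimes>\<^bsub>A\<^esub> s)"
      using \<iota>_inj[OF mult_closed[OF a conjunct1[OF tc]] mult_closed[OF b conjunct1[OF sc]]] by auto
    also have "\<dots> \<longleftrightarrow> (\<forall>i. \<iota> a i * \<iota> t i = \<iota> b i * \<iota> s i)"
      using map_mult[OF a, of t] map_mult[OF b, of s] sc tc by (simp add: fun_eq_iff)
    also have "\<dots> \<longleftrightarrow> quo b t = quo a s"
    proof -
      have "\<iota> a i * \<iota> t i = \<iota> b i * \<iota> s i \<longleftrightarrow> quo b t i = quo a s i" for i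
      proof -
        have "\<iota> a i * \<iota> t i = \<iota> b i * \<iota> s i \<longleftrightarrow> fps_to_fls (\<iota> a i * \<iota> t i) = fps_to_fls (\<iota> b i * \<iota> s i)" by simp
        then show ?thesis using sc tc by (auto simp: quo_def fls_times_fps_to_fls frac_eq_eq)
      qed
      then show ?thesis by (auto simp: fun_eq_iff)
    qed
    finally show ?thesis .
  qed
  then show ?thesis unfolding fraction_def fib_def by blast
qed

text \<open>One power t^k clears the poles of all components, and a further factor t^N in numerator
  and denominator moves both into \<open>R\<close>.\<close>

lemma quo_surj: "\<exists>a\<in>carrier A. \<exists>s\<in>regular_elements A. quo a s = v"
proof -
  define k where "k = (\<Sum>i\<in>UNIV. nat (- fls_subdegree (v i)))"
  have "\<exists>g. v i * fps_to_fls (fps_X ^ k) = fps_to_fls g" for i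
  proof -
    have "nat (- fls_subdegree (v i)) \<le> k" unfolding k_def by (rule member_le_sum) auto
    then show ?thesis by (rule fls_mult_power_eq_fps)
  qed
  then obtain g where g: "\<And>i. v i * fps_to_fls (fps_X ^ k) = fps_to_fls (g i)" by metis
  obtain a where a: "a \<in> carrier A" "\<iota> a = uniformizer ^ N * g" using \<iota>_surj[OF conductor] by blast
  obtain s where s: "s \<in> carrier A" "\<iota> s = uniformizer ^ N * uniformizer ^ k" using \<iota>_surj[OF conductor] by blast
  have "s \<in> regular_elements A" using s by (simp add: regular_iff power_fun_apply uniformizer_def)
  moreover have "quo a s = v"
  proof
    fix i
    have "fps_to_fls (\<iota> a i) = v i * fps_to_fls (\<iota> s i)"
      unfolding a(2) s(2) times_fun_apply fls_times_fps_to_fls g[symmetric]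
      by (simp add: power_fun_apply uniformizer_def mult_ac)
    moreover have "fps_to_fls (\<iota> s i) \<noteq> 0" using \<open>s \<in> regular_elements A\<close> by (simp add: regular_iff)
    ultimately show "quo a s i = v i" by (simp add: quo_def)
  qed
  ultimately show ?thesis using a(1) by blast
qed

lemma fib_nonempty: "\<exists>a s. (a, s) \<in> fib v"
  using quo_surj[of v] by (auto simp: fib_def)

lemma fib_inj: "fib v = fib w \<Longrightarrow> v = w"
  using fib_nonempty[of v] by (auto simp: fib_def)

lemma quo_mult:
  assumes "a \<in> carrier A" "b \<in> carrier A" "s \<in> regular_elements A" "t \<in> regular_elements A"
  shows "quo (a \<otimes>\<^bsub>A\<^esub> b) (s \<otimes>\<^bsub>A\<^esub> t) = quo a s * quo b t"
  using assms by (auto simp: quo_def map_mult regular_iff fun_eq_iff fls_times_fps_to_fls)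

lemma quo_add:
  assumes "a \<in> carrier A" "b \<in> carrier A" "s \<in> regular_elements A" "t \<in> regular_elements A"
  shows "quo (a \<otimes>\<^bsub>A\<^esub> t \<oplus>\<^bsub>A\<^esub> b \<otimes>\<^bsub>A\<^esub> s) (s \<otimes>\<^bsub>A\<^esub> t) = quo a s + quo b t"
  using assms by (auto simp: quo_def map_mult map_add mult_closed regular_iff fun_eq_iff fls_times_fps_to_fls add_frac_eq)

lemma Q_carrier: "carrier (total_fraction_ring A) = range fib"
proof (intro equalityI subsetI)
  fix x assume "x \<in> carrier (total_fraction_ring A)"
  then show "x \<in> range fib" using fraction_eq_fib by (auto simp: total_fraction_ring_def)
next
  fix x assume "x \<in> range fib"
  then obtain v where v: "x = fib v" by blast
  obtain a s where "a \<in> carrier A" "s \<in> regular_elements A" "quo a s = v" using quo_surj by blast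
  then show "x \<in> carrier (total_fraction_ring A)"
    using v fraction_eq_fib[of a s] by (auto simp: total_fraction_ring_def)
qed

lemma UN_fib:
  assumes "\<And>a s b t. (a, s) \<in> fib v \<Longrightarrow> (b, t) \<in> fib w \<Longrightarrow> F a s b t = Z"
  shows "(\<Union>(a, s)\<in>fib v. \<Union>(b, t)\<in>fib w. F a s b t) = Z"
proof -
  obtain a s b t where "(a, s) \<in> fib v" "(b, t) \<in> fib w" using fib_nonempty by metis
  then show ?thesis using assms by fast
qed

lemma Q_mult: "fib v \<otimes>\<^bsub>total_fraction_ring A\<^esub> fib w = fib (v * w)"
proof -
  have "fraction A (a \<otimes>\<^bsub>A\<^esub> b) (s \<otimes>\<^bsub>A\<^esub> t) = fib (v * w)" if "(a, s) \<in> fib v" "(b, t) \<in> fib w" for a s b t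
  proof -
    have *: "a \<in> carrier A" "b \<in> carrier A" "s \<in> regular_elements A" "t \<in> regular_elements A" "quo a s = v" "quo b t = w"
      using that by (auto simp: fib_def)
    show ?thesis using fraction_eq_fib[OF mult_closed[OF *(1,2)] mult_regular[OF *(3,4)]] quo_mult[OF *(1-4)] *(5,6) by simp
  qed
  then show ?thesis by (simp add: total_fraction_ring_def UN_fib)
qed

lemma Q_add: "fib v \<oplus>\<^bsub>total_fraction_ring A\<^esub> fib w = fib (v + w)"
proof -
  have "fraction A (a \<otimes>\<^bsub>A\<^esub> t \<oplus>\<^bsub>A\<^esub> b \<otimes>\<^bsub>A\<^esub> s) (s \<otimes>\<^bsub>A\<^esub> t) = fib (v + w)" if "(a, s) \<in> fib v" "(b, t) \<in> fib w" for a s b t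
  proof -
    have *: "a \<in> carrier A" "b \<in> carrier A" "s \<in> regular_elements A" "t \<in> regular_elements A" "quo a s = v" "quo b t = w"
      using that by (auto simp: fib_def)
    have st: "s \<in> carrier A" "t \<in> carrier A" using *(3,4) by (simp_all add: regular_iff)
    have "a \<otimes>\<^bsub>A\<^esub> t \<oplus>\<^bsub>A\<^esub> b \<otimes>\<^bsub>A\<^esub> s \<in> carrier A" using * st by (intro add_closed mult_closed)
    from fraction_eq_fib[OF this mult_regular[OF *(3,4)]] show ?thesis using quo_add[OF *(1-4)] *(5,6) by simp
  qed
  then show ?thesis by (simp add: total_fraction_ring_def UN_fib)
qed

lemma quo_one: "quo a \<one>\<^bsub>A\<^esub> = emb (\<iota> a)"
  by (simp add: quo_def emb_def map_one)

lemma Q_one: "\<one>\<^bsub>total_fraction_ring A\<^esub> = fib 1"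
proof -
  have "\<one>\<^bsub>total_fraction_ring A\<^esub> = fraction A \<one>\<^bsub>A\<^esub> \<one>\<^bsub>A\<^esub>" by (simp add: total_fraction_ring_def)
  also have "\<dots> = fib 1"
    using fraction_eq_fib[OF one_closed one_regular] unfolding quo_one map_one emb_simps .
  finally show ?thesis .
qed

lemma Q_zero: "\<zero>\<^bsub>total_fraction_ring A\<^esub> = fib 0"
  using fraction_eq_fib[OF zero_closed one_regular]
  unfolding quo_one map_zero emb_simps by (simp add: total_fraction_ring_def)

lemma Q_cring: "cring (total_fraction_ring A)"
proof -
  let ?K = "ring_of_type_algebra :: ('i \<Rightarrow> 'e fls) ring"
  have "fib \<in> ring_iso ?K (total_fraction_ring A)"
    unfolding ring_iso_def ring_hom_def
    using fib_inj by (auto simp: ring_of_type_algebra_def Q_carrier Q_mult Q_add Q_one bij_betw_def inj_on_def)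
  \<comment> \<open>The transported ring has its zero replaced by the image of 0, which already is
    the zero of \<open>total_fraction_ring\<close>.\<close>
  from cring.ring_iso_imp_img_cring[OF cring_from_type_algebra this]
  have "cring (total_fraction_ring A\<lparr>zero := fib \<zero>\<^bsub>?K\<^esub>\<rparr>)" .
  moreover have z: "\<zero>\<^bsub>?K\<^esub> = 0" by (simp only: ring_of_type_algebra_def ring.select_convs)
  have "total_fraction_ring A\<lparr>zero := fib \<zero>\<^bsub>?K\<^esub>\<rparr> = total_fraction_ring A"
    unfolding z Q_zero[symmetric] by simp
  ultimately show ?thesis by (simp only:)
qed

lemma Q_pow: "fib v [^]\<^bsub>total_fraction_ring A\<^esub> (d::nat) = fib (v ^ d)"
proof (induction d)
  interpret Q: cring "total_fraction_ring A" by (rule Q_cring)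
  case 0
  show ?case unfolding Q.nat_pow_0 power_0 Q_one ..
next
  case (Suc d)
  interpret Q: cring "total_fraction_ring A" by (rule Q_cring)
  show ?case unfolding Q.nat_pow_Suc Suc.IH Q_mult power_Suc2 ..
qed

lemma Q_finsum: "(\<Oplus>\<^bsub>total_fraction_ring A\<^esub>i\<in>{..<d::nat}. fib (f i)) = fib (\<Sum>i<d. f i)"
proof (induction d)
  interpret Q: cring "total_fraction_ring A" by (rule Q_cring)
  case 0
  show ?case unfolding lessThan_0 Q.finsum_empty sum.empty Q_zero ..
next
  interpret Q: cring "total_fraction_ring A" by (rule Q_cring)
  case (Suc d)
  have "(\<Oplus>\<^bsub>total_fraction_ring A\<^esub>i\<in>{..<Suc d}. fib (f i)) =
      fib (f d) \<oplus>\<^bsub>total_fraction_ring A\<^esub> (\<Oplus>\<^bsub>total_fraction_ring A\<^esub>i\<in>{..<d}. fib (f i))"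
    unfolding lessThan_Suc by (rule Q.finsum_insert) (auto simp: Q_carrier)
  also have "\<dots> = fib (f d + (\<Sum>i<d. f i))" unfolding Suc.IH Q_add ..
  also have "f d + (\<Sum>i<d. f i) = (\<Sum>i<Suc d. f i)" by (simp only: sum.lessThan_Suc add.commute)
  finally show ?case .
qed

lemma integral_iff:
  "integral_over (total_fraction_ring A) ((\<lambda>a. fraction A a \<one>\<^bsub>A\<^esub>) ` carrier A) (fib v) \<longleftrightarrow>
    (\<exists>(d::nat) c. (\<forall>i<d. c i \<in> R) \<and> v ^ d + (\<Sum>i<d. emb (c i) * v ^ i) = 0)"
proof
  have img: "(\<lambda>a. fraction A a \<one>\<^bsub>A\<^esub>) ` carrier A = (\<lambda>r. fib (emb r)) ` R"
  proof -
    have "(\<lambda>a. fraction A a \<one>\<^bsub>A\<^esub>) ` carrier A = (\<lambda>a. fib (emb (\<iota> a))) ` carrier A"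
      by (rule image_cong[OF refl]) (simp add: fraction_eq_fib one_regular quo_one)
    also have "\<dots> = (\<lambda>r. fib (emb r)) ` R"
      unfolding bij_betw_imp_surj_on[OF bij, symmetric] image_image ..
    finally show ?thesis .
  qed
  have eq: "fib v [^]\<^bsub>total_fraction_ring A\<^esub> d \<oplus>\<^bsub>total_fraction_ring A\<^esub>
      (\<Oplus>\<^bsub>total_fraction_ring A\<^esub>i\<in>{..<d}. C i \<otimes>\<^bsub>total_fraction_ring A\<^esub> fib v [^]\<^bsub>total_fraction_ring A\<^esub> i)
      = fib (v ^ d + (\<Sum>i<d. emb (c i) * v ^ i))" if C: "\<And>i. i < d \<Longrightarrow> C i = fib (emb (c i))" for d :: nat and C c
  proof -
    interpret Q: cring "total_fraction_ring A" by (rule Q_cring)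
    have "(\<Oplus>\<^bsub>total_fraction_ring A\<^esub>i\<in>{..<d}. C i \<otimes>\<^bsub>total_fraction_ring A\<^esub> fib v [^]\<^bsub>total_fraction_ring A\<^esub> i)
        = (\<Oplus>\<^bsub>total_fraction_ring A\<^esub>i\<in>{..<d}. fib (emb (c i) * v ^ i))"
      by (rule Q.finsum_cong') (auto simp: C Q_mult Q_pow Q_carrier)
    then show ?thesis by (simp add: Q_finsum Q_pow Q_add)
  qed
  {
    assume "integral_over (total_fraction_ring A) ((\<lambda>a. fraction A a \<one>\<^bsub>A\<^esub>) ` carrier A) (fib v)"
    then obtain d :: nat and C where C: "\<forall>i<d. C i \<in> (\<lambda>r. fib (emb r)) ` R"
      "fib v [^]\<^bsub>total_fraction_ring A\<^esub> d \<oplus>\<^bsub>total_fraction_ring A\<^esub>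
      (\<Oplus>\<^bsub>total_fraction_ring A\<^esub>i\<in>{..<d}. C i \<otimes>\<^bsub>total_fraction_ring A\<^esub> fib v [^]\<^bsub>total_fraction_ring A\<^esub> i) = fib 0"
      unfolding integral_over_def img Q_zero by blast
    then have "\<forall>i. \<exists>r. i < d \<longrightarrow> r \<in> R \<and> C i = fib (emb r)" by blast
    then obtain c where c: "\<And>i. i < d \<Longrightarrow> c i \<in> R \<and> C i = fib (emb (c i))" by metis
    have "fib (v ^ d + (\<Sum>i<d. emb (c i) * v ^ i)) = fib 0"
      using eq[of d C c] c C(2) by simp
    then have "v ^ d + (\<Sum>i<d. emb (c i) * v ^ i) = 0" by (rule fib_inj)
    then show "\<exists>(d::nat) c. (\<forall>i<d. c i \<in> R) \<and> v ^ d + (\<Sum>i<d. emb (c i) * v ^ i) = 0" using c by blast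
  }
  {
    assume "\<exists>(d::nat) c. (\<forall>i<d. c i \<in> R) \<and> v ^ d + (\<Sum>i<d. emb (c i) * v ^ i) = 0"
    then obtain d :: nat and c where c: "\<forall>i<d. c i \<in> R" "v ^ d + (\<Sum>i<d. emb (c i) * v ^ i) = 0" by blast
    show "integral_over (total_fraction_ring A) ((\<lambda>a. fraction A a \<one>\<^bsub>A\<^esub>) ` carrier A) (fib v)"
      unfolding integral_over_def img Q_zero
      by (rule exI[of _ d], rule exI[of _ "\<lambda>i. fib (emb (c i))"]) (use c eq[of d _ c] in auto)
  }
qed

text \<open>If a component of v had a pole, its inverse y would be a power series with constant term
  zero. Dividing the equation by v^d gives 1 + sum of c_i y^(d-i) = 0, which is false in degree
  zero.\<close>

lemma integrally_closed:
  assumes "v ^ d + (\<Sum>i<d. emb (c i) * v ^ i) = 0"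
  shows "v \<in> range emb"
proof -
  have "\<exists>s. v j = fps_to_fls s" for j
  proof (rule ccontr)
    assume *: "\<not> (\<exists>s. v j = fps_to_fls s)"
    let ?v = "v j"
    have neg: "fls_subdegree ?v < 0"
    proof (rule ccontr)
      assume "\<not> fls_subdegree ?v < 0"
      then have "fps_to_fls (fls_regpart ?v) = ?v" by (intro fls_regpart_to_fls_trivial) simp
      then show False using * by metis
    qed
    then have v0: "?v \<noteq> 0" by auto
    define y where "y = fls_regpart (inverse ?v)"
    have sy: "fls_subdegree (inverse ?v) > 0" using neg v0 by (simp add: fls_inverse_subdegree)
    then have y: "fps_to_fls y = inverse ?v" unfolding y_def by (intro fls_regpart_to_fls_trivial) simp
    have y0: "fps_nth y 0 = 0"
      using fls_eq0_below_subdegree[of 0 "inverse ?v"] sy by (simp add: y_def)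
    have "?v ^ d + (\<Sum>i<d. fps_to_fls (c i j) * ?v ^ i) = 0"
      using fun_cong[OF assms, of j] by (simp add: sum_fun_apply power_fun_apply emb_def)
    then have "inverse ?v ^ d * (?v ^ d + (\<Sum>i<d. fps_to_fls (c i j) * ?v ^ i)) = 0" by simp
    moreover have "inverse ?v ^ d * ?v ^ i = inverse ?v ^ (d - i)" if "i \<le> d" for i
      using v0 that by (simp add: power_inverse power_diff field_simps)
    ultimately have "1 + (\<Sum>i<d. fps_to_fls (c i j) * inverse ?v ^ (d - i)) = 0"
      by (simp add: distrib_left sum_distrib_left mult.left_commute[of "inverse ?v ^ d"])
    then have "fps_to_fls (1 + (\<Sum>i<d. c i j * y ^ (d - i))) = 0"
    proof -
      have "fps_to_fls (\<Sum>i<k. c i j * y ^ (d - i)) = (\<Sum>i<k. fps_to_fls (c i j) * inverse ?v ^ (d - i))" for k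
        by (induction k) (simp_all add: fls_times_fps_to_fls fps_to_fls_power y)
      then show ?thesis using \<open>1 + (\<Sum>i<d. fps_to_fls (c i j) * inverse ?v ^ (d - i)) = 0\<close> by simp
    qed
    then have "1 + (\<Sum>i<d. c i j * y ^ (d - i)) = 0" by (simp only: fps_to_fls_eq_0_iff)
    then have "fps_nth (1 + (\<Sum>i<d. c i j * y ^ (d - i))) 0 = 0" by (simp only: fps_zero_nth)
    moreover have "fps_nth (\<Sum>i<d. c i j * y ^ (d - i)) 0 = 0"
      unfolding fps_sum_nth by (intro sum.neutral ballI) (simp add: fps_nth_power_0 y0)
    ultimately show False by (simp only: fps_add_nth) simp
  qed
  then obtain s where "\<And>j. v j = fps_to_fls (s j)" by metis
  then have "v = emb s" by (simp add: emb_def fun_eq_iff)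
  then show ?thesis by blast
qed

text \<open>Two powers of \<open>s\<close> agree modulo the conductor because the quotient is finite.\<close>

lemma integral_power_series: "\<exists>(d::nat) c. (\<forall>i<d. c i \<in> R) \<and> emb s ^ d + (\<Sum>i<d. emb (c i) * emb s ^ i) = 0"
proof -
  let ?I = "range ((*) (uniformizer ^ N :: 'i \<Rightarrow> 'e fps))"
  have sub: "add_subgroup ?I"
  proof (rule add_subgroupI)
    show "0 \<in> ?I" by (rule range_eqI[of _ _ 0]) simp
    fix x y assume "x \<in> ?I" "y \<in> ?I"
    then obtain u w where "x = uniformizer ^ N * u" "y = uniformizer ^ N * w" by blast
    then have eq: "x - y = uniformizer ^ N * (u - w)" by (simp only: right_diff_distrib)
    show "x - y \<in> ?I" unfolding eq by (rule rangeI)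
  qed
  have "finite (grp_cosets UNIV ?I)"
    using grp_index_uniformizer[of N, where 'i = 'i and 'e = 'e]
    by (intro card_ge_0_finite) (simp only: grp_index_def, simp)
  moreover have "(\<lambda>j. (+) (s ^ Suc j) ` ?I) ` UNIV \<subseteq> grp_cosets UNIV ?I" by (auto simp: grp_cosets_def)
  ultimately have "\<not> inj_on (\<lambda>j. (+) (s ^ Suc j) ` ?I) (UNIV :: nat set)"
    using finite_imageD finite_subset infinite_UNIV_nat by blast
  then obtain a b :: nat where ab: "a < b" "(+) (s ^ Suc b) ` ?I = (+) (s ^ Suc a) ` ?I"
    unfolding inj_on_def by (metis nat_neq_iff)
  then have "s ^ Suc b - s ^ Suc a \<in> ?I" using coset_eq_iff[OF sub] by blast
  then obtain u where "s ^ Suc b - s ^ Suc a = uniformizer ^ N * u" by (rule rangeE)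
  then have r: "s ^ Suc b - s ^ Suc a \<in> R" using conductor[of u] by (simp only:)
  define r where "r = s ^ Suc b - s ^ Suc a"
  have "1 \<in> R" using \<iota>_R[OF one_closed] map_one by simp
  \<comment> \<open>The polynomial is Z^(b+1) - Z^(a+1) - r. The exponents start at 1 so that the
    coefficients -1 and -r occupy different positions.\<close>
  define c where "c i = (if i = 0 then - r else if i = Suc a then - 1 else 0)" for i
  have neg: "- x \<in> R" if "x \<in> R" for x using R_diff[OF zero_R that] by simp
  have cR: "c i \<in> R" for i using neg[OF r[folded r_def]] neg[OF \<open>1 \<in> R\<close>] zero_R by (simp add: c_def)
  have "(\<Sum>i<Suc b. c i * s ^ i) = - r - s ^ Suc a"
  proof -
    have "(\<Sum>i<Suc b. c i * s ^ i) = (\<Sum>i<Suc b. (if i = 0 then - r else 0) + (if i = Suc a then - (s ^ Suc a) else 0))"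
      by (rule sum.cong) (auto simp: c_def)
    then show ?thesis using ab(1) by (simp only: sum.distrib sum.delta finite_lessThan) simp
  qed
  then have 0: "s ^ Suc b + (\<Sum>i<Suc b. c i * s ^ i) = 0" by (simp add: r_def)
  have pow: "emb (s ^ k) = emb s ^ k" for k
  proof (induction k)
    case (Suc k)
    then show ?case by (simp only: power_Suc emb_simps)
  qed (simp only: power_0 emb_simps)
  have "emb (\<Sum>i<k. c i * s ^ i) = (\<Sum>i<k. emb (c i) * emb s ^ i)" for k
  proof (induction k)
    case (Suc k)
    then show ?case by (simp only: sum.lessThan_Suc emb_simps pow)
  qed (simp only: lessThan_0 sum.empty emb_simps)
  then have "emb s ^ Suc b + (\<Sum>i<Suc b. emb (c i) * emb s ^ i) = emb 0"
    unfolding 0[symmetric] emb_simps(1) pow by (simp only:)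
  then show ?thesis using cR unfolding emb_simps(3) by blast
qed

lemma normalization_carrier: "carrier (normalization A) = (\<lambda>s. fib (emb s)) ` UNIV"
proof (intro equalityI subsetI)
  fix x assume "x \<in> carrier (normalization A)"
  then obtain v where v: "x = fib v" "integral_over (total_fraction_ring A) ((\<lambda>a. fraction A a \<one>\<^bsub>A\<^esub>) ` carrier A) (fib v)"
    unfolding normalization_def Let_def by (auto simp: Q_carrier)
  then have "v \<in> range emb" unfolding integral_iff using integrally_closed by blast
  then show "x \<in> (\<lambda>s. fib (emb s)) ` UNIV" using v(1) by blast
next
  fix x assume "x \<in> (\<lambda>s. fib (emb s)) ` UNIV"
  then obtain s where s: "x = fib (emb s)" by blast
  have "integral_over (total_fraction_ring A) ((\<lambda>a. fraction A a \<one>\<^bsub>A\<^esub>) ` carrier A) (fib (emb s))"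
    unfolding integral_iff by (rule integral_power_series)
  then show "x \<in> carrier (normalization A)" unfolding s normalization_def Let_def by (simp add: Q_carrier)
qed

definition norm_map :: "('r \<times> 'r) set \<Rightarrow> 'i \<Rightarrow> 'e fps" where
  "norm_map x = (THE s. x = fib (emb s))"

lemma norm_map_fib: "norm_map (fib (emb s)) = s"
  unfolding norm_map_def by (rule the_equality) (auto dest!: fib_inj emb_inj)

lemma ring_model_normalization: "ring_model (normalization A) UNIV norm_map"
proof
  show "bij_betw norm_map (carrier (normalization A)) UNIV"
  proof (rule bij_betw_imageI)
    show "inj_on norm_map (carrier (normalization A))"
      unfolding normalization_carrier by (rule inj_onI) (auto simp: norm_map_fib)
    have "s \<in> norm_map ` carrier (normalization A)" for s
      unfolding normalization_carrier by (rule image_eqI[of _ _ "fib (emb s)"]) (simp_all add: norm_map_fib)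
    then show "norm_map ` carrier (normalization A) = UNIV" by blast
  qed
  have ops: "fib v \<oplus>\<^bsub>normalization A\<^esub> fib w = fib (v + w)" "fib v \<otimes>\<^bsub>normalization A\<^esub> fib w = fib (v * w)"
    "\<zero>\<^bsub>normalization A\<^esub> = fib 0" "\<one>\<^bsub>normalization A\<^esub> = fib 1" for v w
    using Q_add Q_mult Q_zero Q_one by (simp_all add: normalization_def Let_def)
  show "\<zero>\<^bsub>normalization A\<^esub> \<in> carrier (normalization A)" "\<one>\<^bsub>normalization A\<^esub> \<in> carrier (normalization A)"
    unfolding normalization_carrier ops by (metis emb_simps(3) rangeI, metis emb_simps(4) rangeI)
  show "norm_map \<zero>\<^bsub>normalization A\<^esub> = 0" "norm_map \<one>\<^bsub>normalization A\<^esub> = 1"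
    unfolding ops using norm_map_fib[of 0] norm_map_fib[of 1] by (simp_all add: emb_simps)
  fix a b assume "a \<in> carrier (normalization A)" "b \<in> carrier (normalization A)"
  then obtain s t where st: "a = fib (emb s)" "b = fib (emb t)" unfolding normalization_carrier by blast
  show "a \<oplus>\<^bsub>normalization A\<^esub> b \<in> carrier (normalization A)" "a \<otimes>\<^bsub>normalization A\<^esub> b \<in> carrier (normalization A)"
    unfolding normalization_carrier st ops emb_simps[symmetric] by blast+
  show "norm_map (a \<oplus>\<^bsub>normalization A\<^esub> b) = norm_map a + norm_map b"
    "norm_map (a \<otimes>\<^bsub>normalization A\<^esub> b) = norm_map a * norm_map b"
    unfolding st ops emb_simps[symmetric] norm_map_fib by simp_all
qed simp

end

section \<open>Gorenstein orders with a coefficient field\<close>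

definition const_emb :: "('f \<Rightarrow> 'e) \<Rightarrow> 'f \<Rightarrow> 'i \<Rightarrow> 'e::field fps" where
  "const_emb \<phi> a = (\<lambda>_. fps_const (\<phi> a))"

definition dot :: "nat \<Rightarrow> (nat \<Rightarrow> 's::comm_ring_1) \<Rightarrow> (nat \<Rightarrow> 's) \<Rightarrow> 's" where
  "dot n x v = (\<Sum>a<n. x a * v a)"

lemma dot_diff_left: "dot n (x - y) v = dot n x v - dot n y v"
  by (simp add: dot_def left_diff_distrib sum_subtractf)

lemma dot_diff_right: "dot n x (v - w) = dot n x v - dot n x w"
  by (simp add: dot_def right_diff_distrib sum_subtractf)

lemma dot_zero_right: "dot n x 0 = 0"
  by (simp add: dot_def)

lemma dot_vscale_left: "dot n (vscale r x) v = r * dot n x v"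
  by (simp add: dot_def sum_distrib_left mult.assoc)

lemma dot_vscale_right: "dot n x (vscale r v) = r * dot n x v"
  by (simp add: dot_def sum_distrib_left mult_ac)

text \<open>The double count of \<open>perfect_pairing\<close> with its truncated subtractions
  resolved: the equation reads (q - 1) d a = (q - 1) b.\<close>

lemma double_count_solve:
  fixes a b d q :: nat
  assumes eq: "d * (q * a) + (b - d) * a = q * b + (a - 1) * b" and le: "d \<le> b" "a \<ge> 1" and q: "q > 1"
  shows "d * a = b"
proof -
  obtain a' b' where ab: "a = Suc a'" "b = d + b'"
    using le by (metis One_nat_def Suc_le_D le_iff_add)
  have "int (d * (q * a) + (b - d) * a) = int (q * b + (a - 1) * b)" using eq by (rule arg_cong)
  then have "(int q - 1) * (int d * int a) = (int q - 1) * int b"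
    unfolding ab by (simp add: algebra_simps)
  then have "int d * int a = int b" using q by simp
  then show ?thesis by (metis of_nat_eq_iff of_nat_mult)
qed

text \<open>The functional \<open>\<tau>\<close> exhibits \<open>R\<close> as a Gorenstein order: it induces a perfect pairing
  modulo the conductor under which \<open>R\<close> is its own orthogonal complement.\<close>

locale gorenstein_order =
  fixes \<phi> :: "'f::{field,finite} \<Rightarrow> 'e::{field,finite}" and R :: "('i::finite \<Rightarrow> 'e fps) set"
    and \<tau> :: "('i \<Rightarrow> 'e fps) \<Rightarrow> 'k::ab_group_add" and N :: nat
  assumes phi_diff: "\<phi> (a - b) = \<phi> a - \<phi> b" and phi_mult: "\<phi> (a * b) = \<phi> a * \<phi> b" and phi_one: "\<phi> 1 = 1"
    and R_diff: "r \<in> R \<Longrightarrow> r' \<in> R \<Longrightarrow> r - r' \<in> R" and R_mult: "r \<in> R \<Longrightarrow> r' \<in> R \<Longrightarrow> r * r' \<in> R"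
    and R_one: "1 \<in> R" and R_const: "const_emb \<phi> a \<in> R" and R_conductor: "uniformizer ^ N * s \<in> R"
    and tau_diff: "\<tau> (x - y) = \<tau> x - \<tau> y"
    and tau_range: "card (range \<tau>) = CARD('f)"
    and tau_scalar: "\<tau> s \<noteq> 0 \<Longrightarrow> \<exists>a. \<tau> (const_emb \<phi> a * s) = \<tau> y"
    and tau_R: "s \<in> R \<longleftrightarrow> (\<forall>r\<in>R. \<tau> (r * s) = 0)"
    and tau_perfect: "(\<And>y. \<tau> (x * y) = 0) \<Longrightarrow> x \<in> range ((*) (uniformizer ^ N))"
begin

abbreviation cond :: "'i \<Rightarrow> 'e fps" where "cond \<equiv> uniformizer ^ N"

lemma tau_zero: "\<tau> 0 = 0"
  using tau_diff[of 0 0] by simp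

lemma tau_on_R: "r \<in> R \<Longrightarrow> \<tau> r = 0"
  using tau_R[of r] R_one by (metis mult_1)

lemma mem_cond_vecs:
  fixes x :: "nat \<Rightarrow> 'i \<Rightarrow> 'e fps"
  assumes "x \<in> vecs n" "\<And>j. j < n \<Longrightarrow> x j \<in> range ((*) cond)"
  shows "x \<in> vscale cond ` vecs n"
proof -
  have "\<exists>y. j < n \<longrightarrow> x j = cond * y" for j using assms(2)[of j] by blast
  then obtain y where y: "\<And>j. j < n \<Longrightarrow> x j = cond * y j" by metis
  have "x = vscale cond (\<lambda>j. if j < n then y j else 0)"
    using y assms(1) by (intro ext) (simp add: vecs_def vscale_def)
  moreover have "(\<lambda>j. if j < n then y j else 0) \<in> vecs n" by (simp add: vecs_def)
  ultimately show ?thesis by (rule image_eqI)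
qed

lemma tau_cond_dot:
  assumes "x \<in> vscale cond ` vecs n"
  shows "\<tau> (dot n x v) = 0" "\<tau> (dot n v x) = 0"
proof -
  obtain y where y: "x = vscale cond y" using assms by blast
  show "\<tau> (dot n x v) = 0" unfolding y dot_vscale_left by (rule tau_on_R[OF R_conductor])
  show "\<tau> (dot n v x) = 0" unfolding y dot_vscale_right by (rule tau_on_R[OF R_conductor])
qed

lemma kernel_index:
  assumes W: "add_subgroup W" and lam: "\<And>x y. lam (x - y) = lam x - (lam y :: 'k)"
    and img: "lam ` W = range \<tau>"
  shows "grp_index W {x \<in> W. lam x = 0} = CARD('f)" "add_subgroup {x \<in> W. lam x = 0}"
proof -
  have lam0: "lam 0 = 0" using lam[of 0 0] by simp
  show s: "add_subgroup {x \<in> W. lam x = 0}"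
    by (rule add_subgroupI) (use lam0 lam add_subgroup_zero[OF W] add_subgroup_diff[OF W] in auto)
  have "grp_index W {x \<in> W. lam x = 0} = grp_index (range \<tau>) {0}"
    by (rule grp_index_transfer[OF s add_subgroup_singleton_zero img])
       (use lam add_subgroup_diff[OF W] in auto)
  then show "grp_index W {x \<in> W. lam x = 0} = CARD('f)" by (simp add: grp_index_zero_right tau_range)
qed

text \<open>A functional with values in the image of \<open>\<tau>\<close> is zero or takes all of
  these values, and then its kernel has index |F|. The count is multiplied by |F| to stay within the
  natural numbers.\<close>

lemma card_kernel_transversal:
  fixes W :: "(nat \<Rightarrow> 'i \<Rightarrow> 'e fps) set"
  assumes W: "add_subgroup W" "\<And>a x. x \<in> W \<Longrightarrow> vscale (const_emb \<phi> a) x \<in> W"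
    and C: "vscale cond ` vecs n \<subseteq> W"
    and T: "\<And>a. a \<in> W \<Longrightarrow> \<exists>t\<in>T. a - t \<in> vscale cond ` vecs n"
      "\<And>s t. s \<in> T \<Longrightarrow> t \<in> T \<Longrightarrow> s - t \<in> vscale cond ` vecs n \<Longrightarrow> s = t" and TW: "T \<subseteq> W"
    and lam: "\<And>x y. lam (x - y) = lam x - (lam y :: 'k)"
      "\<And>x. x \<in> vscale cond ` vecs n \<Longrightarrow> lam x = 0"
      "\<And>x. \<exists>s. \<forall>a. lam (vscale (const_emb \<phi> a) x) = \<tau> (const_emb \<phi> a * s) \<and> lam x = \<tau> s"
  shows "CARD('f) * card {t \<in> T. lam t = 0} =
    (if \<forall>x\<in>W. lam x = 0 then CARD('f) * card T else card T)"
proof (cases "\<forall>x\<in>W. lam x = 0")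
  case True
  then have "{t \<in> T. lam t = 0} = T" using TW by blast
  then show ?thesis using True by simp
next
  case False
  then obtain x0 where x0: "x0 \<in> W" "lam x0 \<noteq> 0" by blast
  let ?C = "vscale cond ` vecs n"
  have Cs: "add_subgroup ?C" by (rule submodD(1)[OF submod_vscale_image[OF submod_vecs]])
  have img: "lam ` W = range \<tau>"
  proof (intro equalityI subsetI)
    fix k assume "k \<in> lam ` W"
    then show "k \<in> range \<tau>" using lam(3) by blast
  next
    fix k assume "k \<in> range \<tau>"
    then obtain y where y: "k = \<tau> y" by blast
    obtain s where s: "\<And>a. lam (vscale (const_emb \<phi> a) x0) = \<tau> (const_emb \<phi> a * s) \<and> lam x0 = \<tau> s"
      using lam(3)[of x0] by blast
    obtain a where "\<tau> (const_emb \<phi> a * s) = \<tau> y" using tau_scalar[of s y] s x0(2) by auto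
    then have "lam (vscale (const_emb \<phi> a) x0) = k" using s[of a] y by simp
    then show "k \<in> lam ` W" using W(2)[OF x0(1), of a] by blast
  qed
  note K = kernel_index[OF W(1) lam(1) img]
  let ?K = "{x \<in> W. lam x = 0}"
  have CK: "?C \<subseteq> ?K" using C lam(2) by blast
  have "card {t \<in> T. t \<in> ?K} = grp_index ?K ?C"
    by (rule card_transversal_Int[OF Cs K(2) CK _ T]) auto
  moreover have "{t \<in> T. t \<in> ?K} = {t \<in> T. lam t = 0}" using TW by blast
  moreover have "card T = grp_index W ?C"
    by (rule grp_index_eq_card_transversal[OF Cs TW T, symmetric])
  moreover have "grp_index W ?C = CARD('f) * grp_index ?K ?C"
    using grp_index_mult[OF K(2) Cs W(1) CK] K(1) by simp
  ultimately show ?thesis unfolding if_not_P[OF False] by (simp only:)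
qed

text \<open>Count the pairs (x, v) in L/C times V/C with \<open>\<tau>\<close> (x . v) = 0. For
  fixed v all x qualify if v is in the dual D, otherwise a fraction 1/q of them; for fixed x all v
  qualify iff x is in C, as the pairing on V/C is nondegenerate. With a = (L : C), b = (V : C), d =
  (D : C) this gives d a = b, that is, d = (V : L).\<close>

lemma perfect_pairing:
  fixes L :: "(nat \<Rightarrow> 'i \<Rightarrow> 'e fps) set"
  assumes L: "submod n R L" and CL: "vscale cond ` vecs n \<subseteq> L"
  shows "grp_index {v \<in> vecs n. \<forall>x\<in>L. (\<Sum>a<n. x a * v a) \<in> R} (vscale cond ` vecs n) = grp_index (vecs n) L"
proof -
  let ?V = "vecs n :: (nat \<Rightarrow> 'i \<Rightarrow> 'e fps) set" and ?C = "vscale cond ` vecs n :: (nat \<Rightarrow> 'i \<Rightarrow> 'e fps) set"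
  let ?D = "{v \<in> ?V. \<forall>x\<in>L. (\<Sum>a<n. x a * v a) \<in> R}"
  let ?q = "CARD('f)"
  note Ls = submodD[OF L]
  have Cs: "submod n UNIV ?C" by (rule submod_vscale_image[OF submod_vecs])
  note C = submodD(1,2)[OF Cs]
  \<comment> \<open>Since L is an R-module, vanishing of \<open>\<tau>\<close> on all products x . v
    already forces them into \<open>R\<close>, by \<open>tau_R\<close>.\<close>
  have D_eq: "?D = {v \<in> ?V. \<forall>x\<in>L. \<tau> (dot n x v) = 0}"
  proof (intro Collect_cong conj_cong refl)
    fix v
    show "(\<forall>x\<in>L. (\<Sum>a<n. x a * v a) \<in> R) \<longleftrightarrow> (\<forall>x\<in>L. \<tau> (dot n x v) = 0)"
    proof
      assume "\<forall>x\<in>L. (\<Sum>a<n. x a * v a) \<in> R"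
      then show "\<forall>x\<in>L. \<tau> (dot n x v) = 0" using tau_on_R by (simp add: dot_def)
    next
      assume *: "\<forall>x\<in>L. \<tau> (dot n x v) = 0"
      have "dot n x v \<in> R" if "x \<in> L" for x
        unfolding tau_R[of "dot n x v"] dot_vscale_left[symmetric] using * Ls(3) that by blast
      then show "\<forall>x\<in>L. (\<Sum>a<n. x a * v a) \<in> R" by (simp add: dot_def)
    qed
  qed
  have Dsub: "add_subgroup ?D"
    unfolding D_eq
    by (rule add_subgroupI)
       (auto simp: dot_diff_right tau_diff add_subgroup_diff[OF add_subgroup_vecs] add_subgroup_zero[OF add_subgroup_vecs] tau_zero dot_zero_right)
  have CD: "?C \<subseteq> ?D" unfolding D_eq using C(2) tau_cond_dot(2) by blast
  have Vidx: "grp_index ?V ?C \<noteq> 0" unfolding grp_index_uniformizer_power_vecs by simp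
  have VL: "grp_index ?V ?C = grp_index ?V L * grp_index L ?C"
    by (rule grp_index_mult[OF Ls(1) C(1) add_subgroup_vecs CL Ls(2)])
  have VD: "grp_index ?V ?C = grp_index ?V ?D * grp_index ?D ?C"
    by (rule grp_index_mult[OF Dsub C(1) add_subgroup_vecs CD]) blast
  obtain TL where TL: "TL \<subseteq> L" "card TL = grp_index L ?C"
    "\<And>a. a \<in> L \<Longrightarrow> \<exists>t\<in>TL. a - t \<in> ?C" "\<And>s t. s \<in> TL \<Longrightarrow> t \<in> TL \<Longrightarrow> s - t \<in> ?C \<Longrightarrow> s = t"
    using transversal_exists[OF C(1), of L] by metis
  obtain TV where TV: "TV \<subseteq> ?V" "card TV = grp_index ?V ?C"
    "\<And>a. a \<in> ?V \<Longrightarrow> \<exists>t\<in>TV. a - t \<in> ?C" "\<And>s t. s \<in> TV \<Longrightarrow> t \<in> TV \<Longrightarrow> s - t \<in> ?C \<Longrightarrow> s = t"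
    using transversal_exists[OF C(1), of ?V] by metis
  have pos: "card TL \<noteq> 0" "card TV \<noteq> 0" using TL(2) TV(2) VL Vidx by (simp, simp)
  then have fin: "finite TL" "finite TV" by (auto intro: card_ge_0_finite)
  have RL: "vscale (const_emb \<phi> a) x \<in> L" if "x \<in> L" for a x by (rule Ls(3)[OF R_const that])
  have RV: "vscale (const_emb \<phi> a) x \<in> ?V" if "x \<in> ?V" for a x by (rule vscale_in_vecs[OF that])
  have per_v: "?q * card {x \<in> TL. \<tau> (dot n x v) = 0} = (if v \<in> ?D then ?q * card TL else card TL)" if v: "v \<in> ?V" for v
  proof -
    have "?q * card {x \<in> TL. \<tau> (dot n x v) = 0} = (if \<forall>x\<in>L. \<tau> (dot n x v) = 0 then ?q * card TL else card TL)"
      by (rule card_kernel_transversal[OF Ls(1) RL CL TL(3,4) TL(1)])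
         (auto simp: dot_diff_left tau_diff dot_vscale_left tau_cond_dot)
    then show ?thesis unfolding D_eq using v by simp
  qed
  have per_x: "?q * card {v \<in> TV. \<tau> (dot n x v) = 0} = (if x \<in> ?C then ?q * card TV else card TV)" if x: "x \<in> ?V" for x
  proof -
    have "?q * card {v \<in> TV. \<tau> (dot n x v) = 0} = (if \<forall>v\<in>?V. \<tau> (dot n x v) = 0 then ?q * card TV else card TV)"
      by (rule card_kernel_transversal[OF add_subgroup_vecs RV C(2) TV(3,4) TV(1)])
         (auto simp: dot_diff_right tau_diff dot_vscale_right tau_cond_dot)
    moreover have "(\<forall>v\<in>?V. \<tau> (dot n x v) = 0) \<longleftrightarrow> x \<in> ?C"
    proof
      assume *: "\<forall>v\<in>?V. \<tau> (dot n x v) = 0"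
      show "x \<in> ?C"
      proof (rule mem_cond_vecs[OF x])
        fix j assume j: "j < n"
        show "x j \<in> range ((*) cond)"
        proof (rule tau_perfect)
          fix y
          have "dot n x (vscale y (unit_vec j)) = x j * y"
            using j by (simp add: dot_def unit_vec_def if_distrib[of "\<lambda>z. _ * z"] mult.commute cong: if_cong)
          moreover have "vscale y (unit_vec j) \<in> ?V" by (rule vscale_in_vecs[OF unit_vec_in_vecs[OF j]])
          ultimately show "\<tau> (x j * y) = 0" using * by metis
        qed
      qed
    next
      assume "x \<in> ?C"
      then show "\<forall>v\<in>?V. \<tau> (dot n x v) = 0" using tau_cond_dot(1) by blast
    qed
    ultimately show ?thesis by (simp only:)
  qed
  let ?a = "card TL" and ?b = "card TV" and ?d = "grp_index ?D ?C"
  have dTV: "card {v \<in> TV. v \<in> ?D} = ?d"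
    by (rule card_transversal_Int[OF C(1) Dsub CD _ TV(3,4)]) blast+
  have cTL: "card {x \<in> TL. x \<in> ?C} = 1"
    using card_transversal_Int[OF C(1) C(1) order_refl CL TL(3,4)] grp_index_self[OF C(1)] by simp
  have "(\<Sum>v\<in>TV. card {x \<in> TL. \<tau> (dot n x v) = 0}) = (\<Sum>x\<in>TL. card {v \<in> TV. \<tau> (dot n x v) = 0})"
    by (rule sum_multicount_gen[OF fin(2,1)]) simp
  then have "(\<Sum>v\<in>TV. ?q * card {x \<in> TL. \<tau> (dot n x v) = 0}) = (\<Sum>x\<in>TL. ?q * card {v \<in> TV. \<tau> (dot n x v) = 0})"
    by (simp only: sum_distrib_left[symmetric])
  moreover have "(\<Sum>v\<in>TV. ?q * card {x \<in> TL. \<tau> (dot n x v) = 0}) = ?d * (?q * ?a) + (?b - ?d) * ?a"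
  proof -
    have "(\<Sum>v\<in>TV. ?q * card {x \<in> TL. \<tau> (dot n x v) = 0}) = (\<Sum>v\<in>TV. if v \<in> ?D then ?q * ?a else ?a)"
      by (rule sum.cong[OF refl per_v]) (use TV(1) in blast)
    also have "\<dots> = (\<Sum>v\<in>{v \<in> TV. v \<in> ?D}. ?q * ?a) + (\<Sum>v\<in>TV - {v \<in> TV. v \<in> ?D}. ?a)"
      by (subst sum.If_cases[OF fin(2)]) (intro arg_cong2[where f = "(+)"] sum.cong, auto)
    finally show ?thesis using fin(2) dTV by (simp add: card_Diff_subset)
  qed
  moreover have "(\<Sum>x\<in>TL. ?q * card {v \<in> TV. \<tau> (dot n x v) = 0}) = ?q * ?b + (?a - 1) * ?b"
  proof -
    have "(\<Sum>x\<in>TL. ?q * card {v \<in> TV. \<tau> (dot n x v) = 0}) = (\<Sum>x\<in>TL. if x \<in> ?C then ?q * ?b else ?b)"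
      by (rule sum.cong[OF refl per_x]) (use TL(1) Ls(2) in blast)
    also have "\<dots> = (\<Sum>x\<in>{x \<in> TL. x \<in> ?C}. ?q * ?b) + (\<Sum>x\<in>TL - {x \<in> TL. x \<in> ?C}. ?b)"
      by (subst sum.If_cases[OF fin(1)]) (intro arg_cong2[where f = "(+)"] sum.cong, auto)
    finally show ?thesis using fin(1) cTL by (simp add: card_Diff_subset)
  qed
  moreover have "?d \<le> ?b" unfolding dTV[symmetric] by (rule card_mono[OF fin(2)]) blast
  moreover have "?a \<ge> 1" using pos by simp
  moreover have "?q > 1"
  proof -
    have "card {0, 1 :: 'f} \<le> ?q" by (rule card_mono) auto
    then show ?thesis by simp
  qed
  ultimately have "?d * ?a = ?b"
  proof -
    assume "(\<Sum>v\<in>TV. ?q * card {x \<in> TL. \<tau> (dot n x v) = 0}) = (\<Sum>x\<in>TL. ?q * card {v \<in> TV. \<tau> (dot n x v) = 0})"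
      and 1: "(\<Sum>v\<in>TV. ?q * card {x \<in> TL. \<tau> (dot n x v) = 0}) = ?d * (?q * ?a) + (?b - ?d) * ?a"
      and 2: "(\<Sum>x\<in>TL. ?q * card {v \<in> TV. \<tau> (dot n x v) = 0}) = ?q * ?b + (?a - 1) * ?b"
      and le: "?d \<le> ?b" "?a \<ge> 1" and q: "?q > 1"
    then have "?d * (?q * ?a) + (?b - ?d) * ?a = ?q * ?b + (?a - 1) * ?b" by (simp only:)
    then show "?d * ?a = ?b" by (rule double_count_solve[OF _ le q])
  qed
  then have "?d * grp_index L ?C = grp_index ?V L * grp_index L ?C"
    unfolding TL(2) TV(2) VL .
  then show ?thesis using pos(1) TL(2) by simp
qed

lemma order_lattices: "order_lattices n R cond"
proof
  show "grp_index (UNIV :: ('i \<Rightarrow> 'e fps) set) (range ((*) cond)) \<noteq> 0"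
    unfolding grp_index_uniformizer by simp
qed (fact R_one R_diff R_mult R_conductor free_fps stable_range_fps finite_submods_fps perfect_pairing)+

end

section \<open>Closed formula for the number of stable subspaces\<close>

context fspace_op
begin

lemma num_stable_beyond:
  assumes Y: "subsp Y" "C \<subseteq> Y" and D: "grp_index Y C = q ^ D" and s: "s > D"
  shows "num_stable Y s = 0"
proof -
  have "grp_index H (down H) \<noteq> q ^ s" if H: "H \<in> stable Y" for H
  proof -
    obtain t where "t \<le> D" "grp_index H (down H) = q ^ t" by (rule stable_index[OF Y D H])
    then show ?thesis using s q_gt_1 by simp
  qed
  then have "{H \<in> stable Y. grp_index H (down H) = q ^ s} = {}" by blast
  then show ?thesis unfolding num_stable_def by (simp only: card.empty of_nat_0)
qed

lemma sum_int_image: "(\<Sum>x\<in>int ` {..B}. h x) = (\<Sum>s\<le>B. h (int s))"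
  by (simp add: sum.reindex)

text \<open>\<open>Y j\<close> is X^j Y modulo C, and \<open>r j\<close> is the dimension of its
  quotient by the next one. The recursion \<open>num_stable_rec\<close> is iterated along this
  chain. The bound \<open>B\<close> dominates the total dimension, so all levels are summed over the
  same box.\<close>

lemma card_stable_chain:
  assumes Y: "\<And>j. j \<le> m \<Longrightarrow> subsp (Y j)" "\<And>j. j \<le> m \<Longrightarrow> C \<subseteq> Y j" "\<And>j. j < m \<Longrightarrow> opr ` Y j \<subseteq> Y j"
    and nil: "\<And>j. j < m \<Longrightarrow> (opr ^^ k) ` Y j \<subseteq> C" and last: "Y m = C"
    and down: "\<And>j. j < m \<Longrightarrow> down (Y j) = Y (Suc j)"
    and r: "\<And>j. j < m \<Longrightarrow> grp_index (Y j) (Y (Suc j)) = q ^ r j" and B: "(\<Sum>j<m. r j) \<le> B"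
  shows "of_nat (card (stable (Y 0))) =
    (\<Sum>s\<in>{1..m} \<rightarrow>\<^sub>E int ` {..B}. G_term m (\<lambda>k. int (r (k - 1))) s qc)"
proof -
  have step_sub: "Y (Suc j) \<subseteq> Y j" if j: "j < m" for j
    using down_least[OF Y(1) Y(3)[OF j] Y(2)] j unfolding down[OF j] by simp
  define D where "D j = (\<Sum>l=j..<m. r l)" for j
  have D: "grp_index (Y j) C = q ^ D j" if "j \<le> m" for j
    using that
  proof (induction rule: inc_induct)
    case base
    show ?case unfolding last D_def by (simp add: grp_index_self[OF subspD(1)[OF subsp_C]])
  next
    case (step j)
    have "grp_index (Y j) C = grp_index (Y j) (Y (Suc j)) * grp_index (Y (Suc j)) C"
      by (rule grp_index_subsp_mult[OF Y(1) Y(1) subsp_C Y(2) step_sub]) (use step.hyps in auto)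
    also have "\<dots> = q ^ r j * q ^ D (Suc j)" unfolding step.IH r[OF step.hyps(2)] ..
    also have "\<dots> = q ^ D j"
      unfolding D_def sum.atLeast_Suc_lessThan[OF step.hyps(2)] by (rule power_add[symmetric])
    finally show ?case .
  qed
  have D_le: "D j \<le> B" for j
  proof -
    have "D j \<le> (\<Sum>l<m. r l)" unfolding D_def by (rule sum_mono2) auto
    then show ?thesis using B by simp
  qed
  have D_Suc: "D (Suc j) \<le> D j" for j unfolding D_def by (rule sum_mono2) auto
  \<comment> \<open>\<open>num_stable\<close> extended by zero to negative integers; tuples are
    indexed from 1 and the chain from 0, hence the shift i - 1.\<close>
  let ?W = "\<lambda>i x. if x < 0 then 0 else num_stable (Y (i - 1)) (nat x)"
  let ?f = "\<lambda>k x y. qc powi (y * (int (r (k - 1)) - x)) * qbinomial qc (int (r (k - 1)) - y) (x - y)"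
  let ?S = "int ` {..B}"
  have step: "?W i x = (\<Sum>y\<in>?S. ?W (Suc i) y * ?f i x y)" if i: "1 \<le> i" "i \<le> m" and x: "x \<in> ?S" for i x
  proof -
    obtain j where j: "i = Suc j" "j < m" using i by (cases i) auto
    obtain s where s: "x = int s" using x by blast
    note Yj = Y(1,2)[OF less_imp_le[OF j(2)]] Y(3)[OF j(2)]
    have "num_stable (Y j) s = (\<Sum>s'\<le>D j. num_stable (down (Y j)) s' *
        (qc powi (int s' * (int (r j) - int s)) * qbinomial qc (int (r j) - int s') (int s - int s')))"
      by (rule num_stable_rec[OF Yj nil[OF j(2)] D[OF less_imp_le[OF j(2)]]])
         (simp only: down[OF j(2)] r[OF j(2)])
    also have "\<dots> = (\<Sum>s'\<le>B. num_stable (Y (Suc j)) s' *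
        (qc powi (int s' * (int (r j) - int s)) * qbinomial qc (int (r j) - int s') (int s - int s')))"
      unfolding down[OF j(2)]
    proof (rule sum.mono_neutral_left)
      show "{..D j} \<subseteq> {..B}" using D_le by auto
      have "num_stable (Y (Suc j)) s' = 0" if "s' > D j" for s'
        using num_stable_beyond[OF Y(1,2) D, of "Suc j" s'] j(2) D_Suc[of j] that by simp
      then show "\<forall>s'\<in>{..B} - {..D j}. num_stable (Y (Suc j)) s' *
        (qc powi (int s' * (int (r j) - int s)) * qbinomial qc (int (r j) - int s') (int s - int s')) = 0"
        by simp
    qed simp
    finally show ?thesis unfolding sum_int_image j(1) s by simp
  qed
  have base: "?W (Suc m) y = (if y = 0 then 1 else 0)" for y
    by (simp add: last num_stable_base)
  have "of_nat (card (stable (Y 0))) = (\<Sum>s\<le>D 0. num_stable (Y 0) s)"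
    by (rule card_stable[OF Y(1,2) D]) auto
  also have "\<dots> = (\<Sum>s\<le>B. num_stable (Y 0) s)"
  proof (rule sum.mono_neutral_left)
    show "{..D 0} \<subseteq> {..B}" using D_le by auto
    show "\<forall>s\<in>{..B} - {..D 0}. num_stable (Y 0) s = 0"
      using num_stable_beyond[OF Y(1,2) D] by simp
  qed simp
  also have "\<dots> = (\<Sum>x\<in>?S. ?W 1 x * 1)" unfolding sum_int_image by simp
  also have "\<dots> = (\<Sum>s\<in>{1..m} \<rightarrow>\<^sub>E ?S. 1 * (\<Prod>k=1..m. ?f k (s k) (if k < m then s (Suc k) else 0)))"
    by (rule chain_sum[OF _ _ base step]) auto
  also have "\<dots> = (\<Sum>s\<in>{1..m} \<rightarrow>\<^sub>E ?S. G_term m (\<lambda>k. int (r (k - 1))) s qc)"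
    unfolding G_term_eq_prod[OF qc_nonzero] by (simp only: mult_1_left)
  finally show ?thesis .
qed

end

section \<open>Subspaces of a finite vector space and their Moebius function\<close>

lemma fspace_vscale: "fspace (vscale :: 'e::{field,finite} \<Rightarrow> (nat \<Rightarrow> 'e) \<Rightarrow> _) CARD('e)"
  by unfold_locales (simp_all only: vscale_diff_right vscale_diff_left vscale_vscale vscale_one)

definition subspaces :: "nat \<Rightarrow> (nat \<Rightarrow> 'e::field) set set" where
  "subspaces n = {U. submod n UNIV U}"

definition codim :: "nat \<Rightarrow> (nat \<Rightarrow> 'e::{field,finite}) set \<Rightarrow> nat" where
  "codim n U = (THE r. grp_index (vecs n) U = CARD('e) ^ r)"

lemma card_field_gt_1: "CARD('e::{field,finite}) > 1"
  by (rule fspace.q_gt_1[OF fspace_vscale])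

lemma codim_eq: "grp_index (vecs n) (U :: (nat \<Rightarrow> 'e::{field,finite}) set) = CARD('e) ^ r \<Longrightarrow> codim n U = r"
  unfolding codim_def using card_field_gt_1[where 'e = 'e] by (intro the_equality) auto

lemma grp_index_subspaces:
  fixes U W :: "(nat \<Rightarrow> 'e::{field,finite}) set"
  assumes "submod n UNIV U" "submod n UNIV W" "W \<subseteq> U"
  obtains d where "grp_index U W = CARD('e) ^ d"
proof -
  interpret fspace "vscale :: 'e \<Rightarrow> (nat \<Rightarrow> 'e) \<Rightarrow> _" "CARD('e)" by (rule fspace_vscale)
  have "subsp U" "subsp W" using submodD[OF assms(1)] submodD[OF assms(2)] by (simp_all add: subsp_def)
  moreover have "grp_index U W \<noteq> 0"
    unfolding grp_index_finite_iff[OF submodD(1)[OF assms(1)]] grp_cosets_def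
    by (rule finite_imageI[OF finite_subset[OF submodD(2)[OF assms(1)] finite_vecs]])
  ultimately show thesis using grp_index_power[OF _ _ assms(3)] that by blast
qed

lemma codim_subspace:
  fixes U :: "(nat \<Rightarrow> 'e::{field,finite}) set"
  assumes "submod n UNIV U"
  shows "grp_index (vecs n) U = CARD('e) ^ codim n U" "codim n U \<le> n" "codim n U = 0 \<longleftrightarrow> U = vecs n"
proof -
  obtain r where r: "grp_index (vecs n) U = CARD('e) ^ r"
    by (rule grp_index_subspaces[OF submod_vecs assms submodD(2)[OF assms]])
  then show 1: "grp_index (vecs n) U = CARD('e) ^ codim n U" by (simp add: codim_eq)
  have "CARD('e) ^ n = CARD('e) ^ codim n U * card U"
    using card_eq_grp_index_mult[OF add_subgroup_vecs submodD(1,2)[OF assms]] by (simp add: card_vecs 1)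
  then have "CARD('e) ^ codim n U dvd CARD('e) ^ n" by simp
  then have "CARD('e) ^ codim n U \<le> CARD('e) ^ n" by (rule dvd_imp_le) simp
  then show "codim n U \<le> n" using card_field_gt_1[where 'e = 'e] by simp
  show "codim n U = 0 \<longleftrightarrow> U = vecs n"
    using 1 grp_index_eq_1_iff[OF add_subgroup_vecs submodD(1,2)[OF assms]] card_field_gt_1[where 'e = 'e]
    by (metis One_nat_def card_0_eq less_irrefl nat_power_eq_Suc_0_iff power_0)
qed

lemma qbinomial_sym: "qbinomial x n k = qbinomial x n (n - k)"
  by (simp add: qbinomial_def mult.commute)

lemma finite_subspaces: "finite (subspaces n :: (nat \<Rightarrow> 'e::{field,finite}) set set)"
  by (rule finite_subset[of _ "Pow (vecs n)"]) (auto simp: subspaces_def submod_def finite_vecs)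

text \<open>\<open>card_subspaces\<close> counts by the dimension of U/W; the symmetry of the
  Gaussian binomial turns this into the codimension of U.\<close>

lemma card_subspaces_above:
  fixes W :: "(nat \<Rightarrow> 'e::{field,finite}) set"
  assumes W: "submod n UNIV W"
  shows "of_nat (card {U \<in> subspaces n. W \<subseteq> U \<and> codim n U = r}) =
    (qbinomial (of_nat CARD('e)) (int (codim n W)) (int r) :: complex)"
proof -
  interpret fspace "vscale :: 'e \<Rightarrow> (nat \<Rightarrow> 'e) \<Rightarrow> _" "CARD('e)" by (rule fspace_vscale)
  note WD = submodD[OF W]
  let ?d = "codim n W"
  have sub: "subsp (vecs n)" "subsp W" using WD vscale_in_vecs add_subgroup_vecs by (auto simp: subsp_def)
  have mult: "CARD('e) ^ ?d = CARD('e) ^ codim n U * grp_index U W" if "U \<in> subspaces n" "W \<subseteq> U" for U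
  proof -
    have U: "submod n UNIV U" using that(1) by (simp add: subspaces_def)
    show ?thesis
      unfolding codim_subspace(1)[OF W, symmetric] codim_subspace(1)[OF U, symmetric]
      by (rule grp_index_mult[OF submodD(1)[OF U] WD(1) add_subgroup_vecs that(2) submodD(2)[OF U]])
  qed
  show ?thesis
  proof (cases "r \<le> ?d")
    case True
    have "codim n U = r \<longleftrightarrow> grp_index U W = CARD('e) ^ (?d - r)" if U: "U \<in> subspaces n" "W \<subseteq> U" for U
    proof
      assume "codim n U = r"
      then have "CARD('e) ^ r * CARD('e) ^ (?d - r) = CARD('e) ^ r * grp_index U W"
        using mult[OF U] True by (simp add: power_add[symmetric])
      then show "grp_index U W = CARD('e) ^ (?d - r)" by simp
    next
      assume "grp_index U W = CARD('e) ^ (?d - r)"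
      then have "CARD('e) ^ ?d = CARD('e) ^ (codim n U + (?d - r))" using mult[OF U] by (simp add: power_add)
      then have "?d = codim n U + (?d - r)" using q_gt_1 by (simp only: power_inject_exp)
      then show "codim n U = r" using True by simp
    qed
    moreover have "U \<in> subspaces n \<longleftrightarrow> subsp U \<and> U \<subseteq> vecs n" for U
      by (auto simp: subspaces_def submod_def subsp_def)
    ultimately have "{U \<in> subspaces n. W \<subseteq> U \<and> codim n U = r} =
        {U. subsp U \<and> W \<subseteq> U \<and> U \<subseteq> vecs n \<and> grp_index U W = CARD('e) ^ (?d - r)}" by blast
    then have "of_nat (card {U \<in> subspaces n. W \<subseteq> U \<and> codim n U = r}) = qbinomial qc (int ?d) (int (?d - r))"
      using card_subspaces[OF sub WD(2) codim_subspace(1)[OF W]] by simp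
    also have "\<dots> = qbinomial qc (int ?d) (int r)"
      using qbinomial_sym[of qc "int ?d" "int r"] True by (simp add: of_nat_diff)
    finally show ?thesis .
  next
    case False
    have "codim n U \<noteq> r" if U: "U \<in> subspaces n" "W \<subseteq> U" for U
    proof
      assume "codim n U = r"
      then have "CARD('e) ^ r dvd CARD('e) ^ ?d" using mult[OF U] by simp
      then have "CARD('e) ^ r \<le> CARD('e) ^ ?d" by (rule dvd_imp_le) simp
      then show False using False q_gt_1 by simp
    qed
    then have empty: "{U \<in> subspaces n. W \<subseteq> U \<and> codim n U = r} = {}" by blast
    show ?thesis unfolding empty using False by (simp add: qbinomial_def)
  qed
qed

text \<open>The Moebius function of the interval from U to the whole space in the lattice of
  subspaces.\<close>

definition moebius :: "nat \<Rightarrow> (nat \<Rightarrow> 'e::{field,finite}) set \<Rightarrow> complex" where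
  "moebius n U = (- 1) ^ codim n U * of_nat CARD('e) ^ (codim n U choose 2)"

text \<open>Grouped by codimension, the sum becomes \<open>sum_alternating_qbinomial\<close> for the
  codimension of W.\<close>

lemma sum_moebius_above:
  fixes W :: "(nat \<Rightarrow> 'e::{field,finite}) set"
  assumes W: "submod n UNIV W"
  shows "(\<Sum>U\<in>{U \<in> subspaces n. W \<subseteq> U}. moebius n U) = (if W = vecs n then 1 else 0)"
proof -
  let ?Q = "of_nat CARD('e) :: complex"
  let ?w = "\<lambda>r. (- 1) ^ r * ?Q ^ (r choose 2)" and ?A = "{U \<in> subspaces n. W \<subseteq> U}"
  let ?d = "codim n W"
  have fin: "finite ?A" by (rule finite_subset[OF _ finite_subspaces]) blast
  have le: "codim n U \<le> ?d" if "U \<in> ?A" for U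
  proof (rule ccontr)
    assume gt: "\<not> codim n U \<le> ?d"
    have "(of_nat (card {U' \<in> subspaces n. W \<subseteq> U' \<and> codim n U' = codim n U}) :: complex) = 0"
      unfolding card_subspaces_above[OF W] using gt by (simp add: qbinomial_def)
    then have "card {U' \<in> subspaces n. W \<subseteq> U' \<and> codim n U' = codim n U} = 0" by (simp only: of_nat_eq_0_iff)
    moreover have "finite {U' \<in> subspaces n. W \<subseteq> U' \<and> codim n U' = codim n U}"
      by (rule finite_subset[OF _ finite_subspaces]) blast
    ultimately have "{U' \<in> subspaces n. W \<subseteq> U' \<and> codim n U' = codim n U} = {}" by (simp only: card_0_eq)
    then show False using that by blast
  qed
  have "(\<Sum>U\<in>?A. moebius n U) = (\<Sum>r\<le>?d. \<Sum>U\<in>{U \<in> ?A. codim n U = r}. moebius n U)"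
    by (rule sum.group[symmetric, OF fin]) (use le in auto)
  also have "\<dots> = (\<Sum>r\<le>?d. ?w r * qbinomial ?Q (int ?d) (int r))"
  proof (rule sum.cong[OF refl])
    fix r
    have eq: "{U \<in> ?A. codim n U = r} = {U \<in> subspaces n. W \<subseteq> U \<and> codim n U = r}" by blast
    have "(\<Sum>U\<in>{U \<in> ?A. codim n U = r}. moebius n U) = (\<Sum>U\<in>{U \<in> ?A. codim n U = r}. ?w r)"
      by (rule sum.cong) (auto simp: moebius_def)
    then show "(\<Sum>U\<in>{U \<in> ?A. codim n U = r}. moebius n U) = ?w r * qbinomial ?Q (int ?d) (int r)"
      unfolding eq card_subspaces_above[OF W, symmetric] by simp
  qed
  also have "\<dots> = (if ?d = 0 then 1 else 0)"
    by (rule sum_alternating_qbinomial) (rule fspace.qc_power[OF fspace_vscale])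
  finally show ?thesis using codim_subspace(3)[OF W] by simp
qed

section \<open>Lattices cut out by residue conditions\<close>

lemma subgroup_sum_absorb:
  assumes "add_subgroup A" "B \<subseteq> A" "0 \<in> B"
  shows "subgroup_sum A B = A" "subgroup_sum B A = A"
proof -
  show "subgroup_sum A B = A"
  proof (rule antisym)
    show "subgroup_sum A B \<subseteq> A" by (rule subgroup_sum_least[OF assms(1) order_refl assms(2)])
    show "A \<subseteq> subgroup_sum A B"
    proof
      fix a assume "a \<in> A"
      then have "a + 0 \<in> subgroup_sum A B" by (rule subgroup_sumI[OF _ assms(3)])
      then show "a \<in> subgroup_sum A B" by simp
    qed
  qed
  show "subgroup_sum B A = A"
  proof (rule antisym)
    show "subgroup_sum B A \<subseteq> A" by (rule subgroup_sum_least[OF assms(1,2) order_refl])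
    show "A \<subseteq> subgroup_sum B A"
    proof
      fix a assume "a \<in> A"
      then have "0 + a \<in> subgroup_sum B A" by (rule subgroup_sumI[OF assms(3)])
      then show "a \<in> subgroup_sum B A" by simp
    qed
  qed
qed

lemma vscale_uniformizer_power_inj:
  fixes x :: "nat \<Rightarrow> 'i \<Rightarrow> 'e::field fps"
  assumes "vscale (uniformizer ^ k) x = vscale (uniformizer ^ k) y"
  shows "x = y"
  using assms
proof (induction k)
  case (Suc k)
  have "vscale uniformizer (vscale (uniformizer ^ k) x) = vscale uniformizer (vscale (uniformizer ^ k) y)"
    using Suc.prems unfolding vscale_vscale power_Suc .
  then show ?case by (rule Suc.IH[OF vscale_inj])
qed simp

lemma grp_index_vscale_uniformizer_power:
  fixes A B :: "(nat \<Rightarrow> 'i \<Rightarrow> 'e::field fps) set"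
  assumes "submod n UNIV A" "submod n UNIV B"
  shows "grp_index (vscale (uniformizer ^ k) ` A) (vscale (uniformizer ^ k) ` B) = grp_index A B"
proof (rule sym, rule grp_index_transfer[OF submodD(1)[OF assms(2)] submodD(1)[OF submod_vscale_image[OF assms(2)]] refl])
  fix x y :: "nat \<Rightarrow> 'i \<Rightarrow> 'e fps"
  have "vscale (uniformizer ^ k) (x - y) \<in> vscale (uniformizer ^ k) ` B \<longleftrightarrow> x - y \<in> B"
  proof
    assume "vscale (uniformizer ^ k) (x - y) \<in> vscale (uniformizer ^ k) ` B"
    then obtain z where "z \<in> B" "vscale (uniformizer ^ k) (x - y) = vscale (uniformizer ^ k) z" by blast
    then show "x - y \<in> B" using vscale_uniformizer_power_inj[of k "x - y" z] by simp
  qed (rule imageI)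
  then show "x - y \<in> B \<longleftrightarrow>
      vscale (uniformizer ^ k) x - vscale (uniformizer ^ k) y \<in> vscale (uniformizer ^ k) ` B"
    unfolding vscale_diff_right by (rule sym)
qed

text \<open>For subspaces \<open>Y i\<close> this is an S-lattice between V and its radical t
  V.\<close>

definition lat :: "nat \<Rightarrow> ('i \<Rightarrow> (nat \<Rightarrow> 'e) set) \<Rightarrow> (nat \<Rightarrow> 'i \<Rightarrow> 'e::field fps) set" where
  "lat n Y = {x \<in> vecs n. \<forall>i. residue_vec i x \<in> Y i}"

lemma submod_lat:
  fixes Y :: "'i \<Rightarrow> (nat \<Rightarrow> 'e::field) set"
  assumes "\<And>i. submod n UNIV (Y i)"
  shows "submod n UNIV (lat n Y)"
  unfolding submod_def lat_def
proof (intro conjI ballI add_subgroupI)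
  show "0 \<in> {x \<in> vecs n. \<forall>i. residue_vec i x \<in> Y i}"
  proof -
    have "residue_vec i (0 :: nat \<Rightarrow> 'i \<Rightarrow> 'e fps) = 0" for i using residue_vec_diff[of i 0 0] by simp
    then show ?thesis
      by (simp add: add_subgroup_zero[OF submodD(1)[OF assms]] add_subgroup_zero[OF add_subgroup_vecs])
  qed
qed (use assms[THEN submodD(1)] assms[THEN submodD(3)] in
  \<open>auto simp: residue_vec_diff residue_vec_vscale add_subgroup_diff add_subgroup_diff[OF add_subgroup_vecs] vscale_in_vecs\<close>)

text \<open>After passing to residues all groups are finite, and the index becomes a quotient of
  cardinalities, each of which is a product over i.\<close>

lemma grp_index_lat:
  fixes Y :: "'i::finite \<Rightarrow> (nat \<Rightarrow> 'e::{field,finite}) set"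
  assumes Y: "\<And>i. submod n UNIV (Y i)"
  shows "grp_index (vecs n) (lat n Y) = (\<Prod>i\<in>UNIV. grp_index (vecs n) (Y i))"
proof -
  let ?f = "\<lambda>x i. residue_vec i (x :: nat \<Rightarrow> 'i \<Rightarrow> 'e fps)"
  let ?A = "Pi UNIV (\<lambda>_. vecs n) :: ('i \<Rightarrow> nat \<Rightarrow> 'e) set"
  have Pi: "Pi UNIV Z = PiE UNIV Z" for Z :: "'i \<Rightarrow> (nat \<Rightarrow> 'e) set" by (auto simp: PiE_def)
  have sub: "add_subgroup (Pi UNIV Z)" if "\<And>i. add_subgroup (Z i)" for Z :: "'i \<Rightarrow> (nat \<Rightarrow> 'e) set"
    using that by (intro add_subgroupI) (auto simp: Pi_iff add_subgroup_zero add_subgroup_diff)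
  note subs = sub[OF submodD(1)[OF Y]] sub[of "\<lambda>_. vecs n", OF add_subgroup_vecs]
  have img: "?f ` vecs n = ?A"
  proof (intro equalityI subsetI)
    fix g assume "g \<in> ?A"
    then have "\<exists>x\<in>vecs n. residue_vec i x = g i" for i by (intro residue_vec_surj) auto
    then obtain x where x: "\<And>i. x i \<in> vecs n \<and> residue_vec i (x i) = g i" by metis
    have "(\<lambda>a i. x i a i) \<in> vecs n" by (rule combine_components[OF submod_vecs]) (use x in simp)
    moreover have "g = ?f (\<lambda>a i. x i a i)" using x by (auto simp: residue_vec_def fun_eq_iff)
    ultimately show "g \<in> ?f ` vecs n" by blast
  qed (auto intro: residue_vec_in_vecs)
  have "grp_index (vecs n) (lat n Y) = grp_index ?A (Pi UNIV Y)"
  proof (rule grp_index_transfer[OF submodD(1)[OF submod_lat[OF Y]] subs(1) img])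
    fix x y :: "nat \<Rightarrow> 'i \<Rightarrow> 'e fps" assume "x \<in> vecs n" "y \<in> vecs n"
    then have "x - y \<in> vecs n" by (rule add_subgroup_diff[OF add_subgroup_vecs])
    then show "x - y \<in> lat n Y \<longleftrightarrow> ?f x - ?f y \<in> Pi UNIV Y"
      by (simp add: lat_def residue_vec_diff Pi_iff)
  qed
  moreover have "card ?A = grp_index ?A (Pi UNIV Y) * card (Pi UNIV Y)"
    by (rule card_eq_grp_index_mult[OF subs(2,1)]) (use submodD(2)[OF Y] in blast)
  moreover have "card ?A = (\<Prod>i\<in>UNIV. grp_index (vecs n) (Y i)) * card (Pi UNIV Y)"
    unfolding Pi card_PiE[OF finite] prod.distrib[symmetric]
    by (rule prod.cong[OF refl]) (rule card_eq_grp_index_mult[OF add_subgroup_vecs submodD(1,2)[OF Y]])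
  moreover have "card ?A \<noteq> 0" unfolding Pi card_PiE[OF finite] by (simp add: card_vecs)
  ultimately show ?thesis by (metis mult_cancel2 mult_0_right)
qed

lemma uniformizer_sub_lat:
  assumes "\<And>i. submod n UNIV (Y i)" "k > 0"
  shows "vscale (uniformizer ^ k) ` vecs n \<subseteq> lat n Y"
proof
  fix z :: "nat \<Rightarrow> 'a \<Rightarrow> 'b fps" assume "z \<in> vscale (uniformizer ^ k) ` vecs n"
  then obtain x where x: "x \<in> vecs n" "z = vscale (uniformizer ^ k) x" by blast
  obtain j where j: "k = Suc j" using assms(2) by (cases k) auto
  have z: "z = vscale uniformizer (vscale (uniformizer ^ j) x)" unfolding x(2) vscale_vscale j power_Suc ..
  show "z \<in> lat n Y"
    using x(1) add_subgroup_zero[OF submodD(1)[OF assms(1)]]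
    by (simp add: lat_def z residue_vscale_uniformizer vscale_in_vecs)
qed

lemma G_term_cong:
  assumes "\<And>k. 1 \<le> k \<Longrightarrow> k \<le> m \<Longrightarrow> r k = r' k"
  shows "G_term m r s x = G_term m r' s x"
  unfolding G_term_def
  by (intro arg_cong2[where f = "(*)"] arg_cong2[where f = "(powi)"] refl sum.cong prod.cong) (use assms in auto)

section \<open>Quadratic orders: modules over R as subspaces stable under x\<close>

lemma (in gorenstein_order) fspace_const:
  "fspace (\<lambda>a. vscale (const_emb \<phi> a) :: (nat \<Rightarrow> 'i \<Rightarrow> 'e fps) \<Rightarrow> _) CARD('f)"
proof
  fix a b :: 'f and x y :: "nat \<Rightarrow> 'i \<Rightarrow> 'e fps"
  have "(const_emb \<phi> (a - b) :: 'i \<Rightarrow> 'e fps) = const_emb \<phi> a - const_emb \<phi> b"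
    by (simp add: const_emb_def phi_diff fun_eq_iff)
  then show "vscale (const_emb \<phi> (a - b)) x = vscale (const_emb \<phi> a) x - vscale (const_emb \<phi> b) x"
    by (simp only: vscale_diff_left)
  have "const_emb \<phi> a * const_emb \<phi> b = (const_emb \<phi> (a * b) :: 'i \<Rightarrow> 'e fps)"
    by (simp add: const_emb_def phi_mult fun_eq_iff)
  then show "vscale (const_emb \<phi> a) (vscale (const_emb \<phi> b) x) = vscale (const_emb \<phi> (a * b)) x"
    by (simp only: vscale_vscale)
  have "(const_emb \<phi> 1 :: 'i \<Rightarrow> 'e fps) = 1" by (simp add: const_emb_def phi_one fun_eq_iff)
  then show "vscale (const_emb \<phi> 1) x = x" by (simp only: vscale_one)
qed (simp_all only: vscale_diff_right)

text \<open>With x = t^e, the numbers \<open>e\<close>, \<open>CARD('i)\<close> and \<open>f\<close>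
  are the ramification index, the number of primes and the residue degree of S over F[[x]];
  \<open>degree\<close> says that S has rank 2. \<open>expansion\<close> says that \<open>R\<close>
  is spanned by the powers of x over F together with x^m S.\<close>

locale quadratic_order = gorenstein_order \<phi> R \<tau> "e * m"
  for \<phi> :: "'f::{field,finite} \<Rightarrow> 'e::{field,finite}" and R :: "('i::finite \<Rightarrow> 'e fps) set"
    and \<tau> :: "('i \<Rightarrow> 'e fps) \<Rightarrow> 'k::ab_group_add" and e m :: nat +
  fixes f n :: nat
  assumes e_pos: "e > 0" and m_pos: "m > 0" and card_ext: "CARD('e) = CARD('f) ^ f"
    and degree: "e * CARD('i) * f = 2" and X_mem: "uniformizer ^ e \<in> R"
    and expansion: "r \<in> R \<Longrightarrow> \<exists>a u. r = (\<Sum>j<m. const_emb \<phi> (a j) * (uniformizer ^ e) ^ j) + uniformizer ^ (e * m) * u"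
begin

sublocale order_lattices n R cond
  by (rule order_lattices)

sublocale op: fspace_op "\<lambda>a. vscale (const_emb \<phi> a)" "CARD('f)" "vscale (uniformizer ^ e)" C
proof (rule fspace_op.intro[OF fspace_const], unfold_locales)
  fix a :: 'f and x y :: "nat \<Rightarrow> 'i \<Rightarrow> 'e fps"
  show "vscale (uniformizer ^ e) (vscale (const_emb \<phi> a) x) = vscale (const_emb \<phi> a) (vscale (uniformizer ^ e) x)"
    by (simp only: vscale_vscale mult.commute)
  show "vscale (uniformizer ^ e) (x - y) = vscale (uniformizer ^ e) x - vscale (uniformizer ^ e) y"
    by (rule vscale_diff_right)
  show "fspace.subsp (\<lambda>a. vscale (const_emb \<phi> a)) C"
    unfolding fspace.subsp_def[OF fspace_const] using submodD[OF submod_C] by blast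
qed (use submodD[OF submod_C] in auto)

lemma cond_eq: "cond = (uniformizer ^ e) ^ m"
  by (rule power_mult)

lemma funpow_vscale: "(vscale s ^^ k) x = vscale (s ^ k) x"
  by (induction k) (simp_all only: funpow.simps id_apply power_0 vscale_one comp_apply vscale_vscale power_Suc)

text \<open>By \<open>expansion\<close> an element of \<open>R\<close> acts as a polynomial in x
  plus an element of c S, and c S maps V into C. So for modules containing C only stability under F
  and x matters.\<close>

lemma mem_stable_iff:
  assumes "A \<subseteq> V"
  shows "L \<in> op.stable A \<longleftrightarrow> submod n R L \<and> C \<subseteq> L \<and> L \<subseteq> A"
proof
  assume "submod n R L \<and> C \<subseteq> L \<and> L \<subseteq> A"
  then show "L \<in> op.stable A"
    using submodD[of n R L] R_const X_mem by (auto simp: op.stable_def op.subsp_def)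
next
  assume "L \<in> op.stable A"
  then have sub: "op.subsp L" and CL: "C \<subseteq> L" "L \<subseteq> A" and opL: "vscale (uniformizer ^ e) ` L \<subseteq> L"
    by (auto simp: op.stable_def)
  note L = op.subspD[OF sub]
  have pow: "vscale ((uniformizer ^ e) ^ j) x \<in> L" if x: "x \<in> L" for x j
  proof (induction j)
    case 0
    show ?case unfolding power_0 vscale_one by (rule x)
  next
    case (Suc j)
    then show ?case unfolding power_Suc vscale_vscale[symmetric] using opL by blast
  qed
  have "vscale r x \<in> L" if r: "r \<in> R" and x: "x \<in> L" for r x
  proof -
    obtain a u where au: "r = (\<Sum>j<m. const_emb \<phi> (a j) * (uniformizer ^ e) ^ j) + cond * u"
      using expansion[OF r] by blast
    have "x \<in> V" using x CL assms by blast
    then have "vscale (cond * u) x \<in> L"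
      unfolding vscale_vscale[symmetric] using CL(1) vscale_in_vecs by blast
    moreover have "(\<Sum>j<m. vscale (const_emb \<phi> (a j) * (uniformizer ^ e) ^ j) x) \<in> L"
      unfolding vscale_vscale[symmetric] by (rule add_subgroup_sum[OF L(1)]) (rule L(2)[OF pow[OF x]])
    ultimately show ?thesis
      unfolding au vscale_add_left vscale_sum_left by (rule add_subgroup_add[OF L(1), rotated])
  qed
  then show "submod n R L \<and> C \<subseteq> L \<and> L \<subseteq> A" using L(1) CL assms by (auto simp: submod_def)
qed

text \<open>The chain of \<open>card_stable_chain\<close> is x^j L for j < m, with L =
  \<open>lat n Y\<close>, followed by C. As x^m L lies in C and C in x^(m-1) L, the successive
  dimensions are 2n, except that the last is 2n minus the codimension of L over F. This is the tuple
  ((2n)^(m-1), c) of the theorem.\<close>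

lemma card_stable_lat:
  assumes Y: "\<And>i. submod n UNIV (Y i)"
  shows "of_nat (card (op.stable (lat n Y))) = (\<Sum>s\<in>{1..m} \<rightarrow>\<^sub>E int ` {..2 * n * m}.
    G_term m (top_tuple m n (2 * int n - int (f * (\<Sum>i\<in>UNIV. codim n (Y i))))) s (of_nat CARD('f) :: complex))"
proof -
  let ?q = "CARD('f)" and ?\<rho> = "f * (\<Sum>i\<in>UNIV. codim n (Y i))" and ?x = "uniformizer ^ e :: 'i \<Rightarrow> 'e fps"
  let ?L = "lat n Y"
  note Ls = submod_lat[OF Y]
  note L = submodD[OF Ls]
  have q: "?q > 1" by (rule card_field_gt_1)
  have "?\<rho> \<le> f * (\<Sum>i\<in>(UNIV :: 'i set). n)"
    by (intro mult_le_mono sum_mono codim_subspace(2) Y order_refl)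
  also have "\<dots> \<le> e * CARD('i) * f * n" using e_pos by simp
  finally have rho: "?\<rho> \<le> 2 * n" unfolding degree .
  have idxL: "grp_index V ?L = ?q ^ ?\<rho>"
    unfolding grp_index_lat[OF Y] codim_subspace(1)[OF Y] card_ext power_mult[symmetric] power_sum[symmetric] sum_distrib_left ..
  have xpow: "?x ^ j = uniformizer ^ (e * j)" for j by (rule power_mult[symmetric])
  have idxV: "grp_index V (vscale (?x ^ j) ` V) = ?q ^ (2 * n * j)" for j
  proof -
    have "f * (CARD('i) * n * (e * j)) = 2 * n * j" unfolding degree[symmetric] by (simp only: mult_ac)
    then show ?thesis
      unfolding xpow grp_index_uniformizer_power_vecs card_ext power_mult[symmetric] by (simp only:)
  qed
  let ?I = "\<lambda>j. vscale (?x ^ j) ` ?L"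
  have Is: "submod n UNIV (?I j)" for j by (rule submod_vscale_image[OF Ls])
  have idxI: "grp_index V (?I j) = ?q ^ (2 * n * j + ?\<rho>)" for j
  proof -
    have "grp_index V (?I j) = grp_index V (vscale (?x ^ j) ` V) * grp_index (vscale (?x ^ j) ` V) (?I j)"
      by (rule grp_index_mult[OF submodD(1)[OF submod_vscale_image[OF submod_vecs[of n UNIV]]] submodD(1)[OF Is] add_subgroup_vecs image_mono[OF L(2)]
           submodD(2)[OF submod_vscale_image[OF submod_vecs[of n UNIV]]]])
    then show ?thesis
      unfolding idxV unfolding xpow grp_index_vscale_uniformizer_power[OF submod_vecs Ls] idxL
      by (simp only: power_add)
  qed
  have CI: "C \<subseteq> ?I j" if "j < m" for j
  proof
    fix z assume "z \<in> C"
    then obtain v where v: "v \<in> V" "z = vscale cond v" by blast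
    have c: "cond = ?x ^ j * uniformizer ^ (e * (m - j))"
      unfolding xpow power_add[symmetric] using that by (simp add: distrib_left[symmetric])
    have "vscale (uniformizer ^ (e * (m - j))) ` V \<subseteq> ?L"
      by (rule uniformizer_sub_lat) (use Y e_pos that in simp_all)
    then have "vscale (uniformizer ^ (e * (m - j))) v \<in> ?L" using v(1) by blast
    then show "z \<in> ?I j" unfolding v(2) c vscale_vscale[symmetric] by (rule imageI)
  qed
  let ?Y = "\<lambda>j. if j < m then ?I j else C"
  \<comment> \<open>The last step goes from x^(m-1) L to C = x^m V instead of x^m L and is shorter
    by (V : L). The truncated subtraction is exact by \<open>rho\<close>.\<close>
  let ?r = "\<lambda>j. if j < m - 1 then 2 * n else 2 * n - ?\<rho>"
  have Ys: "submod n UNIV (?Y j)" for j using Is submod_C by simp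
  have Im: "?I m \<subseteq> C" unfolding cond_eq by (rule image_mono[OF L(2)])
  have image_I: "vscale ?x ` ?I j = ?I (Suc j)" for j
    by (simp only: image_image vscale_vscale power_Suc)
  have I_Suc: "?I (Suc j) \<subseteq> ?I j" for j
    unfolding image_I[symmetric] using submodD(3)[OF Is[of j], of ?x] by (intro image_subsetI) simp
  have C0: "0 \<in> C" by (rule add_subgroup_zero[OF subgroup_C])
  have "of_nat (card (op.stable (?Y 0))) =
    (\<Sum>s\<in>{1..m} \<rightarrow>\<^sub>E int ` {..2 * n * m}. G_term m (\<lambda>k. int (?r (k - 1))) s (of_nat ?q :: complex))"
  proof (rule op.card_stable_chain[where k = m and Y = ?Y and r = ?r])
    fix j
    show "op.subsp (?Y j)" using submodD[OF Ys[of j]] by (auto simp: op.subsp_def)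
    show "C \<subseteq> ?Y j" using CI by simp
    assume j: "j < m"
    show "vscale ?x ` ?Y j \<subseteq> ?Y j" using submodD(3)[OF Ys[of j]] by blast
    show "(vscale ?x ^^ m) ` ?Y j \<subseteq> C"
    proof -
      have "(vscale ?x ^^ m) ` ?Y j = vscale cond ` ?Y j" unfolding funpow_vscale cond_eq ..
      also have "\<dots> \<subseteq> C" by (rule image_mono[OF submodD(2)[OF Ys]])
      finally show ?thesis .
    qed
    show "op.down (?Y j) = ?Y (Suc j)"
    proof (cases "Suc j < m")
      case True
      then show ?thesis
        using subgroup_sum_absorb(1)[OF submodD(1)[OF Is] CI[OF True] C0] j by (simp add: op.down_def image_I)
    next
      case False
      then have "Suc j = m" using j by simp
      then show ?thesis
        using subgroup_sum_absorb(2)[OF subgroup_C Im add_subgroup_zero[OF submodD(1)[OF Is]]] j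
        by (simp add: op.down_def image_I)
    qed
    show "grp_index (?Y j) (?Y (Suc j)) = ?q ^ ?r j"
    proof (cases "Suc j < m")
      case True
      have "grp_index V (?I (Suc j)) = grp_index V (?I j) * grp_index (?I j) (?I (Suc j))"
        by (rule grp_index_mult[OF submodD(1)[OF Is] submodD(1)[OF Is] add_subgroup_vecs I_Suc submodD(2)[OF Is]])
      moreover have "grp_index V (?I (Suc j)) = grp_index V (?I j) * ?q ^ (2 * n)"
        unfolding idxI power_add[symmetric] by (simp add: algebra_simps)
      moreover have "grp_index V (?I j) \<noteq> 0" unfolding idxI by simp
      ultimately have "grp_index (?I j) (?I (Suc j)) = ?q ^ (2 * n)" by (metis mult_left_cancel)
      then show ?thesis using True by simp
    next
      case False
      then have mj: "m = Suc j" using j by simp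
      have "grp_index V C = grp_index V (?I j) * grp_index (?I j) C"
        by (rule grp_index_mult[OF submodD(1)[OF Is] subgroup_C add_subgroup_vecs CI[OF j] submodD(2)[OF Is]])
      moreover have "grp_index V C = grp_index V (?I j) * ?q ^ (2 * n - ?\<rho>)"
      proof -
        have "grp_index V C = ?q ^ (2 * n * m)" unfolding cond_eq by (rule idxV)
        also have "2 * n * m = (2 * n * j + ?\<rho>) + (2 * n - ?\<rho>)" using rho mj by simp
        finally show ?thesis unfolding idxI by (simp only: power_add)
      qed
      moreover have "grp_index V (?I j) \<noteq> 0" unfolding idxI by simp
      ultimately have "grp_index (?I j) C = ?q ^ (2 * n - ?\<rho>)" by (metis mult_left_cancel)
      then show ?thesis using mj by simp
    qed
  next
    have "(\<Sum>j<m. ?r j) \<le> (\<Sum>j<m. 2 * n)" by (rule sum_mono) simp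
    then show "(\<Sum>j<m. ?r j) \<le> 2 * n * m" by (simp add: mult.commute)
  qed simp
  moreover have "?Y 0 = ?L" using m_pos by simp
  moreover have "G_term m (\<lambda>k. int (?r (k - 1))) s (of_nat ?q) =
      (G_term m (top_tuple m n (2 * int n - int ?\<rho>)) s (of_nat ?q) :: complex)" for s
    by (rule G_term_cong) (use rho in \<open>auto simp: top_tuple_def of_nat_diff\<close>)
  ultimately show ?thesis by simp
qed

end

section \<open>The number of lattices with full span\<close>

context quadratic_order
begin

definition lattice_count :: "nat \<Rightarrow> complex" where
  "lattice_count \<rho> = (\<Sum>s\<in>{1..m} \<rightarrow>\<^sub>E int ` {..2 * n * m}.
    G_term m (top_tuple m n (2 * int n - int (f * \<rho>))) s (of_nat CARD('f)))"

definition weight_r :: "nat \<Rightarrow> complex" where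
  "weight_r r = (- 1) ^ r * of_nat CARD('e) ^ (r choose 2)"

lemma card_sublattices:
  assumes Y: "\<And>i. submod n UNIV (Y i)"
  shows "of_nat (card {L. submod n R L \<and> C \<subseteq> L \<and> L \<subseteq> lat n Y}) = lattice_count (\<Sum>i\<in>UNIV. codim n (Y i))"
proof -
  have "{L. submod n R L \<and> C \<subseteq> L \<and> L \<subseteq> lat n Y} = op.stable (lat n Y)"
    using mem_stable_iff[of "lat n Y"] by (auto simp: lat_def)
  then show ?thesis unfolding lattice_count_def using card_stable_lat[OF Y] by simp
qed

lemma subset_lat_iff:
  assumes L: "submod n R L" and Y: "\<And>i. submod n UNIV (Y i)"
  shows "L \<subseteq> lat n Y \<longleftrightarrow> (\<forall>i. residue_vec i ` gen_hull n L \<subseteq> Y i)"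
proof
  assume "L \<subseteq> lat n Y"
  then have "gen_hull n L \<subseteq> lat n Y" by (rule gen_hull_least[OF submod_lat[OF Y]])
  then show "\<forall>i. residue_vec i ` gen_hull n L \<subseteq> Y i" by (auto simp: lat_def)
next
  assume "\<forall>i. residue_vec i ` gen_hull n L \<subseteq> Y i"
  then show "L \<subseteq> lat n Y" using gen_hull_subset[of L n] submodD(2)[OF L] by (auto simp: lat_def)
qed

text \<open>L lies in \<open>lat n Y\<close> iff each residue of S L lies in \<open>Y i\<close>, so
  the sum factors into one sum of Moebius values for each i. The product is 1 iff all residues of S
  L are full, which means S L = V by \<open>nakayama\<close>.\<close>

lemma moebius_inversion:
  assumes L: "submod n R L" and CL: "C \<subseteq> L"
  shows "(\<Sum>Y\<in>UNIV \<rightarrow>\<^sub>E subspaces n. if L \<subseteq> lat n Y then \<Prod>i\<in>UNIV. moebius n (Y i) else 0) =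
    (if gen_hull n L = V then 1 else 0)"
proof -
  let ?g = "gen_hull n L"
  let ?U = "\<lambda>i. residue_vec i ` ?g"
  note g = submod_gen_hull[OF submodD(2)[OF L]]
  have U: "submod n UNIV (?U i)" for i by (rule submod_residue_image[OF g])
  have "(\<Sum>Y\<in>UNIV \<rightarrow>\<^sub>E subspaces n. if L \<subseteq> lat n Y then \<Prod>i\<in>UNIV. moebius n (Y i) else 0) =
      (\<Sum>Y\<in>Pi\<^sub>E UNIV (\<lambda>i. {W \<in> subspaces n. ?U i \<subseteq> W}). \<Prod>i\<in>UNIV. moebius n (Y i))"
  proof (rule sum.mono_neutral_cong_right)
    show "finite (UNIV \<rightarrow>\<^sub>E subspaces n :: ('i \<Rightarrow> (nat \<Rightarrow> 'e) set) set)" by (intro finite_PiE finite_subspaces) simp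
    show "(\<Pi>\<^sub>E i\<in>UNIV. {W \<in> subspaces n. ?U i \<subseteq> W}) \<subseteq> UNIV \<rightarrow>\<^sub>E subspaces n" by auto
    have iff: "L \<subseteq> lat n Y \<longleftrightarrow> (\<forall>i. ?U i \<subseteq> Y i)" if "Y \<in> UNIV \<rightarrow>\<^sub>E subspaces n" for Y
      by (rule subset_lat_iff[OF L]) (use that in \<open>auto simp: subspaces_def\<close>)
    show "\<forall>Y\<in>(UNIV \<rightarrow>\<^sub>E subspaces n) - (\<Pi>\<^sub>E i\<in>UNIV. {W \<in> subspaces n. ?U i \<subseteq> W}).
        (if L \<subseteq> lat n Y then \<Prod>i\<in>UNIV. moebius n (Y i) else 0) = 0"
      by (auto simp: iff PiE_UNIV_domain Pi_iff)
    fix Y assume Y: "Y \<in> (\<Pi>\<^sub>E i\<in>UNIV. {W \<in> subspaces n. ?U i \<subseteq> W})"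
    then have "Y \<in> UNIV \<rightarrow>\<^sub>E subspaces n" "\<forall>i. ?U i \<subseteq> Y i" by auto
    then show "(if L \<subseteq> lat n Y then \<Prod>i\<in>UNIV. moebius n (Y i) else 0) = (\<Prod>i\<in>UNIV. moebius n (Y i))"
      by (simp add: iff)
  qed
  also have "\<dots> = (\<Prod>i\<in>UNIV. \<Sum>W\<in>{W \<in> subspaces n. ?U i \<subseteq> W}. moebius n W)"
    by (rule prod_sum_PiE[symmetric]) (simp, rule finite_subset[OF _ finite_subspaces], blast)
  also have "\<dots> = (\<Prod>i\<in>UNIV. if ?U i = vecs n then 1 else 0)"
    unfolding sum_moebius_above[OF U] ..
  also have "\<dots> = (if \<forall>i. ?U i = vecs n then 1 else 0)" by (simp add: prod_zero_iff)
  also have "(\<forall>i. ?U i = vecs n) \<longleftrightarrow> ?g = V"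
  proof
    assume res: "\<forall>i. ?U i = vecs n"
    have "C \<subseteq> ?g" using CL gen_hull_subset by blast
    then show "?g = V"
      using nakayama[OF g finite_index_between(1)[OF submodD(1)[OF g] _ submodD(2)[OF g]]] res by blast
  next
    assume "?g = V"
    moreover have "residue_vec i ` V = vecs n" for i
      using residue_vec_surj[of _ n i] by (auto intro: residue_vec_in_vecs)
    ultimately show "\<forall>i. ?U i = vecs n" by (simp only: simp_thms)
  qed
  finally show ?thesis .
qed

lemma full_lattices_eq: "full_lattices = {L. submod n R L \<and> C \<subseteq> L \<and> gen_hull n L = V}"
proof (intro equalityI subsetI)
  fix L assume L: "L \<in> full_lattices"
  show "L \<in> {L. submod n R L \<and> C \<subseteq> L \<and> gen_hull n L = V}"
    using C_sub_full(1)[OF L] L unfolding full_lattices_def by blast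
qed (simp add: full_lattices_def)

lemma card_subspaces_codim:
  "of_nat (card {U \<in> subspaces n. codim n (U :: (nat \<Rightarrow> 'e) set) = r}) =
    (qbinomial (of_nat CARD('e)) (int n) (int r) :: complex)"
proof -
  have z: "submod n UNIV ({0} :: (nat \<Rightarrow> 'e) set)"
    by (simp add: submod_def add_subgroup_singleton_zero vecs_def)
  have "codim n ({0} :: (nat \<Rightarrow> 'e) set) = n"
    by (rule codim_eq) (simp add: grp_index_zero_right card_vecs)
  moreover have "{U \<in> subspaces n. {0} \<subseteq> U \<and> codim n U = r} = {U \<in> subspaces n. codim n (U :: (nat \<Rightarrow> 'e) set) = r}"
    using add_subgroup_zero by (auto simp: subspaces_def submod_def)
  ultimately show ?thesis using card_subspaces_above[OF z, of r] by simp
qed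

text \<open>Sum \<open>moebius_inversion\<close> over all L containing C, exchange the sums, and
  group the families Y by their codimensions, on which both the weight and the number of L inside
  \<open>lat n Y\<close> depend.\<close>

lemma card_full_lattices:
  "of_nat (card full_lattices) = (\<Sum>r\<in>UNIV \<rightarrow>\<^sub>E {..n}.
    (\<Prod>i\<in>(UNIV :: 'i set). qbinomial (of_nat CARD('e)) (int n) (int (r i)) * weight_r (r i)) * lattice_count (\<Sum>i\<in>UNIV. r i))"
proof -
  let ?A = "{L. submod n R L \<and> C \<subseteq> L}"
  let ?P = "UNIV \<rightarrow>\<^sub>E subspaces n :: ('i \<Rightarrow> (nat \<Rightarrow> 'e) set) set"
  let ?c = "\<lambda>Y i. codim n ((Y :: 'i \<Rightarrow> (nat \<Rightarrow> 'e) set) i)"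
  have finA: "finite ?A"
    by (rule finite_subset[OF _ finite_between_subgroups[OF subgroup_V subgroup_C grp_index_V_C_pos]])
       (auto simp: submod_def)
  have finP: "finite ?P" by (intro finite_PiE finite_subspaces) simp
  have sub: "submod n UNIV (Y i)" if "Y \<in> ?P" for Y i using that by (auto simp: subspaces_def)
  have "of_nat (card full_lattices) = (\<Sum>L\<in>?A. if gen_hull n L = V then 1 else 0 :: complex)"
    unfolding full_lattices_eq using finA by (simp add: sum.If_cases Collect_conj_eq Int_ac)
  also have "\<dots> = (\<Sum>L\<in>?A. \<Sum>Y\<in>?P. if L \<subseteq> lat n Y then \<Prod>i\<in>UNIV. moebius n (Y i) else 0)"
    by (rule sum.cong[OF refl]) (rule moebius_inversion[symmetric], auto)
  also have "\<dots> = (\<Sum>Y\<in>?P. \<Sum>L\<in>?A. if L \<subseteq> lat n Y then \<Prod>i\<in>UNIV. moebius n (Y i) else 0)"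
    by (rule sum.swap)
  also have "\<dots> = (\<Sum>Y\<in>?P. (\<Prod>i\<in>UNIV. weight_r (?c Y i)) * lattice_count (\<Sum>i\<in>UNIV. ?c Y i))"
  proof (rule sum.cong[OF refl])
    fix Y assume Y: "Y \<in> ?P"
    have eq: "{L \<in> ?A. L \<subseteq> lat n Y} = {L. submod n R L \<and> C \<subseteq> L \<and> L \<subseteq> lat n Y}" by blast
    have "(\<Sum>L\<in>?A. if L \<subseteq> lat n Y then \<Prod>i\<in>UNIV. moebius n (Y i) else 0) =
        (\<Sum>L\<in>{L \<in> ?A. L \<subseteq> lat n Y}. \<Prod>i\<in>UNIV. moebius n (Y i))"
      by (rule sum.inter_filter[OF finA, symmetric])
    also have "\<dots> = (\<Prod>i\<in>UNIV. weight_r (?c Y i)) * of_nat (card {L. submod n R L \<and> C \<subseteq> L \<and> L \<subseteq> lat n Y})"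
      unfolding eq by (simp add: moebius_def weight_r_def)
    finally show "(\<Sum>L\<in>?A. if L \<subseteq> lat n Y then \<Prod>i\<in>UNIV. moebius n (Y i) else 0) =
        (\<Prod>i\<in>UNIV. weight_r (?c Y i)) * lattice_count (\<Sum>i\<in>UNIV. ?c Y i)"
      unfolding card_sublattices[OF sub[OF Y]] .
  qed
  also have "\<dots> = (\<Sum>r\<in>UNIV \<rightarrow>\<^sub>E {..n}. \<Sum>Y\<in>{Y \<in> ?P. ?c Y = r}.
      (\<Prod>i\<in>UNIV. weight_r (?c Y i)) * lattice_count (\<Sum>i\<in>UNIV. ?c Y i))"
    by (rule sum.group[symmetric, OF finP]) (auto intro!: finite_PiE codim_subspace(2) sub)
  also have "\<dots> = (\<Sum>r\<in>UNIV \<rightarrow>\<^sub>E {..n}.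
    (\<Prod>i\<in>(UNIV :: 'i set). qbinomial (of_nat CARD('e)) (int n) (int (r i)) * weight_r (r i)) * lattice_count (\<Sum>i\<in>UNIV. r i))"
  proof (rule sum.cong[OF refl])
    fix r :: "'i \<Rightarrow> nat"
    have "{Y \<in> ?P. ?c Y = r} = Pi\<^sub>E UNIV (\<lambda>i. {U \<in> subspaces n. codim n U = r i})"
      by (auto simp: PiE_UNIV_domain Pi_iff)
    then have "of_nat (card {Y \<in> ?P. ?c Y = r}) = (\<Prod>i\<in>UNIV. qbinomial (of_nat CARD('e)) (int n) (int (r i)) :: complex)"
      by (simp only: card_PiE[OF finite] of_nat_prod card_subspaces_codim)
    moreover have "(\<Sum>Y\<in>{Y \<in> ?P. ?c Y = r}. (\<Prod>i\<in>UNIV. weight_r (?c Y i)) * lattice_count (\<Sum>i\<in>UNIV. ?c Y i)) =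
        (\<Sum>Y\<in>{Y \<in> ?P. ?c Y = r}. (\<Prod>i\<in>UNIV. weight_r (r i)) * lattice_count (\<Sum>i\<in>UNIV. r i))"
      by (rule sum.cong) auto
    ultimately show "(\<Sum>Y\<in>{Y \<in> ?P. ?c Y = r}. (\<Prod>i\<in>UNIV. weight_r (?c Y i)) * lattice_count (\<Sum>i\<in>UNIV. ?c Y i)) =
        (\<Prod>i\<in>UNIV. qbinomial (of_nat CARD('e)) (int n) (int (r i)) * weight_r (r i)) * lattice_count (\<Sum>i\<in>UNIV. r i)"
      by (simp only: sum_constant prod.distrib mult.assoc)
  qed
  finally show ?thesis .
qed

lemma grp_index_V_cond: "grp_index V C = CARD('f) ^ (2 * n * m)"
proof -
  have "f * (CARD('i) * n * (e * m)) = 2 * n * m" unfolding degree[symmetric] by (simp only: mult_ac)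
  then show ?thesis unfolding grp_index_uniformizer_power_vecs card_ext power_mult[symmetric] by (simp only:)
qed

text \<open>R^n is its own dual lattice, so \<open>duality\<close> gives (R^n : C) = (V : R^n).
  Hence this index is the square root of (V : C).\<close>

lemma grp_index_V_Rn: "grp_index V Rn = CARD('f) ^ (n * m)"
proof -
  have "{v \<in> V. \<forall>x\<in>Rn. (\<Sum>a<n. x a * v a) \<in> R} = Rn"
  proof (intro equalityI subsetI)
    fix v assume v: "v \<in> {v \<in> V. \<forall>x\<in>Rn. (\<Sum>a<n. x a * v a) \<in> R}"
    have "v j \<in> R" for j
    proof (cases "j < n")
      case True
      have "unit_vec j \<in> Rn" using unit_vec_in_vecs[OF True] one_mem zero_mem by (simp add: Rn_def unit_vec_def)
      then have "(\<Sum>a<n. unit_vec j a * v a) \<in> R" using v by blast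
      moreover have "(\<Sum>a<n. unit_vec j a * v a) = v j"
        using True by (simp add: unit_vec_def if_distrib[of "\<lambda>z. z * _"] cong: if_cong)
      ultimately show ?thesis by simp
    next
      case False
      then show ?thesis using v zero_mem by (simp add: vecs_def)
    qed
    then show "v \<in> Rn" using v by (simp add: Rn_def)
  next
    fix v assume v: "v \<in> Rn"
    have "add_subgroup R" using zero_mem diff_mem by (intro add_subgroupI)
    then have "(\<Sum>a<n. x a * v a) \<in> R" if "x \<in> Rn" for x
      by (rule add_subgroup_sum) (use that v mult_mem in \<open>simp add: Rn_def\<close>)
    then show "v \<in> {v \<in> V. \<forall>x\<in>Rn. (\<Sum>a<n. x a * v a) \<in> R}" using v by (simp add: Rn_def)
  qed
  then have "grp_index Rn C = grp_index V Rn"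
    using duality[OF submod_Rn C_sub_Rn] by simp
  moreover have "grp_index V C = grp_index V Rn * grp_index Rn C"
    by (rule finite_index_between(3)[OF submodD(1)[OF submod_Rn] C_sub_Rn submodD(2)[OF submod_Rn]])
  ultimately have "grp_index V Rn ^ 2 = (CARD('f) ^ (n * m)) ^ 2"
    unfolding grp_index_V_cond by (simp add: power2_eq_square power_add[symmetric] mult_2 add_mult_distrib)
  then show ?thesis by (rule power2_eq_imp_eq) simp_all
qed

theorem zeta_quotient:
  fixes zR zS :: dirichlet_series
  assumes "\<And>k. k \<noteq> 0 \<Longrightarrow> zR k = of_nat (card {L. submod n R L \<and> L \<subseteq> Rn \<and> grp_index Rn L = k})"
    and "zR 0 = 0"
    and "\<And>k. k \<noteq> 0 \<Longrightarrow> zS k = of_nat (card {M. submod n (UNIV :: ('i \<Rightarrow> 'e fps) set) M \<and> grp_index V M = k})"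
    and "zS 0 = 0"
  shows "dirichlet_poly_value (dirichlet_divide (dirichlet_shift zR n) (dirichlet_shift zS n)) 0
    (of_nat CARD('f) powi (- (int m * int n ^ 2)) * (\<Sum>r\<in>UNIV \<rightarrow>\<^sub>E {..n}.
    (\<Prod>i\<in>(UNIV :: 'i set). qbinomial (of_nat CARD('e)) (int n) (int (r i)) * weight_r (r i)) * lattice_count (\<Sum>i\<in>UNIV. r i)))"
proof -
  let ?q = "of_nat CARD('f) :: complex"
  have q: "?q \<noteq> 0" by simp
  \<comment> \<open>The exponents of (V : C)^n and (V : R^n)^n differ by m n^2: the origin of the
    prefactor.\<close>
  have e: "2 * n * m * n = n * m * n + m * n ^ 2" by (simp add: power2_eq_square algebra_simps)
  have "of_nat (grp_index V Rn) ^ n / of_nat (grp_index V C) ^ n = ?q ^ (n * m * n) / ?q ^ (2 * n * m * n)"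
    unfolding grp_index_V_cond grp_index_V_Rn of_nat_power power_mult[symmetric] ..
  also have "\<dots> = 1 / ?q ^ (m * n ^ 2)" unfolding e power_add using q by simp
  also have "\<dots> = ?q powi (- (int m * int n ^ 2))"
    by (simp add: power_int_minus divide_inverse flip: of_nat_power of_nat_mult)
  finally have eq: "of_nat (card full_lattices) * of_nat (grp_index V Rn) ^ n / of_nat (grp_index V C) ^ n =
      ?q powi (- (int m * int n ^ 2)) * of_nat (card full_lattices)"
    unfolding times_divide_eq_right[symmetric] by (simp only: mult.commute)
  show ?thesis
    unfolding card_full_lattices[symmetric] eq[symmetric] by (rule order_zeta_quotient) (use assms in simp_all)
qed

end

section \<open>Orders containing a power of the uniformizer\<close>

text \<open>Substitution of T^e for the variable.\<close>

definition dil :: "nat \<Rightarrow> 'e::field fps \<Rightarrow> 'e fps" where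
  "dil e g = g oo fps_X ^ e"

definition coeff_map :: "('f::field \<Rightarrow> 'e::field) \<Rightarrow> 'f fps \<Rightarrow> 'e fps" where
  "coeff_map \<phi> g = Abs_fps (\<lambda>i. \<phi> (fps_nth g i))"

text \<open>F[[x]] embedded diagonally with x = T^e, plus x^m S: the common shape of the three
  orders inside their normalizations.\<close>

definition order_set :: "('f::field \<Rightarrow> 'e::field) \<Rightarrow> nat \<Rightarrow> nat \<Rightarrow> ('i \<Rightarrow> 'e fps) set" where
  "order_set \<phi> e m = {\<lambda>i. dil e (coeff_map \<phi> g) + fps_X ^ (e * m) * u i | g u. True}"

lemma order_setI: "s = (\<lambda>i. dil e (coeff_map \<phi> g) + fps_X ^ (e * m) * u i) \<Longrightarrow> s \<in> order_set \<phi> e m"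
  unfolding order_set_def by (rule CollectI) (intro exI conjI TrueI)

lemma dil_nth:
  assumes "e > 0"
  shows "fps_nth (dil e g) k = (if e dvd k then fps_nth g (k div e) else 0)"
proof -
  have "fps_nth (dil e g) k = (\<Sum>i=0..k. fps_nth g i * (if k = e * i then 1 else 0))"
    unfolding dil_def fps_compose_nth power_mult[symmetric] fps_X_power_nth ..
  also have "\<dots> = (\<Sum>i\<in>{i \<in> {0..k}. k = e * i}. fps_nth g i)"
    by (subst sum.inter_filter) (auto intro!: sum.cong)
  also have "{i \<in> {0..k}. k = e * i} = (if e dvd k then {k div e} else {})"
    using assms by (auto simp: dvd_def)
  finally show ?thesis by simp
qed

lemma dil_add: "dil e (a + b) = dil e a + dil e b"
  unfolding dil_def by (rule fps_compose_add_distrib)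

lemma dil_mult: "e > 0 \<Longrightarrow> dil e (a * b) = dil e a * dil e b"
  unfolding dil_def by (rule fps_compose_mult_distrib) simp

lemma dil_one_left: "dil 1 g = g"
  by (simp add: fps_eq_iff dil_nth)

lemma dil_X_power: "e > 0 \<Longrightarrow> dil e (fps_X ^ k) = fps_X ^ (e * k)"
  by (auto simp: fps_eq_iff dil_nth)

lemma dil_one: "e > 0 \<Longrightarrow> dil e 1 = 1"
  using dil_X_power[of e 0] by simp

lemma coeff_map_id: "coeff_map id g = g"
  by (simp add: fps_eq_iff coeff_map_def)

lemma fps_X_power_divides:
  assumes "\<And>k. k < N \<Longrightarrow> fps_nth a k = 0"
  shows "a = fps_X ^ N * fps_shift N a"
  by (rule fps_ext) (simp add: fps_X_power_mult_nth assms)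

lemma mem_order_set_iff:
  assumes e: "e > 0"
  shows "s \<in> order_set \<phi> e m \<longleftrightarrow>
    (\<exists>a. \<forall>i. \<forall>k<e * m. fps_nth (s i) k = (if e dvd k then \<phi> (a (k div e)) else 0))"
proof
  assume "s \<in> order_set \<phi> e m"
  then obtain g u where s: "s = (\<lambda>i. dil e (coeff_map \<phi> g) + fps_X ^ (e * m) * u i)"
    unfolding order_set_def by blast
  show "\<exists>a. \<forall>i. \<forall>k<e * m. fps_nth (s i) k = (if e dvd k then \<phi> (a (k div e)) else 0)"
    unfolding s by (intro exI[of _ "fps_nth g"]) (simp add: dil_nth[OF e] coeff_map_def fps_X_power_mult_nth)
next
  assume "\<exists>a. \<forall>i. \<forall>k<e * m. fps_nth (s i) k = (if e dvd k then \<phi> (a (k div e)) else 0)"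
  then obtain a where a: "\<And>i k. k < e * m \<Longrightarrow> fps_nth (s i) k = (if e dvd k then \<phi> (a (k div e)) else 0)" by blast
  let ?d = "dil e (coeff_map \<phi> (Abs_fps a))"
  have "s i - ?d = fps_X ^ (e * m) * fps_shift (e * m) (s i - ?d)" for i
    by (rule fps_X_power_divides) (simp add: a dil_nth[OF e] coeff_map_def)
  then have "s = (\<lambda>i. ?d + fps_X ^ (e * m) * fps_shift (e * m) (s i - ?d))" by (simp add: fun_eq_iff algebra_simps)
  then show "s \<in> order_set \<phi> e m" by (rule order_setI)
qed

section \<open>Hypersurface rings\<close>

text \<open>Evaluation of a power series in Y over F[[X]], with \<open>h\<close> applied to the
  coefficients and Y sent to \<open>u\<close>. As \<open>u\<close> will have constant term zero,
  terms with j > k do not reach degree k and the truncated sum is exact.\<close>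

definition ev :: "('a::field fps \<Rightarrow> 'a fps) \<Rightarrow> 'a fps \<Rightarrow> 'a fps fps \<Rightarrow> 'a fps" where
  "ev h u G = Abs_fps (\<lambda>k. fps_nth (\<Sum>j\<le>k. h (fps_nth G j) * u ^ j) k)"

lemma nth_mult_power_zero:
  fixes u :: "'a::field fps"
  assumes "fps_nth u 0 = 0" "k < j"
  shows "fps_nth (a * u ^ j) k = 0"
  unfolding fps_mult_nth
  by (rule sum.neutral) (use startsby_zero_power_prefix[OF assms(1), of j] assms(2) in auto)

locale fps_eval =
  fixes h :: "'a::field fps \<Rightarrow> 'a fps" and u :: "'a fps"
  assumes h_add: "h (a + b) = h a + h b" and h_mult: "h (a * b) = h a * h b" and h_one: "h 1 = 1"
    and u_0: "fps_nth u 0 = 0"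
begin

lemma h_zero: "h 0 = 0"
proof -
  have "h (0 + 0) = h 0 + h 0" by (rule h_add)
  then have "h 0 = h 0 + h 0" by (simp only: add_0_left)
  then show ?thesis by (simp only: add_cancel_right_right)
qed

lemma h_sum: "h (sum f I) = (\<Sum>i\<in>I. h (f i))"
  by (induction I rule: infinite_finite_induct) (simp_all add: h_add h_zero)

lemma ev_nth:
  assumes "k \<le> K"
  shows "fps_nth (ev h u G) k = fps_nth (\<Sum>j\<le>K. h (fps_nth G j) * u ^ j) k"
  unfolding ev_def fps_sum_nth fps_nth_Abs_fps
  by (rule sum.mono_neutral_left) (use assms nth_mult_power_zero[OF u_0] in auto)

lemma ev_add: "ev h u (G + H) = ev h u G + ev h u H"
  by (rule fps_ext) (simp add: ev_def h_add distrib_right sum.distrib)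

lemma ev_const: "ev h u (fps_const c) = h c"
proof (rule fps_ext)
  fix k
  have "(\<Sum>j\<le>k. h (fps_nth (fps_const c) j) * u ^ j) = (\<Sum>j\<le>k. if j = 0 then h c else 0)"
    by (rule sum.cong) (simp_all add: h_zero)
  then show "fps_nth (ev h u (fps_const c)) k = fps_nth (h c) k" unfolding ev_nth[OF order_refl] by simp
qed

lemma ev_X: "ev h u fps_X = u"
proof (rule fps_ext)
  fix k
  have "(\<Sum>j\<le>Suc k. h (fps_nth fps_X j) * u ^ j) = (\<Sum>j\<le>Suc k. if j = 1 then u else 0)"
    by (rule sum.cong) (simp_all add: h_zero h_one)
  then have "(\<Sum>j\<le>Suc k. h (fps_nth fps_X j) * u ^ j) = u" by (simp add: sum.delta)
  then show "fps_nth (ev h u fps_X) k = fps_nth u k"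
    unfolding ev_nth[OF le_SucI[OF order_refl]] by (simp only:)
qed

lemma ev_mult: "ev h u (G * H) = ev h u G * ev h u H"
proof (rule fps_ext)
  fix k
  let ?a = "\<lambda>i. h (fps_nth G i) * u ^ i" and ?b = "\<lambda>j. h (fps_nth H j) * u ^ j"
  have "fps_nth (ev h u G * ev h u H) k = (\<Sum>l=0..k. fps_nth (\<Sum>i\<le>k. ?a i) l * fps_nth (\<Sum>j\<le>k. ?b j) (k - l))"
    unfolding fps_mult_nth by (rule sum.cong[OF refl]) (simp only: ev_nth[of _ k] atLeastAtMost_iff diff_le_self)
  also have "\<dots> = fps_nth ((\<Sum>i\<le>k. ?a i) * (\<Sum>j\<le>k. ?b j)) k" by (rule fps_mult_nth[symmetric])
  also have "\<dots> = (\<Sum>(i, j)\<in>{..k} \<times> {..k}. fps_nth (?a i * ?b j) k)"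
    by (simp only: sum_product fps_sum_nth sum.cartesian_product[symmetric])
  \<comment> \<open>The pairs with i + j > k contribute a multiple of u^(i+j), which has no term of
    degree k.\<close>
  also have "\<dots> = (\<Sum>(i, j)\<in>{(i, j). i + j \<le> k}. fps_nth (?a i * ?b j) k)"
  proof (rule sum.mono_neutral_right)
    have "fps_nth (?a i * ?b j) k = 0" if "\<not> i + j \<le> k" for i j
    proof -
      have eq: "?a i * ?b j = h (fps_nth G i) * h (fps_nth H j) * u ^ (i + j)" by (simp only: power_add mult_ac)
      show ?thesis unfolding eq by (rule nth_mult_power_zero[OF u_0]) (use that in simp)
    qed
    then show "\<forall>p\<in>{..k} \<times> {..k} - {(i, j). i + j \<le> k}. (case p of (i, j) \<Rightarrow> fps_nth (?a i * ?b j) k) = 0"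
      by auto
  qed auto
  also have "\<dots> = (\<Sum>d\<le>k. \<Sum>i\<le>d. fps_nth (?a i * ?b (d - i)) k)"
    by (rule sum.triangle_reindex_eq)
  also have "\<dots> = (\<Sum>d\<le>k. fps_nth (h (fps_nth (G * H) d) * u ^ d) k)"
  proof (rule sum.cong[OF refl])
    fix d
    have "h (fps_nth (G * H) d) * u ^ d = (\<Sum>i\<le>d. ?a i * ?b (d - i))"
      unfolding fps_mult_nth h_sum h_mult sum_distrib_right atLeast0AtMost
    proof (rule sum.cong[OF refl])
      fix i assume "i \<in> {..d}"
      then have "u ^ d = u ^ i * u ^ (d - i)" by (simp add: power_add[symmetric])
      then show "h (fps_nth G i) * h (fps_nth H (d - i)) * u ^ d = ?a i * ?b (d - i)" by (simp only: mult_ac)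
    qed
    then show "(\<Sum>i\<le>d. fps_nth (?a i * ?b (d - i)) k) = fps_nth (h (fps_nth (G * H) d) * u ^ d) k"
      by (simp only: fps_sum_nth)
  qed
  also have "\<dots> = fps_nth (ev h u (G * H)) k" unfolding ev_def fps_nth_Abs_fps fps_sum_nth ..
  finally show "fps_nth (ev h u (G * H)) k = fps_nth (ev h u G * ev h u H) k" by (rule sym)
qed

lemma ev_one: "ev h u 1 = 1"
  using ev_const[of 1] h_one by simp

lemma ev_power: "ev h u (G ^ k) = ev h u G ^ k"
  by (induction k) (simp_all add: ev_one ev_mult)

lemma ev_diff: "ev h u (G - H) = ev h u G - ev h u H"
  using ev_add[of "G - H" H] by (simp add: algebra_simps)

end

lemma fps_eval_id: "fps_nth u 0 = 0 \<Longrightarrow> fps_eval (\<lambda>g. g) u"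
  by unfold_locales simp_all

lemma fps_eval_dil: "e > 0 \<Longrightarrow> fps_nth u 0 = 0 \<Longrightarrow> fps_eval (dil e) u"
  by unfold_locales (simp_all add: dil_add dil_mult dil_one)

text \<open>Division by Y^d - v(X). The remainder has degree below d in Y iff Q_j = G_(j+d) + v
  Q_(j+d) for all j, solved by Q_j = sum over k of G_(j+d+dk) v^k.\<close>

lemma weierstrass_division:
  fixes G :: "'a::field fps fps"
  assumes v: "fps_nth v 0 = 0"
  shows "\<exists>Q. \<forall>j\<ge>d. fps_nth (G - (fps_X ^ d - fps_const v) * Q) j = 0"
proof -
  interpret fps_eval "\<lambda>g. g" v by (rule fps_eval_id[OF v])
  \<comment> \<open>The solution is an infinite sum in powers of v; it is obtained by evaluating the
    series \<open>S j\<close> at v.\<close>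
  define S where "S j = Abs_fps (\<lambda>k. fps_nth G (j + d + d * k))" for j
  define Q where "Q = Abs_fps (\<lambda>j. ev (\<lambda>g. g) v (S j))"
  have "S j = fps_const (fps_nth G (j + d)) + fps_X * S (j + d)" for j
  proof (rule fps_ext)
    fix k
    show "fps_nth (S j) k = fps_nth (fps_const (fps_nth G (j + d)) + fps_X * S (j + d)) k"
      by (cases k) (simp_all add: S_def algebra_simps)
  qed
  then have rec: "fps_nth Q j = fps_nth G (j + d) + v * fps_nth Q (j + d)" for j
    unfolding Q_def fps_nth_Abs_fps by (metis ev_add ev_const ev_mult ev_X)
  have "fps_nth (G - (fps_X ^ d - fps_const v) * Q) j = 0" if "j \<ge> d" for j
    using rec[of "j - d"] that by (simp add: left_diff_distrib fps_X_power_mult_nth)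
  then show ?thesis by blast
qed

text \<open>The first isomorphism theorem; \<open>h\<close> is constant on a coset of its kernel, so
  the image of the coset is a singleton and \<open>the_elem\<close> extracts its value.\<close>

lemma ring_model_quotient:
  fixes h :: "'r::comm_ring_1 \<Rightarrow> 's::comm_ring_1"
  assumes add: "\<And>a b. h (a + b) = h a + h b" and mult: "\<And>a b. h (a * b) = h a * h b" and one: "h 1 = 1"
    and ker: "\<And>a. h a = 0 \<longleftrightarrow> f dvd a"
  shows "ring_model (ring_of_type_algebra Quot (Idl\<^bsub>ring_of_type_algebra\<^esub> {f})) (range h) (\<lambda>Z. the_elem (h ` Z))"
proof -
  let ?A = "ring_of_type_algebra :: 'r ring" and ?B = "ring_of_type_algebra :: 's ring"
  have sel: "carrier ?A = UNIV" "\<And>x y. x \<otimes>\<^bsub>?A\<^esub> y = x * y" "\<And>x y. x \<oplus>\<^bsub>?A\<^esub> y = x + y" "\<one>\<^bsub>?A\<^esub> = 1" "\<zero>\<^bsub>?A\<^esub> = 0"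
    "carrier ?B = UNIV" "\<And>x y. x \<otimes>\<^bsub>?B\<^esub> y = x * y" "\<And>x y. x \<oplus>\<^bsub>?B\<^esub> y = x + y" "\<one>\<^bsub>?B\<^esub> = 1" "\<zero>\<^bsub>?B\<^esub> = 0"
    by (simp_all add: ring_of_type_algebra_def)
  interpret A: cring ?A by (rule cring_from_type_algebra)
  interpret B: cring ?B by (rule cring_from_type_algebra)
  interpret H: ring_hom_ring ?A ?B h
    by (rule ring_hom_ringI2[OF A.ring_axioms B.ring_axioms]) (simp add: ring_hom_def sel add mult one)
  have K: "a_kernel ?A ?B h = Idl\<^bsub>?A\<^esub> {f}"
    unfolding A.cgenideal_eq_genideal[of f, unfolded sel, OF UNIV_I, symmetric] cgenideal_def a_kernel_def' sel
    using ker by (auto simp: dvd_def mult.commute)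
  let ?Q = "?A Quot (Idl\<^bsub>?A\<^esub> {f})" and ?j = "\<lambda>Z. the_elem (h ` Z)"
  have iso: "?j \<in> ring_iso ?Q (?B\<lparr>carrier := h ` UNIV\<rparr>)"
    using H.FactRing_iso_set_aux unfolding K sel .
  interpret Q: ring ?Q by (rule ideal.quotient_is_ring[OF A.genideal_ideal]) (simp add: sel)
  have hom: "?j (x \<otimes>\<^bsub>?Q\<^esub> y) = ?j x * ?j y" "?j (x \<oplus>\<^bsub>?Q\<^esub> y) = ?j x + ?j y"
    if "x \<in> carrier ?Q" "y \<in> carrier ?Q" for x y
    using iso that by (simp_all add: ring_iso_def ring_hom_def sel)
  have hom_one: "?j \<one>\<^bsub>?Q\<^esub> = 1" using iso by (simp add: ring_iso_def ring_hom_def sel)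
  have hom_zero: "?j \<zero>\<^bsub>?Q\<^esub> = 0" using hom(2)[OF Q.zero_closed Q.zero_closed] Q.l_zero[OF Q.zero_closed] by simp
  have bij: "bij_betw ?j (carrier ?Q) (range h)" using iso by (simp add: ring_iso_def)
  have "h a - h b = h (a - b)" for a b using add[of "a - b" b] by simp
  then have diff: "x - y \<in> range h" if "x \<in> range h" "y \<in> range h" for x y using that by auto
  show ?thesis
    by (rule ring_model.intro[OF bij Q.add.m_closed Q.m_closed Q.zero_closed Q.one_closed hom(2) hom(1) hom_zero hom_one diff])
qed

text \<open>The first summand has only even exponents and the second only odd ones.\<close>

lemma dil_2_independent:
  assumes eq: "dil 2 a + dil 2 b * fps_X ^ (2 * m + 1) = (0 :: 'a::field fps)"
  shows "a = 0" "b = 0"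
proof -
  have nth: "fps_nth (dil 2 a) k + (if k < 2 * m + 1 then 0 else fps_nth (dil 2 b) (k - (2 * m + 1))) = 0" for k
  proof -
    have "fps_nth (dil 2 a + dil 2 b * fps_X ^ (2 * m + 1)) k = fps_nth 0 k" unfolding eq ..
    then show ?thesis by (simp only: fps_add_nth fps_X_power_mult_right_nth fps_zero_nth)
  qed
  show "a = 0"
  proof (rule fps_ext)
    fix k
    have "\<not> 2 dvd 2 * k - (2 * m + 1)" if "\<not> 2 * k < 2 * m + 1" using that by presburger
    then show "fps_nth a k = fps_nth 0 k" using nth[of "2 * k"] by (simp add: dil_nth split: if_splits)
  qed
  show "b = 0"
  proof (rule fps_ext)
    fix k
    show "fps_nth b k = fps_nth 0 k" using nth[of "2 * k + (2 * m + 1)"] by (simp add: dil_nth)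
  qed
qed

lemma fps_remainder:
  fixes G :: "'b::comm_ring_1 fps"
  assumes "\<And>j. j \<ge> 2 \<Longrightarrow> fps_nth G j = 0"
  shows "G = fps_const (fps_nth G 0) + fps_const (fps_nth G 1) * fps_X"
proof (rule fps_ext)
  fix k :: nat
  consider "k = 0" | "k = 1" | "k \<ge> 2" by linarith
  then show "fps_nth G k = fps_nth (fps_const (fps_nth G 0) + fps_const (fps_nth G 1) * fps_X) k"
    by cases (use assms in auto)
qed

lemma fps_even_odd: "z = dil 2 (Abs_fps (\<lambda>k. fps_nth z (2 * k))) + fps_X * dil 2 (Abs_fps (\<lambda>k. fps_nth z (2 * k + 1)))"
proof (rule fps_ext)
  fix k
  show "fps_nth z k = fps_nth (dil 2 (Abs_fps (\<lambda>k. fps_nth z (2 * k))) + fps_X * dil 2 (Abs_fps (\<lambda>k. fps_nth z (2 * k + 1)))) k"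
    by (cases "even k"; cases k) (auto simp: dil_nth elim!: oddE evenE)
qed

text \<open>The parametrization X = T^2, Y = T^(2m+1). Modulo Y^2 - X^(2m+1) every series is a(X) +
  b(X) Y, sent to a(T^2) + b(T^2) T^(2m+1), which vanishes only for a = b = 0. The image contains
  T^(2m) z for every z: the even part of z goes into a, the odd part into b.\<close>

lemma ramified_model:
  obtains \<iota> where "ring_model (ramified_order m :: 'a fps fps set ring) (order_set id 2 m :: (unit \<Rightarrow> 'a::field fps) set) \<iota>"
proof -
  let ?u = "fps_X ^ (2 * m + 1) :: 'a fps"
  interpret fps_eval "dil 2" ?u by (rule fps_eval_dil) simp_all
  let ?f = "var_Y ^ 2 - var_X ^ (2 * m + 1) :: 'a fps fps"
  let ?h = "\<lambda>G (_ :: unit). ev (dil 2) ?u G"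
  have f: "?f = fps_X ^ 2 - fps_const ?u" by (simp add: fps_const_power)
  have evf: "ev (dil 2) ?u ?f = 0"
    unfolding f ev_diff ev_power ev_X ev_const dil_X_power[of 2, simplified] power_mult[symmetric] by (simp add: mult.commute)
  have ev_linear: "ev (dil 2) ?u (fps_const a + fps_const b * fps_X) = dil 2 a + dil 2 b * ?u" for a b
    by (simp only: ev_add ev_mult ev_const ev_X)
  have ex: "\<exists>a b Q. G = (fps_const a + fps_const b * fps_X) + ?f * Q" for G
  proof -
    obtain Q where "\<forall>j\<ge>2. fps_nth (G - (fps_X ^ 2 - fps_const ?u) * Q) j = 0"
      using weierstrass_division[OF u_0, of 2 G] by blast
    then have "G - ?f * Q = fps_const (fps_nth (G - ?f * Q) 0) + fps_const (fps_nth (G - ?f * Q) 1) * fps_X"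
      unfolding f by (intro fps_remainder) blast
    then show ?thesis by (metis diff_add_cancel)
  qed
  have ev_expand: "ev (dil 2) ?u ((fps_const a + fps_const b * fps_X) + ?f * Q) = dil 2 a + dil 2 b * ?u" for a b Q
    by (simp only: ev_add[of _ "?f * Q"] ev_linear ev_mult[of ?f] evf mult_zero_left add_0_right)
  have M: "ring_model (ramified_order m) (range ?h) (\<lambda>Z. the_elem (?h ` Z))"
    unfolding ramified_order_def hypersurface_ring_def
  proof (rule ring_model_quotient)
    fix G
    show "?h G = 0 \<longleftrightarrow> ?f dvd G"
    proof
      assume "?h G = 0"
      then have z: "ev (dil 2) ?u G = 0" by (simp add: fun_eq_iff)
      obtain a b Q where G: "G = (fps_const a + fps_const b * fps_X) + ?f * Q" using ex by blast
      have "dil 2 a + dil 2 b * ?u = 0" using z unfolding G ev_expand .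
      from dil_2_independent[OF this] have "G = ?f * Q" unfolding G by simp
      then show "?f dvd G" by (rule dvdI)
    next
      assume "?f dvd G"
      then obtain Q where "G = ?f * Q" by (rule dvdE)
      then have "ev (dil 2) ?u G = 0" by (simp only: ev_mult[of ?f] evf mult_zero_left)
      then show "?h G = 0" by (simp add: fun_eq_iff)
    qed
  qed (simp_all only: ev_add ev_mult ev_one plus_fun_def times_fun_def one_fun_def)
  have R: "range ?h = order_set id 2 m"
  proof (intro equalityI subsetI)
    fix s assume "s \<in> range ?h"
    then obtain G where s: "s = ?h G" by blast
    obtain a b Q where G: "G = (fps_const a + fps_const b * fps_X) + ?f * Q" using ex by blast
    have "s = (\<lambda>i. dil 2 (coeff_map id a) + fps_X ^ (2 * m) * (fps_X * dil 2 b))"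
      unfolding s G ev_expand coeff_map_id by (simp add: mult_ac)
    then show "s \<in> order_set id 2 m" by (rule order_setI)
  next
    fix s :: "unit \<Rightarrow> 'a fps" assume "s \<in> order_set id 2 m"
    then obtain g z where s: "s = (\<lambda>i. dil 2 g + fps_X ^ (2 * m) * z i)"
      unfolding order_set_def coeff_map_id by blast
    let ?a = "Abs_fps (\<lambda>k. fps_nth (z ()) (2 * k))" and ?b = "Abs_fps (\<lambda>k. fps_nth (z ()) (2 * k + 1))"
    have "dil 2 g + fps_X ^ (2 * m) * z () = dil 2 g + fps_X ^ (2 * m) * (dil 2 ?a + fps_X * dil 2 ?b)"
      using fps_even_odd[of "z ()"] by (simp only:)
    also have "\<dots> = dil 2 (g + fps_X ^ m * ?a) + dil 2 ?b * ?u"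
      unfolding dil_add dil_mult[of 2, simplified] dil_X_power[of 2, simplified] by (simp add: algebra_simps)
    also have "\<dots> = ev (dil 2) ?u (fps_const (g + fps_X ^ m * ?a) + fps_const ?b * fps_X)" by (rule ev_linear[symmetric])
    finally have "s = ?h (fps_const (g + fps_X ^ m * ?a) + fps_const ?b * fps_X)"
      unfolding s by (simp add: fun_eq_iff)
    then show "s \<in> range ?h" by blast
  qed
  show thesis using M unfolding R by (rule that)
qed

text \<open>The two branches are Y = 0 (at \<open>False\<close>) and Y = X^m (at
  \<open>True\<close>). A series vanishing on the former is divisible by Y, and if it also vanishes
  on the latter, the quotient is divisible by Y - X^m. The image consists of the pairs congruent
  modulo X^m.\<close>

lemma split_model:
  assumes m: "m > 0"
  obtains \<iota> where "ring_model (split_order m :: 'a fps fps set ring) (order_set id 1 m :: (bool \<Rightarrow> 'a::field fps) set) \<iota>"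
proof -
  let ?u = "fps_X ^ m :: 'a fps" and ?e = "\<lambda>v. ev (\<lambda>g. g) (v :: 'a fps)"
  interpret E0: fps_eval "\<lambda>g. g" "0 :: 'a fps" by (rule fps_eval_id) simp
  interpret E: fps_eval "\<lambda>g. g" ?u by (rule fps_eval_id) (use m in simp)
  let ?f = "var_Y * (var_Y - var_X ^ m) :: 'a fps fps"
  let ?h = "\<lambda>G (i :: bool). if i then ?e ?u G else ?e 0 G"
  have f: "?f = fps_X * (fps_X - fps_const ?u)" by (simp add: fps_const_power)
  have split_X: "G = fps_const (fps_nth G 0) + fps_X * fps_shift 1 G" for G :: "'a fps fps"
    by (rule fps_ext) simp
  have e0: "?e 0 (fps_const a + fps_X * G) = a" and eu: "?e ?u (fps_const a + fps_X * G) = a + ?u * ?e ?u G" for a G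
    by (simp_all only: E0.ev_add E0.ev_mult E0.ev_const E0.ev_X E.ev_add E.ev_mult E.ev_const E.ev_X mult_zero_left add_0_right)
  have evf: "?e 0 ?f = 0" "?e ?u ?f = 0"
    unfolding f by (simp_all only: E0.ev_mult E0.ev_X E.ev_mult E.ev_diff E.ev_X E.ev_const diff_self mult_zero_left mult_zero_right)
  have M: "ring_model (split_order m) (range ?h) (\<lambda>Z. the_elem (?h ` Z))"
    unfolding split_order_def hypersurface_ring_def
  proof (rule ring_model_quotient)
    fix G :: "'a fps fps"
    show "?h G = 0 \<longleftrightarrow> ?f dvd G"
    proof
      assume h0: "?h G = 0"
      have z: "?e ?u G = 0" "?e 0 G = 0" using fun_cong[OF h0, of True] fun_cong[OF h0, of False] by simp_all
      let ?G = "fps_shift 1 G"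
      have a: "fps_nth G 0 = 0" using z(2) e0[of "fps_nth G 0" ?G] split_X[of G] by simp
      have G: "G = fps_X * ?G" using split_X[of G] unfolding a by simp
      have "?u * ?e ?u ?G = 0" using z(1) eu[of "fps_nth G 0" ?G] split_X[of G] a by simp
      then have zG: "?e ?u ?G = 0" by simp
      obtain Q where Q1: "\<forall>j\<ge>1. fps_nth (?G - (fps_X ^ 1 - fps_const ?u) * Q) j = 0"
        using weierstrass_division[OF E.u_0, of 1 ?G] by blast
      have Q: "?G - (fps_X - fps_const ?u) * Q = fps_const (fps_nth (?G - (fps_X - fps_const ?u) * Q) 0)" (is "_ = fps_const ?r")
      proof (rule fps_ext)
        fix k
        show "fps_nth (?G - (fps_X - fps_const ?u) * Q) k = fps_nth (fps_const ?r) k"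
        proof (cases "k = 0")
          case False
          then have "fps_nth (?G - (fps_X - fps_const ?u) * Q) k = 0"
            using Q1[rule_format, of k] unfolding power_one_right by linarith
          then show ?thesis using False by (simp only: fps_nth_fps_const if_False)
        qed (simp only: fps_nth_fps_const simp_thms if_True)
      qed
      have "?e ?u (?G - (fps_X - fps_const ?u) * Q) = 0"
        by (simp only: E.ev_diff E.ev_mult E.ev_X E.ev_const zG diff_self mult_zero_left)
      then have "?r = 0" using E.ev_const[of ?r] Q by simp
      then have "?G = (fps_X - fps_const ?u) * Q" using Q by simp
      then have "G = ?f * Q" using G unfolding f by (simp only: mult.assoc)
      then show "?f dvd G" by (rule dvdI)
    next
      assume "?f dvd G"
      then obtain Q where G: "G = ?f * Q" by (rule dvdE)
      have "?e ?u G = 0" "?e 0 G = 0" unfolding G by (simp_all only: E.ev_mult[of ?f] E0.ev_mult[of ?f] evf mult_zero_left)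
      then show "?h G = 0" by (simp add: fun_eq_iff)
    qed
  next
    show "?h (a + b) = ?h a + ?h b" "?h (a * b) = ?h a * ?h b" for a b
      by (simp_all only: E.ev_add E0.ev_add E.ev_mult E0.ev_mult plus_fun_def times_fun_def fun_eq_iff) simp_all
    show "?h 1 = 1" by (simp add: fun_eq_iff E.ev_one E0.ev_one)
  qed
  have R: "range ?h = order_set id 1 m"
  proof (intro equalityI subsetI)
    fix s assume "s \<in> range ?h"
    then obtain G where s: "s = ?h G" by blast
    let ?a = "fps_nth G 0" and ?G = "fps_shift 1 G"
    have "?e ?u G = ?a + ?u * ?e ?u ?G" "?e 0 G = ?a"
      using eu[of ?a ?G] e0[of ?a ?G] split_X[of G] by simp_all
    then have "s = (\<lambda>i. dil 1 (coeff_map id ?a) + fps_X ^ (1 * m) * (if i then ?e ?u ?G else 0))"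
      unfolding s dil_one_left coeff_map_id by (auto simp: fun_eq_iff)
    then show "s \<in> order_set id 1 m" by (rule order_setI)
  next
    fix s :: "bool \<Rightarrow> 'a fps" assume "s \<in> order_set id 1 m"
    then obtain g z where s: "s = (\<lambda>i. g + ?u * z i)"
      unfolding order_set_def coeff_map_id dil_one_left mult_1_left by blast
    let ?G = "fps_const (g + ?u * z False) + fps_X * fps_const (z True - z False)"
    have "s = ?h ?G" unfolding s e0 eu E.ev_const by (auto simp: fun_eq_iff algebra_simps)
    then show "s \<in> range ?h" by (rule range_eqI)
  qed
  show thesis using M unfolding R by (rule that)
qed

lemma inert_model:
  fixes \<phi> :: "'a::field \<Rightarrow> 'b::field"
  assumes add: "\<And>a b. \<phi> (a + b) = \<phi> a + \<phi> b" and diff: "\<And>r r' :: unit \<Rightarrow> 'b fps. r \<in> order_set \<phi> 1 m \<Longrightarrow> r' \<in> order_set \<phi> 1 m \<Longrightarrow> r - r' \<in> order_set \<phi> 1 m"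
    and mult: "\<And>r r' :: unit \<Rightarrow> 'b fps. r \<in> order_set \<phi> 1 m \<Longrightarrow> r' \<in> order_set \<phi> 1 m \<Longrightarrow> r * r' \<in> order_set \<phi> 1 m"
    and one: "(1 :: unit \<Rightarrow> 'b fps) \<in> order_set \<phi> 1 m"
  shows "ring_model (inert_order \<phi> m) (order_set \<phi> 1 m) (\<lambda>x (_ :: unit). x)"
proof -
  let ?A = "inert_order \<phi> m" and ?R = "order_set \<phi> 1 m :: (unit \<Rightarrow> 'b fps) set" and ?j = "\<lambda>x (_ :: unit). (x :: 'b fps)"
  have sel: "x \<otimes>\<^bsub>?A\<^esub> y = x * y" "x \<oplus>\<^bsub>?A\<^esub> y = x + y" "\<one>\<^bsub>?A\<^esub> = 1" "\<zero>\<^bsub>?A\<^esub> = 0" for x y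
    by (simp_all add: inert_order_def ring_of_type_algebra_def)
  have carr: "x \<in> carrier ?A \<longleftrightarrow> ?j x \<in> ?R" for x
    unfolding order_set_def dil_one_left coeff_map_def mult_1_left
    by (auto simp: inert_order_def fun_eq_iff)
  have sum: "r + r' \<in> ?R" if "r \<in> ?R" "r' \<in> ?R" for r r' :: "unit \<Rightarrow> 'b fps"
  proof -
    have "r - ((r' - r') - r') \<in> ?R" by (intro diff that)
    then show ?thesis by simp
  qed
  show ?thesis
  proof (rule ring_model.intro)
    show "bij_betw ?j (carrier ?A) ?R"
    proof (rule bij_betw_imageI)
      show "inj_on ?j (carrier ?A)" by (rule inj_onI) (simp add: fun_eq_iff)
      show "?j ` carrier ?A = ?R"
      proof (intro equalityI subsetI)
        fix s assume "s \<in> ?R"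
        moreover have "s = ?j (s ())" by (simp add: fun_eq_iff)
        ultimately show "s \<in> ?j ` carrier ?A" using carr[of "s ()"] by (metis imageI)
      qed (use carr in auto)
    qed
    fix a b assume ab: "a \<in> carrier ?A" "b \<in> carrier ?A"
    have e: "?j (a + b) = ?j a + ?j b" "?j (a * b) = ?j a * ?j b" by (simp_all add: fun_eq_iff)
    show "a \<oplus>\<^bsub>?A\<^esub> b \<in> carrier ?A" unfolding sel carr e using ab carr by (intro sum) auto
    show "a \<otimes>\<^bsub>?A\<^esub> b \<in> carrier ?A" unfolding sel carr e using ab carr by (intro mult) auto
    show "?j (a \<oplus>\<^bsub>?A\<^esub> b) = ?j a + ?j b" "?j (a \<otimes>\<^bsub>?A\<^esub> b) = ?j a * ?j b" unfolding sel by (rule e)+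
  next
    have e: "?j 0 = 0" "?j 1 = 1" by (simp_all add: fun_eq_iff)
    show "\<zero>\<^bsub>?A\<^esub> \<in> carrier ?A" unfolding sel carr e using diff[OF one one] by simp
    show "\<one>\<^bsub>?A\<^esub> \<in> carrier ?A" unfolding sel carr e by (rule one)
    show "?j \<zero>\<^bsub>?A\<^esub> = 0" "?j \<one>\<^bsub>?A\<^esub> = 1" unfolding sel by (rule e)+
  qed (rule diff)
qed

section \<open>Verification of the order axioms for F[[x]] + x^m S\<close>

locale field_embedding =
  fixes \<phi> :: "'f::{field,finite} \<Rightarrow> 'e::{field,finite}"
  assumes phi_diff: "\<phi> (a - b) = \<phi> a - \<phi> b" and phi_mult: "\<phi> (a * b) = \<phi> a * \<phi> b" and phi_one: "\<phi> 1 = 1"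
begin

lemma phi_zero: "\<phi> 0 = 0"
  using phi_diff[of 0 0] by simp

lemma phi_add: "\<phi> (a + b) = \<phi> a + \<phi> b"
  using phi_diff[of "a + b" b] by simp

lemma phi_sum: "\<phi> (sum g I) = (\<Sum>i\<in>I. \<phi> (g i))"
  by (induction I rule: infinite_finite_induct) (simp_all add: phi_add phi_zero)

lemma coeff_map_mult: "coeff_map \<phi> (a * b) = coeff_map \<phi> a * coeff_map \<phi> b"
  by (rule fps_ext) (simp add: coeff_map_def fps_mult_nth phi_sum phi_mult)

lemma coeff_map_diff: "coeff_map \<phi> (a - b) = coeff_map \<phi> a - coeff_map \<phi> b"
  by (rule fps_ext) (simp add: coeff_map_def phi_diff)

lemma coeff_map_X_power: "coeff_map \<phi> (fps_X ^ k) = fps_X ^ k"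
  by (rule fps_ext) (simp add: coeff_map_def phi_one phi_zero)

lemma coeff_map_const: "coeff_map \<phi> (fps_const a) = fps_const (\<phi> a)"
  by (rule fps_ext) (simp add: coeff_map_def phi_zero)

lemma dil_diff: "dil e (a - b) = dil e a - dil e b"
  using dil_add[of e "a - b" b] by (simp add: algebra_simps)

lemma order_set_diff:
  assumes "r \<in> order_set \<phi> e m" "r' \<in> order_set \<phi> e m"
  shows "r - r' \<in> order_set \<phi> e m"
proof -
  obtain g u g' u' where r: "r = (\<lambda>i. dil e (coeff_map \<phi> g) + fps_X ^ (e * m) * u i)"
    "r' = (\<lambda>i. dil e (coeff_map \<phi> g') + fps_X ^ (e * m) * u' i)"
    using assms unfolding order_set_def by blast
  have "r - r' = (\<lambda>i. dil e (coeff_map \<phi> (g - g')) + fps_X ^ (e * m) * (u i - u' i))"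
    unfolding r coeff_map_diff dil_diff by (simp add: fun_eq_iff algebra_simps)
  then show ?thesis by (rule order_setI)
qed

lemma order_set_mult:
  assumes e: "e > 0" and "r \<in> order_set \<phi> e m" "r' \<in> order_set \<phi> e m"
  shows "r * r' \<in> order_set \<phi> e m"
proof -
  obtain g u g' u' where r: "r = (\<lambda>i. dil e (coeff_map \<phi> g) + fps_X ^ (e * m) * u i)"
    "r' = (\<lambda>i. dil e (coeff_map \<phi> g') + fps_X ^ (e * m) * u' i)"
    using assms unfolding order_set_def by blast
  have "r * r' = (\<lambda>i. dil e (coeff_map \<phi> (g * g')) + fps_X ^ (e * m) *
      (dil e (coeff_map \<phi> g) * u' i + u i * dil e (coeff_map \<phi> g') + fps_X ^ (e * m) * u i * u' i))"
    unfolding r coeff_map_mult dil_mult[OF e] by (simp add: fun_eq_iff algebra_simps)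
  then show ?thesis by (rule order_setI)
qed

lemma order_set_const:
  assumes e: "e > 0"
  shows "const_emb \<phi> a \<in> order_set \<phi> e m"
proof -
  have "const_emb \<phi> a = (\<lambda>i :: 'i. dil e (coeff_map \<phi> (fps_const a)) + fps_X ^ (e * m) * 0)"
    unfolding coeff_map_const const_emb_def dil_def by simp
  then show ?thesis by (rule order_setI)
qed

lemma order_set_X_power:
  assumes e: "e > 0"
  shows "(\<lambda>_. fps_X ^ (e * j)) \<in> order_set \<phi> e m"
proof -
  have "(\<lambda>_. fps_X ^ (e * j)) = (\<lambda>i :: 'i. dil e (coeff_map \<phi> (fps_X ^ j)) + fps_X ^ (e * m) * 0)"
    unfolding coeff_map_X_power dil_X_power[OF e] by simp
  then show ?thesis by (rule order_setI)
qed

lemma order_set_conductor: "uniformizer ^ (e * m) * s \<in> order_set \<phi> e m"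
proof -
  have "uniformizer ^ (e * m) * s = (\<lambda>i. dil e (coeff_map \<phi> 0) + fps_X ^ (e * m) * s i)"
    using coeff_map_diff[of 0 0] dil_diff[of e 0 0]
    by (simp add: fun_eq_iff power_fun_apply uniformizer_def)
  then show ?thesis by (rule order_setI)
qed

lemma one_in_order_set: "e > 0 \<Longrightarrow> 1 \<in> order_set \<phi> e m"
  using order_set_X_power[of e 0 m] by (simp add: one_fun_def)

lemma order_set_expansion:
  fixes r :: "'i \<Rightarrow> 'e fps"
  assumes e: "e > 0" and r: "r \<in> order_set \<phi> e m"
  shows "\<exists>a u. r = (\<Sum>j<m. const_emb \<phi> (a j) * (uniformizer ^ e) ^ j) + uniformizer ^ (e * m) * u"
proof -
  obtain a where a: "\<And>i k. k < e * m \<Longrightarrow> fps_nth (r i) k = (if e dvd k then \<phi> (a (k div e)) else 0)"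
    using r unfolding mem_order_set_iff[OF e] by blast
  let ?p = "\<Sum>j<m. fps_const (\<phi> (a j)) * fps_X ^ (e * j) :: 'e fps"
  have p: "fps_nth ?p k = (if e dvd k then \<phi> (a (k div e)) else 0)" if k: "k < e * m" for k
  proof -
    have "fps_nth ?p k = (\<Sum>j<m. if k = e * j then \<phi> (a j) else 0)"
      unfolding fps_sum_nth by (rule sum.cong) simp_all
    also have "\<dots> = (\<Sum>j\<in>{j \<in> {..<m}. k = e * j}. \<phi> (a j))" by (rule sum.inter_filter[symmetric]) simp
    also have "{j \<in> {..<m}. k = e * j} = (if e dvd k then {k div e} else {})"
      using e k by (auto simp: dvd_def)
    finally show ?thesis by simp
  qed
  have d: "r i - ?p = fps_X ^ (e * m) * fps_shift (e * m) (r i - ?p)" for i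
    by (rule fps_X_power_divides) (simp only: fps_sub_nth a p diff_self)
  have "r = (\<Sum>j<m. const_emb \<phi> (a j) * (uniformizer ^ e) ^ j) + uniformizer ^ (e * m) * (\<lambda>i. fps_shift (e * m) (r i - ?p))"
  proof (rule ext)
    fix i :: 'i
    have s: "(\<Sum>j<m. const_emb \<phi> (a j) * (uniformizer ^ e) ^ j :: 'i \<Rightarrow> 'e fps) i = ?p"
      unfolding sum_fun_apply times_fun_apply power_fun_apply const_emb_def uniformizer_def power_mult ..
    show "r i = ((\<Sum>j<m. const_emb \<phi> (a j) * (uniformizer ^ e) ^ j) + uniformizer ^ (e * m) * (\<lambda>i. fps_shift (e * m) (r i - ?p))) i"
      unfolding plus_fun_apply s
      unfolding times_fun_apply power_fun_apply uniformizer_def d[of i, symmetric] by (simp only: add_diff_eq add_diff_cancel_left')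
  qed
  then show ?thesis by blast
qed

text \<open>The Gorenstein functional is a linear functional \<open>lam\<close> of the coefficients
  in degree em - 1, just below the conductor. By \<open>lam_order\<close> the order is cut out by
  the conditions \<open>\<tau>\<close> (x^j s) = 0 for j < m, so orthogonality to the powers of x
  already gives membership, and nondegeneracy of \<open>lam\<close> gives that of the
  pairing.\<close>

lemma quadratic_orderI:
  fixes lam :: "('i::finite \<Rightarrow> 'e) \<Rightarrow> 'k::ab_group_add"
  assumes e: "e > 0" and m: "m > 0" and card_ext: "CARD('e) = CARD('f) ^ f" and degree: "e * CARD('i) * f = 2"
    and lam_diff: "\<And>z w. lam (\<lambda>i. z i - w i) = lam z - lam w" and lam_range: "card (range lam) = CARD('f)"
    and lam_scalar: "\<And>z y. lam z \<noteq> 0 \<Longrightarrow> \<exists>a. lam (\<lambda>i. \<phi> a * z i) = lam y"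
    and lam_nondeg: "\<And>z i. (\<And>w. lam (\<lambda>i. z i * w i) = 0) \<Longrightarrow> z i = 0"
    and lam_order: "\<And>s. s \<in> order_set \<phi> e m \<longleftrightarrow> (\<forall>j<m. lam (\<lambda>i. fps_nth (s i) (e * m - 1 - e * j)) = 0)"
  shows "quadratic_order \<phi> (order_set \<phi> e m) (\<lambda>s. lam (\<lambda>i. fps_nth (s i) (e * m - 1))) e m f"
proof -
  let ?R = "order_set \<phi> e m :: ('i \<Rightarrow> 'e fps) set" and ?\<tau> = "\<lambda>s. lam (\<lambda>i. fps_nth (s i) (e * m - 1))"
  have em: "e * m > 0" using e m by simp
  have xpow: "uniformizer ^ k = (\<lambda>_ :: 'i. fps_X ^ k :: 'e fps)" for k
    by (simp add: fun_eq_iff power_fun_apply uniformizer_def)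
  have range_tau: "range ?\<tau> = range lam"
  proof -
    have "lam z \<in> range ?\<tau>" for z
      by (rule image_eqI[of _ _ "\<lambda>i. fps_const (z i) * fps_X ^ (e * m - 1)"]) simp_all
    then show ?thesis by auto
  qed
  show ?thesis
  proof unfold_locales
    show "r - r' \<in> ?R" "r * r' \<in> ?R" if "r \<in> ?R" "r' \<in> ?R" for r r'
      using order_set_diff order_set_mult[OF e] that by blast+
    show "(1 :: 'i \<Rightarrow> 'e fps) \<in> ?R" by (rule one_in_order_set[OF e])
    show "const_emb \<phi> a \<in> ?R" for a by (rule order_set_const[OF e])
    show "uniformizer ^ (e * m) * s \<in> ?R" for s by (rule order_set_conductor)
    show "?\<tau> (x - y) = ?\<tau> x - ?\<tau> y" for x y using lam_diff by simp
    show "card (range ?\<tau>) = CARD('f)" unfolding range_tau by (rule lam_range)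
    show "\<exists>a. ?\<tau> (const_emb \<phi> a * s) = ?\<tau> y" if "?\<tau> s \<noteq> 0" for s y
      using lam_scalar[OF that, of "\<lambda>i. fps_nth (y i) (e * m - 1)"] by (simp add: const_emb_def)
    show "s \<in> ?R \<longleftrightarrow> (\<forall>r\<in>?R. ?\<tau> (r * s) = 0)" for s
    proof
      assume s: "s \<in> ?R"
      show "\<forall>r\<in>?R. ?\<tau> (r * s) = 0"
      proof
        fix r assume "r \<in> ?R"
        then have "r * s \<in> ?R" using order_set_mult[OF e] s by blast
        then show "?\<tau> (r * s) = 0" using m unfolding lam_order by (auto dest!: spec[of _ 0])
      qed
    next
      assume *: "\<forall>r\<in>?R. ?\<tau> (r * s) = 0"
      show "s \<in> ?R"
        unfolding lam_order
      proof (intro allI impI)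
        fix j assume j: "j < m"
        then have "e * j + e \<le> e * m" using mult_le_mono2[of "Suc j" m e] by simp
        then have "\<not> e * m - 1 < e * j" using e by simp
        then have "(\<lambda>i. fps_nth (((\<lambda>_. fps_X ^ (e * j)) * s) i) (e * m - 1)) = (\<lambda>i. fps_nth (s i) (e * m - 1 - e * j))"
          by (simp add: fun_eq_iff fps_X_power_mult_nth)
        then show "lam (\<lambda>i. fps_nth (s i) (e * m - 1 - e * j)) = 0"
          using bspec[OF * order_set_X_power[OF e, of j m]] by (simp only:)
      qed
    qed
    show "x \<in> range ((*) (uniformizer ^ (e * m)))" if x: "\<And>y. ?\<tau> (x * y) = 0" for x
    proof -
      \<comment> \<open>Multiplication by w T^(em-1-k) moves the coefficient of degree k, times w,
        to the degree that the functional reads.\<close>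
      have z: "fps_nth (x i) k = 0" if k: "k < e * m" for i k
      proof (rule lam_nondeg[of "\<lambda>i. fps_nth (x i) k" i])
        fix w
        have "(\<lambda>i. fps_nth ((x * (\<lambda>i. fps_const (w i) * fps_X ^ (e * m - 1 - k))) i) (e * m - 1)) = (\<lambda>i. fps_nth (x i) k * w i)"
          using k by (simp add: fun_eq_iff mult.assoc[symmetric] fps_X_power_mult_right_nth)
        then show "lam (\<lambda>i. fps_nth (x i) k * w i) = 0" using x[of "\<lambda>i. fps_const (w i) * fps_X ^ (e * m - 1 - k)"] by (simp only:)
      qed
      have "x i = (uniformizer ^ (e * m) * (\<lambda>i. fps_shift (e * m) (x i))) i" for i
        unfolding xpow times_fun_apply by (rule fps_X_power_divides) (rule z)
      then have eq: "uniformizer ^ (e * m) * (\<lambda>i. fps_shift (e * m) (x i)) = x" by (intro ext) (rule sym)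
      have "uniformizer ^ (e * m) * (\<lambda>i. fps_shift (e * m) (x i)) \<in> range ((*) (uniformizer ^ (e * m)))"
        by (rule rangeI)
      then show ?thesis unfolding eq .
    qed
    show "uniformizer ^ e \<in> ?R" using order_set_X_power[OF e, of 1 m] by (simp add: xpow)
    show "\<exists>a u. r = (\<Sum>j<m. const_emb \<phi> (a j) * (uniformizer ^ e) ^ j) + uniformizer ^ (e * m) * u" if "r \<in> ?R" for r
      by (rule order_set_expansion[OF e that])
  qed (fact e m card_ext degree phi_diff phi_mult phi_one)+
qed

text \<open>For e = 1 membership means that each coefficient below degree m lies in the diagonal
  copy of F, which is the kernel of \<open>lam\<close>; the substitution k = m - 1 - j reverses the
  order of the conditions.\<close>

lemma lam_order_unramified:
  assumes kernel: "\<And>z :: 'i \<Rightarrow> 'e. lam z = 0 \<longleftrightarrow> (\<exists>a. \<forall>i. z i = \<phi> a)"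
  shows "s \<in> order_set \<phi> 1 m \<longleftrightarrow> (\<forall>j<m. lam (\<lambda>i. fps_nth (s i) (1 * m - 1 - 1 * j)) = 0)"
proof -
  have "s \<in> order_set \<phi> 1 m \<longleftrightarrow> (\<exists>a. \<forall>k<m. \<forall>i. fps_nth (s i) k = \<phi> (a k))"
    unfolding mem_order_set_iff[OF zero_less_one] by simp blast
  also have "\<dots> \<longleftrightarrow> (\<forall>k<m. lam (\<lambda>i. fps_nth (s i) k) = 0)"
    unfolding kernel by metis
  also have "\<dots> \<longleftrightarrow> (\<forall>j<m. lam (\<lambda>i. fps_nth (s i) (1 * m - 1 - 1 * j)) = 0)"
  proof
    assume *: "\<forall>j<m. lam (\<lambda>i. fps_nth (s i) (1 * m - 1 - 1 * j)) = 0"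
    show "\<forall>k<m. lam (\<lambda>i. fps_nth (s i) k) = 0"
    proof (intro allI impI)
      fix k assume "k < m"
      then show "lam (\<lambda>i. fps_nth (s i) k) = 0" using *[rule_format, of "m - 1 - k"] by simp
    qed
  qed simp
  finally show ?thesis .
qed

end

lemma field_embedding_id: "field_embedding (id :: 'a::{field,finite} \<Rightarrow> 'a)"
  by unfold_locales simp_all

text \<open>The order consists of the series without odd exponents below 2m, and 2m - 1 - 2j runs
  through exactly these exponents. So the functional is the coefficient of T^(2m-1).\<close>

lemma quadratic_order_ramified:
  assumes m: "m > 0"
  shows "quadratic_order (id :: 'a::{field,finite} \<Rightarrow> 'a) (order_set id 2 m :: (unit \<Rightarrow> 'a fps) set)
    (\<lambda>s. fps_nth (s ()) (2 * m - 1)) 2 m 1"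
proof (rule field_embedding.quadratic_orderI[OF field_embedding_id, of 2 m 1 "\<lambda>z. z ()"])
  fix z w y :: "unit \<Rightarrow> 'a" and i :: unit
  have "range (\<lambda>z :: unit \<Rightarrow> 'a. z ()) = UNIV" by (rule surjI[of _ "\<lambda>c _. c"]) simp
  then show "card (range (\<lambda>z :: unit \<Rightarrow> 'a. z ())) = CARD('a)" by simp
  show "\<exists>a. id a * z () = y ()" if "z () \<noteq> 0" using that by (intro exI[of _ "y () / z ()"]) simp
  show "z i = 0" if "\<And>w. z () * w () = 0" using that[of "\<lambda>_. 1"] by simp
next
  fix s :: "unit \<Rightarrow> 'a fps"
  have "s \<in> order_set id 2 m \<longleftrightarrow> (\<forall>k<2 * m. odd k \<longrightarrow> fps_nth (s ()) k = 0)"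
    unfolding mem_order_set_iff[of 2, simplified]
  proof
    assume *: "\<forall>k<2 * m. odd k \<longrightarrow> fps_nth (s ()) k = 0"
    show "\<exists>a. \<forall>i. \<forall>k<2 * m. fps_nth (s i) k = (if even k then id (a (k div 2)) else 0)"
      by (rule exI[of _ "\<lambda>k. fps_nth (s ()) (2 * k)"]) (use * in auto)
  qed auto
  also have "\<dots> \<longleftrightarrow> (\<forall>j<m. fps_nth (s ()) (2 * m - 1 - 2 * j) = 0)"
  proof
    assume *: "\<forall>j<m. fps_nth (s ()) (2 * m - 1 - 2 * j) = 0"
    show "\<forall>k<2 * m. odd k \<longrightarrow> fps_nth (s ()) k = 0"
    proof (intro allI impI)
      fix k assume k: "k < 2 * m" "odd k"
      then obtain l where l: "k = 2 * l + 1" by (elim oddE)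
      then have "2 * m - 1 - 2 * (m - 1 - l) = k" "m - 1 - l < m" using k by linarith+
      then show "fps_nth (s ()) k = 0" using *[rule_format, of "m - 1 - l"] by simp
    qed
  next
    assume *: "\<forall>k<2 * m. odd k \<longrightarrow> fps_nth (s ()) k = 0"
    show "\<forall>j<m. fps_nth (s ()) (2 * m - 1 - 2 * j) = 0"
    proof (intro allI impI)
      fix j assume "j < m"
      then have "2 * m - 1 - 2 * j = 2 * (m - 1 - j) + 1" by linarith
      then have "odd (2 * m - 1 - 2 * j)" by simp
      moreover have "2 * m - 1 - 2 * j < 2 * m" using m by linarith
      ultimately show "fps_nth (s ()) (2 * m - 1 - 2 * j) = 0" using * by blast
    qed
  qed
  finally show "s \<in> order_set id 2 m \<longleftrightarrow> (\<forall>j<m. fps_nth (s ()) (2 * m - 1 - 2 * j) = 0)" .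
qed (use m in simp_all)

text \<open>The functional is the difference of the two components; its kernel on F x F is the
  diagonal.\<close>

lemma quadratic_order_split:
  assumes m: "m > 0"
  shows "quadratic_order (id :: 'a::{field,finite} \<Rightarrow> 'a) (order_set id 1 m :: (bool \<Rightarrow> 'a fps) set)
    (\<lambda>s. fps_nth (s True) (1 * m - 1) - fps_nth (s False) (1 * m - 1)) 1 m 1"
proof (rule field_embedding.quadratic_orderI[OF field_embedding_id, of 1 m 1 "\<lambda>z. z True - z False"])
  fix z w y :: "bool \<Rightarrow> 'a" and i :: bool
  have "range (\<lambda>z :: bool \<Rightarrow> 'a. z True - z False) = UNIV" by (rule surjI[of _ "\<lambda>c i. if i then c else 0"]) simp
  then show "card (range (\<lambda>z :: bool \<Rightarrow> 'a. z True - z False)) = CARD('a)" by simp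
  show "\<exists>a. id a * z True - id a * z False = y True - y False" if "z True - z False \<noteq> 0"
    using that by (intro exI[of _ "(y True - y False) / (z True - z False)"]) (simp only: id_apply right_diff_distrib[symmetric] nonzero_eq_divide_eq[symmetric] nonzero_divide_eq_eq not_False_eq_True divide_eq_eq, simp)
  show "z i = 0" if "\<And>w. z True * w True - z False * w False = 0"
    using that[of "\<lambda>i. if i then 1 else 0"] that[of "\<lambda>i. if i then 0 else 1"] by (cases i) simp_all
  show "(z True - w True) - (z False - w False) = (z True - z False) - (w True - w False)" by simp
next
  fix s :: "bool \<Rightarrow> 'a fps"
  show "s \<in> order_set id 1 m \<longleftrightarrow> (\<forall>j<m. fps_nth (s True) (1 * m - 1 - 1 * j) - fps_nth (s False) (1 * m - 1 - 1 * j) = 0)"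
    by (rule field_embedding.lam_order_unramified[OF field_embedding_id, of "\<lambda>z. z True - z False"])
       (auto simp: all_bool_eq)
qed (use m in simp_all)

text \<open>The functional is the second coordinate with respect to a basis \<open>1, \<omega>\<close>.\<close>

lemma quadratic_order_inert:
  fixes \<phi> :: "'a::{field,finite} \<Rightarrow> 'b::{field,finite}"
  assumes "field_embedding \<phi>" and m: "m > 0" and card: "CARD('b) = CARD('a) ^ 2"
  obtains \<tau> :: "(unit \<Rightarrow> 'b fps) \<Rightarrow> 'a" where "quadratic_order \<phi> (order_set \<phi> 1 m) \<tau> 1 m 2"
proof -
  interpret field_embedding \<phi> by fact
  have q: "CARD('a) > 1" by (rule card_field_gt_1)
  have inj: "a = 0" if "\<phi> a = 0" for a
  proof (rule ccontr)
    assume "a \<noteq> 0"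
    then have "\<phi> (a * inverse a) = 1" using phi_one by simp
    then show False using that by (simp add: phi_mult)
  qed
  have "card (range \<phi>) \<le> CARD('a)" by (rule card_image_le) simp
  also have "\<dots> < CARD('b)" unfolding card power2_eq_square using q by simp
  finally have "range \<phi> \<noteq> UNIV" by auto
  \<comment> \<open>E is larger than F, and 1 together with any element outside F is a basis because
    E has only |F|^2 elements.\<close>
  then obtain \<omega> where \<omega>: "\<omega> \<notin> range \<phi>" by blast
  let ?f = "\<lambda>(a, b). \<phi> a + \<phi> b * \<omega>"
  have indep: "b = 0 \<and> a = 0" if eq: "\<phi> a + \<phi> b * \<omega> = 0" for a b
  proof -
    have "b = 0"
    proof (rule ccontr)
      assume b: "b \<noteq> 0"
      have "\<phi> b * \<phi> (inverse b) = 1" using b phi_one by (simp add: phi_mult[symmetric])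
      moreover have "\<phi> b * \<omega> = - \<phi> a" using eq by (simp add: eq_neg_iff_add_eq_0 add.commute)
      ultimately have "\<omega> = - \<phi> a * \<phi> (inverse b)"
        by (metis mult.assoc mult.commute mult.right_neutral)
      also have "\<dots> = \<phi> (- a * inverse b)"
        using phi_diff[of 0 "a * inverse b"] by (simp add: phi_mult phi_zero)
      finally show False using \<omega> by blast
    qed
    then show ?thesis using eq inj by (simp add: phi_zero)
  qed
  have f_diff: "(\<phi> a + \<phi> b * \<omega>) - (\<phi> a' + \<phi> b' * \<omega>) = \<phi> (a - a') + \<phi> (b - b') * \<omega>" for a b a' b'
    by (simp add: phi_diff algebra_simps)
  have uniq: "a = a' \<and> b = b'" if "\<phi> a + \<phi> b * \<omega> = \<phi> a' + \<phi> b' * \<omega>" for a b a' b'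
    using indep[of "a - a'" "b - b'"] f_diff[of a b a' b'] that by simp
  have "inj ?f" using uniq by (auto intro!: injI)
  then have "range ?f = UNIV"
    by (intro card_subset_eq) (simp_all add: card_image card power2_eq_square)
  then have "\<exists>a b. x = \<phi> a + \<phi> b * \<omega>" for x by (metis (mono_tags, lifting) UNIV_I case_prod_beta imageE)
  then obtain c d where cd: "\<And>x. x = \<phi> (c x) + \<phi> (d x) * \<omega>" by metis
  have d_eq: "d (\<phi> a + \<phi> b * \<omega>) = b" for a b using uniq[OF cd[of "\<phi> a + \<phi> b * \<omega>"]] by simp
  have d_diff: "d (x - y) = d x - d y" for x y
    using d_eq[of "c x - c y" "d x - d y"] f_diff[of "c x" "d x" "c y" "d y"] cd[of x] cd[of y] by simp
  have d_scale: "d (\<phi> a * x) = a * d x" for a x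
  proof -
    have "\<phi> a * x = \<phi> (a * c x) + \<phi> (a * d x) * \<omega>"
      by (subst cd[of x]) (simp add: phi_mult algebra_simps)
    then show ?thesis using d_eq by simp
  qed
  have d_omega: "d \<omega> = 1" using d_eq[of 0 1] by (simp add: phi_zero phi_one)
  have d_zero: "d x = 0 \<longleftrightarrow> (\<exists>a. x = \<phi> a)" for x
    using cd[of x] d_eq[of _ 0] by (auto simp: phi_zero)
  have "quadratic_order \<phi> (order_set \<phi> 1 m) (\<lambda>s. d (fps_nth (s ()) (1 * m - 1))) 1 m 2"
  proof (rule quadratic_orderI[of 1 m 2 "\<lambda>z. d (z ())"])
    fix z w y :: "unit \<Rightarrow> 'b" and i :: unit
    have "range (\<lambda>z :: unit \<Rightarrow> 'b. d (z ())) = UNIV"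
      by (rule surjI[of _ "\<lambda>b _. \<phi> 0 + \<phi> b * \<omega>"]) (rule d_eq)
    then show "card (range (\<lambda>z :: unit \<Rightarrow> 'b. d (z ()))) = CARD('a)" by simp
    show "\<exists>a. d (\<phi> a * z ()) = d (y ())" if "d (z ()) \<noteq> 0"
      unfolding d_scale using that by (intro exI[of _ "d (y ()) / d (z ())"]) simp
    show "z i = 0" if "\<And>w. d (z () * w ()) = 0"
    proof (rule ccontr)
      assume "z i \<noteq> 0"
      then have "z () * (\<omega> / z ()) = \<omega>" by simp
      then show False using that[of "\<lambda>_. \<omega> / z ()"] d_omega by simp
    qed
    show "d (z () - w ()) = d (z ()) - d (w ())" by (rule d_diff)
  next
    fix s :: "unit \<Rightarrow> 'b fps"
    show "s \<in> order_set \<phi> 1 m \<longleftrightarrow> (\<forall>j<m. d (fps_nth (s ()) (1 * m - 1 - 1 * j)) = 0)"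
      by (rule lam_order_unramified[of "\<lambda>z. d (z ())"]) (auto simp: d_zero)
  qed (use m card in simp_all)
  then show thesis by (rule that)
qed

text \<open>Carries the count inside S^n back to the zeta functions of the ring records:
  \<open>\<iota>\<close> models the order and \<open>norm_map\<close> its normalization, whose image
  is all of S.\<close>

lemma (in quadratic_order) normalized_value:
  assumes "ring_model A R \<iota>"
  shows "dirichlet_poly_value (normalized_coh_zeta A n) 0
    (of_nat CARD('f) powi (- (int m * int n ^ 2)) * (\<Sum>r\<in>UNIV \<rightarrow>\<^sub>E {..n}.
      (\<Prod>i\<in>(UNIV :: 'i set). qbinomial (of_nat CARD('e)) (int n) (int (r i)) * ((- 1) ^ r i * of_nat CARD('e) ^ (r i choose 2))) *
      (\<Sum>s\<in>{1..m} \<rightarrow>\<^sub>E int ` {..2 * n * m}. G_term m (top_tuple m n (2 * int n - int (f * (\<Sum>i\<in>UNIV. r i)))) s (of_nat CARD('f)))))"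
proof -
  interpret M: ring_model A R \<iota> by fact
  interpret P: power_series_order A R \<iota> "e * m" by unfold_locales (rule R_conductor)
  interpret N: ring_model "normalization A" UNIV P.norm_map by (rule P.ring_model_normalization)
  have R: "M.Rvecs n = Rn" by (simp add: M.Rvecs_def Rn_def)
  have V: "N.Rvecs n = V" by (simp add: N.Rvecs_def)
  have sub: "M \<subseteq> V" if "submod n (UNIV :: ('i \<Rightarrow> 'e fps) set) M" for M by (rule submodD(2)[OF that])
  have "dirichlet_poly_value (dirichlet_divide (dirichlet_shift (lattice_zeta A (free_module A n)) n)
      (dirichlet_shift (lattice_zeta (normalization A) (free_module (normalization A) n)) n)) 0
    (of_nat CARD('f) powi (- (int m * int n ^ 2)) * (\<Sum>r\<in>UNIV \<rightarrow>\<^sub>E {..n}.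
    (\<Prod>i\<in>(UNIV :: 'i set). qbinomial (of_nat CARD('e)) (int n) (int (r i)) * weight_r (r i)) * lattice_count (\<Sum>i\<in>UNIV. r i)))"
  proof (rule zeta_quotient)
    fix k :: nat assume k: "k \<noteq> 0"
    show "lattice_zeta A (free_module A n) k = of_nat (card {L. submod n R L \<and> L \<subseteq> Rn \<and> grp_index Rn L = k})"
      using M.lattice_zeta_eq[OF k, of n] unfolding R .
    have "{L. submod n UNIV L \<and> L \<subseteq> V \<and> grp_index V L = k} = {M. submod n UNIV M \<and> grp_index V M = k}"
      using sub by blast
    then show "lattice_zeta (normalization A) (free_module (normalization A) n) k =
        of_nat (card {M. submod n (UNIV :: ('i \<Rightarrow> 'e fps) set) M \<and> grp_index V M = k})"
      using N.lattice_zeta_eq[OF k, of n] unfolding V by (simp only:)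
  qed (rule M.lattice_zeta_zero N.lattice_zeta_zero)+
  then show ?thesis unfolding normalized_coh_zeta_def finitized_coh_zeta_def weight_r_def lattice_count_def .
qed

section \<open>Reduction of the infinite sums, and the three families\<close>

lemma infsum_finite_support:
  fixes F :: "'x \<Rightarrow> complex"
  assumes "finite B" "B \<subseteq> A" "\<And>x. x \<in> A \<Longrightarrow> x \<notin> B \<Longrightarrow> F x = 0"
  shows "infsum F A = sum F B"
proof -
  have "infsum F A = infsum F B" by (rule infsum_cong_neutral) (use assms in auto)
  then show ?thesis using assms(1) by simp
qed

text \<open>The support lies in 0 \<le> s_k \<le> 2n; the larger box up to 2nm is the one over which
  \<open>card_stable_lat\<close> sums.\<close>

lemma G_term_zero:
  fixes x :: complex
  assumes m: "m \<ge> 1" and c: "c \<le> 2 * int n" and s: "s \<in> int_tuples m" "s \<notin> {1..m} \<rightarrow>\<^sub>E int ` {..2 * n * m}"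
  shows "G_term m (top_tuple m n c) s x = 0"
proof (rule ccontr)
  assume nz: "G_term m (top_tuple m n c) s x \<noteq> 0"
  have top: "top_tuple m n c k \<le> 2 * int n" if "1 \<le> k" "k \<le> m" for k
    using that c by (simp add: top_tuple_def)
  have "s k \<in> int ` {..2 * n * m}" if k: "k \<in> {1..m}" for k
  proof -
    have b: "0 \<le> s k" "s k \<le> 2 * int n" using G_term_support[OF nz top, of k] k by simp_all
    have "2 * n * 1 \<le> 2 * n * m" using m by (intro mult_le_mono2)
    then have "nat (s k) \<le> 2 * n * m" using b by linarith
    then show ?thesis using b by (intro image_eqI[of _ _ "nat (s k)"]) simp_all
  qed
  then have "s \<in> {1..m} \<rightarrow>\<^sub>E int ` {..2 * n * m}" using s(1) by (auto simp: PiE_iff)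
  then show False using s(2) by blast
qed

lemma qbinomial_outside:
  assumes "r \<notin> int ` {..n}"
  shows "qbinomial x (int n) r = 0"
proof -
  have "\<not> (0 \<le> r \<and> r \<le> int n)"
  proof
    assume "0 \<le> r \<and> r \<le> int n"
    then have "r \<in> int ` {..n}" by (intro image_eqI[of _ _ "nat r"]) auto
    then show False using assms by blast
  qed
  then show ?thesis by (simp only: qbinomial_def if_False)
qed

lemma sum_PiE_unit:
  fixes n :: nat
  shows "(\<Sum>r\<in>UNIV \<rightarrow>\<^sub>E {..n}. h r) = (\<Sum>k\<le>n. h (\<lambda>_ :: unit. k))"
  by (rule sum.reindex_bij_witness[of _ "\<lambda>k _. k" "\<lambda>r. r ()"]) (auto simp: PiE_UNIV_domain)

lemma sum_PiE_bool:
  fixes n :: nat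
  shows "(\<Sum>r\<in>UNIV \<rightarrow>\<^sub>E {..n}. h r) = (\<Sum>a\<le>n. \<Sum>b\<le>n. h (\<lambda>i. if i then a else b))"
proof -
  have eq: "(\<lambda>i. if i then r True else r False) = r" for r :: "bool \<Rightarrow> nat"
    by (simp add: fun_eq_iff all_bool_eq)
  show ?thesis
    unfolding sum.cartesian_product
  proof (rule sum.reindex_bij_witness[where i = "\<lambda>(a, b) i. if i then a else b" and j = "\<lambda>r. (r True, r False)"])
    fix r :: "bool \<Rightarrow> nat" assume r: "r \<in> UNIV \<rightarrow>\<^sub>E {..n}"
    show "(case (r True, r False) of (a, b) \<Rightarrow> \<lambda>i. if i then a else b) = r" unfolding prod.case by (rule eq)
    show "(r True, r False) \<in> {..n} \<times> {..n}" using r by (auto simp: PiE_UNIV_domain)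
    show "(case (r True, r False) of (a, b) \<Rightarrow> h (\<lambda>i. if i then a else b)) = h r"
      unfolding prod.case by (rule arg_cong[where f = h, OF eq])
  qed (auto simp: PiE_UNIV_domain)
qed

lemma int_choose_two: "int r * (int r - 1) div 2 = int (r choose 2)" "int r ^ 2 - int r = int (2 * (r choose 2))"
proof -
  have "int r * (int r - 1) = int (r * (r - 1))" by (cases r) (simp_all add: algebra_simps)
  then show "int r * (int r - 1) div 2 = int (r choose 2)" by (simp only: choose_two zdiv_int) simp
  have "2 * (r choose 2) = r * (r - 1)" unfolding choose_two by (rule dvd_mult_div_cancel) (cases "even r"; simp)
  then show "int r ^ 2 - int r = int (2 * (r choose 2))" by (cases r) (simp_all add: power2_eq_square algebra_simps)
qed

text \<open>\<open>d\<close> is the residue degree: 1 in the ramified case, 2 in the inert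
  case.\<close>

lemma infsum_one:
  fixes q :: complex
  assumes m: "m \<ge> 1" and d: "d \<ge> 0" and w: "\<And>r. r \<notin> int ` {..n} \<Longrightarrow> w r = 0"
  shows "(\<Sum>\<^sub>\<infinity>(r, s)\<in>UNIV \<times> int_tuples m. w r * G_term m (top_tuple m n (2 * int n - d * r)) s q) =
    (\<Sum>k\<le>n. w (int k) * (\<Sum>s\<in>{1..m} \<rightarrow>\<^sub>E int ` {..2 * n * m}. G_term m (top_tuple m n (2 * int n - d * int k)) s q))"
proof -
  let ?S = "{1..m} \<rightarrow>\<^sub>E int ` {..2 * n * m}"
  have "(\<Sum>\<^sub>\<infinity>(r, s)\<in>UNIV \<times> int_tuples m. w r * G_term m (top_tuple m n (2 * int n - d * r)) s q) =
    (\<Sum>(r, s)\<in>int ` {..n} \<times> ?S. w r * G_term m (top_tuple m n (2 * int n - d * r)) s q)"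
  proof (rule infsum_finite_support)
    show "finite (int ` {..n} \<times> ?S)" by (intro finite_cartesian_product finite_PiE) auto
    show "int ` {..n} \<times> ?S \<subseteq> UNIV \<times> int_tuples m" by (intro Sigma_mono PiE_mono) auto
    fix p assume p: "p \<in> UNIV \<times> int_tuples m" "p \<notin> int ` {..n} \<times> ?S"
    define r s where "r = fst p" and "s = snd p"
    then have rs: "p = (r, s)" by (simp only: prod.collapse)
    have "w r * G_term m (top_tuple m n (2 * int n - d * r)) s q = 0"
    proof (cases "r \<in> int ` {..n}")
      case True
      then have "0 \<le> r" by (rule imageE) (simp only: of_nat_0_le_iff)
      then have "0 \<le> d * r" using d by (intro mult_nonneg_nonneg)
      then have c: "2 * int n - d * r \<le> 2 * int n" by linarith
      have "s \<in> int_tuples m" using p(1) unfolding rs by (simp only: mem_Times_iff snd_conv)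
      moreover have "s \<notin> ?S" using p(2) True unfolding rs by blast
      ultimately have "G_term m (top_tuple m n (2 * int n - d * r)) s q = 0" by (rule G_term_zero[OF m c])
      then show ?thesis by (simp only: mult_zero_right)
    next
      case False
      then have "w r = 0" by (rule w)
      then show ?thesis by (simp only: mult_zero_left)
    qed
    then show "(case p of (r, s) \<Rightarrow> w r * G_term m (top_tuple m n (2 * int n - d * r)) s q) = 0" unfolding rs prod.case .
  qed
  also have "\<dots> = (\<Sum>r\<in>int ` {..n}. \<Sum>s\<in>?S. w r * G_term m (top_tuple m n (2 * int n - d * r)) s q)"
    by (rule sum.cartesian_product[symmetric])
  finally show ?thesis unfolding sum_distrib_left by (simp add: sum.reindex)
qed

lemma infsum_two:
  fixes q :: complex
  assumes m: "m \<ge> 1" and w: "\<And>a b. a \<notin> int ` {..n} \<Longrightarrow> w a b = 0" "\<And>a b. b \<notin> int ` {..n} \<Longrightarrow> w a b = 0"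
  shows "(\<Sum>\<^sub>\<infinity>(a, b, s)\<in>UNIV \<times> UNIV \<times> int_tuples m. w a b * G_term m (top_tuple m n (2 * int n - a - b)) s q) =
    (\<Sum>a\<le>n. \<Sum>b\<le>n. w (int a) (int b) * (\<Sum>s\<in>{1..m} \<rightarrow>\<^sub>E int ` {..2 * n * m}. G_term m (top_tuple m n (2 * int n - int a - int b)) s q))"
proof -
  let ?S = "{1..m} \<rightarrow>\<^sub>E int ` {..2 * n * m}" and ?I = "int ` {..n}"
  have "(\<Sum>\<^sub>\<infinity>(a, b, s)\<in>UNIV \<times> UNIV \<times> int_tuples m. w a b * G_term m (top_tuple m n (2 * int n - a - b)) s q) =
    (\<Sum>(a, b, s)\<in>?I \<times> ?I \<times> ?S. w a b * G_term m (top_tuple m n (2 * int n - a - b)) s q)"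
  proof (rule infsum_finite_support)
    show "finite (?I \<times> ?I \<times> ?S)" by (intro finite_cartesian_product finite_PiE) auto
    show "?I \<times> ?I \<times> ?S \<subseteq> UNIV \<times> UNIV \<times> int_tuples m" by (intro Sigma_mono PiE_mono) auto
    fix p assume p: "p \<in> UNIV \<times> UNIV \<times> int_tuples m" "p \<notin> ?I \<times> ?I \<times> ?S"
    define a b s where "a = fst p" and "b = fst (snd p)" and "s = snd (snd p)"
    then have rs: "p = (a, b, s)" by (simp only: prod.collapse)
    have "w a b * G_term m (top_tuple m n (2 * int n - a - b)) s q = 0"
    proof (cases "a \<in> ?I \<and> b \<in> ?I")
      case True
      then have ab: "a \<in> ?I" "b \<in> ?I" by (simp_all only: simp_thms)
      have "0 \<le> a" by (rule imageE[OF ab(1)]) (simp only: of_nat_0_le_iff)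
      moreover have "0 \<le> b" by (rule imageE[OF ab(2)]) (simp only: of_nat_0_le_iff)
      ultimately have c: "2 * int n - a - b \<le> 2 * int n" by linarith
      have "s \<in> int_tuples m" using p(1) unfolding rs by (simp only: mem_Times_iff snd_conv)
      moreover have "s \<notin> ?S" using p(2) True unfolding rs by blast
      ultimately have "G_term m (top_tuple m n (2 * int n - a - b)) s q = 0" by (rule G_term_zero[OF m c])
      then show ?thesis by (simp only: mult_zero_right)
    next
      case False
      then have "w a b = 0" using w by blast
      then show ?thesis by (simp only: mult_zero_left)
    qed
    then show "(case p of (a, b, s) \<Rightarrow> w a b * G_term m (top_tuple m n (2 * int n - a - b)) s q) = 0" unfolding rs prod.case .
  qed
  also have "\<dots> = (\<Sum>a\<in>?I. \<Sum>b\<in>?I. \<Sum>s\<in>?S. w a b * G_term m (top_tuple m n (2 * int n - a - b)) s q)"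
    by (simp only: sum.cartesian_product)
  finally show ?thesis unfolding sum_distrib_left by (simp add: sum.reindex)
qed

lemma ramified_value:
  fixes m n :: nat and q :: complex
  assumes q: "q = of_nat CARD('a::{field,finite})" and m: "m \<ge> 1"
  shows "dirichlet_poly_value (normalized_coh_zeta (ramified_order m :: 'a fps fps set ring) n) 0
    (q powi (- (int m * int n ^ 2)) * (\<Sum>\<^sub>\<infinity>(r, s)\<in>UNIV \<times> int_tuples m.
       qbinomial q (int n) r * (-1) powi r * q powi (r * (r - 1) div 2) * G_term m (top_tuple m n (2 * int n - r)) s q))"
proof -
  obtain \<iota> where model: "ring_model (ramified_order m :: 'a fps fps set ring) (order_set id 2 m :: (unit \<Rightarrow> 'a fps) set) \<iota>"
    by (rule ramified_model)
  interpret Q: quadratic_order "id :: 'a \<Rightarrow> 'a" "order_set id 2 m :: (unit \<Rightarrow> 'a fps) set" "\<lambda>s. fps_nth (s ()) (2 * m - 1)" 2 m 1 n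
    by (rule quadratic_order_ramified) (use m in simp)
  let ?w = "\<lambda>r. qbinomial q (int n) r * (-1) powi r * q powi (r * (r - 1) div 2)"
  have inf: "(\<Sum>\<^sub>\<infinity>(r, s)\<in>UNIV \<times> int_tuples m. ?w r * G_term m (top_tuple m n (2 * int n - 1 * r)) s q) =
    (\<Sum>k\<le>n. ?w (int k) * (\<Sum>s\<in>{1..m} \<rightarrow>\<^sub>E int ` {..2 * n * m}. G_term m (top_tuple m n (2 * int n - 1 * int k)) s q))"
    by (rule infsum_one[OF m zero_le_one, of _ ?w]) (simp add: qbinomial_outside)
  have w: "?w (int k) = qbinomial q (int n) (int k) * ((- 1) ^ k * q ^ (k choose 2))" for k
    unfolding int_choose_two power_int_of_nat by (simp only: mult.assoc)
  show ?thesis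
    using Q.normalized_value[OF model] inf
    unfolding q[symmetric] sum_PiE_unit w mult_1_left by (simp add: UNIV_unit)
qed

lemma split_value:
  fixes m n :: nat and q :: complex
  assumes q: "q = of_nat CARD('a::{field,finite})" and m: "m \<ge> 1"
  shows "dirichlet_poly_value (normalized_coh_zeta (split_order m :: 'a fps fps set ring) n) 0
    (q powi (- (int m * int n ^ 2)) * (\<Sum>\<^sub>\<infinity>(r1, r2, s)\<in>UNIV \<times> UNIV \<times> int_tuples m.
       qbinomial q (int n) r1 * qbinomial q (int n) r2 * (-1) powi (r1 + r2) *
       q powi (r1 * (r1 - 1) div 2 + r2 * (r2 - 1) div 2) * G_term m (top_tuple m n (2 * int n - r1 - r2)) s q))"
proof -
  obtain \<iota> where model: "ring_model (split_order m :: 'a fps fps set ring) (order_set id 1 m :: (bool \<Rightarrow> 'a fps) set) \<iota>"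
    by (rule split_model[of m]) (use m in simp)
  interpret Q: quadratic_order "id :: 'a \<Rightarrow> 'a" "order_set id 1 m :: (bool \<Rightarrow> 'a fps) set"
      "\<lambda>s. fps_nth (s True) (1 * m - 1) - fps_nth (s False) (1 * m - 1)" 1 m 1 n
    by (rule quadratic_order_split) (use m in simp)
  let ?w = "\<lambda>r1 r2. qbinomial q (int n) r1 * qbinomial q (int n) r2 * (-1) powi (r1 + r2) *
       q powi (r1 * (r1 - 1) div 2 + r2 * (r2 - 1) div 2)"
  let ?g = "\<lambda>k. \<Sum>s\<in>{1..m} \<rightarrow>\<^sub>E int ` {..2 * n * m}. G_term m (top_tuple m n (2 * int n - k)) s q"
  let ?p = "\<lambda>k. qbinomial q (int n) (int k) * ((- 1) ^ k * q ^ (k choose 2))"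
  have inf: "(\<Sum>\<^sub>\<infinity>(r1, r2, s)\<in>UNIV \<times> UNIV \<times> int_tuples m. ?w r1 r2 * G_term m (top_tuple m n (2 * int n - r1 - r2)) s q) =
    (\<Sum>a\<le>n. \<Sum>b\<le>n. ?w (int a) (int b) * (\<Sum>s\<in>{1..m} \<rightarrow>\<^sub>E int ` {..2 * n * m}. G_term m (top_tuple m n (2 * int n - int a - int b)) s q))"
    by (rule infsum_two[OF m, of _ ?w]) (simp_all add: qbinomial_outside)
  have w: "?w (int a) (int b) = ?p a * ?p b" for a b
    unfolding int_choose_two of_nat_add[symmetric] power_int_of_nat power_add by (simp only: mult_ac)
  have top: "2 * int n - int a - int b = 2 * int n - (int a + int b)" for a b by simp
  have sum: "(\<Sum>r\<in>UNIV \<rightarrow>\<^sub>E {..n}. (\<Prod>i\<in>(UNIV :: bool set). ?p (r i)) * ?g (int (1 * (\<Sum>i\<in>UNIV. r i)))) =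
      (\<Sum>a\<le>n. \<Sum>b\<le>n. ?p a * ?p b * ?g (int a + int b))"
    unfolding sum_PiE_bool
  proof (intro sum.cong refl arg_cong2[where f = "(*)"])
    fix a b
    show "(\<Prod>i\<in>(UNIV :: bool set). ?p (if i then a else b)) = ?p a * ?p b" by (simp add: UNIV_bool mult_ac)
    have "int (1 * (\<Sum>i\<in>(UNIV :: bool set). if i then a else b)) = int a + int b" by (simp add: UNIV_bool)
    then show "G_term m (top_tuple m n (2 * int n - int (1 * (\<Sum>i\<in>(UNIV :: bool set). if i then a else b)))) s q =
        G_term m (top_tuple m n (2 * int n - (int a + int b))) s q" for s by (simp only:)
  qed
  have "dirichlet_poly_value (normalized_coh_zeta (split_order m :: 'a fps fps set ring) n) 0
    (q powi (- (int m * int n ^ 2)) * (\<Sum>a\<le>n. \<Sum>b\<le>n. ?p a * ?p b * ?g (int a + int b)))"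
    using Q.normalized_value[OF model] unfolding q[symmetric] sum .
  then show ?thesis unfolding inf w top .
qed

lemma inert_value:
  fixes m n :: nat and q :: complex and \<phi> :: "'a::{field,finite} \<Rightarrow> 'b::{field,finite}"
  assumes q: "q = of_nat CARD('a)" and m: "m \<ge> 1" and card: "CARD('b) = CARD('a) ^ 2"
    and \<phi>: "\<phi> \<in> ring_hom ring_of_type_algebra ring_of_type_algebra"
  shows "dirichlet_poly_value (normalized_coh_zeta (inert_order \<phi> m) n) 0
    (q powi (- (int m * int n ^ 2)) * (\<Sum>\<^sub>\<infinity>(r, s)\<in>UNIV \<times> int_tuples m.
       qbinomial (q ^ 2) (int n) r * (-1) powi r * q powi (r ^ 2 - r) * G_term m (top_tuple m n (2 * int n - 2 * r)) s q))"
proof -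
  have add: "\<phi> (a + b) = \<phi> a + \<phi> b" and mult: "\<phi> (a * b) = \<phi> a * \<phi> b" and one: "\<phi> 1 = 1" for a b
    using \<phi> by (simp_all add: ring_hom_def ring_of_type_algebra_def)
  have "\<phi> (a - b) = \<phi> a - \<phi> b" for a b using add[of "a - b" b] by simp
  then interpret F: field_embedding \<phi> by unfold_locales (simp_all add: mult one)
  have m0: "m > 0" using m by linarith
  obtain \<tau> :: "(unit \<Rightarrow> 'b fps) \<Rightarrow> 'a" where order: "quadratic_order \<phi> (order_set \<phi> 1 m) \<tau> 1 m 2"
    by (rule quadratic_order_inert[OF F.field_embedding_axioms m0 card])
  have model: "ring_model (inert_order \<phi> m) (order_set \<phi> 1 m) (\<lambda>x (_ :: unit). x)"
    by (rule inert_model[OF add F.order_set_diff F.order_set_mult F.one_in_order_set]) simp_all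
  interpret Q: quadratic_order \<phi> "order_set \<phi> 1 m :: (unit \<Rightarrow> 'b fps) set" \<tau> 1 m 2 n by (rule order)
  have Q: "of_nat CARD('b) = q ^ 2" unfolding q card by simp
  let ?w = "\<lambda>r. qbinomial (q ^ 2) (int n) r * (-1) powi r * q powi (r ^ 2 - r)"
  have inf: "(\<Sum>\<^sub>\<infinity>(r, s)\<in>UNIV \<times> int_tuples m. ?w r * G_term m (top_tuple m n (2 * int n - 2 * r)) s q) =
    (\<Sum>k\<le>n. ?w (int k) * (\<Sum>s\<in>{1..m} \<rightarrow>\<^sub>E int ` {..2 * n * m}. G_term m (top_tuple m n (2 * int n - 2 * int k)) s q))"
    by (rule infsum_one[OF m, of 2 _ ?w]) (simp_all add: qbinomial_outside)
  \<comment> \<open>q^(r^2 - r) is (q^2) to the power \<open>r choose 2\<close>: the Moebius weight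
    over the residue field with q^2 elements.\<close>
  have w: "?w (int k) = qbinomial (q ^ 2) (int n) (int k) * ((- 1) ^ k * (q ^ 2) ^ (k choose 2))" for k
    unfolding int_choose_two power_int_of_nat power_mult by (simp only: mult.assoc)
  show ?thesis
    using Q.normalized_value[OF model] inf
    unfolding q[symmetric] Q sum_PiE_unit w by (simp add: UNIV_unit)
qed

theorem theorem4p1:
  fixes card_F m n :: nat and q :: complex
  assumes "card_F = CARD('a::{field,finite})" and "q = of_nat card_F" and "m \<ge> 1"
  shows
    "dirichlet_poly_value (normalized_coh_zeta (ramified_order m :: 'a fps fps set ring) n) 0
       (q powi (- (int m * int n ^ 2)) *
        (\<Sum>\<^sub>\<infinity>(r, s)\<in>UNIV \<times> int_tuples m.
           qbinomial q (int n) r * (-1) powi r * q powi (r * (r - 1) div 2) *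
           G_term m (top_tuple m n (2 * int n - r)) s q))
   \<and> dirichlet_poly_value (normalized_coh_zeta (split_order m :: 'a fps fps set ring) n) 0
       (q powi (- (int m * int n ^ 2)) *
        (\<Sum>\<^sub>\<infinity>(r1, r2, s)\<in>UNIV \<times> UNIV \<times> int_tuples m.
           qbinomial q (int n) r1 * qbinomial q (int n) r2 * (-1) powi (r1 + r2) *
           q powi (r1 * (r1 - 1) div 2 + r2 * (r2 - 1) div 2) *
           G_term m (top_tuple m n (2 * int n - r1 - r2)) s q))
   \<and> (\<forall>\<phi> :: 'a \<Rightarrow> 'b::{field,finite}.
        CARD('b) = card_F ^ 2 \<longrightarrow> \<phi> \<in> ring_hom ring_of_type_algebra ring_of_type_algebra \<longrightarrow>
        dirichlet_poly_value (normalized_coh_zeta (inert_order \<phi> m) n) 0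
          (q powi (- (int m * int n ^ 2)) *
           (\<Sum>\<^sub>\<infinity>(r, s)\<in>UNIV \<times> int_tuples m.
              qbinomial (q ^ 2) (int n) r * (-1) powi r * q powi (r ^ 2 - r) *
              G_term m (top_tuple m n (2 * int n - 2 * r)) s q)))"
proof -
  have q: "q = of_nat CARD('a)" using assms(1,2) by simp
  show ?thesis
  proof (intro conjI allI impI)
    fix \<phi> :: "'a \<Rightarrow> 'b"
    assume "CARD('b) = card_F ^ 2" and \<phi>: "\<phi> \<in> ring_hom ring_of_type_algebra ring_of_type_algebra"
    then have card: "CARD('b) = CARD('a) ^ 2" by (simp only: assms(1))
    show "dirichlet_poly_value (normalized_coh_zeta (inert_order \<phi> m) n) 0
          (q powi (- (int m * int n ^ 2)) *
           (\<Sum>\<^sub>\<infinity>(r, s)\<in>UNIV \<times> int_tuples m.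
              qbinomial (q ^ 2) (int n) r * (-1) powi r * q powi (r ^ 2 - r) *
              G_term m (top_tuple m n (2 * int n - 2 * r)) s q))"
      by (rule inert_value[OF q assms(3) card \<phi>])
  qed (fact ramified_value[OF q assms(3)] split_value[OF q assms(3)])+
qed

end
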